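(* For a Dedekind complete vector lattice $E$ and $T\in\mathcal{L}_{\mathrm{ob}}(E)$, let $\lambda_T:\mathcal{L}_{\mathrm{ob}}(E)\to\mathcal{L}_{\mathrm{ob}}(E)$, $\lambda_T(S)=TS$. Consider the six modes of convergence $\mathrm{o}$, $\mathrm{uo}$, $\widehat\tau_{\mathcal{L}_{\mathrm{ob}}(E)}$, $\mathrm{SO}$, $\mathrm{SUO}$, $\mathrm{S}\widehat\tau_E$ for nets in $\mathcal{L}_{\mathrm{ob}}(E)$. Below, $E$ ranges over the Dedekind complete vector lattices (admitting a Hausdorff uo-Lebesgue topology in case one of the two modes under consideration is $\widehat\tau_{\mathcal{L}_{\mathrm{ob}}(E)}$ or $\mathrm{S}\widehat\tau_E$). Then the following hold. (A) For the pairs $(c_1,c_2)$ with $c_1=\mathrm{o}$ and $c_2$ any of the six modes, and with $c_1=\mathrm{SO}$ and $c_2\in\{\mathrm{SO},\mathrm{SUO},\mathrm{S}\widehat\tau_E\}$: $\lambda_T$ is $c_1$-$c_2$ continuous on $\mathcal{L}_{\mathrm{ob}}(E)$ for every such $E$ and every $T\in\mathcal{L}_{\mathrm{oc}}(E)$, but there exist such an $E$ and a $T\in\mathcal{L}_{\mathrm{ob}}(E)$ for which $\lambda_T$ is not $c_1$-$c_2$ continuous. (B) For the pairs $(\mathrm{uo},\mathrm{uo})$, $(\mathrm{uo},\widehat\tau_{\mathcal{L}_{\mathrm{ob}}(E)})$, $(\widehat\tau_{\mathcal{L}_{\mathrm{ob}}(E)},\widehat\tau_{\mathcal{L}_{\mathrm{ob}}(E)})$,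 $(\mathrm{SUO},\mathrm{SUO})$, $(\mathrm{SUO},\mathrm{S}\widehat\tau_E)$ and $(\mathrm{S}\widehat\tau_E,\mathrm{S}\widehat\tau_E)$: $\lambda_T$ is $c_1$-$c_2$ continuous on $\mathcal{L}_{\mathrm{ob}}(E)$ for every such $E$ and every $T\in\mathrm{Orth}(E)$, but there exist such an $E$ and a $T\in\mathcal{L}_{\mathrm{oc}}(E)$ for which $\lambda_T$ is not $c_1$-$c_2$ continuous. (C) For each of the remaining pairs $(c_1,c_2)$: there exist such an $E$ and a $T\in\mathrm{Orth}(E)$ for which $\lambda_T$ is not $c_1$-$c_2$ continuous on $\mathcal{L}_{\mathrm{ob}}(E)$.
   Context: All vector lattices are real and Archimedean. $\mathcal{L}_{\mathrm{ob}}(E)$ is the space of order bounded linear operators $E\to E$, which is a Dedekind complete vector lattice in the operator order when $E$ is Dedekind complete. $\mathcal{L}_{\mathrm{oc}}(E)$ is the set of order continuous linear operators on $E$ (those $T$ for which $x_\alpha\xrightarrow{\mathrm{o}}0$ implies $Tx_\alpha\xrightarrow{\mathrm{o}}0$ for every net). $\mathrm{Orth}(E)$ is the set of orthomorphisms on $E$, i.e. of order bounded linear operators $T:E\to E$ with $T(B)\subseteq B$ for every band $B$ of $E$. One has $\mathrm{Orth}(E)\subseteq\mathcal{L}_{\mathrm{oc}}(E)\subseteq\mathcal{L}_{\mathrm{ob}}(E)$. In a vector lattice $G$, a net $(x_\alpha)_{\alpha\in A}$ is order convergent to $x$ (mode o; $x_\alpha\xrightarrow{\mathrm{o}}x$)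 if there is a net $(y_\beta)_{\beta\in B}$ in $G$ with $y_\beta\downarrow 0$ such that for every $\beta_0\in B$ there is $\alpha_0\in A$ with $|x-x_\alpha|\le y_{\beta_0}$ for all $\alpha\ge\alpha_0$. It is unbounded order convergent to $x$ (mode uo; $x_\alpha\xrightarrow{\mathrm{uo}}x$) if $|x_\alpha-x|\wedge y\xrightarrow{\mathrm{o}}0$ for all $y\in G^+$. A uo-Lebesgue topology on $G$ is a locally solid linear topology $\tau$ on $G$ such that $x_\alpha\xrightarrow{\mathrm{uo}}0$ implies $x_\alpha\xrightarrow{\tau}0$ for every net. $G$ admits at most one Hausdorff uo-Lebesgue topology, denoted $\widehat\tau_G$ if it exists. For Dedekind complete $E$, $\mathcal{L}_{\mathrm{ob}}(E)$ admits one if and only if $E$ does. For nets in $\mathcal{L}_{\mathrm{ob}}(E)$, the modes o, uo and $\widehat\tau_{\mathcal{L}_{\mathrm{ob}}(E)}$ are taken in the vector lattice $\mathcal{L}_{\mathrm{ob}}(E)$. The strong modes are pointwise: $S_\alpha\to S$ in the sense of SO (resp. SUO, resp. $\mathrm{S}\widehat\tau_E$) means that $S_\alpha x\to Sx$ in order (resp. in unbounded order, resp. in $\widehat\tau_E$) in $E$ for every $x\in E$. A map $\Phi:\mathcal{L}_{\mathrm{ob}}(E)\to\mathcal{L}_{\mathrm{ob}}(E)$ is $c_1$-$c_2$ continuous if, for every net $(S_\alpha)$ and every $S$ in $\mathcal{L}_{\mathrm{ob}}(E)$, $S_\alpha\to S$ in the sense of $c_1$ implies $\Phi(S_\alpha)\to\Phi(S)$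 in the sense of $c_2$. *)

theory Defs
  imports
    "HOL-Analysis.Analysis"
    "HOL-Algebra.Lattice"
    "HOL-Library.Function_Algebras"
begin

section \<open>Vector lattices\<close>

text \<open>Functions into a real vector space form a real vector space pointwise. This is needed for
  operators, which live in the type \<open>'a \<Rightarrow> 'a\<close>; addition and zero come from
  \<open>HOL-Library.Function_Algebras\<close>.\<close>

instantiation "fun" :: (type, scaleR) scaleR
begin

definition scaleR_fun_def: "a *\<^sub>R f = (\<lambda>x. a *\<^sub>R f x)"

instance ..

end

instance "fun" :: (type, real_vector) real_vector
  by standard (simp_all add: scaleR_fun_def fun_eq_iff scaleR_add_right scaleR_add_left)

text \<open>A vector lattice is a linear subspace \<open>carrier E\<close> of an ambient real vector space, with its own
  order \<open>\<sqsubseteq>\<^bsub>E\<^esub>\<close> (unrelated to any order on the ambient type). Every real vector space occurs as such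
  a subspace, so this is no restriction. The order is a partial order in the sense of
  \<open>HOL-Algebra\<close>, whose field \<open>eq\<close> is forced to be equality by the locale \<open>lattice\<close>.
  Vector lattices are Archimedean by convention.\<close>

locale vector_lattice = lattice E for E :: "'a::real_vector gorder" (structure) +
  assumes subspace_carrier: "subspace (carrier E)"
    and add_right_le:
      "\<lbrakk>x \<in> carrier E; y \<in> carrier E; z \<in> carrier E; x \<sqsubseteq> y\<rbrakk> \<Longrightarrow> x + z \<sqsubseteq> y + z"
    and scaleR_le:
      "\<lbrakk>x \<in> carrier E; y \<in> carrier E; x \<sqsubseteq> y; 0 \<le> a\<rbrakk> \<Longrightarrow> a *\<^sub>R x \<sqsubseteq> a *\<^sub>R y"
    and archimedean:
      "\<lbrakk>x \<in> carrier E; y \<in> carrier E; 0 \<sqsubseteq> x; \<And>n::nat. real n *\<^sub>R x \<sqsubseteq> y\<rbrakk> \<Longrightarrow> x = 0"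

locale dedekind_complete_vector_lattice = vector_lattice +
  assumes sup_exists:
    "\<lbrakk>D \<subseteq> carrier E; D \<noteq> {}; Upper E D \<noteq> {}\<rbrakk> \<Longrightarrow> \<exists>s. least E s (Upper E D)"

definition vabs :: "'a::real_vector gorder \<Rightarrow> 'a \<Rightarrow> 'a"
  where "vabs G x = x \<squnion>\<^bsub>G\<^esub> (- x)"

definition solid :: "'a::real_vector gorder \<Rightarrow> 'a set \<Rightarrow> bool"
  where "solid G A \<longleftrightarrow> A \<subseteq> carrier G \<and>
    (\<forall>x\<in>carrier G. \<forall>y\<in>A. vabs G x \<sqsubseteq>\<^bsub>G\<^esub> vabs G y \<longrightarrow> x \<in> A)"

text \<open>A band is a solid linear subspace that is closed under existing suprema.\<close>

definition band :: "'a::real_vector gorder \<Rightarrow> 'a set \<Rightarrow> bool"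
  where "band G B \<longleftrightarrow> subspace B \<and> solid G B \<and>
    (\<forall>D s. D \<subseteq> B \<and> least G s (Upper G D) \<longrightarrow> s \<in> B)"


section \<open>Nets and convergence\<close>

text \<open>A net is given by an index set \<open>A\<close>, a preorder \<open>r\<close> directing it, and a function on \<open>A\<close>.\<close>

definition directed_by :: "'i set \<Rightarrow> ('i \<Rightarrow> 'i \<Rightarrow> bool) \<Rightarrow> bool"
  where "directed_by A r \<longleftrightarrow> A \<noteq> {} \<and> (\<forall>\<alpha>\<in>A. r \<alpha> \<alpha>) \<and>
    (\<forall>\<alpha>\<in>A. \<forall>\<beta>\<in>A. \<forall>\<gamma>\<in>A. r \<alpha> \<beta> \<longrightarrow> r \<beta> \<gamma> \<longrightarrow> r \<alpha> \<gamma>) \<and>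
    (\<forall>\<alpha>\<in>A. \<forall>\<beta>\<in>A. \<exists>\<gamma>\<in>A. r \<alpha> \<gamma> \<and> r \<beta> \<gamma>)"

text \<open>The filter of tails, used to express topological convergence of nets by \<open>limitin\<close>.\<close>

definition tail_filter :: "'i set \<Rightarrow> ('i \<Rightarrow> 'i \<Rightarrow> bool) \<Rightarrow> 'i filter"
  where "tail_filter A r = (INF \<alpha>\<in>A. principal {\<beta>\<in>A. r \<alpha> \<beta>})"

lemma directed_byD:
  assumes "directed_by A r"
  shows "A \<noteq> {}"
    and "\<And>\<alpha>. \<alpha> \<in> A \<Longrightarrow> r \<alpha> \<alpha>"
    and "\<And>\<alpha> \<beta> \<gamma>. \<lbrakk>\<alpha> \<in> A; \<beta> \<in> A; \<gamma> \<in> A; r \<alpha> \<beta>; r \<beta> \<gamma>\<rbrakk> \<Longrightarrow> r \<alpha> \<gamma>"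
    and "\<And>\<alpha> \<beta>. \<lbrakk>\<alpha> \<in> A; \<beta> \<in> A\<rbrakk> \<Longrightarrow> \<exists>\<gamma>\<in>A. r \<alpha> \<gamma> \<and> r \<beta> \<gamma>"
  using assms unfolding directed_by_def by blast+

lemma eventually_tail_filter:
  assumes A: "directed_by A r"
  shows "eventually P (tail_filter A r) \<longleftrightarrow> (\<exists>\<alpha>\<^sub>0\<in>A. \<forall>\<alpha>\<in>A. r \<alpha>\<^sub>0 \<alpha> \<longrightarrow> P \<alpha>)"
proof -
  have "\<exists>c\<in>A. principal {\<gamma>\<in>A. r c \<gamma>} \<le> inf (principal {\<gamma>\<in>A. r a \<gamma>}) (principal {\<gamma>\<in>A. r b \<gamma>})"
    if ab: "a \<in> A" "b \<in> A" for a b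
  proof -
    obtain c where c: "c \<in> A" "r a c" "r b c" using directed_byD(4)[OF A ab] by blast
    have "{\<gamma>\<in>A. r c \<gamma>} \<subseteq> {\<gamma>\<in>A. r a \<gamma>} \<inter> {\<gamma>\<in>A. r b \<gamma>}"
      using directed_byD(3)[OF A ab(1) c(1) _ c(2)] directed_byD(3)[OF A ab(2) c(1) _ c(3)] by blast
    with c(1) show ?thesis by auto
  qed
  then have "eventually P (tail_filter A r) \<longleftrightarrow> (\<exists>a\<in>A. eventually P (principal {\<gamma>\<in>A. r a \<gamma>}))"
    unfolding tail_filter_def by (rule eventually_INF_base[OF directed_byD(1)[OF A]])
  then show ?thesis by (auto simp: eventually_principal)
qed

text \<open>\<open>decreasing_to_zero G B s y\<close> is \<open>y\<^sub>\<beta> \<down> 0\<close>.\<close>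

definition decreasing_to_zero ::
    "'g::real_vector gorder \<Rightarrow> 'j set \<Rightarrow> ('j \<Rightarrow> 'j \<Rightarrow> bool) \<Rightarrow> ('j \<Rightarrow> 'g) \<Rightarrow> bool"
  where "decreasing_to_zero G B s y \<longleftrightarrow> directed_by B s \<and> y \<in> B \<rightarrow> carrier G \<and>
    (\<forall>\<beta>\<in>B. \<forall>\<gamma>\<in>B. s \<beta> \<gamma> \<longrightarrow> y \<gamma> \<sqsubseteq>\<^bsub>G\<^esub> y \<beta>) \<and>
    greatest G 0 (Lower G (y ` B))"

text \<open>The dominating net may have an index set different from that of the given net. Its index set
  is taken inside the type of \<open>G\<close>; lemma \<open>order_convI\<close> below shows that this is no restriction.\<close>

definition order_conv ::
    "'g::real_vector gorder \<Rightarrow> 'i set \<Rightarrow> ('i \<Rightarrow> 'i \<Rightarrow> bool) \<Rightarrow> ('i \<Rightarrow> 'g) \<Rightarrow> 'g \<Rightarrow> bool"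
  where "order_conv G A r x l \<longleftrightarrow>
    (\<exists>(B :: 'g set) s y. decreasing_to_zero G B s y \<and>
      (\<forall>\<beta>\<^sub>0\<in>B. \<exists>\<alpha>\<^sub>0\<in>A. \<forall>\<alpha>\<in>A. r \<alpha>\<^sub>0 \<alpha> \<longrightarrow> vabs G (l - x \<alpha>) \<sqsubseteq>\<^bsub>G\<^esub> y \<beta>\<^sub>0))"

definition uo_conv ::
    "'g::real_vector gorder \<Rightarrow> 'i set \<Rightarrow> ('i \<Rightarrow> 'i \<Rightarrow> bool) \<Rightarrow> ('i \<Rightarrow> 'g) \<Rightarrow> 'g \<Rightarrow> bool"
  where "uo_conv G A r x l \<longleftrightarrow>
    (\<forall>y\<in>carrier G. 0 \<sqsubseteq>\<^bsub>G\<^esub> y \<longrightarrow> order_conv G A r (\<lambda>\<alpha>. vabs G (x \<alpha> - l) \<sqinter>\<^bsub>G\<^esub> y) 0)"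

text \<open>HOL cannot quantify over all index types inside a formula. For a net in \<open>G :: 'g gorder\<close>, all
  notions of convergence depend only on the images of its tails, so every net can be replaced by the
  one indexed by the pairs \<open>(U, u)\<close> with \<open>U\<close> the image of a tail and \<open>u \<in> U\<close>. Hence nets with
  index sets in \<open>'g set \<times> 'g\<close> represent all nets.\<close>

type_synonym 'g net_index = "'g set \<times> 'g"


section \<open>Hausdorff uo-Lebesgue topologies\<close>

definition linear_topology :: "'g::real_vector gorder \<Rightarrow> 'g topology \<Rightarrow> bool"
  where "linear_topology G \<tau> \<longleftrightarrow> topspace \<tau> = carrier G \<and>
    continuous_map (prod_topology \<tau> \<tau>) \<tau> (\<lambda>(x, y). x + y) \<and>
    continuous_map (prod_topology euclideanreal \<tau>) \<tau> (\<lambda>(a, x). a *\<^sub>R x)"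

definition locally_solid :: "'g::real_vector gorder \<Rightarrow> 'g topology \<Rightarrow> bool"
  where "locally_solid G \<tau> \<longleftrightarrow> linear_topology G \<tau> \<and>
    (\<forall>U. openin \<tau> U \<and> 0 \<in> U \<longrightarrow>
      (\<exists>V W. openin \<tau> V \<and> 0 \<in> V \<and> V \<subseteq> W \<and> W \<subseteq> U \<and> solid G W))"

definition uo_Lebesgue :: "'g::real_vector gorder \<Rightarrow> 'g topology \<Rightarrow> bool"
  where "uo_Lebesgue G \<tau> \<longleftrightarrow> locally_solid G \<tau> \<and>
    (\<forall>(A :: 'g net_index set) r x.
      directed_by A r \<and> x \<in> A \<rightarrow> carrier G \<and> uo_conv G A r x 0 \<longrightarrow>
      limitin \<tau> x 0 (tail_filter A r))"

definition admits_Hausdorff_uo_Lebesgue :: "'g::real_vector gorder \<Rightarrow> bool"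
  where "admits_Hausdorff_uo_Lebesgue G \<longleftrightarrow> (\<exists>\<tau>. uo_Lebesgue G \<tau> \<and> Hausdorff_space \<tau>)"

definition tau_hat :: "'g::real_vector gorder \<Rightarrow> 'g topology"
  where "tau_hat G = (THE \<tau>. uo_Lebesgue G \<tau> \<and> Hausdorff_space \<tau>)"


section \<open>Operators\<close>

text \<open>An operator on \<open>E\<close> is extended by zero outside \<open>carrier E\<close>, so that equality of operators is
  equality of functions and pointwise operations are those of the ambient function space.\<close>

definition linear_operators :: "'a::real_vector gorder \<Rightarrow> ('a \<Rightarrow> 'a) set"
  where "linear_operators E = {T. T \<in> carrier E \<rightarrow> carrier E \<and>
    (\<forall>x\<in>carrier E. \<forall>y\<in>carrier E. T (x + y) = T x + T y) \<and>
    (\<forall>a. \<forall>x\<in>carrier E. T (a *\<^sub>R x) = a *\<^sub>R T x) \<and>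
    (\<forall>x. x \<notin> carrier E \<longrightarrow> T x = 0)}"

definition order_bounded :: "'a::real_vector gorder \<Rightarrow> ('a \<Rightarrow> 'a) \<Rightarrow> bool"
  where "order_bounded E T \<longleftrightarrow> (\<forall>a\<in>carrier E. \<forall>b\<in>carrier E.
    \<exists>c\<in>carrier E. \<exists>d\<in>carrier E. T ` \<lbrace>a..b\<rbrace>\<^bsub>E\<^esub> \<subseteq> \<lbrace>c..d\<rbrace>\<^bsub>E\<^esub>)"

definition Lob :: "'a::real_vector gorder \<Rightarrow> ('a \<Rightarrow> 'a) gorder"
  where "Lob E = \<lparr>carrier = {T \<in> linear_operators E. order_bounded E T},
    eq = (=),
    le = (\<lambda>S T. \<forall>x\<in>carrier E. 0 \<sqsubseteq>\<^bsub>E\<^esub> x \<longrightarrow> S x \<sqsubseteq>\<^bsub>E\<^esub> T x)\<rparr>"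

definition Loc :: "'a::real_vector gorder \<Rightarrow> ('a \<Rightarrow> 'a) set"
  where "Loc E = {T \<in> linear_operators E.
    \<forall>(A :: 'a net_index set) r x.
      directed_by A r \<and> x \<in> A \<rightarrow> carrier E \<and> order_conv E A r x 0 \<longrightarrow>
      order_conv E A r (\<lambda>\<alpha>. T (x \<alpha>)) 0}"

definition Orth :: "'a::real_vector gorder \<Rightarrow> ('a \<Rightarrow> 'a) set"
  where "Orth E = {T \<in> carrier (Lob E). \<forall>B. band E B \<longrightarrow> T ` B \<subseteq> B}"


section \<open>The six modes of convergence for nets of order bounded operators\<close>

datatype conv_mode =
    Mode_o      \<comment> \<open>order convergence in \<open>Lob E\<close>\<close>
  | Mode_uo     \<comment> \<open>unbounded order convergence in \<open>Lob E\<close>\<close>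
  | Mode_tau    \<comment> \<open>convergence in the Hausdorff uo-Lebesgue topology of \<open>Lob E\<close>\<close>
  | Mode_SO     \<comment> \<open>pointwise order convergence in \<open>E\<close>\<close>
  | Mode_SUO    \<comment> \<open>pointwise unbounded order convergence in \<open>E\<close>\<close>
  | Mode_Stau   \<comment> \<open>pointwise convergence in the Hausdorff uo-Lebesgue topology of \<open>E\<close>\<close>

fun mode_conv ::
    "conv_mode \<Rightarrow> 'a::real_vector gorder \<Rightarrow> 'i set \<Rightarrow> ('i \<Rightarrow> 'i \<Rightarrow> bool) \<Rightarrow> ('i \<Rightarrow> 'a \<Rightarrow> 'a) \<Rightarrow>
      ('a \<Rightarrow> 'a) \<Rightarrow> bool"
  where
    "mode_conv Mode_o E A r S L = order_conv (Lob E) A r S L"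
  | "mode_conv Mode_uo E A r S L = uo_conv (Lob E) A r S L"
  | "mode_conv Mode_tau E A r S L = limitin (tau_hat (Lob E)) S L (tail_filter A r)"
  | "mode_conv Mode_SO E A r S L = (\<forall>x\<in>carrier E. order_conv E A r (\<lambda>\<alpha>. S \<alpha> x) (L x))"
  | "mode_conv Mode_SUO E A r S L = (\<forall>x\<in>carrier E. uo_conv E A r (\<lambda>\<alpha>. S \<alpha> x) (L x))"
  | "mode_conv Mode_Stau E A r S L =
      (\<forall>x\<in>carrier E. limitin (tau_hat E) (\<lambda>\<alpha>. S \<alpha> x) (L x) (tail_filter A r))"

definition mode_continuous ::
    "conv_mode \<Rightarrow> conv_mode \<Rightarrow> 'a::real_vector gorder \<Rightarrow> (('a \<Rightarrow> 'a) \<Rightarrow> ('a \<Rightarrow> 'a)) \<Rightarrow> bool"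
  where "mode_continuous c1 c2 E \<Phi> \<longleftrightarrow>
    (\<forall>(A :: ('a \<Rightarrow> 'a) net_index set) r S L.
      directed_by A r \<and> S \<in> A \<rightarrow> carrier (Lob E) \<and> L \<in> carrier (Lob E) \<and> mode_conv c1 E A r S L \<longrightarrow>
      mode_conv c2 E A r (\<lambda>\<alpha>. \<Phi> (S \<alpha>)) (\<Phi> L))"

definition left_mult :: "('a \<Rightarrow> 'a) \<Rightarrow> ('a \<Rightarrow> 'a) \<Rightarrow> ('a \<Rightarrow> 'a)"
  where "left_mult T S = T \<circ> S"

definition admissible :: "conv_mode \<Rightarrow> conv_mode \<Rightarrow> 'a::real_vector gorder \<Rightarrow> bool"
  where "admissible c1 c2 E \<longleftrightarrow> dedekind_complete_vector_lattice E \<and>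
    ({c1, c2} \<inter> {Mode_tau, Mode_Stau} \<noteq> {} \<longrightarrow> admits_Hausdorff_uo_Lebesgue E)"


section \<open>The choices of index types are no restriction\<close>

lemma order_convI:
  fixes G :: "'g::real_vector gorder" and B :: "'j set"
  assumes G: "vector_lattice G"
    and y: "decreasing_to_zero G B s y"
    and dom: "\<And>\<beta>\<^sub>0. \<beta>\<^sub>0 \<in> B \<Longrightarrow>
      \<exists>\<alpha>\<^sub>0\<in>A. \<forall>\<alpha>\<in>A. r \<alpha>\<^sub>0 \<alpha> \<longrightarrow> vabs G (l - x \<alpha>) \<sqsubseteq>\<^bsub>G\<^esub> y \<beta>\<^sub>0"
  shows "order_conv G A r x l"
proof -
  interpret vector_lattice G by (rule G)
  have c: "y b \<in> carrier G" if "b \<in> B" for b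
    using y that by (auto simp: decreasing_to_zero_def)
  have d: "\<exists>d\<in>B. y d \<sqsubseteq>\<^bsub>G\<^esub> y b \<and> y d \<sqsubseteq>\<^bsub>G\<^esub> y b'" if "b \<in> B" "b' \<in> B" for b b'
  proof -
    have B: "directed_by B s" using y by (simp add: decreasing_to_zero_def)
    obtain d where d: "d \<in> B" "s b d" "s b' d" using directed_byD(4)[OF B \<open>b \<in> B\<close> \<open>b' \<in> B\<close>] by blast
    moreover have "\<forall>\<beta>\<in>B. \<forall>\<gamma>\<in>B. s \<beta> \<gamma> \<longrightarrow> y \<gamma> \<sqsubseteq>\<^bsub>G\<^esub> y \<beta>"
      using y by (simp add: decreasing_to_zero_def)
    ultimately show ?thesis using that by blast
  qed
  have "directed_by (y ` B) (\<lambda>u v. v \<sqsubseteq>\<^bsub>G\<^esub> u)"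
    unfolding directed_by_def
  proof (intro conjI ballI impI)
    show "y ` B \<noteq> {}" using y by (auto simp: decreasing_to_zero_def directed_by_def)
  next
    fix u assume "u \<in> y ` B"
    then show "u \<sqsubseteq>\<^bsub>G\<^esub> u" using c by auto
  next
    fix u v w assume "u \<in> y ` B" "v \<in> y ` B" "w \<in> y ` B" "v \<sqsubseteq>\<^bsub>G\<^esub> u" "w \<sqsubseteq>\<^bsub>G\<^esub> v"
    moreover from this have "u \<in> carrier G" "v \<in> carrier G" "w \<in> carrier G" using c by auto
    ultimately show "w \<sqsubseteq>\<^bsub>G\<^esub> u" using le_trans[of w v u] by simp
  next
    fix u v assume "u \<in> y ` B" "v \<in> y ` B"
    then obtain b b' where b: "b \<in> B" "b' \<in> B" "u = y b" "v = y b'" by blast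
    then show "\<exists>w\<in>y ` B. w \<sqsubseteq>\<^bsub>G\<^esub> u \<and> w \<sqsubseteq>\<^bsub>G\<^esub> v" using d[OF b(1,2)] by blast
  qed
  then have "decreasing_to_zero G (y ` B) (\<lambda>u v. v \<sqsubseteq>\<^bsub>G\<^esub> u) (\<lambda>u. u)"
    using y c by (auto simp: decreasing_to_zero_def)
  moreover have "\<forall>u\<in>y ` B. \<exists>\<alpha>\<^sub>0\<in>A. \<forall>\<alpha>\<in>A. r \<alpha>\<^sub>0 \<alpha> \<longrightarrow> vabs G (l - x \<alpha>) \<sqsubseteq>\<^bsub>G\<^esub> u"
    using dom by blast
  ultimately show ?thesis
    unfolding order_conv_def by blast
qed

lemma net_reindex:
  fixes x :: "'i \<Rightarrow> 'g"
  assumes A: "directed_by A r"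
  obtains A' :: "'g net_index set" and r' where
    "directed_by A' r'" "snd ` A' \<subseteq> x ` A"
    "\<forall>P. (\<exists>\<alpha>\<^sub>0\<in>A. \<forall>\<alpha>\<in>A. r \<alpha>\<^sub>0 \<alpha> \<longrightarrow> P (x \<alpha>)) \<longleftrightarrow>
      (\<exists>\<alpha>\<^sub>0\<in>A'. \<forall>\<alpha>\<in>A'. r' \<alpha>\<^sub>0 \<alpha> \<longrightarrow> P (snd \<alpha>))"
proof
  define tl where "tl a = x ` {b\<in>A. r a b}" for a
  define A' where "A' = {(U, u). (\<exists>a\<in>A. U = tl a) \<and> u \<in> U}"
  define r' :: "'g net_index \<Rightarrow> 'g net_index \<Rightarrow> bool" where "r' p q \<longleftrightarrow> fst q \<subseteq> fst p" for p q
  have ne: "x a \<in> tl a" if "a \<in> A" for a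
    using directed_byD(2)[OF A that] that by (auto simp: tl_def)
  have sub: "tl b \<subseteq> tl a" if "a \<in> A" "b \<in> A" "r a b" for a b
    using directed_byD(3)[OF A that(1,2) _ that(3)] unfolding tl_def by blast
  show "directed_by A' r'"
    unfolding directed_by_def
  proof (intro conjI ballI impI)
    obtain a where "a \<in> A" using directed_byD(1)[OF A] by blast
    then show "A' \<noteq> {}" using ne by (auto simp: A'_def)
  next
    fix p q assume "p \<in> A'" "q \<in> A'"
    then obtain a b where ab: "a \<in> A" "fst p = tl a" "b \<in> A" "fst q = tl b"
      by (auto simp: A'_def)
    obtain c where c: "c \<in> A" "r a c" "r b c" using directed_byD(4)[OF A ab(1,3)] by blast
    have "(tl c, x c) \<in> A'" using ne c by (auto simp: A'_def)
    moreover have "r' p (tl c, x c)" "r' q (tl c, x c)"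
      using sub ab c by (auto simp: r'_def)
    ultimately show "\<exists>w\<in>A'. r' p w \<and> r' q w" by blast
  qed (auto simp: r'_def)
  show "snd ` A' \<subseteq> x ` A" by (auto simp: A'_def tl_def)
  show "\<forall>P. (\<exists>\<alpha>\<^sub>0\<in>A. \<forall>\<alpha>\<in>A. r \<alpha>\<^sub>0 \<alpha> \<longrightarrow> P (x \<alpha>)) \<longleftrightarrow>
      (\<exists>\<alpha>\<^sub>0\<in>A'. \<forall>\<alpha>\<in>A'. r' \<alpha>\<^sub>0 \<alpha> \<longrightarrow> P (snd \<alpha>))"
  proof (intro allI iffI)
    fix P
    assume "\<exists>\<alpha>\<^sub>0\<in>A. \<forall>\<alpha>\<in>A. r \<alpha>\<^sub>0 \<alpha> \<longrightarrow> P (x \<alpha>)"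
    then obtain a where a: "a \<in> A" "\<forall>u\<in>tl a. P u" by (auto simp: tl_def)
    then have "(tl a, x a) \<in> A'" using ne by (auto simp: A'_def)
    moreover have "\<forall>q\<in>A'. r' (tl a, x a) q \<longrightarrow> P (snd q)"
      using a by (auto simp: A'_def r'_def)
    ultimately show "\<exists>\<alpha>\<^sub>0\<in>A'. \<forall>\<alpha>\<in>A'. r' \<alpha>\<^sub>0 \<alpha> \<longrightarrow> P (snd \<alpha>)" by blast
  next
    fix P
    assume "\<exists>\<alpha>\<^sub>0\<in>A'. \<forall>\<alpha>\<in>A'. r' \<alpha>\<^sub>0 \<alpha> \<longrightarrow> P (snd \<alpha>)"
    then obtain p where p: "p \<in> A'" "\<forall>q\<in>A'. r' p q \<longrightarrow> P (snd q)" by blast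
    then obtain a where a: "a \<in> A" "fst p = tl a" by (auto simp: A'_def)
    have "P (x b)" if "b \<in> A" "r a b" for b
    proof -
      have "(tl b, x b) \<in> A'" using ne[OF that(1)] that(1) by (auto simp: A'_def)
      moreover have "r' p (tl b, x b)" using sub[OF a(1) that] a(2) by (simp add: r'_def)
      ultimately show ?thesis using p(2) by fastforce
    qed
    with a show "\<exists>\<alpha>\<^sub>0\<in>A. \<forall>\<alpha>\<in>A. r \<alpha>\<^sub>0 \<alpha> \<longrightarrow> P (x \<alpha>)" by blast
  qed
qed

lemma order_conv_reindex:
  assumes tails: "\<forall>P. (\<exists>\<alpha>\<^sub>0\<in>A. \<forall>\<alpha>\<in>A. r \<alpha>\<^sub>0 \<alpha> \<longrightarrow> P (x \<alpha>)) \<longleftrightarrow>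
      (\<exists>\<alpha>\<^sub>0\<in>A'. \<forall>\<alpha>\<in>A'. r' \<alpha>\<^sub>0 \<alpha> \<longrightarrow> P (x' \<alpha>))"
  shows "order_conv G A r (\<lambda>\<alpha>. f (x \<alpha>)) l \<longleftrightarrow> order_conv G A' r' (\<lambda>\<alpha>. f (x' \<alpha>)) l"
proof -
  have "(\<exists>\<alpha>\<^sub>0\<in>A. \<forall>\<alpha>\<in>A. r \<alpha>\<^sub>0 \<alpha> \<longrightarrow> vabs G (l - f (x \<alpha>)) \<sqsubseteq>\<^bsub>G\<^esub> u) \<longleftrightarrow>
      (\<exists>\<alpha>\<^sub>0\<in>A'. \<forall>\<alpha>\<in>A'. r' \<alpha>\<^sub>0 \<alpha> \<longrightarrow> vabs G (l - f (x' \<alpha>)) \<sqsubseteq>\<^bsub>G\<^esub> u)" for u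
    by (rule tails[THEN spec])
  then show ?thesis unfolding order_conv_def by (simp only:)
qed

lemma uo_conv_reindex:
  assumes tails: "\<forall>P. (\<exists>\<alpha>\<^sub>0\<in>A. \<forall>\<alpha>\<in>A. r \<alpha>\<^sub>0 \<alpha> \<longrightarrow> P (x \<alpha>)) \<longleftrightarrow>
      (\<exists>\<alpha>\<^sub>0\<in>A'. \<forall>\<alpha>\<in>A'. r' \<alpha>\<^sub>0 \<alpha> \<longrightarrow> P (x' \<alpha>))"
  shows "uo_conv G A r (\<lambda>\<alpha>. f (x \<alpha>)) l \<longleftrightarrow> uo_conv G A' r' (\<lambda>\<alpha>. f (x' \<alpha>)) l"
proof -
  have "order_conv G A r (\<lambda>\<alpha>. vabs G (f (x \<alpha>) - l) \<sqinter>\<^bsub>G\<^esub> y) 0 \<longleftrightarrow>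
      order_conv G A' r' (\<lambda>\<alpha>. vabs G (f (x' \<alpha>) - l) \<sqinter>\<^bsub>G\<^esub> y) 0" for y
    by (rule order_conv_reindex[where f = "\<lambda>v. vabs G (f v - l) \<sqinter>\<^bsub>G\<^esub> y"]) (rule tails)
  then show ?thesis unfolding uo_conv_def by (simp only:)
qed

lemma limitin_reindex:
  assumes A: "directed_by A r" and A': "directed_by A' r'"
    and tails: "\<forall>P. (\<exists>\<alpha>\<^sub>0\<in>A. \<forall>\<alpha>\<in>A. r \<alpha>\<^sub>0 \<alpha> \<longrightarrow> P (x \<alpha>)) \<longleftrightarrow>
      (\<exists>\<alpha>\<^sub>0\<in>A'. \<forall>\<alpha>\<in>A'. r' \<alpha>\<^sub>0 \<alpha> \<longrightarrow> P (x' \<alpha>))"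
  shows "limitin \<tau> (\<lambda>\<alpha>. f (x \<alpha>)) l (tail_filter A r) \<longleftrightarrow>
    limitin \<tau> (\<lambda>\<alpha>. f (x' \<alpha>)) l (tail_filter A' r')"
proof -
  have "(\<exists>\<alpha>\<^sub>0\<in>A. \<forall>\<alpha>\<in>A. r \<alpha>\<^sub>0 \<alpha> \<longrightarrow> f (x \<alpha>) \<in> U) \<longleftrightarrow>
      (\<exists>\<alpha>\<^sub>0\<in>A'. \<forall>\<alpha>\<in>A'. r' \<alpha>\<^sub>0 \<alpha> \<longrightarrow> f (x' \<alpha>) \<in> U)" for U
    by (rule tails[THEN spec])
  then show ?thesis
    unfolding limitin_def eventually_tail_filter[OF A] eventually_tail_filter[OF A'] by (simp only:)
qed

lemma mode_conv_reindex:
  assumes A: "directed_by A r" and A': "directed_by A' r'"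
    and tails: "\<forall>P. (\<exists>\<alpha>\<^sub>0\<in>A. \<forall>\<alpha>\<in>A. r \<alpha>\<^sub>0 \<alpha> \<longrightarrow> P (x \<alpha>)) \<longleftrightarrow>
      (\<exists>\<alpha>\<^sub>0\<in>A'. \<forall>\<alpha>\<in>A'. r' \<alpha>\<^sub>0 \<alpha> \<longrightarrow> P (x' \<alpha>))"
  shows "mode_conv c E A r (\<lambda>\<alpha>. f (x \<alpha>)) l \<longleftrightarrow> mode_conv c E A' r' (\<lambda>\<alpha>. f (x' \<alpha>)) l"
proof (cases c)
  case Mode_o
  show ?thesis unfolding Mode_o mode_conv.simps
    by (rule order_conv_reindex) (rule tails)
next
  case Mode_uo
  show ?thesis unfolding Mode_uo mode_conv.simps
    by (rule uo_conv_reindex) (rule tails)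
next
  case Mode_tau
  show ?thesis unfolding Mode_tau mode_conv.simps
    by (rule limitin_reindex[OF A A']) (rule tails)
next
  case Mode_SO
  have "order_conv E A r (\<lambda>\<alpha>. f (x \<alpha>) z) (l z) \<longleftrightarrow> order_conv E A' r' (\<lambda>\<alpha>. f (x' \<alpha>) z) (l z)" for z
    by (rule order_conv_reindex[where f = "\<lambda>v. f v z"]) (rule tails)
  then show ?thesis unfolding Mode_SO mode_conv.simps by (simp only:)
next
  case Mode_SUO
  have "uo_conv E A r (\<lambda>\<alpha>. f (x \<alpha>) z) (l z) \<longleftrightarrow> uo_conv E A' r' (\<lambda>\<alpha>. f (x' \<alpha>) z) (l z)" for z
    by (rule uo_conv_reindex[where f = "\<lambda>v. f v z"]) (rule tails)
  then show ?thesis unfolding Mode_SUO mode_conv.simps by (simp only:)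
next
  case Mode_Stau
  have "limitin (tau_hat E) (\<lambda>\<alpha>. f (x \<alpha>) z) (l z) (tail_filter A r) \<longleftrightarrow>
      limitin (tau_hat E) (\<lambda>\<alpha>. f (x' \<alpha>) z) (l z) (tail_filter A' r')" for z
    by (rule limitin_reindex[OF A A', where f = "\<lambda>v. f v z"]) (rule tails)
  then show ?thesis unfolding Mode_Stau mode_conv.simps by (simp only:)
qed

lemma uo_LebesgueD:
  fixes A :: "'i set" and x :: "'i \<Rightarrow> 'g::real_vector"
  assumes "uo_Lebesgue G \<tau>" "directed_by A r" "x \<in> A \<rightarrow> carrier G" "uo_conv G A r x 0"
  shows "limitin \<tau> x 0 (tail_filter A r)"
proof -
  obtain A' :: "'g net_index set" and r' where *: "directed_by A' r'" "snd ` A' \<subseteq> x ` A"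
    "\<forall>P. (\<exists>\<alpha>\<^sub>0\<in>A. \<forall>\<alpha>\<in>A. r \<alpha>\<^sub>0 \<alpha> \<longrightarrow> P (x \<alpha>)) \<longleftrightarrow>
      (\<exists>\<alpha>\<^sub>0\<in>A'. \<forall>\<alpha>\<in>A'. r' \<alpha>\<^sub>0 \<alpha> \<longrightarrow> P (snd \<alpha>))"
    by (rule net_reindex[OF assms(2), where x = x]) (rule that)
  have "snd \<in> A' \<rightarrow> carrier G"
  proof
    fix p assume "p \<in> A'"
    then have "snd p \<in> x ` A" using *(2) by blast
    then show "snd p \<in> carrier G" using assms(3) by (auto dest: funcset_mem)
  qed
  moreover have "uo_conv G A' r' snd 0"
    using uo_conv_reindex[OF *(3), where f = "\<lambda>u. u" and G = G and l = 0] assms(4) by (simp only:)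
  ultimately have "limitin \<tau> snd 0 (tail_filter A' r')"
    using assms(1) *(1) unfolding uo_Lebesgue_def by blast
  then show ?thesis
    using limitin_reindex[OF assms(2) *(1) *(3), where f = "\<lambda>u. u" and \<tau> = \<tau> and l = 0] by (simp only:)
qed

lemma LocD:
  fixes A :: "'i set" and x :: "'i \<Rightarrow> 'a::real_vector"
  assumes "T \<in> Loc E" "directed_by A r" "x \<in> A \<rightarrow> carrier E" "order_conv E A r x 0"
  shows "order_conv E A r (\<lambda>\<alpha>. T (x \<alpha>)) 0"
proof -
  obtain A' :: "'a net_index set" and r' where *: "directed_by A' r'" "snd ` A' \<subseteq> x ` A"
    "\<forall>P. (\<exists>\<alpha>\<^sub>0\<in>A. \<forall>\<alpha>\<in>A. r \<alpha>\<^sub>0 \<alpha> \<longrightarrow> P (x \<alpha>)) \<longleftrightarrow>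
      (\<exists>\<alpha>\<^sub>0\<in>A'. \<forall>\<alpha>\<in>A'. r' \<alpha>\<^sub>0 \<alpha> \<longrightarrow> P (snd \<alpha>))"
    by (rule net_reindex[OF assms(2), where x = x]) (rule that)
  have "snd \<in> A' \<rightarrow> carrier E"
  proof
    fix p assume "p \<in> A'"
    then have "snd p \<in> x ` A" using *(2) by blast
    then show "snd p \<in> carrier E" using assms(3) by (auto dest: funcset_mem)
  qed
  moreover have "order_conv E A' r' snd 0"
    using order_conv_reindex[OF *(3), where f = "\<lambda>u. u" and G = E and l = 0] assms(4) by (simp only:)
  ultimately have "order_conv E A' r' (\<lambda>\<alpha>. T (snd \<alpha>)) 0"
    using assms(1) *(1) unfolding Loc_def by blast
  then show ?thesis
    using order_conv_reindex[OF *(3), where f = T and G = E and l = 0] by (simp only:)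
qed

lemma mode_continuousD:
  fixes A :: "'i set" and S :: "'i \<Rightarrow> 'a::real_vector \<Rightarrow> 'a"
  assumes "mode_continuous c1 c2 E \<Phi>" "directed_by A r" "S \<in> A \<rightarrow> carrier (Lob E)"
    "L \<in> carrier (Lob E)" "mode_conv c1 E A r S L"
  shows "mode_conv c2 E A r (\<lambda>\<alpha>. \<Phi> (S \<alpha>)) (\<Phi> L)"
proof -
  obtain A' :: "('a \<Rightarrow> 'a) net_index set" and r' where *: "directed_by A' r'" "snd ` A' \<subseteq> S ` A"
    "\<forall>P. (\<exists>\<alpha>\<^sub>0\<in>A. \<forall>\<alpha>\<in>A. r \<alpha>\<^sub>0 \<alpha> \<longrightarrow> P (S \<alpha>)) \<longleftrightarrow>
      (\<exists>\<alpha>\<^sub>0\<in>A'. \<forall>\<alpha>\<in>A'. r' \<alpha>\<^sub>0 \<alpha> \<longrightarrow> P (snd \<alpha>))"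
    by (rule net_reindex[OF assms(2), where x = S]) (rule that)
  have "snd \<in> A' \<rightarrow> carrier (Lob E)"
  proof
    fix p assume "p \<in> A'"
    then have "snd p \<in> S ` A" using *(2) by blast
    then show "snd p \<in> carrier (Lob E)" using assms(3) by (auto dest: funcset_mem)
  qed
  moreover have "mode_conv c1 E A' r' snd L"
    using mode_conv_reindex[OF assms(2) *(1) *(3), where f = "\<lambda>u. u" and c = c1 and E = E and l = L]
      assms(5) by (simp only:)
  ultimately have "mode_conv c2 E A' r' (\<lambda>\<alpha>. \<Phi> (snd \<alpha>)) (\<Phi> L)"
    using assms(1,4) *(1) unfolding mode_continuous_def by blast
  then show ?thesis
    using mode_conv_reindex[OF assms(2) *(1) *(3), where f = \<Phi> and c = c2 and E = E and l = "\<Phi> L"]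
    by (simp only:)
qed

end

theory Submission
  imports Defs
begin

text \<open>
  The continuity assertions rest on \<open>\<bar>T S - T L\<bar> \<le> \<bar>T\<bar> \<bar>S - L\<bar>\<close>, so that only multiplication by
  the positive operator \<open>\<bar>T\<bar>\<close> matters. If \<open>T\<close> is order continuous, then so is \<open>\<bar>T\<bar>\<close> (Ogasawara's theorem,
  \<open>Loc_modulus\<close>), and it preserves dominating nets \<open>y\<^sub>\<beta> \<down> 0\<close>, in \<open>E\<close> and pointwise in \<open>Lob E\<close>. If \<open>T\<close> is an
  orthomorphism, then \<open>\<pi> = \<bar>T\<bar>\<close> satisfies \<open>\<pi> x \<sqinter> y \<le> (1 + \<pi>) (x \<sqinter> y)\<close> for positive \<open>x\<close> and \<open>y\<close>
  (\<open>positive_orthomorphism.meet_leq\<close>). Hence \<open>\<pi>\<close> preserves smallness of truncations, which is what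
  unbounded order convergence is about. Since \<open>S \<mapsto> \<pi> S\<close> is an orthomorphism of \<open>Lob E\<close>
  (\<open>Lob_positive_orthomorphism\<close>), one argument serves the strong modes and the modes of \<open>Lob E\<close>.

  Hausdorff uo-Lebesgue topologies enter through two facts. A neighbourhood of zero in such a topology
  contains all \<open>x\<close> with \<open>\<bar>x\<bar> \<sqinter> u\<close> in some smaller neighbourhood, for a suitable \<open>u\<close> (\<open>unbounded_nbhd\<close>), and
  on the interval \<open>[0, u]\<close> any two such topologies agree by Amemiya's theorem (\<open>nbhd_on_interval\<close>). This
  gives uniqueness and, with \<open>meet_leq\<close>, continuity of orthomorphisms. On \<open>Lob E\<close> the topology exists as
  soon as it does on \<open>E\<close>: the sets of all \<open>S\<close> with \<open>(\<bar>S\<bar> \<sqinter> R) x\<close> in \<open>U\<close> form a base of it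
  (\<open>Lob_uo_Lebesgue_base\<close>).

  All counterexamples live on one lattice, the bounded martingales on the infinite binary tree. This is a
  concrete model of the space of essentially bounded functions of a sequence of coin tosses; the value at
  a node is the mean over the cylinder of that node, so that the value at the root is the integral. There
  the implications between the modes that fail for the identity operator are refuted as follows.
  \<^item> Evaluations at nodes with disjoint cylinders are disjoint functionals, hence unbounded order null, but
    all of them send \<open>1\<close> to \<open>1\<close>.
  \<^item> The operators \<open>f \<mapsto> (\<integral>f) b\<^sub>n\<close> with disjoint \<open>b\<^sub>n\<close> of integral one are unbounded order null, also
    pointwise, but the sequence of the \<open>b\<^sub>n\<close> is not order bounded.
  \<^item> Multiplication by the indicators of the cylinders (the typewriter) tends to zero in probability but
    not unbounded in order.
  \<^item> Integration against the Rademacher functions tends pointwise to zero in order, but all these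
    functionals have the integral as modulus.

  For an order continuous \<open>T\<close> that does not preserve the unbounded modes, the integral undoes the second
  example: \<open>T = (f \<mapsto> (\<integral>f) 1)\<close> maps every member of that sequence to \<open>T\<close>. For an order bounded \<open>T\<close> that
  does not preserve order convergence, \<open>T = (f \<mapsto> \<phi> f 1)\<close> with \<open>\<phi> f\<close> a generalized limit of \<open>f\<close> along
  one branch is unchanged when composed with the multiplications by the indicators of the cylinders around
  that branch, although these decrease to zero.
\<close>

section \<open>Calculus in vector lattices\<close>

context vector_lattice
begin

lemma zero_closed [simp, intro]: "0 \<in> carrier E"
  using subspace_carrier by (rule subspace_0)

lemma add_closed [simp, intro]: "x \<in> carrier E \<Longrightarrow> y \<in> carrier E \<Longrightarrow> x + y \<in> carrier E"
  using subspace_carrier by (rule subspace_add)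

lemma scaleR_closed [simp, intro]: "x \<in> carrier E \<Longrightarrow> a *\<^sub>R x \<in> carrier E"
  using subspace_carrier by (rule subspace_scale)

lemma uminus_closed [simp, intro]: "x \<in> carrier E \<Longrightarrow> - x \<in> carrier E"
  using subspace_carrier by (rule subspace_neg)

lemma diff_closed [simp, intro]: "x \<in> carrier E \<Longrightarrow> y \<in> carrier E \<Longrightarrow> x - y \<in> carrier E"
  using subspace_carrier by (rule subspace_diff)

text \<open>The positive cone defines an order on the whole ambient type that agrees with \<open>\<sqsubseteq>\<close> on the carrier.
  It makes the ambient group an ordered group, so that sums and differences can be moved across
  inequalities without side conditions, and a comparison with a member of the carrier forces membership.\<close>

definition leq :: "'a \<Rightarrow> 'a \<Rightarrow> bool" (infix "\<preceq>" 50)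
  where "x \<preceq> y \<longleftrightarrow> y - x \<in> carrier E \<and> 0 \<sqsubseteq> y - x"

lemma leq_iff: "x \<in> carrier E \<Longrightarrow> y \<in> carrier E \<Longrightarrow> x \<sqsubseteq> y \<longleftrightarrow> x \<preceq> y"
  using add_right_le[of x y "- x"] add_right_le[of 0 "y - x" x] by (auto simp: leq_def)

lemma leq_closed: "x \<preceq> y \<Longrightarrow> x \<in> carrier E \<longleftrightarrow> y \<in> carrier E"
  unfolding leq_def
  by (metis add_closed diff_closed add_diff_cancel_left' diff_add_cancel uminus_closed minus_diff_eq)

lemma leq_carrier: "0 \<preceq> x \<Longrightarrow> x \<in> carrier E"
  by (simp add: leq_def)

sublocale ord: ordered_ab_group_add "(+)" 0 "(-)" uminus leq "\<lambda>x y. x \<preceq> y \<and> \<not> y \<preceq> x"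
proof
  show "x \<preceq> x" for x by (simp add: leq_def)
  show "x \<preceq> z" if "x \<preceq> y" "y \<preceq> z" for x y z
  proof -
    have d: "z - x = (z - y) + (y - x)" by simp
    have c: "z - y \<in> carrier E" "y - x \<in> carrier E" "0 \<sqsubseteq> z - y" "0 \<sqsubseteq> y - x"
      using that by (auto simp: leq_def)
    have "y - x \<sqsubseteq> (z - y) + (y - x)" using add_right_le[of 0 "z - y" "y - x"] c by simp
    moreover have m: "(z - y) + (y - x) \<in> carrier E" using c(1,2) by (rule add_closed)
    ultimately have "0 \<sqsubseteq> (z - y) + (y - x)" using c le_trans[of 0 "y - x" "(z - y) + (y - x)"] by auto
    with m have "(z - y) + (y - x) \<in> carrier E" "0 \<sqsubseteq> (z - y) + (y - x)" by auto
    then show ?thesis unfolding leq_def d by blast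
  qed
  show "x = y" if "x \<preceq> y" "y \<preceq> x" for x y
  proof -
    have "y - x \<in> carrier E" "0 \<sqsubseteq> y - x" "0 \<sqsubseteq> x - y" using that by (auto simp: leq_def)
    moreover have "y - x \<sqsubseteq> 0" using add_right_le[of 0 "x - y" "y - x"] that by (auto simp: leq_def)
    ultimately have "y - x = 0" by (intro le_antisym) auto
    then show ?thesis by simp
  qed
qed (auto simp: leq_def)

lemma scaleR_mono: "x \<preceq> y \<Longrightarrow> 0 \<le> a \<Longrightarrow> a *\<^sub>R x \<preceq> a *\<^sub>R y"
  using scaleR_le[of 0 "y - x" a] by (auto simp: leq_def simp flip: scaleR_diff_right)

lemma scaleR_nonneg: "0 \<preceq> x \<Longrightarrow> 0 \<le> a \<Longrightarrow> 0 \<preceq> a *\<^sub>R x"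
  using scaleR_mono[of 0 x a] by simp

lemma scaleR_mono_left: "a \<le> b \<Longrightarrow> 0 \<preceq> x \<Longrightarrow> a *\<^sub>R x \<preceq> b *\<^sub>R x"
  using scaleR_nonneg[of x "b - a"] by (simp add: scaleR_diff_left)

lemma archimedeanD:
  assumes "0 \<preceq> x" "\<And>n::nat. real n *\<^sub>R x \<preceq> y"
  shows "x = 0"
proof (rule archimedean)
  have y: "y \<in> carrier E" using assms(2)[of 0] leq_closed by fastforce
  show "x \<in> carrier E" "y \<in> carrier E" "0 \<sqsubseteq> x" using assms(1) y by (auto simp: leq_iff leq_carrier)
  show "real n *\<^sub>R x \<sqsubseteq> y" for n using assms y by (simp add: leq_iff leq_carrier)
qed

lemma archimedean_inverse:
  assumes "0 \<preceq> x" "\<And>n::nat. x \<preceq> inverse (real (Suc n)) *\<^sub>R y"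
  shows "x = 0"
proof (rule archimedeanD[OF assms(1)])
  fix n :: nat
  have "real n *\<^sub>R x \<preceq> real (Suc n) *\<^sub>R x" using assms(1) by (intro scaleR_mono_left) auto
  also have "\<dots> \<preceq> real (Suc n) *\<^sub>R (inverse (real (Suc n)) *\<^sub>R y)" by (intro scaleR_mono assms) auto
  finally (ord.order_trans) show "real n *\<^sub>R x \<preceq> y" by simp
qed

lemma meet_leq1: "x \<in> carrier E \<Longrightarrow> y \<in> carrier E \<Longrightarrow> x \<sqinter> y \<preceq> x"
  by (simp add: meet_left flip: leq_iff)

lemma meet_leq2: "x \<in> carrier E \<Longrightarrow> y \<in> carrier E \<Longrightarrow> x \<sqinter> y \<preceq> y"
  by (simp add: meet_right flip: leq_iff)

lemma leq_meet_iff [simp]: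
  assumes "x \<in> carrier E" "y \<in> carrier E"
  shows "z \<preceq> x \<sqinter> y \<longleftrightarrow> z \<preceq> x \<and> z \<preceq> y"
proof
  assume "z \<preceq> x \<sqinter> y" then show "z \<preceq> x \<and> z \<preceq> y"
    using ord.order_trans[OF _ meet_leq1[OF assms]] ord.order_trans[OF _ meet_leq2[OF assms]] by blast
next
  assume z: "z \<preceq> x \<and> z \<preceq> y"
  then have "z \<in> carrier E" using assms leq_closed by blast
  then show "z \<preceq> x \<sqinter> y" using z assms meet_le[of z x y] by (simp flip: leq_iff)
qed

lemma join_leq1: "x \<in> carrier E \<Longrightarrow> y \<in> carrier E \<Longrightarrow> x \<preceq> x \<squnion> y"
  by (simp add: join_left flip: leq_iff)

lemma join_leq2: "x \<in> carrier E \<Longrightarrow> y \<in> carrier E \<Longrightarrow> y \<preceq> x \<squnion> y"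
  by (simp add: join_right flip: leq_iff)

lemma join_leq_iff [simp]:
  assumes "x \<in> carrier E" "y \<in> carrier E"
  shows "x \<squnion> y \<preceq> z \<longleftrightarrow> x \<preceq> z \<and> y \<preceq> z"
proof
  assume "x \<squnion> y \<preceq> z" then show "x \<preceq> z \<and> y \<preceq> z"
    using ord.order_trans[OF join_leq1[OF assms]] ord.order_trans[OF join_leq2[OF assms]] by blast
next
  assume z: "x \<preceq> z \<and> y \<preceq> z"
  then have "z \<in> carrier E" using assms leq_closed by blast
  then show "x \<squnion> y \<preceq> z" using z assms join_le[of x z y] by (simp flip: leq_iff)
qed

lemma meet_mono:
  assumes "x \<preceq> x'" "y \<preceq> y'" "x \<in> carrier E" "y \<in> carrier E"
  shows "x \<sqinter> y \<preceq> x' \<sqinter> y'"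
proof -
  have "x' \<in> carrier E" "y' \<in> carrier E" using assms leq_closed by blast+
  then show ?thesis using assms meet_leq1 meet_leq2 ord.order_trans by (metis leq_meet_iff)
qed

lemma meet_commute: "x \<in> carrier E \<Longrightarrow> y \<in> carrier E \<Longrightarrow> x \<sqinter> y = y \<sqinter> x"
  by (rule ord.order.antisym) (auto simp: meet_leq1 meet_leq2)

lemma join_commute: "x \<in> carrier E \<Longrightarrow> y \<in> carrier E \<Longrightarrow> x \<squnion> y = y \<squnion> x"
  by (rule ord.order.antisym) (auto simp: join_leq1 join_leq2)

lemma meet_absorb1: "x \<preceq> y \<Longrightarrow> x \<in> carrier E \<Longrightarrow> x \<sqinter> y = x"
  by (rule ord.order.antisym) (auto simp: meet_leq1 leq_closed)

lemma meet_absorb2: "y \<preceq> x \<Longrightarrow> x \<in> carrier E \<Longrightarrow> x \<sqinter> y = y"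
  by (rule ord.order.antisym) (auto simp: meet_leq2 leq_closed)

lemma join_absorb1: "y \<preceq> x \<Longrightarrow> x \<in> carrier E \<Longrightarrow> x \<squnion> y = x"
  by (rule ord.order.antisym) (auto simp: join_leq1 leq_closed)

lemma add_meet:
  assumes "x \<in> carrier E" "y \<in> carrier E" "z \<in> carrier E"
  shows "(x + z) \<sqinter> (y + z) = x \<sqinter> y + z"
proof (rule ord.order.antisym)
  have "(x + z) \<sqinter> (y + z) - z \<preceq> x \<sqinter> y"
    using assms meet_leq1[of "x + z" "y + z"] meet_leq2[of "x + z" "y + z"]
    by (metis add_closed leq_meet_iff ord.diff_le_eq)
  then show "(x + z) \<sqinter> (y + z) \<preceq> x \<sqinter> y + z" by (simp add: ord.diff_le_eq)
qed (use assms in \<open>auto simp: meet_leq1 meet_leq2\<close>)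

lemma neg_join:
  assumes "x \<in> carrier E" "y \<in> carrier E"
  shows "- (x \<squnion> y) = (- x) \<sqinter> (- y)"
proof (rule ord.order.antisym)
  have "x \<squnion> y \<preceq> - ((- x) \<sqinter> (- y))"
    using assms meet_leq1[of "- x" "- y"] meet_leq2[of "- x" "- y"] by (simp add: ord.le_minus_iff)
  then show "(- x) \<sqinter> (- y) \<preceq> - (x \<squnion> y)" by (simp add: ord.le_minus_iff)
qed (use assms in \<open>auto simp: join_leq1 join_leq2\<close>)

lemma neg_meet: "x \<in> carrier E \<Longrightarrow> y \<in> carrier E \<Longrightarrow> - (x \<sqinter> y) = (- x) \<squnion> (- y)"
  using neg_join[of "- x" "- y"] by (metis minus_minus uminus_closed)

lemma add_join:
  assumes "x \<in> carrier E" "y \<in> carrier E" "z \<in> carrier E"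
  shows "(x + z) \<squnion> (y + z) = x \<squnion> y + z"
proof -
  have "- (x \<squnion> y) - z = - ((x + z) \<squnion> (y + z))"
    using add_meet[of "- x" "- y" "- z"] assms by (simp add: neg_join)
  then show ?thesis by (metis add.commute add_uminus_conv_diff minus_add_distrib neg_equal_iff_equal)
qed

lemma join_add_meet:
  assumes "x \<in> carrier E" "y \<in> carrier E"
  shows "x \<squnion> y + x \<sqinter> y = x + y"
proof -
  have "(- x) \<sqinter> (- y) + (x + y) = y \<sqinter> x"
    using add_meet[of "- x" "- y" "x + y"] assms by simp
  then have "- (x \<squnion> y) + (x + y) = x \<sqinter> y"
    using neg_join[of x y] meet_commute[of x y] assms by metis
  then show ?thesis by (simp add: algebra_simps)
qed

lemma scaleR_meet:
  assumes "x \<in> carrier E" "y \<in> carrier E" "0 < a"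
  shows "a *\<^sub>R (x \<sqinter> y) = (a *\<^sub>R x) \<sqinter> (a *\<^sub>R y)"
proof (rule ord.order.antisym)
  have "inverse a *\<^sub>R ((a *\<^sub>R x) \<sqinter> (a *\<^sub>R y)) \<preceq> x \<sqinter> y"
    using scaleR_mono[OF meet_leq1[of "a *\<^sub>R x" "a *\<^sub>R y"], of "inverse a"]
      scaleR_mono[OF meet_leq2[of "a *\<^sub>R x" "a *\<^sub>R y"], of "inverse a"] assms by simp
  from scaleR_mono[OF this, of a] show "(a *\<^sub>R x) \<sqinter> (a *\<^sub>R y) \<preceq> a *\<^sub>R (x \<sqinter> y)" using assms by simp
qed (use assms in \<open>auto intro: scaleR_mono simp: meet_leq1 meet_leq2\<close>)

lemma vabs_closed [simp, intro]: "x \<in> carrier E \<Longrightarrow> vabs E x \<in> carrier E"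
  by (simp add: vabs_def)

lemma vabs_leq_iff: "x \<in> carrier E \<Longrightarrow> vabs E x \<preceq> y \<longleftrightarrow> x \<preceq> y \<and> - x \<preceq> y"
  by (simp add: vabs_def)

lemma leq_vabs: "x \<in> carrier E \<Longrightarrow> x \<preceq> vabs E x"
  by (simp add: vabs_def join_leq1)

lemma neg_leq_vabs: "x \<in> carrier E \<Longrightarrow> - x \<preceq> vabs E x"
  by (simp add: vabs_def join_leq2)

lemma vabs_neg [simp]: "x \<in> carrier E \<Longrightarrow> vabs E (- x) = vabs E x"
  by (simp add: vabs_def join_commute)

lemma vabs_minus_commute: "x \<in> carrier E \<Longrightarrow> y \<in> carrier E \<Longrightarrow> vabs E (x - y) = vabs E (y - x)"
  using vabs_neg[of "x - y"] by simp

lemma half_nonneg: "0 \<preceq> x + x \<Longrightarrow> 0 \<preceq> x"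
  using scaleR_nonneg[of "x + x" "1/2"] by (simp flip: scaleR_2)

lemma vabs_nonneg: "x \<in> carrier E \<Longrightarrow> 0 \<preceq> vabs E x"
  using ord.add_mono[OF leq_vabs neg_leq_vabs, of x x] by (auto intro!: half_nonneg[of "vabs E x"])

lemma vabs_of_nonneg: "0 \<preceq> x \<Longrightarrow> vabs E x = x"
  unfolding vabs_def
proof (rule join_absorb1)
  assume "0 \<preceq> x"
  then show "- x \<preceq> x" using ord.order_trans[of "- x" 0 x] by simp
qed (rule leq_carrier)

lemma vabs_vabs: "x \<in> carrier E \<Longrightarrow> vabs E (vabs E x) = vabs E x"
  by (simp add: vabs_nonneg vabs_of_nonneg)

lemma vabs_zero [simp]: "vabs E 0 = 0"
  by (simp add: vabs_of_nonneg)

lemma vabs_eq_zero: "x \<in> carrier E \<Longrightarrow> vabs E x \<preceq> 0 \<Longrightarrow> x = 0"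
  by (auto simp: vabs_leq_iff intro: ord.order.antisym)

lemma vabs_triangle:
  assumes "x \<in> carrier E" "y \<in> carrier E"
  shows "vabs E (x + y) \<preceq> vabs E x + vabs E y"
  using ord.add_mono[OF leq_vabs leq_vabs, OF assms] ord.add_mono[OF neg_leq_vabs neg_leq_vabs, OF assms] assms
  by (simp add: vabs_leq_iff)

lemma vabs_scaleR_leq:
  assumes "x \<in> carrier E"
  shows "vabs E (a *\<^sub>R x) \<preceq> \<bar>a\<bar> *\<^sub>R vabs E x"
proof -
  have "\<bar>a\<bar> *\<^sub>R x \<preceq> \<bar>a\<bar> *\<^sub>R vabs E x" "\<bar>a\<bar> *\<^sub>R (- x) \<preceq> \<bar>a\<bar> *\<^sub>R vabs E x"
    using assms by (intro scaleR_mono leq_vabs neg_leq_vabs; simp)+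
  then show ?thesis using assms by (cases "0 \<le> a") (auto simp: vabs_leq_iff)
qed

abbreviation pp :: "'a \<Rightarrow> 'a" where "pp x \<equiv> x \<squnion> 0"

lemma pp_nonneg: "x \<in> carrier E \<Longrightarrow> 0 \<preceq> pp x"
  by (simp add: join_leq2)

lemma leq_pp: "x \<in> carrier E \<Longrightarrow> x \<preceq> pp x"
  by (simp add: join_leq1)

lemma pp_mono: "x \<preceq> y \<Longrightarrow> x \<in> carrier E \<Longrightarrow> pp x \<preceq> pp y"
  using ord.order_trans[OF _ leq_pp] by (simp add: leq_closed pp_nonneg)

lemma pp_leq_vabs: "x \<in> carrier E \<Longrightarrow> pp x \<preceq> vabs E x"
  by (simp add: leq_vabs vabs_nonneg)

lemma pp_of_nonneg: "0 \<preceq> x \<Longrightarrow> pp x = x"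
  by (simp add: join_absorb1 leq_carrier)

lemma pp_diff: "x \<in> carrier E \<Longrightarrow> y \<in> carrier E \<Longrightarrow> pp (x - y) = x - x \<sqinter> y"
proof -
  assume c: "x \<in> carrier E" "y \<in> carrier E"
  have "pp (x - y) = x \<squnion> y - y" using add_join[of x y "- y"] c by simp
  moreover have "x \<squnion> y = x + y - x \<sqinter> y" using join_add_meet[OF c] by (simp add: eq_diff_eq)
  ultimately show ?thesis by simp
qed

lemma diff_pp: "x \<in> carrier E \<Longrightarrow> pp x - pp (- x) = x"
  using add_join[of x 0 "- x"] join_commute[of 0 "- x"] by (simp add: algebra_simps)

lemma pp_meet_pp:
  assumes "x \<in> carrier E"
  shows "pp x \<sqinter> pp (- x) = 0"
proof -
  have "(pp (- x) + x) \<sqinter> (0 + pp (- x)) = x \<sqinter> 0 + pp (- x)"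
    using add_meet[of x 0 "pp (- x)"] assms by (simp add: algebra_simps)
  moreover have "pp (- x) + x = pp x" using diff_pp[of x] assms by (simp add: algebra_simps)
  moreover have "x \<sqinter> 0 = - pp (- x)" using neg_join[of "- x" 0] assms by simp
  ultimately show ?thesis by simp
qed

lemma add_pp: "x \<in> carrier E \<Longrightarrow> pp x + pp (- x) = vabs E x"
proof -
  assume x: "x \<in> carrier E"
  have "vabs E x = x \<squnion> - x" by (simp add: vabs_def)
  also have "\<dots> = ((x + x) \<squnion> 0) - x" using add_join[of "x + x" 0 "- x"] x by simp
  also have "(x + x) \<squnion> 0 = 2 *\<^sub>R pp x"
  proof -
    have "pp x = - ((- x) \<sqinter> 0)" using neg_meet[of "- x" 0] x by simp
    then have "2 *\<^sub>R pp x = - ((2 *\<^sub>R (- x)) \<sqinter> 0)" using scaleR_meet[of "- x" 0 2] x by simp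
    also have "\<dots> = (2 *\<^sub>R x) \<squnion> 0" using neg_meet[of "2 *\<^sub>R (- x)" 0] x by simp
    finally show ?thesis by (simp add: scaleR_2)
  qed
  finally have "vabs E x = 2 *\<^sub>R pp x - x" .
  then show ?thesis using diff_pp[OF x] by (simp add: scaleR_2 algebra_simps)
qed

lemma meet_add_leq:
  assumes "0 \<preceq> x" "0 \<preceq> y" "0 \<preceq> z"
  shows "x \<sqinter> (y + z) \<preceq> x \<sqinter> y + x \<sqinter> z"
proof -
  note c = assms[THEN leq_carrier]
  let ?m = "x \<sqinter> (y + z)"
  have x: "?m \<preceq> x" and yz: "?m \<preceq> y + z" using c meet_leq1 meet_leq2 by auto
  have "?m - z \<preceq> x" "?m - z \<preceq> y"
    using yz ord.order_trans[OF x, of "x + z"] assms by (simp_all add: ord.diff_le_eq)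
  then have "?m - z \<preceq> x \<sqinter> y" using c leq_meet_iff by blast
  then have "?m - x \<sqinter> y \<preceq> z" by (simp add: ord.diff_le_eq add.commute)
  moreover have "?m - x \<sqinter> y \<preceq> x"
    using ord.order_trans[OF x, of "x + x \<sqinter> y"] c assms by (simp add: ord.diff_le_eq)
  ultimately have "?m - x \<sqinter> y \<preceq> x \<sqinter> z" using c leq_meet_iff by blast
  then show ?thesis by (simp add: ord.diff_le_eq add.commute)
qed

lemma meet_nonneg: "0 \<preceq> x \<Longrightarrow> 0 \<preceq> y \<Longrightarrow> 0 \<preceq> x \<sqinter> y"
  by (simp add: leq_carrier)

lemma sum_nonneg: "(\<And>i. i \<in> I \<Longrightarrow> 0 \<preceq> f i) \<Longrightarrow> 0 \<preceq> sum f I"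
  by (induction I rule: infinite_finite_induct) (auto intro: ord.add_nonneg_nonneg)

lemma disjoint_add:
  assumes "0 \<preceq> x" "0 \<preceq> y" "0 \<preceq> z" "x \<sqinter> y = 0" "x \<sqinter> z = 0"
  shows "x \<sqinter> (y + z) = 0"
  using meet_add_leq[OF assms(1-3)] assms meet_nonneg[of x "y + z"]
  by (auto intro: ord.order.antisym simp: ord.add_nonneg_nonneg)

lemma disjoint_mono:
  assumes "x \<sqinter> y = 0" "0 \<preceq> x'" "x' \<preceq> x" "0 \<preceq> y'" "y' \<preceq> y"
  shows "x' \<sqinter> y' = 0"
  using assms meet_mono[of x' x y' y] meet_nonneg[of x' y'] leq_carrier
  by (auto intro: ord.order.antisym)

lemma disjoint_scaleR:
  assumes "x \<sqinter> y = 0" "0 \<preceq> x" "0 \<preceq> y" "0 \<le> a"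
  shows "x \<sqinter> (a *\<^sub>R y) = 0"
proof -
  have "max 1 a *\<^sub>R (x \<sqinter> y) = (max 1 a *\<^sub>R x) \<sqinter> (max 1 a *\<^sub>R y)"
    using assms leq_carrier by (intro scaleR_meet) auto
  then show ?thesis using assms scaleR_mono_left[of 1 "max 1 a" x]
    by (intro disjoint_mono[of "max 1 a *\<^sub>R x" "max 1 a *\<^sub>R y" x "a *\<^sub>R y"])
      (auto intro: scaleR_nonneg scaleR_mono_left)
qed

text \<open>Truncation at \<open>u\<close> keeps the triangle inequality because \<open>(a + b) \<sqinter> u \<le> a \<sqinter> u + b \<sqinter> u\<close> for positive
  elements. This makes addition continuous for neighbourhoods that are defined by truncations.\<close>

lemma meet_triangle:
  assumes "x \<in> carrier E" "y \<in> carrier E" "0 \<preceq> u"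
  shows "vabs E (x + y) \<sqinter> u \<preceq> vabs E x \<sqinter> u + vabs E y \<sqinter> u"
proof -
  have "vabs E (x + y) \<sqinter> u \<preceq> (vabs E x + vabs E y) \<sqinter> u"
    using assms leq_carrier by (intro meet_mono vabs_triangle) auto
  also have "\<dots> \<preceq> vabs E x \<sqinter> u + vabs E y \<sqinter> u"
    using meet_add_leq[of u "vabs E x" "vabs E y"] assms leq_carrier
    by (simp add: vabs_nonneg meet_commute)
  finally (ord.order_trans) show ?thesis .
qed

text \<open>The common part \<open>p = a \<sqinter> x\<close> determines the other three pieces.\<close>

lemma Riesz_decomposition:
  assumes "0 \<preceq> a" "0 \<preceq> b" "0 \<preceq> x" "0 \<preceq> y" "a + b = x + y"
  obtains p q r s where "0 \<preceq> p" "0 \<preceq> q" "0 \<preceq> r" "0 \<preceq> s"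
    "a = p + q" "b = r + s" "x = p + r" "y = q + s"
proof
  note c = assms(1-4)[THEN leq_carrier]
  let ?p = "a \<sqinter> x"
  show "0 \<preceq> ?p" "0 \<preceq> a - ?p" "0 \<preceq> x - ?p" using assms c by (auto simp: meet_leq1 meet_leq2)
  have "a \<preceq> (a + y) \<sqinter> (x + y)" using assms c by (simp flip: assms(5))
  then have "a \<preceq> y + a \<sqinter> x" using add_meet[of a x y] c by (simp add: add.commute)
  then show "0 \<preceq> y - (a - ?p)" by (simp add: ord.diff_le_eq)
  show "b = (x - ?p) + (y - (a - ?p))" using assms(5) by (simp add: algebra_simps)
qed auto

section \<open>Infinite suprema and infima\<close>

text \<open>The bounds range over the ambient type; for a nonempty subset of the carrier the result is nevertheless
  the supremum in \<open>E\<close>, by \<open>least_Upper_iff\<close>.\<close>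

definition is_sup :: "'a set \<Rightarrow> 'a \<Rightarrow> bool"
  where "is_sup D s \<longleftrightarrow> (\<forall>d\<in>D. d \<preceq> s) \<and> (\<forall>u. (\<forall>d\<in>D. d \<preceq> u) \<longrightarrow> s \<preceq> u)"

definition is_inf :: "'a set \<Rightarrow> 'a \<Rightarrow> bool"
  where "is_inf D s \<longleftrightarrow> (\<forall>d\<in>D. s \<preceq> d) \<and> (\<forall>u. (\<forall>d\<in>D. u \<preceq> d) \<longrightarrow> u \<preceq> s)"

lemma is_supD: "is_sup D s \<Longrightarrow> d \<in> D \<Longrightarrow> d \<preceq> s" "is_sup D s \<Longrightarrow> (\<And>d. d \<in> D \<Longrightarrow> d \<preceq> u) \<Longrightarrow> s \<preceq> u"
  by (auto simp: is_sup_def)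

lemma is_infD: "is_inf D s \<Longrightarrow> d \<in> D \<Longrightarrow> s \<preceq> d" "is_inf D s \<Longrightarrow> (\<And>d. d \<in> D \<Longrightarrow> u \<preceq> d) \<Longrightarrow> u \<preceq> s"
  by (auto simp: is_inf_def)

lemma is_sup_unique: "is_sup D s \<Longrightarrow> is_sup D t \<Longrightarrow> s = t"
  by (auto simp: is_sup_def intro: ord.order.antisym)

lemma is_sup_carrier: "is_sup D s \<Longrightarrow> D \<noteq> {} \<Longrightarrow> D \<subseteq> carrier E \<Longrightarrow> s \<in> carrier E"
  unfolding is_sup_def using leq_closed by blast

lemma is_inf_carrier: "is_inf D s \<Longrightarrow> D \<noteq> {} \<Longrightarrow> D \<subseteq> carrier E \<Longrightarrow> s \<in> carrier E"
  unfolding is_inf_def using leq_closed by blast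

lemma is_sup_neg: "is_sup (uminus ` D) (- s) \<longleftrightarrow> is_inf D s"
  unfolding is_sup_def is_inf_def
  by (auto simp: ord.minus_le_iff) (metis minus_minus ord.minus_le_iff)+

lemma is_sup_diff:
  assumes "is_inf D s" shows "is_sup ((\<lambda>d. x - d) ` D) (x - s)"
  unfolding is_sup_def
proof (intro conjI ballI allI impI)
  fix u assume "\<forall>d\<in>(\<lambda>d. x - d) ` D. d \<preceq> u"
  then have "x - u \<preceq> d" if "d \<in> D" for d using that by (auto simp: ord.diff_le_eq add.commute)
  from is_infD(2)[OF assms this] show "x - s \<preceq> u" by (simp add: ord.diff_le_eq add.commute)
qed (use is_infD(1)[OF assms] in \<open>auto intro: ord.diff_left_mono\<close>)

lemma is_inf_diff:
  assumes "is_sup D s" shows "is_inf ((\<lambda>d. x - d) ` D) (x - s)"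
  unfolding is_inf_def
proof (intro conjI ballI allI impI)
  fix u assume "\<forall>d\<in>(\<lambda>d. x - d) ` D. u \<preceq> d"
  then have "d \<preceq> x - u" if "d \<in> D" for d using that by (auto simp: ord.le_diff_eq add.commute)
  from is_supD(2)[OF assms this] show "u \<preceq> x - s" by (simp add: ord.le_diff_eq add.commute)
qed (use is_supD(1)[OF assms] in \<open>auto intro: ord.diff_left_mono\<close>)

lemma least_Upper_iff:
  assumes "D \<subseteq> carrier E" "D \<noteq> {}"
  shows "least E s (Upper E D) \<longleftrightarrow> is_sup D s"
proof
  assume l: "least E s (Upper E D)"
  then have s: "s \<in> carrier E" by (simp add: least_def Upper_def)
  show "is_sup D s" unfolding is_sup_def
  proof (intro conjI ballI allI impI)
    show "d \<preceq> s" if "d \<in> D" for d using l that assms s by (auto simp: least_def Upper_def leq_iff)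
    fix u assume u: "\<forall>d\<in>D. d \<preceq> u"
    then have "u \<in> carrier E" using assms leq_closed by blast
    then have "u \<in> Upper E D" using u assms by (auto simp: Upper_def leq_iff)
    then show "s \<preceq> u" using l s \<open>u \<in> carrier E\<close> by (auto simp: least_def leq_iff)
  qed
next
  assume i: "is_sup D s"
  then have s: "s \<in> carrier E" using assms is_sup_carrier by blast
  have "s \<in> Upper E D" using s is_supD(1)[OF i] assms by (auto simp: Upper_def leq_iff subset_iff)
  moreover have "s \<sqsubseteq> u" if u: "u \<in> Upper E D" for u
  proof -
    have uc: "u \<in> carrier E" using u by (simp add: Upper_def)
    have "d \<preceq> u" if "d \<in> D" for d using u uc that assms by (auto simp: Upper_def leq_iff subset_iff)
    then have "s \<preceq> u" by (rule is_supD(2)[OF i])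
    then show ?thesis using s uc by (simp add: leq_iff)
  qed
  ultimately show "least E s (Upper E D)" unfolding least_def by (auto simp: Upper_def)
qed

lemma greatest_Lower_iff:
  assumes "D \<subseteq> carrier E" "D \<noteq> {}"
  shows "greatest E s (Lower E D) \<longleftrightarrow> is_inf D s"
proof
  assume l: "greatest E s (Lower E D)"
  then have s: "s \<in> carrier E" by (simp add: greatest_def Lower_def)
  show "is_inf D s" unfolding is_inf_def
  proof (intro conjI ballI allI impI)
    show "s \<preceq> d" if "d \<in> D" for d using l that assms s by (auto simp: greatest_def Lower_def leq_iff)
    fix u assume u: "\<forall>d\<in>D. u \<preceq> d"
    then have "u \<in> carrier E" using assms leq_closed by blast
    then have "u \<in> Lower E D" using u assms by (auto simp: Lower_def leq_iff)
    then show "u \<preceq> s" using l s \<open>u \<in> carrier E\<close> by (auto simp: greatest_def leq_iff)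
  qed
next
  assume i: "is_inf D s"
  then have s: "s \<in> carrier E" using assms is_inf_carrier by blast
  have "s \<in> Lower E D" using s is_infD(1)[OF i] assms by (auto simp: Lower_def leq_iff subset_iff)
  moreover have "u \<sqsubseteq> s" if u: "u \<in> Lower E D" for u
  proof -
    have uc: "u \<in> carrier E" using u by (simp add: Lower_def)
    have "u \<preceq> d" if "d \<in> D" for d using u uc that assms by (auto simp: Lower_def leq_iff subset_iff)
    then have "u \<preceq> s" by (rule is_infD(2)[OF i])
    then show ?thesis using s uc by (simp add: leq_iff)
  qed
  ultimately show "greatest E s (Lower E D)" unfolding greatest_def by (auto simp: Lower_def)
qed

text \<open>The infinite distributive law. An upper bound \<open>u\<close> of the \<open>d \<sqinter> y\<close> yields the upper bound
  \<open>u - y + (s \<squnion> y)\<close> of \<open>D\<close>, because \<open>d = d \<sqinter> y - y + (d \<squnion> y)\<close>.\<close>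

lemma is_sup_meet:
  assumes "is_sup D s" "D \<noteq> {}" "D \<subseteq> carrier E" "y \<in> carrier E"
  shows "is_sup ((\<lambda>d. d \<sqinter> y) ` D) (s \<sqinter> y)"
  unfolding is_sup_def
proof (intro conjI ballI allI impI)
  have s: "s \<in> carrier E" using is_sup_carrier assms by blast
  show "d \<preceq> s \<sqinter> y" if "d \<in> (\<lambda>d. d \<sqinter> y) ` D" for d
  proof -
    from that obtain d' where d': "d' \<in> D" "d = d' \<sqinter> y" by blast
    moreover have "d' \<in> carrier E" using d' assms by blast
    ultimately show ?thesis using meet_mono[OF is_supD(1)[OF assms(1)], of d' y y] assms by simp
  qed
  fix u assume u: "\<forall>d\<in>(\<lambda>d. d \<sqinter> y) ` D. d \<preceq> u"
  have "d \<preceq> u - y + (s \<squnion> y)" if d: "d \<in> D" for d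
  proof -
    have dc: "d \<in> carrier E" using d assms by auto
    have "d = d \<sqinter> y - y + (d \<squnion> y)" using join_add_meet[of d y] dc assms by (simp add: algebra_simps)
    also have "\<dots> \<preceq> u - y + (s \<squnion> y)"
    proof (rule ord.add_mono)
      show "d \<sqinter> y - y \<preceq> u - y" using u d by (intro ord.diff_right_mono) simp
      show "d \<squnion> y \<preceq> s \<squnion> y"
        using dc assms s is_supD(1)[OF assms(1) d] ord.order_trans[OF _ join_leq1] by (simp add: join_leq2)
    qed
    finally show ?thesis .
  qed
  then have "s \<preceq> u - y + (s \<squnion> y)" by (rule is_supD(2)[OF assms(1)])
  then have "s + y \<preceq> u + (s \<squnion> y)" by (simp add: algebra_simps)
  then have "(s \<squnion> y) + s \<sqinter> y \<preceq> (s \<squnion> y) + u"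
    using join_add_meet[of s y] s assms by (simp add: add.commute)
  then show "s \<sqinter> y \<preceq> u" by simp
qed

lemma is_sup_disjoint:
  assumes "is_sup D s" "D \<noteq> {}" "D \<subseteq> carrier E" "y \<in> carrier E" "\<And>d. d \<in> D \<Longrightarrow> d \<sqinter> y \<preceq> 0"
  shows "s \<sqinter> y \<preceq> 0"
  using is_supD(2)[OF is_sup_meet[OF assms(1-4)]] assms(5) by auto

end

context dedekind_complete_vector_lattice
begin

lemma ex_is_sup:
  assumes "D \<subseteq> carrier E" "D \<noteq> {}" "\<And>d. d \<in> D \<Longrightarrow> d \<preceq> u"
  shows "\<exists>s. is_sup D s"
proof -
  have "u \<in> carrier E" using assms leq_closed by blast
  then have "u \<in> Upper E D" using assms by (auto simp: Upper_def leq_iff subset_iff)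
  then have "Upper E D \<noteq> {}" by blast
  then show ?thesis using sup_exists[of D] assms least_Upper_iff by blast
qed

lemma ex_is_inf:
  assumes "D \<subseteq> carrier E" "D \<noteq> {}" "\<And>d. d \<in> D \<Longrightarrow> u \<preceq> d"
  shows "\<exists>s. is_inf D s"
proof -
  have "\<exists>s. is_sup (uminus ` D) s" using assms by (intro ex_is_sup[of _ "- u"]) auto
  then show ?thesis using is_sup_neg by (metis minus_minus)
qed

end

section \<open>Order convergence and solid sets\<close>

context vector_lattice
begin

lemma decreasing_to_zeroI:
  assumes "directed_by B s" "\<And>b c. b \<in> B \<Longrightarrow> c \<in> B \<Longrightarrow> s b c \<Longrightarrow> y c \<preceq> y b" "is_inf (y ` B) 0"
  shows "decreasing_to_zero E B s y"
proof -
  have c: "y b \<in> carrier E" if "b \<in> B" for b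
    using is_infD(1)[OF assms(3), of "y b"] that leq_carrier by blast
  then have "greatest E 0 (Lower E (y ` B))"
    using directed_byD(1)[OF assms(1)] assms(3) by (subst greatest_Lower_iff) auto
  then show ?thesis using assms(1,2) c by (auto simp: decreasing_to_zero_def leq_iff)
qed

lemma decreasing_to_zeroD:
  assumes "decreasing_to_zero E B s y"
  shows "directed_by B s" "\<And>b. b \<in> B \<Longrightarrow> y b \<in> carrier E"
    "\<And>b c. b \<in> B \<Longrightarrow> c \<in> B \<Longrightarrow> s b c \<Longrightarrow> y c \<preceq> y b" "is_inf (y ` B) 0"
    "\<And>b. b \<in> B \<Longrightarrow> 0 \<preceq> y b"
proof -
  show "directed_by B s" using assms by (simp add: decreasing_to_zero_def)
  show 2: "y b \<in> carrier E" if "b \<in> B" for b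
    using assms that by (auto simp: decreasing_to_zero_def)
  show "y c \<preceq> y b" if "b \<in> B" "c \<in> B" "s b c" for b c
    using assms that 2 by (simp add: decreasing_to_zero_def leq_iff)
  have "B \<noteq> {}" using directed_byD(1) assms by (auto simp: decreasing_to_zero_def directed_by_def)
  then show *: "is_inf (y ` B) 0"
    using assms 2 greatest_Lower_iff[of "y ` B" 0] by (auto simp: decreasing_to_zero_def)
  show "0 \<preceq> y b" if "b \<in> B" for b using is_infD(1)[OF *] that by blast
qed

lemma order_conv_leqI:
  assumes "decreasing_to_zero E B s y"
    "\<And>b. b \<in> B \<Longrightarrow> \<exists>\<alpha>\<^sub>0\<in>A. \<forall>\<alpha>\<in>A. r \<alpha>\<^sub>0 \<alpha> \<longrightarrow> vabs E (l - x \<alpha>) \<preceq> y b"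
  shows "order_conv E A r x l"
proof (rule order_convI[OF vector_lattice_axioms assms(1)])
  fix b assume b: "b \<in> B"
  then have c: "y b \<in> carrier E" using decreasing_to_zeroD(2)[OF assms(1)] by blast
  have "z \<sqsubseteq> y b" if "z \<preceq> y b" for z using that c leq_closed leq_iff by blast
  then show "\<exists>\<alpha>\<^sub>0\<in>A. \<forall>\<alpha>\<in>A. r \<alpha>\<^sub>0 \<alpha> \<longrightarrow> vabs E (l - x \<alpha>) \<sqsubseteq> y b" using assms(2)[OF b] by blast
qed

lemma order_conv_leqE:
  assumes "order_conv E A r x l" "\<And>\<alpha>. \<alpha> \<in> A \<Longrightarrow> x \<alpha> \<in> carrier E" "l \<in> carrier E"
  obtains B :: "'a set" and s y where "decreasing_to_zero E B s y"
    "\<And>b. b \<in> B \<Longrightarrow> \<exists>\<alpha>\<^sub>0\<in>A. \<forall>\<alpha>\<in>A. r \<alpha>\<^sub>0 \<alpha> \<longrightarrow> vabs E (l - x \<alpha>) \<preceq> y b"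
proof -
  obtain B :: "'a set" and s y where *: "decreasing_to_zero E B s y"
    "\<And>b. b \<in> B \<Longrightarrow> \<exists>\<alpha>\<^sub>0\<in>A. \<forall>\<alpha>\<in>A. r \<alpha>\<^sub>0 \<alpha> \<longrightarrow> vabs E (l - x \<alpha>) \<sqsubseteq> y b"
    using assms(1) unfolding order_conv_def by blast
  have "\<exists>\<alpha>\<^sub>0\<in>A. \<forall>\<alpha>\<in>A. r \<alpha>\<^sub>0 \<alpha> \<longrightarrow> vabs E (l - x \<alpha>) \<preceq> y b" if "b \<in> B" for b
    using *(2)[OF that] decreasing_to_zeroD(2)[OF *(1) that] assms by (auto simp: leq_iff)
  with *(1) show thesis by (rule that)
qed

lemma order_conv_mono:
  assumes "order_conv E A r x l" "\<And>\<alpha>. \<alpha> \<in> A \<Longrightarrow> x \<alpha> \<in> carrier E" "l \<in> carrier E"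
    "\<And>\<alpha>. \<alpha> \<in> A \<Longrightarrow> vabs E (l' - x' \<alpha>) \<preceq> vabs E (l - x \<alpha>)"
  shows "order_conv E A r x' l'"
proof -
  obtain B :: "'a set" and s y where *: "decreasing_to_zero E B s y"
    "\<And>b. b \<in> B \<Longrightarrow> \<exists>\<alpha>\<^sub>0\<in>A. \<forall>\<alpha>\<in>A. r \<alpha>\<^sub>0 \<alpha> \<longrightarrow> vabs E (l - x \<alpha>) \<preceq> y b"
    using order_conv_leqE[OF assms(1-3)] by blast
  show ?thesis
  proof (rule order_conv_leqI[OF *(1)])
    fix b assume "b \<in> B"
    then show "\<exists>\<alpha>\<^sub>0\<in>A. \<forall>\<alpha>\<in>A. r \<alpha>\<^sub>0 \<alpha> \<longrightarrow> vabs E (l' - x' \<alpha>) \<preceq> y b"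
      using *(2) assms(4) ord.order_trans by meson
  qed
qed

lemma order_conv_null_mono:
  assumes "order_conv E A r x 0" "\<And>\<alpha>. \<alpha> \<in> A \<Longrightarrow> 0 \<preceq> x' \<alpha>" "\<And>\<alpha>. \<alpha> \<in> A \<Longrightarrow> x' \<alpha> \<preceq> x \<alpha>"
  shows "order_conv E A r x' 0"
proof (rule order_conv_mono[OF assms(1)])
  fix \<alpha> assume a: "\<alpha> \<in> A"
  then have n: "0 \<preceq> x \<alpha>" using ord.order_trans[OF assms(2,3)] by blast
  then show c: "x \<alpha> \<in> carrier E" by (rule leq_carrier)
  show "vabs E (0 - x' \<alpha>) \<preceq> vabs E (0 - x \<alpha>)"
    using a n assms(2,3) c by (simp add: vabs_of_nonneg leq_carrier)
qed simp

lemma order_conv_imp_uo_conv: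
  assumes "order_conv E A r x l" "\<And>\<alpha>. \<alpha> \<in> A \<Longrightarrow> x \<alpha> \<in> carrier E" "l \<in> carrier E"
  shows "uo_conv E A r x l"
  unfolding uo_conv_def
proof (intro ballI impI)
  fix y assume y: "y \<in> carrier E" "0 \<sqsubseteq> y"
  then have y0: "0 \<preceq> y" by (simp add: leq_iff)
  show "order_conv E A r (\<lambda>\<alpha>. vabs E (x \<alpha> - l) \<sqinter> y) 0"
  proof (rule order_conv_mono[OF assms])
    fix \<alpha> assume a: "\<alpha> \<in> A"
    then have c: "x \<alpha> \<in> carrier E" using assms by blast
    then have "0 \<preceq> vabs E (x \<alpha> - l) \<sqinter> y" using y y0 assms by (simp add: vabs_nonneg)
    then show "vabs E (0 - vabs E (x \<alpha> - l) \<sqinter> y) \<preceq> vabs E (l - x \<alpha>)"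
      using c y assms by (simp add: vabs_of_nonneg meet_leq1 vabs_minus_commute[of l])
  qed
qed

lemma uo_conv_null_iff: "uo_conv E A r (\<lambda>\<alpha>. x \<alpha> - l) 0 \<longleftrightarrow> uo_conv E A r x l"
  by (simp add: uo_conv_def)

lemma uo_convD: "uo_conv E A r x l \<Longrightarrow> 0 \<preceq> y \<Longrightarrow> order_conv E A r (\<lambda>\<alpha>. vabs E (x \<alpha> - l) \<sqinter> y) 0"
  by (simp add: uo_conv_def leq_carrier leq_iff)

lemma uo_convI: "(\<And>y. 0 \<preceq> y \<Longrightarrow> order_conv E A r (\<lambda>\<alpha>. vabs E (x \<alpha> - l) \<sqinter> y) 0) \<Longrightarrow> uo_conv E A r x l"
  by (auto simp: uo_conv_def leq_carrier leq_iff)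

lemma decreasing_to_zero_order_conv:
  assumes "decreasing_to_zero E B s y"
  shows "order_conv E B s y 0"
proof (rule order_conv_leqI[OF assms])
  fix b assume b: "b \<in> B"
  note D = decreasing_to_zeroD[OF assms]
  show "\<exists>\<alpha>\<^sub>0\<in>B. \<forall>\<alpha>\<in>B. s \<alpha>\<^sub>0 \<alpha> \<longrightarrow> vabs E (0 - y \<alpha>) \<preceq> y b"
    using b D by (intro bexI[of _ b]) (auto simp: vabs_of_nonneg)
qed

lemma solidD:
  assumes "solid E W" "y \<in> W" "x \<in> carrier E" "vabs E x \<preceq> vabs E y"
  shows "x \<in> W"
proof -
  have "y \<in> carrier E" using assms by (auto simp: solid_def)
  then have "vabs E x \<sqsubseteq> vabs E y" using assms by (simp add: leq_iff)
  then show ?thesis using assms unfolding solid_def by blast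
qed

lemma solidD_nonneg: "solid E W \<Longrightarrow> y \<in> W \<Longrightarrow> 0 \<preceq> x \<Longrightarrow> x \<preceq> y \<Longrightarrow> x \<in> W"
  using ord.order_trans[of 0 x y] by (rule_tac solidD[of W y]) (auto simp: vabs_of_nonneg leq_carrier)

lemma solidI:
  assumes "W \<subseteq> carrier E" "\<And>x y. x \<in> carrier E \<Longrightarrow> y \<in> W \<Longrightarrow> vabs E x \<preceq> vabs E y \<Longrightarrow> x \<in> W"
  shows "solid E W"
  unfolding solid_def
proof (intro conjI ballI impI)
  fix x y assume xy: "x \<in> carrier E" "y \<in> W" "vabs E x \<sqsubseteq> vabs E y"
  then have "y \<in> carrier E" using assms by blast
  then show "x \<in> W" using xy by (intro assms(2)[of x y]) (auto simp: leq_iff)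
qed (rule assms(1))

lemma solid_vabs_iff: "solid E W \<Longrightarrow> x \<in> carrier E \<Longrightarrow> vabs E x \<in> W \<longleftrightarrow> x \<in> W"
  using solidD[of W x "vabs E x"] solidD[of W "vabs E x" x] by (auto simp: vabs_vabs)

end

lemma directed_by_nat: "directed_by (UNIV :: nat set) (\<le>)"
proof -
  have "\<exists>c. a \<le> c \<and> b \<le> c" for a b :: nat by (rule exI[of _ "max a b"]) simp
  then show ?thesis by (auto simp: directed_by_def)
qed

section \<open>Locally solid topologies\<close>

locale locally_solid_lattice = vector_lattice +
  fixes \<tau> :: "'a topology"
  assumes locally_solid: "locally_solid E \<tau>"
begin

lemma topspace_eq: "topspace \<tau> = carrier E"
  and continuous_add: "continuous_map (prod_topology \<tau> \<tau>) \<tau> (\<lambda>(x, y). x + y)"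
  and continuous_scaleR: "continuous_map (prod_topology euclideanreal \<tau>) \<tau> (\<lambda>(a, x). a *\<^sub>R x)"
  using locally_solid by (auto simp: locally_solid_def linear_topology_def)

definition solid_nbhd :: "'a set \<Rightarrow> bool"
  where "solid_nbhd W \<longleftrightarrow> solid E W \<and> (\<exists>V. openin \<tau> V \<and> 0 \<in> V \<and> V \<subseteq> W)"

lemma solid_nbhd_solid: "solid_nbhd W \<Longrightarrow> solid E W"
  by (simp add: solid_nbhd_def)

lemma solid_nbhd_subset: "solid_nbhd W \<Longrightarrow> W \<subseteq> carrier E"
  by (simp add: solid_nbhd_def solid_def)

lemma zero_in_solid_nbhd: "solid_nbhd W \<Longrightarrow> 0 \<in> W"
  by (auto simp: solid_nbhd_def)

lemma ex_solid_nbhd: "openin \<tau> U \<Longrightarrow> 0 \<in> U \<Longrightarrow> \<exists>W. solid_nbhd W \<and> W \<subseteq> U"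
  using locally_solid unfolding locally_solid_def solid_nbhd_def by meson

lemma solid_nbhd_Int:
  assumes "solid_nbhd V" "solid_nbhd W"
  shows "solid_nbhd (V \<inter> W)"
proof -
  obtain V' W' where "openin \<tau> V'" "0 \<in> V'" "V' \<subseteq> V" "openin \<tau> W'" "0 \<in> W'" "W' \<subseteq> W"
    using assms by (auto simp: solid_nbhd_def)
  then have "openin \<tau> (V' \<inter> W')" "0 \<in> V' \<inter> W'" "V' \<inter> W' \<subseteq> V \<inter> W" by auto
  then show ?thesis using assms unfolding solid_nbhd_def solid_def by blast
qed

lemma continuous_translation: "x \<in> carrier E \<Longrightarrow> continuous_map \<tau> \<tau> (\<lambda>y. x + y)"
  using continuous_map_compose[OF _ continuous_add, of \<tau> "\<lambda>y. (x, y)"]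
  by (simp add: comp_def continuous_map_pairwise topspace_eq)

lemma continuous_scaling: "continuous_map \<tau> \<tau> (\<lambda>y. a *\<^sub>R y)"
  using continuous_map_compose[OF _ continuous_scaleR, of \<tau> "\<lambda>y. (a, y)"]
  by (simp add: comp_def continuous_map_pairwise topspace_eq)

lemma solid_nbhd_half:
  assumes "solid_nbhd W"
  obtains V where "solid_nbhd V" "\<And>x y. x \<in> V \<Longrightarrow> y \<in> V \<Longrightarrow> x + y \<in> W"
proof -
  obtain O' where O': "openin \<tau> O'" "0 \<in> O'" "O' \<subseteq> W" using assms by (auto simp: solid_nbhd_def)
  define P where "P = {z \<in> topspace (prod_topology \<tau> \<tau>). (\<lambda>(x, y). x + y) z \<in> O'}"
  have P: "openin (prod_topology \<tau> \<tau>) P"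
    unfolding P_def by (rule openin_continuous_map_preimage[OF continuous_add O'(1)])
  have "(0, 0) \<in> P" using O' by (simp add: P_def topspace_eq)
  from iffD1[OF openin_prod_topology_alt P, rule_format, OF this]
  obtain U1 U2 where U: "openin \<tau> U1" "openin \<tau> U2" "0 \<in> U1" "0 \<in> U2" "U1 \<times> U2 \<subseteq> P"
    by blast
  then obtain V where V: "solid_nbhd V" "V \<subseteq> U1 \<inter> U2"
    using ex_solid_nbhd[of "U1 \<inter> U2"] by auto
  show thesis
  proof (rule that[OF V(1)])
    fix x y assume "x \<in> V" "y \<in> V"
    then have "(x, y) \<in> P" using V U by blast
    then show "x + y \<in> W" using O' by (auto simp: P_def)
  qed
qed

lemma solid_nbhd_absorbing:
  assumes "solid_nbhd W" "x \<in> carrier E"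
  obtains c where "0 < c" "c *\<^sub>R x \<in> W"
proof -
  obtain O' where O': "openin \<tau> O'" "0 \<in> O'" "O' \<subseteq> W" using assms by (auto simp: solid_nbhd_def)
  have "continuous_map euclideanreal \<tau> (\<lambda>a. a *\<^sub>R x)"
    using continuous_map_compose[OF _ continuous_scaleR, of euclideanreal "\<lambda>a. (a, x)"] assms
    by (simp add: comp_def continuous_map_pairwise topspace_eq)
  from openin_continuous_map_preimage[OF this O'(1)]
  have "open {a. a *\<^sub>R x \<in> O'}" by simp
  moreover have "0 \<in> {a. a *\<^sub>R x \<in> O'}" using O' by simp
  ultimately obtain e where e: "e > 0" "ball 0 e \<subseteq> {a. a *\<^sub>R x \<in> O'}" by (meson open_contains_ball)
  then have "(e/2) *\<^sub>R x \<in> O'" by (auto simp: subset_iff dist_norm)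
  then show thesis using e O' by (intro that[of "e/2"]) auto
qed

lemma solid_nbhd_scale:
  assumes "solid_nbhd W"
  obtains V where "solid_nbhd V" "\<And>x. x \<in> V \<Longrightarrow> a *\<^sub>R x \<in> W"
proof -
  obtain O' where O': "openin \<tau> O'" "0 \<in> O'" "O' \<subseteq> W" using assms by (auto simp: solid_nbhd_def)
  have "openin \<tau> {x \<in> topspace \<tau>. a *\<^sub>R x \<in> O'}"
    by (rule openin_continuous_map_preimage[OF continuous_scaling O'(1)])
  moreover have "0 \<in> {x \<in> topspace \<tau>. a *\<^sub>R x \<in> O'}" using O' topspace_eq by simp
  ultimately obtain V where "solid_nbhd V" "V \<subseteq> {x \<in> topspace \<tau>. a *\<^sub>R x \<in> O'}"
    using ex_solid_nbhd by blast
  then show thesis using that O' by blast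
qed

lemma openin_iff_solid_nbhd:
  "openin \<tau> U \<longleftrightarrow> U \<subseteq> carrier E \<and> (\<forall>x\<in>U. \<exists>W. solid_nbhd W \<and> (\<forall>w\<in>W. x + w \<in> U))"
proof (intro iffI conjI ballI)
  assume U: "openin \<tau> U"
  then show "U \<subseteq> carrier E" using openin_subset topspace_eq by blast
  fix x assume x: "x \<in> U"
  then have "openin \<tau> {w \<in> topspace \<tau>. x + w \<in> U}"
    using openin_continuous_map_preimage[OF continuous_translation U] \<open>U \<subseteq> carrier E\<close> by blast
  moreover have "0 \<in> {w \<in> topspace \<tau>. x + w \<in> U}" using x topspace_eq by simp
  ultimately obtain W where "solid_nbhd W" "W \<subseteq> {w \<in> topspace \<tau>. x + w \<in> U}"
    using ex_solid_nbhd by blast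
  then show "\<exists>W. solid_nbhd W \<and> (\<forall>w\<in>W. x + w \<in> U)" by blast
next
  assume U: "U \<subseteq> carrier E \<and> (\<forall>x\<in>U. \<exists>W. solid_nbhd W \<and> (\<forall>w\<in>W. x + w \<in> U))"
  show "openin \<tau> U"
  proof (subst openin_subopen, intro ballI)
    fix x assume x: "x \<in> U"
    then obtain W V where W: "openin \<tau> V" "0 \<in> V" "V \<subseteq> W" "\<forall>w\<in>W. x + w \<in> U"
      using U by (meson solid_nbhd_def)
    have xc: "x \<in> carrier E" using x U by blast
    have "openin \<tau> {y \<in> topspace \<tau>. - x + y \<in> V}"
      using openin_continuous_map_preimage[OF continuous_translation W(1), of "- x"] xc by simp
    moreover have "y \<in> U" if "- x + y \<in> V" for y
    proof -
      have "x + (- x + y) \<in> U" using that W by blast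
      then show ?thesis by simp
    qed
    ultimately show "\<exists>T. openin \<tau> T \<and> x \<in> T \<and> T \<subseteq> U" using xc W(2) topspace_eq
      by (intro exI[of _ "{y \<in> topspace \<tau>. - x + y \<in> V}"]) auto
  qed
qed

lemma limitin_iff_solid_nbhd:
  assumes A: "directed_by A r" and "f \<in> A \<rightarrow> carrier E" "l \<in> carrier E"
  shows "limitin \<tau> f l (tail_filter A r) \<longleftrightarrow>
    (\<forall>W. solid_nbhd W \<longrightarrow> (\<exists>\<alpha>\<^sub>0\<in>A. \<forall>\<alpha>\<in>A. r \<alpha>\<^sub>0 \<alpha> \<longrightarrow> f \<alpha> - l \<in> W))"
  unfolding limitin_def eventually_tail_filter[OF A]
proof (intro iffI allI impI conjI)
  fix W
  assume l: "l \<in> topspace \<tau> \<and> (\<forall>U. openin \<tau> U \<and> l \<in> U \<longrightarrow> (\<exists>\<alpha>\<^sub>0\<in>A. \<forall>\<alpha>\<in>A. r \<alpha>\<^sub>0 \<alpha> \<longrightarrow> f \<alpha> \<in> U))"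
    and W: "solid_nbhd W"
  obtain V where V: "openin \<tau> V" "0 \<in> V" "V \<subseteq> W" using W by (auto simp: solid_nbhd_def)
  have "openin \<tau> {y \<in> topspace \<tau>. - l + y \<in> V}"
    using openin_continuous_map_preimage[OF continuous_translation V(1), of "- l"] assms by simp
  moreover have "l \<in> {y \<in> topspace \<tau>. - l + y \<in> V}" using V l by simp
  ultimately obtain \<alpha>\<^sub>0 where "\<alpha>\<^sub>0\<in>A" "\<forall>\<alpha>\<in>A. r \<alpha>\<^sub>0 \<alpha> \<longrightarrow> f \<alpha> \<in> {y \<in> topspace \<tau>. - l + y \<in> V}"
    using l by blast
  then show "\<exists>\<alpha>\<^sub>0\<in>A. \<forall>\<alpha>\<in>A. r \<alpha>\<^sub>0 \<alpha> \<longrightarrow> f \<alpha> - l \<in> W" using V by (intro bexI[of _ \<alpha>\<^sub>0]) auto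
next
  assume *: "\<forall>W. solid_nbhd W \<longrightarrow> (\<exists>\<alpha>\<^sub>0\<in>A. \<forall>\<alpha>\<in>A. r \<alpha>\<^sub>0 \<alpha> \<longrightarrow> f \<alpha> - l \<in> W)"
  show "l \<in> topspace \<tau>" using assms topspace_eq by simp
  fix U assume "openin \<tau> U \<and> l \<in> U"
  then obtain W where W: "solid_nbhd W" "\<forall>w\<in>W. l + w \<in> U" using openin_iff_solid_nbhd by blast
  then obtain \<alpha>\<^sub>0 where "\<alpha>\<^sub>0\<in>A" "\<forall>\<alpha>\<in>A. r \<alpha>\<^sub>0 \<alpha> \<longrightarrow> f \<alpha> - l \<in> W" using * by blast
  moreover have "f \<alpha> \<in> U" if "f \<alpha> - l \<in> W" for \<alpha>
  proof -
    have "l + (f \<alpha> - l) \<in> U" using that W by blast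
    then show ?thesis by simp
  qed
  ultimately show "\<exists>\<alpha>\<^sub>0\<in>A. \<forall>\<alpha>\<in>A. r \<alpha>\<^sub>0 \<alpha> \<longrightarrow> f \<alpha> \<in> U" by blast
qed

lemma Hausdorff_solid_nbhd:
  assumes "Hausdorff_space \<tau>" "x \<in> carrier E" "\<And>W. solid_nbhd W \<Longrightarrow> x \<in> W"
  shows "x = 0"
proof (rule ccontr)
  assume "x \<noteq> 0"
  then obtain U V where "openin \<tau> U" "openin \<tau> V" "0 \<in> U" "x \<in> V" "disjnt U V"
    using assms(1,2) unfolding Hausdorff_space_def topspace_eq by (metis zero_closed)
  then show False using assms(3) ex_solid_nbhd by (fastforce simp: disjnt_iff)
qed

end

locale uo_Lebesgue_lattice = vector_lattice +
  fixes \<tau> :: "'a topology"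
  assumes uo_Lebesgue: "uo_Lebesgue E \<tau>"
    and Hausdorff: "Hausdorff_space \<tau>"

sublocale uo_Lebesgue_lattice \<subseteq> locally_solid_lattice
  using uo_Lebesgue by unfold_locales (simp add: uo_Lebesgue_def)

context uo_Lebesgue_lattice
begin

lemma uo_conv_imp_limitin:
  assumes "directed_by A r" "f \<in> A \<rightarrow> carrier E" "l \<in> carrier E" "uo_conv E A r f l"
  shows "limitin \<tau> f l (tail_filter A r)"
proof -
  have c: "(\<lambda>\<alpha>. f \<alpha> - l) \<in> A \<rightarrow> carrier E" using assms by auto
  have "limitin \<tau> (\<lambda>\<alpha>. f \<alpha> - l) 0 (tail_filter A r)"
    using assms by (intro uo_LebesgueD[OF uo_Lebesgue assms(1) c]) (simp add: uo_conv_null_iff)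
  then show ?thesis
    by (simp add: limitin_iff_solid_nbhd[OF assms(1-3)] limitin_iff_solid_nbhd[OF assms(1) c])
qed

lemma decreasing_to_zero_in_solid_nbhd:
  assumes y: "decreasing_to_zero E B s y" and W: "solid_nbhd W"
  obtains b where "b \<in> B" "y b \<in> W"
proof -
  note D = decreasing_to_zeroD[OF y]
  have "uo_conv E B s y 0"
    by (rule order_conv_imp_uo_conv[OF decreasing_to_zero_order_conv[OF y]]) (use D in auto)
  then have "limitin \<tau> y 0 (tail_filter B s)"
    using D by (intro uo_conv_imp_limitin) auto
  then obtain b where "b \<in> B" "\<forall>c\<in>B. s b c \<longrightarrow> y c - 0 \<in> W"
    using W D(1,2) by (subst (asm) limitin_iff_solid_nbhd) auto
  then show thesis using that[of b] directed_byD(2)[OF D(1)] by auto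
qed

end

section \<open>Unbounded order null sequences\<close>

context dedekind_complete_vector_lattice
begin

lemma limsup_exists:
  fixes z :: "nat \<Rightarrow> 'a"
  assumes "\<And>k. 0 \<preceq> z k" "\<And>k. z k \<preceq> u"
  obtains y w where "\<And>n. is_sup (z ` {n..}) (y n)" "is_inf (range y) w" "0 \<preceq> w"
    "decreasing_to_zero E UNIV (\<le>) (\<lambda>n. y n - w)"
proof -
  have zc: "z k \<in> carrier E" for k using assms leq_carrier by blast
  have "\<exists>s. is_sup (z ` {n..}) s" for n
    using zc assms by (intro ex_is_sup[of _ u]) auto
  then obtain y where y: "\<And>n. is_sup (z ` {n..}) (y n)" by metis
  have z_le: "z k \<preceq> y n" if "n \<le> k" for n k using is_supD(1)[OF y] that by auto
  have y0: "0 \<preceq> y n" for n using ord.order_trans[OF assms(1) z_le] by blast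
  have anti: "y m \<preceq> y n" if "n \<le> m" for n m
    by (rule is_supD(2)[OF y]) (use that in \<open>auto intro: z_le\<close>)
  obtain w where w: "is_inf (range y) w"
    using ex_is_inf[of "range y" 0] y0 leq_carrier by blast
  have w0: "0 \<preceq> w" by (rule is_infD(2)[OF w]) (use y0 in auto)
  have "is_inf (range (\<lambda>n. y n - w)) 0"
    unfolding is_inf_def
  proof (intro conjI ballI allI impI)
    show "0 \<preceq> d" if "d \<in> range (\<lambda>n. y n - w)" for d using that is_infD(1)[OF w] by auto
    fix v assume v: "\<forall>d\<in>range (\<lambda>n. y n - w). v \<preceq> d"
    have "v + w \<preceq> d" if "d \<in> range y" for d
    proof -
      obtain n where "d = y n" using \<open>d \<in> range y\<close> by blast
      moreover have "v \<preceq> y n - w" using v by blast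
      ultimately show ?thesis by (simp add: ord.le_diff_eq)
    qed
    then have "v + w \<preceq> w" by (rule is_infD(2)[OF w])
    then show "v \<preceq> 0" by simp
  qed
  then have "decreasing_to_zero E UNIV (\<le>) (\<lambda>n. y n - w)"
    using anti by (intro decreasing_to_zeroI directed_by_nat) (auto intro: ord.diff_right_mono)
  then show thesis using that y w w0 by blast
qed

text \<open>A sequence is unbounded order null as soon as the limit superior \<open>w\<close> of its truncations is
  disjoint from every truncated member, because \<open>w\<close> lies below the supremum of these.\<close>

lemma uo_null_seqI:
  fixes r :: "nat \<Rightarrow> 'a"
  assumes r0: "\<And>k. 0 \<preceq> r k"
    and disj: "\<And>u y w m. 0 \<preceq> u \<Longrightarrow> (\<And>n. is_sup ((\<lambda>k. r k \<sqinter> u) ` {n..}) (y n)) \<Longrightarrow>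
      (\<And>n. w \<preceq> y n) \<Longrightarrow> 0 \<preceq> w \<Longrightarrow> r m \<sqinter> u \<sqinter> w = 0"
  shows "uo_conv E UNIV (\<le>) r 0"
proof (rule uo_convI)
  fix u assume u: "0 \<preceq> u"
  have uc: "u \<in> carrier E" and rc: "\<And>k. r k \<in> carrier E" using u r0 leq_carrier by auto
  have z0: "0 \<preceq> r k \<sqinter> u" for k using u uc r0 rc by simp
  have zu: "r k \<sqinter> u \<preceq> u" for k using uc rc meet_leq2 by simp
  obtain y w where y: "\<And>n. is_sup ((\<lambda>k. r k \<sqinter> u) ` {n..}) (y n)"
    and w: "is_inf (range y) w" "0 \<preceq> w" and dec: "decreasing_to_zero E UNIV (\<le>) (\<lambda>n. y n - w)"
    using limsup_exists[of "\<lambda>k. r k \<sqinter> u" u, OF z0 zu] by blast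
  have wy: "w \<preceq> y n" for n using is_infD(1)[OF w(1)] by blast
  have "y 0 \<sqinter> w \<preceq> 0"
    by (rule is_sup_disjoint[OF y]) (use disj[OF u y wy w(2)] rc uc leq_carrier[OF w(2)] in auto)
  moreover have "y 0 \<sqinter> w = w"
    using wy[of 0] leq_closed[OF wy[of 0]] leq_carrier[OF w(2)] by (simp add: meet_absorb2)
  ultimately have "w = 0" using w(2) by (auto intro: ord.order.antisym)
  then have dec': "decreasing_to_zero E UNIV (\<le>) y" using dec by simp
  show "order_conv E UNIV (\<le>) (\<lambda>k. vabs E (r k - 0) \<sqinter> u) 0"
  proof (rule order_conv_leqI[OF dec'])
    fix n :: nat
    have "r k \<sqinter> u \<preceq> y n" if "n \<le> k" for k using is_supD(1)[OF y[of n]] that by auto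
    then show "\<exists>k0\<in>UNIV. \<forall>k\<in>UNIV. k0 \<le> k \<longrightarrow> vabs E (0 - vabs E (r k - 0) \<sqinter> u) \<preceq> y n"
      using z0 r0 rc uc by (intro bexI[of _ n]) (auto simp: vabs_of_nonneg)
  qed
qed

lemma disjoint_seq_uo_null:
  fixes r :: "nat \<Rightarrow> 'a"
  assumes r0: "\<And>k. 0 \<preceq> r k" and disj: "\<And>m n. m < n \<Longrightarrow> r n \<sqinter> r m = 0"
  shows "uo_conv E UNIV (\<le>) r 0"
proof (rule uo_null_seqI[OF r0])
  fix u y w and m :: nat
  assume u: "0 \<preceq> u" and y: "\<And>n. is_sup ((\<lambda>k. r k \<sqinter> u) ` {n..}) (y n)" and w: "\<And>n. w \<preceq> y n" "0 \<preceq> w"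
  have c: "u \<in> carrier E" "\<And>k. r k \<in> carrier E" "w \<in> carrier E" using u r0 w(2) leq_carrier by auto
  have "y (Suc m) \<sqinter> r m \<preceq> 0"
  proof (rule is_sup_disjoint[OF y])
    fix d assume "d \<in> (\<lambda>k. r k \<sqinter> u) ` {Suc m..}"
    then obtain k where "k \<in> {Suc m..}" and d: "d = r k \<sqinter> u" by blast
    then have k: "m < k" by simp
    from d have "d \<sqinter> r m \<preceq> r k \<sqinter> r m" using c by (intro meet_mono) (auto simp: meet_leq1)
    then show "d \<sqinter> r m \<preceq> 0" using disj[OF k] by simp
  qed (use c in auto)
  moreover have "r m \<sqinter> u \<sqinter> w \<preceq> y (Suc m) \<sqinter> r m"
  proof -
    have yc: "y (Suc m) \<in> carrier E" using w(1) c leq_closed by blast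
    have "r m \<sqinter> u \<sqinter> w \<preceq> w" "r m \<sqinter> u \<sqinter> w \<preceq> r m \<sqinter> u" "r m \<sqinter> u \<preceq> r m"
      using c meet_leq1[of "r m \<sqinter> u" w] meet_leq2[of "r m \<sqinter> u" w] meet_leq1[of "r m" u] by auto
    then show ?thesis using c yc ord.order_trans[OF _ w(1)[of "Suc m"]] ord.order_trans[of _ "r m \<sqinter> u" "r m"]
      by simp
  qed
  moreover have "0 \<preceq> r m \<sqinter> u \<sqinter> w" using u r0 w(2) c by simp
  ultimately show "r m \<sqinter> u \<sqinter> w = 0" using ord.order_trans ord.order.antisym by meson
qed

end

section \<open>Uniqueness of Hausdorff uo-Lebesgue topologies\<close>

context locally_solid_lattice
begin

text \<open>The members of a chain act like the balls of radius \<open>2\<^sup>-\<^sup>n\<close> of a pseudonorm: sums of elements of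
  \<open>W k\<close> with \<open>k > n\<close> belong to \<open>W n\<close>. A topology that is not metrizable is reached by varying the chain.\<close>

definition nbhd_chain :: "(nat \<Rightarrow> 'a set) \<Rightarrow> bool"
  where "nbhd_chain W \<longleftrightarrow> (\<forall>n. solid_nbhd (W n) \<and> (\<forall>x\<in>W (Suc n). \<forall>y\<in>W (Suc n). x + y \<in> W n))"

lemma nbhd_chainD:
  assumes "nbhd_chain W"
  shows "solid_nbhd (W n)" "x \<in> W (Suc n) \<Longrightarrow> y \<in> W (Suc n) \<Longrightarrow> x + y \<in> W n"
  using assms by (auto simp: nbhd_chain_def)

lemma nbhd_chain_antimono:
  assumes "nbhd_chain W" "m \<le> n"
  shows "W n \<subseteq> W m"
  using assms(2)
proof (induction rule: dec_induct)
  case (step n)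
  have "x \<in> W n" if "x \<in> W (Suc n)" for x
    using nbhd_chainD(2)[OF assms(1) that zero_in_solid_nbhd[OF nbhd_chainD(1)[OF assms(1)]]] by simp
  then show ?case using step by blast
qed simp

lemma ex_nbhd_chain:
  assumes "solid_nbhd U"
  obtains W where "nbhd_chain W" "\<And>x y. x \<in> W 0 \<Longrightarrow> y \<in> W 0 \<Longrightarrow> x + y \<in> U"
proof -
  define half where "half V = (SOME V'. solid_nbhd V' \<and> (\<forall>x\<in>V'. \<forall>y\<in>V'. x + y \<in> V))" for V
  have half: "solid_nbhd (half V)" "\<forall>x\<in>half V. \<forall>y\<in>half V. x + y \<in> V" if V: "solid_nbhd V" for V
  proof -
    obtain V' where "solid_nbhd V' \<and> (\<forall>x\<in>V'. \<forall>y\<in>V'. x + y \<in> V)"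
      using solid_nbhd_half[OF V] by metis
    then have "solid_nbhd (half V) \<and> (\<forall>x\<in>half V. \<forall>y\<in>half V. x + y \<in> V)"
      unfolding half_def by (rule someI)
    then show "solid_nbhd (half V)" "\<forall>x\<in>half V. \<forall>y\<in>half V. x + y \<in> V" by auto
  qed
  define W where "W n = (half ^^ Suc n) U" for n
  have W: "solid_nbhd ((half ^^ n) U)" for n by (induction n) (use assms half in auto)
  have "nbhd_chain W" unfolding nbhd_chain_def
  proof (intro allI conjI)
    show "solid_nbhd (W n)" for n unfolding W_def by (rule W)
    show "\<forall>x\<in>W (Suc n). \<forall>y\<in>W (Suc n). x + y \<in> W n" for n
      using half(2)[OF W[of "Suc n"]] by (simp add: W_def)
  qed
  moreover have "x + y \<in> U" if "x \<in> W 0" "y \<in> W 0" for x y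
    using half(2)[OF assms] that by (simp add: W_def)
  ultimately show thesis by (rule that)
qed

lemma nbhd_chain_Int: "nbhd_chain W \<Longrightarrow> nbhd_chain W' \<Longrightarrow> nbhd_chain (\<lambda>n. W n \<inter> W' n)"
  by (simp add: nbhd_chain_def solid_nbhd_Int)

lemma nbhd_chain_sum:
  assumes W: "nbhd_chain W" and z: "\<And>k. n < k \<Longrightarrow> z k \<in> W k"
  shows "(\<Sum>k\<in>{n<..n + j}. z k) \<in> W n"
  using z
proof (induction j arbitrary: n)
  case 0
  then show ?case using zero_in_solid_nbhd[OF nbhd_chainD(1)[OF W]] by simp
next
  case (Suc j)
  have "{n<..n + Suc j} = insert (Suc n) {Suc n<..Suc n + j}" by auto
  then have "(\<Sum>k\<in>{n<..n + Suc j}. z k) = z (Suc n) + (\<Sum>k\<in>{Suc n<..Suc n + j}. z k)" by simp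
  also have "\<dots> \<in> W n"
    by (rule nbhd_chainD(2)[OF W Suc.prems Suc.IH]) (use Suc.prems in auto)
  finally show ?case .
qed

end

locale dedekind_complete_uo_Lebesgue_lattice =
  dedekind_complete_vector_lattice + uo_Lebesgue_lattice
begin

text \<open>The differences \<open>s - d\<close> decrease to zero along \<open>D\<close>, so one of them is in \<open>W (Suc n)\<close>.\<close>

lemma directed_sup_in_nbhd_chain:
  assumes W: "nbhd_chain W" and D: "D \<noteq> {}" "\<And>d. d \<in> D \<Longrightarrow> d \<in> W (Suc n)"
    "\<And>d e. d \<in> D \<Longrightarrow> e \<in> D \<Longrightarrow> \<exists>f\<in>D. d \<preceq> f \<and> e \<preceq> f" and s: "is_sup D s"
  shows "s \<in> W n"
proof -
  have "decreasing_to_zero E D (\<preceq>) (\<lambda>d. s - d)"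
  proof (rule decreasing_to_zeroI)
    show "directed_by D (\<preceq>)" using D unfolding directed_by_def by (auto intro: ord.order_trans)
    show "is_inf ((\<lambda>d. s - d) ` D) 0" using is_inf_diff[OF s, of s] by simp
  qed (auto intro: ord.diff_left_mono)
  then obtain d where "d \<in> D" "s - d \<in> W (Suc n)"
    using decreasing_to_zero_in_solid_nbhd nbhd_chainD(1)[OF W] by blast
  then show ?thesis using nbhd_chainD(2)[OF W, of "s - d" n d] D(2) by simp
qed

text \<open>Finite suprema are dominated by finite sums, which \<open>nbhd_chain_sum\<close> controls.\<close>

lemma tail_sup_in_nbhd_chain:
  assumes W: "nbhd_chain W" and z: "\<And>k. Suc n < k \<Longrightarrow> z k \<in> W k" "\<And>k. 0 \<preceq> z k"
    and s: "is_sup (z ` {Suc n<..}) s"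
  shows "s \<in> W n"
proof -
  have zc: "z k \<in> carrier E" for k using z(2) leq_carrier by blast
  have "\<exists>p. is_sup (z ` {Suc n<..Suc n + Suc j}) p" for j
    using zc is_supD(1)[OF s] by (intro ex_is_sup[of _ s]) auto
  then obtain p where p: "\<And>j. is_sup (z ` {Suc n<..Suc n + Suc j}) (p j)" by metis
  have mono: "p i \<preceq> p j" if "i \<le> j" for i j
    by (rule is_supD(2)[OF p]) (use is_supD(1)[OF p] that in auto)
  have p_in: "p j \<in> W (Suc n)" for j
  proof -
    let ?S = "\<Sum>k\<in>{Suc n<..Suc n + Suc j}. z k"
    have "z k \<preceq> ?S" if "k \<in> {Suc n<..Suc n + Suc j}" for k
    proof -
      have "?S = z k + (\<Sum>i\<in>{Suc n<..Suc n + Suc j} - {k}. z i)" using that by (intro sum.remove) auto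
      moreover have "0 \<preceq> (\<Sum>i\<in>{Suc n<..Suc n + Suc j} - {k}. z i)"
        using z(2) by (intro sum_nonneg) auto
      ultimately show ?thesis by simp
    qed
    then have "p j \<preceq> ?S" by (intro is_supD(2)[OF p]) auto
    moreover have "z (Suc (Suc n)) \<preceq> p j" by (rule is_supD(1)[OF p]) auto
    then have "0 \<preceq> p j" using z(2) ord.order_trans by blast
    moreover have "?S \<in> W (Suc n)" using nbhd_chain_sum[OF W z(1)] by blast
    ultimately show ?thesis using solidD_nonneg nbhd_chainD(1)[OF W] solid_nbhd_solid by blast
  qed
  have sup_p: "is_sup (range p) s" unfolding is_sup_def
  proof (intro conjI ballI allI impI)
    show "d \<preceq> s" if d: "d \<in> range p" for d
    proof -
      obtain j where "d = p j" using d by blast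
      moreover have "p j \<preceq> s" by (rule is_supD(2)[OF p]) (use is_supD(1)[OF s] in auto)
      ultimately show ?thesis by simp
    qed
    fix u assume u: "\<forall>d\<in>range p. d \<preceq> u"
    show "s \<preceq> u"
    proof (rule is_supD(2)[OF s])
      fix d assume "d \<in> z ` {Suc n<..}"
      then obtain k where k: "Suc n < k" "d = z k" by auto
      then have "z k \<preceq> p k" by (intro is_supD(1)[OF p]) auto
      then show "d \<preceq> u" using k u ord.order_trans by blast
    qed
  qed
  have "\<exists>f\<in>range p. d \<preceq> f \<and> e \<preceq> f" if "d \<in> range p" "e \<in> range p" for d e
  proof -
    obtain i j where "d = p i" "e = p j" using \<open>d \<in> range p\<close> \<open>e \<in> range p\<close> by blast
    then show ?thesis using mono[of i "max i j"] mono[of j "max i j"] by auto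
  qed
  from directed_sup_in_nbhd_chain[OF W _ _ this sup_p] show ?thesis using p_in by blast
qed

text \<open>The intersection of a chain of neighbourhoods is a band; \<open>q\<close> is the component of \<open>x\<close> in it.\<close>

lemma ex_component:
  assumes W: "nbhd_chain W" and x: "0 \<preceq> x"
  obtains q where "is_sup {d. (\<forall>n. d \<in> W n) \<and> 0 \<preceq> d \<and> d \<preceq> x} q" "\<And>n. q \<in> W n" "0 \<preceq> q" "q \<preceq> x"
proof -
  let ?D = "{d. (\<forall>n. d \<in> W n) \<and> 0 \<preceq> d \<and> d \<preceq> x}"
  have z: "0 \<in> ?D" using x zero_in_solid_nbhd[OF nbhd_chainD(1)[OF W]] by simp
  have "?D \<subseteq> carrier E" using leq_carrier by blast
  then obtain q where q: "is_sup ?D q" using z ex_is_sup[of ?D x] by blast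
  have "\<exists>f\<in>?D. d \<preceq> f \<and> e \<preceq> f" if de: "d \<in> ?D" "e \<in> ?D" for d e
  proof (rule bexI[of _ "d \<squnion> e"])
    have c: "d \<in> carrier E" "e \<in> carrier E" using de leq_carrier by blast+
    show "d \<preceq> d \<squnion> e \<and> e \<preceq> d \<squnion> e" using c join_leq1 join_leq2 by blast
    then have 0: "0 \<preceq> d \<squnion> e" using de ord.order_trans by blast
    have le: "d \<squnion> e \<preceq> d + e" using de c by simp
    have "d \<squnion> e \<in> W n" for n
    proof -
      have "d + e \<in> W n" using de nbhd_chainD(2)[OF W] by blast
      then show ?thesis using 0 le solidD_nonneg nbhd_chainD(1)[OF W] solid_nbhd_solid by blast
    qed
    then show "d \<squnion> e \<in> ?D" using de c 0 by simp
  qed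
  then have "q \<in> W n" for n
    using z by (intro directed_sup_in_nbhd_chain[OF W _ _ _ q]) auto
  moreover have "0 \<preceq> q" by (rule is_supD(1)[OF q z])
  moreover have "q \<preceq> x" by (rule is_supD(2)[OF q]) auto
  ultimately show thesis using that q by blast
qed

text \<open>Let \<open>q n\<close> be the component of \<open>x n\<close> in the band \<open>N\<close> of all elements that lie in every \<open>W k\<close>, and let
  \<open>r n = x n - q n\<close>. If \<open>w\<close> is below all tail suprema of the truncated \<open>r k\<close>, then its meet with \<open>r m\<close> is below
  the tail suprema of \<open>x k \<sqinter> x m\<close>. These suprema are as small as desired, so the meet is in \<open>N\<close>, and it is zero
  because \<open>r m\<close> is disjoint from \<open>N\<close>. Hence \<open>r\<close> is unbounded order null and finally in \<open>W 0\<close>.\<close>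

lemma almost_disjoint_seq:
  fixes x :: "nat \<Rightarrow> 'a"
  assumes W: "nbhd_chain W" and x0: "\<And>n. 0 \<preceq> x n"
    and small: "\<And>m n. m < n \<Longrightarrow> x n \<sqinter> x m \<in> W n"
  shows "\<exists>n. \<exists>r\<in>W 0. \<exists>q\<in>W 0. x n = r + q"
proof -
  have xc: "x n \<in> carrier E" for n using x0 leq_carrier by blast
  have W_solid: "solid E (W n)" for n using nbhd_chainD(1)[OF W] solid_nbhd_solid by blast
  have "\<forall>n. \<exists>q. is_sup {d. (\<forall>k. d \<in> W k) \<and> 0 \<preceq> d \<and> d \<preceq> x n} q \<and> (\<forall>k. q \<in> W k) \<and> 0 \<preceq> q \<and> q \<preceq> x n"
  proof
    fix n
    obtain q where "is_sup {d. (\<forall>k. d \<in> W k) \<and> 0 \<preceq> d \<and> d \<preceq> x n} q" "\<And>k. q \<in> W k" "0 \<preceq> q" "q \<preceq> x n"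
      using ex_component[OF W x0] by blast
    then show "\<exists>q. is_sup {d. (\<forall>k. d \<in> W k) \<and> 0 \<preceq> d \<and> d \<preceq> x n} q \<and> (\<forall>k. q \<in> W k) \<and> 0 \<preceq> q \<and> q \<preceq> x n"
      by blast
  qed
  from choice[OF this]
  obtain q where q: "\<And>n. is_sup {d. (\<forall>k. d \<in> W k) \<and> 0 \<preceq> d \<and> d \<preceq> x n} (q n)"
    "\<And>n k. q n \<in> W k" "\<And>n. 0 \<preceq> q n" "\<And>n. q n \<preceq> x n" by blast
  define r where "r n = x n - q n" for n
  have r0: "0 \<preceq> r n" for n using q(4) by (simp add: r_def)
  have rx: "r n \<preceq> x n" for n using q(3) by (simp add: r_def ord.diff_le_eq)
  have rc: "r n \<in> carrier E" for n using r0 leq_carrier by blast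
  have r_disj: "d = 0" if d: "\<And>k. d \<in> W k" "0 \<preceq> d" "d \<preceq> r n" for d n
  proof -
    have "d + q n \<in> W k" for k using nbhd_chainD(2)[OF W] d(1) q(2) by blast
    moreover have "d + q n \<preceq> x n" using d(3) by (simp add: r_def ord.le_diff_eq)
    ultimately have "d + q n \<preceq> q n" using d q(3) by (intro is_supD(1)[OF q(1)]) (simp add: ord.add_nonneg_nonneg)
    then show ?thesis using d(2) by (simp add: ord.order.antisym)
  qed
  have "uo_conv E UNIV (\<le>) r 0"
  proof (rule uo_null_seqI[OF r0])
    fix u y w and m :: nat
    assume u: "0 \<preceq> u" and y: "\<And>n. is_sup ((\<lambda>k. r k \<sqinter> u) ` {n..}) (y n)"
      and w: "\<And>n. w \<preceq> y n" "0 \<preceq> w"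
    have c: "u \<in> carrier E" "w \<in> carrier E" using u w(2) leq_carrier by auto
    let ?d = "r m \<sqinter> u \<sqinter> w"
    have d0: "0 \<preceq> ?d" using u r0 w(2) c rc by simp
    have d_le: "?d \<preceq> w" "?d \<preceq> r m \<sqinter> u" "r m \<sqinter> u \<preceq> r m"
      using c rc meet_leq1[of "r m \<sqinter> u" w] meet_leq2[of "r m \<sqinter> u" w] meet_leq1[of "r m" u] by auto
    have "?d \<in> W j" for j
    proof -
      \<comment> \<open>Far enough for \<open>small\<close> to apply to all \<open>k\<close> in the tail and for the two steps lost in
        \<open>tail_sup_in_nbhd_chain\<close>.\<close>
      let ?n = "Suc (Suc (m + j))"
      have yc: "y ?n \<in> carrier E" using w(1) c leq_closed by blast
      have "is_sup ((\<lambda>d. d \<sqinter> x m) ` (\<lambda>k. r k \<sqinter> u) ` {?n..}) (y ?n \<sqinter> x m)"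
        using rc c xc by (intro is_sup_meet[OF y]) auto
      moreover have "(\<lambda>d. d \<sqinter> x m) ` (\<lambda>k. r k \<sqinter> u) ` {?n..} = (\<lambda>k. r k \<sqinter> u \<sqinter> x m) ` {Suc (m + j)<..}"
        by (auto simp: image_image Suc_le_eq)
      ultimately have s: "is_sup ((\<lambda>k. r k \<sqinter> u \<sqinter> x m) ` {Suc (m + j)<..}) (y ?n \<sqinter> x m)" by simp
      have "y ?n \<sqinter> x m \<in> W (m + j)"
      proof (rule tail_sup_in_nbhd_chain[OF W _ _ s])
        show n: "0 \<preceq> r k \<sqinter> u \<sqinter> x m" for k using r0 u x0 rc c xc by simp
        fix k assume k: "Suc (m + j) < k"
        have "r k \<sqinter> u \<preceq> r k" using rc c meet_leq1 by blast
        then have "r k \<sqinter> u \<preceq> x k" using rx ord.order_trans by blast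
        then have "r k \<sqinter> u \<sqinter> x m \<preceq> x k \<sqinter> x m" using rc c xc by (intro meet_mono) auto
        then show "r k \<sqinter> u \<sqinter> x m \<in> W k"
          using k small[of m k] n[of k] solidD_nonneg[OF W_solid] by auto
      qed
      then have "y ?n \<sqinter> x m \<in> W j" using nbhd_chain_antimono[OF W, of j "m + j"] by auto
      moreover have "?d \<preceq> y ?n \<sqinter> x m"
        using ord.order_trans[OF d_le(1) w(1)[of ?n]]
          ord.order_trans[OF ord.order_trans[OF d_le(2,3)] rx] yc xc by simp
      ultimately show ?thesis using d0 solidD_nonneg[OF W_solid] by blast
    qed
    then show "?d = 0" using d0 d_le ord.order_trans by (intro r_disj[of _ m]) blast+
  qed
  then have "limitin \<tau> r 0 (tail_filter UNIV (\<le>))"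
    using rc by (intro uo_conv_imp_limitin directed_by_nat) auto
  then have "\<forall>V. solid_nbhd V \<longrightarrow> (\<exists>n. \<forall>k. n \<le> k \<longrightarrow> r k - 0 \<in> V)"
    using rc by (subst (asm) limitin_iff_solid_nbhd[OF directed_by_nat]) auto
  then obtain n where "\<forall>k. n \<le> k \<longrightarrow> r k - 0 \<in> W 0" using nbhd_chainD(1)[OF W] by blast
  then have "r n \<in> W 0" by simp
  moreover have "x n = r n + q n" by (simp add: r_def)
  ultimately show ?thesis using q(2) by blast
qed

text \<open>If truncations of elements outside \<open>U\<close> could be arbitrarily small, one could pick inductively positive
  elements outside \<open>U\<close>, each with a small truncation at the sum of the previous ones. They would be
  almost disjoint from each other, contradicting \<open>almost_disjoint_seq\<close>. Therefore a uo-Lebesgue topology is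
  determined by its behaviour on order intervals.\<close>

lemma unbounded_nbhd:
  assumes U: "solid_nbhd U"
  obtains u V where "0 \<preceq> u" "solid_nbhd V" "\<And>x. x \<in> carrier E \<Longrightarrow> vabs E x \<sqinter> u \<in> V \<Longrightarrow> x \<in> U"
proof (rule ccontr)
  note conclude = that
  assume no: "\<not> thesis"
  have ex: "\<exists>x. x \<in> carrier E \<and> vabs E x \<sqinter> u \<in> V \<and> x \<notin> U" if "0 \<preceq> u" "solid_nbhd V" for u V
    using conclude[OF that] no by blast
  obtain W where W: "nbhd_chain W" "\<And>x y. x \<in> W 0 \<Longrightarrow> y \<in> W 0 \<Longrightarrow> x + y \<in> U"
    using ex_nbhd_chain[OF U] by blast
  define g where "g u V = vabs E (SOME x. x \<in> carrier E \<and> vabs E x \<sqinter> u \<in> V \<and> x \<notin> U)" for u V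
  have g: "0 \<preceq> g u V" "g u V \<sqinter> u \<in> V" "g u V \<notin> U" if "0 \<preceq> u" "solid_nbhd V" for u V
    using someI_ex[OF ex[OF that]] solid_vabs_iff[OF solid_nbhd_solid[OF U]] unfolding g_def
    by (auto intro: vabs_nonneg)
  \<comment> \<open>The sum \<open>s n\<close> of the elements \<open>x m\<close> with \<open>m < n\<close> chosen below dominates each of them.\<close>
  define s where "s = rec_nat 0 (\<lambda>n t. t + g t (W n))"
  have s_simps: "s 0 = 0" "s (Suc n) = s n + g (s n) (W n)" for n by (simp_all add: s_def)
  have Wn: "solid_nbhd (W n)" for n using nbhd_chainD(1)[OF W(1)] .
  have s0: "0 \<preceq> s n" for n
    by (induction n) (use g(1) Wn in \<open>auto simp: s_simps intro: ord.add_nonneg_nonneg\<close>)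
  define x where "x n = g (s n) (W n)" for n
  have x: "0 \<preceq> x n" "x n \<sqinter> s n \<in> W n" "x n \<notin> U" for n using g[OF s0 Wn] by (auto simp: x_def)
  have s_mono: "s m \<preceq> s n" if "m \<le> n" for m n
    using that
  proof (induction rule: dec_induct)
    case (step n)
    then show ?case using x(1)[of n] ord.order_trans[of "s m" "s n" "s (Suc n)"] by (simp add: s_simps x_def)
  qed simp
  have small: "x n \<sqinter> x m \<in> W n" if "m < n" for m n
  proof (rule solidD_nonneg[OF solid_nbhd_solid[OF Wn] x(2)])
    have c: "x n \<in> carrier E" "x m \<in> carrier E" "s n \<in> carrier E" using x(1) s0 leq_carrier by auto
    show "0 \<preceq> x n \<sqinter> x m" using x(1) c by simp
    have "x m \<preceq> s (Suc m)" using s0[of m] by (simp add: s_simps x_def)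
    also have "s (Suc m) \<preceq> s n" using that by (intro s_mono) simp
    finally (ord.order_trans) show "x n \<sqinter> x m \<preceq> x n \<sqinter> s n" using c by (intro meet_mono) auto
  qed
  obtain n r q where "r \<in> W 0" "q \<in> W 0" "x n = r + q"
    using almost_disjoint_seq[OF W(1) x(1) small] by blast
  then show False using W(2) x(3) by metis
qed

end

text \<open>Amemiya's theorem. As the chains \<open>W\<close> of \<open>\<sigma>\<close>-neighbourhoods shrink, the components \<open>q W\<close> of \<open>u\<close> in their
  intersections decrease to zero, so that \<open>q W\<close> is \<open>\<tau>\<close>-small for some \<open>W\<close>. If elements \<open>x n\<close> of \<open>W n\<close> below \<open>u\<close>
  were all outside \<open>U\<close>, their limit superior \<open>w\<close> would lie in every \<open>W n\<close>, hence below \<open>q W\<close>. Then \<open>w\<close> and,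
  by order continuity of \<open>\<tau>\<close>, some tail supremum \<open>y n \<succeq> x n\<close> would be \<open>\<tau>\<close>-small, a contradiction.\<close>

lemma (in dedekind_complete_vector_lattice) nbhd_on_interval:
  assumes "uo_Lebesgue_lattice E \<sigma>" "uo_Lebesgue_lattice E \<tau>"
    and u: "0 \<preceq> u" and U: "locally_solid_lattice.solid_nbhd E \<tau> U"
  obtains W where "locally_solid_lattice.solid_nbhd E \<sigma> W" "\<And>x. x \<in> W \<Longrightarrow> 0 \<preceq> x \<Longrightarrow> x \<preceq> u \<Longrightarrow> x \<in> U"
proof -
  interpret \<sigma>: uo_Lebesgue_lattice E \<sigma> by (rule assms)
  interpret \<tau>: uo_Lebesgue_lattice E \<tau> by (rule assms)
  interpret \<sigma>: dedekind_complete_uo_Lebesgue_lattice E \<sigma> ..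
  interpret \<tau>: dedekind_complete_uo_Lebesgue_lattice E \<tau> ..
  obtain V where V: "\<tau>.solid_nbhd V" "\<And>x y. x \<in> V \<Longrightarrow> y \<in> V \<Longrightarrow> x + y \<in> U"
    using \<tau>.solid_nbhd_half[OF U] by blast
  let ?I = "{W. \<sigma>.nbhd_chain W}"
  let ?r = "\<lambda>W W'. \<forall>n. W' n \<subseteq> (W n :: 'a set)"
  define q where "q W = (SOME q. is_sup {d. (\<forall>n. d \<in> W n) \<and> 0 \<preceq> d \<and> d \<preceq> u} q)" for W :: "nat \<Rightarrow> 'a set"
  have q: "is_sup {d. (\<forall>n. d \<in> W n) \<and> 0 \<preceq> d \<and> d \<preceq> u} (q W)" "\<forall>n. q W \<in> W n" "0 \<preceq> q W" "q W \<preceq> u"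
    if W: "\<sigma>.nbhd_chain W" for W
  proof -
    obtain q' where q': "is_sup {d. (\<forall>n. d \<in> W n) \<and> 0 \<preceq> d \<and> d \<preceq> u} q'"
      "\<And>n. q' \<in> W n" "0 \<preceq> q'" "q' \<preceq> u"
      using \<sigma>.ex_component[OF W u] by blast
    then have "q W = q'"
      unfolding q_def by (intro some_equality) (auto intro: is_sup_unique)
    then show "is_sup {d. (\<forall>n. d \<in> W n) \<and> 0 \<preceq> d \<and> d \<preceq> u} (q W)" "\<forall>n. q W \<in> W n" "0 \<preceq> q W" "q W \<preceq> u"
      using q' by auto
  qed
  obtain W0 where W0: "\<sigma>.nbhd_chain W0"
    using \<sigma>.ex_solid_nbhd[OF openin_topspace] \<sigma>.topspace_eq \<sigma>.ex_nbhd_chain zero_closed by metis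
  have "decreasing_to_zero E ?I ?r q"
  proof (rule decreasing_to_zeroI)
    show "directed_by ?I ?r"
      unfolding directed_by_def
    proof (intro conjI ballI impI)
      fix W W' assume "W \<in> ?I" "W' \<in> ?I"
      then show "\<exists>W''\<in>?I. (\<forall>n. W'' n \<subseteq> W n) \<and> (\<forall>n. W'' n \<subseteq> W' n)"
        using \<sigma>.nbhd_chain_Int by (intro bexI[of _ "\<lambda>n. W n \<inter> W' n"]) auto
    qed (use W0 in blast)+
    show "q W' \<preceq> q W" if "W \<in> ?I" "W' \<in> ?I" "\<forall>n. W' n \<subseteq> W n" for W W'
      using that q[of W'] by (intro is_supD(1)[OF q(1)]) auto
    show "is_inf (q ` ?I) 0" unfolding is_inf_def
    proof (intro conjI ballI allI impI)
      show "0 \<preceq> d" if "d \<in> q ` ?I" for d using that q(3) by auto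
      fix z assume z: "\<forall>d\<in>q ` ?I. z \<preceq> d"
      then have "z \<preceq> q W0" using W0 by blast
      then have zc: "z \<in> carrier E" using q(3)[OF W0] leq_closed leq_carrier by blast
      have "pp z \<in> X" if X: "\<sigma>.solid_nbhd X" for X
      proof -
        obtain W where W: "\<sigma>.nbhd_chain W" "\<And>x y. x \<in> W 0 \<Longrightarrow> y \<in> W 0 \<Longrightarrow> x + y \<in> X"
          using \<sigma>.ex_nbhd_chain[OF X] by blast
        have "pp z \<preceq> q W" using z W(1) q(3)[OF W(1)] zc by auto
        then have "pp z \<in> W 0"
          using solidD_nonneg[of "W 0" "q W" "pp z"] \<sigma>.nbhd_chainD(1)[OF W(1)] \<sigma>.solid_nbhd_solid q(2)[OF W(1)]
            pp_nonneg[OF zc] by blast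
        then show ?thesis
          using W(2)[of "pp z" 0] \<sigma>.zero_in_solid_nbhd[OF \<sigma>.nbhd_chainD(1)[OF W(1)]] by simp
      qed
      then have "pp z = 0" using zc by (intro \<sigma>.Hausdorff_solid_nbhd \<sigma>.Hausdorff) auto
      then show "z \<preceq> 0" using leq_pp[OF zc] by simp
    qed
  qed
  then obtain W where W: "\<sigma>.nbhd_chain W" "q W \<in> V"
    using \<tau>.decreasing_to_zero_in_solid_nbhd[OF _ V(1)] by blast
  have "\<exists>n. \<forall>x. x \<in> W n \<longrightarrow> 0 \<preceq> x \<longrightarrow> x \<preceq> u \<longrightarrow> x \<in> U"
  proof (rule ccontr)
    assume "\<not> ?thesis"
    then have "\<forall>n. \<exists>x. x \<in> W n \<and> 0 \<preceq> x \<and> x \<preceq> u \<and> x \<notin> U" by blast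
    then obtain x where x: "\<And>n. x n \<in> W n" "\<And>n. 0 \<preceq> x n" "\<And>n. x n \<preceq> u" "\<And>n. x n \<notin> U" by metis
    obtain y w where y: "\<And>n. is_sup (x ` {n..}) (y n)" and w: "is_inf (range y) w" "0 \<preceq> w"
      and dec: "decreasing_to_zero E UNIV (\<le>) (\<lambda>n. y n - w)"
      by (rule limsup_exists[of x u, OF x(2,3)]) (rule that; assumption)
    have wy: "w \<preceq> y n" for n using is_infD(1)[OF w(1)] by blast
    have "{Suc (Suc n)..} = {Suc n<..}" for n by auto
    then have "y (Suc (Suc n)) \<in> W n" for n
      using y[of "Suc (Suc n)"] x by (intro \<sigma>.tail_sup_in_nbhd_chain[OF W(1), of n x]) auto
    then have "w \<in> W n" for n
      using solidD_nonneg[OF \<sigma>.solid_nbhd_solid[OF \<sigma>.nbhd_chainD(1)[OF W(1)]]] w(2) wy by blast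
    moreover have "w \<preceq> u"
      using wy[of 0] is_supD(2)[OF y[of 0], of u] x(3) ord.order_trans by blast
    ultimately have "w \<preceq> q W" using w(2) by (intro is_supD(1)[OF q(1)[OF W(1)]]) auto
    then have wV: "w \<in> V" using solidD_nonneg[OF \<tau>.solid_nbhd_solid[OF V(1)] W(2) w(2)] by blast
    obtain n where "y n - w \<in> V"
      using \<tau>.decreasing_to_zero_in_solid_nbhd[OF dec V(1)] by blast
    then have "y n \<in> U" using V(2)[of "y n - w" w] wV by simp
    moreover have "x n \<preceq> y n" by (rule is_supD(1)[OF y]) auto
    ultimately have "x n \<in> U" using solidD_nonneg[OF \<tau>.solid_nbhd_solid[OF U]] x(2) by blast
    then show False using x(4) by blast
  qed
  then show thesis using that \<sigma>.nbhd_chainD(1)[OF W(1)] by blast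
qed

text \<open>\<open>unbounded_nbhd\<close> reduces the comparison of the topologies to an order interval.\<close>

lemma (in dedekind_complete_vector_lattice) uo_Lebesgue_nbhd_subset:
  assumes "uo_Lebesgue_lattice E \<sigma>" "uo_Lebesgue_lattice E \<tau>"
    and U: "locally_solid_lattice.solid_nbhd E \<tau> U"
  obtains W where "locally_solid_lattice.solid_nbhd E \<sigma> W" "W \<subseteq> U"
proof -
  interpret \<sigma>: uo_Lebesgue_lattice E \<sigma> by (rule assms)
  interpret \<tau>: uo_Lebesgue_lattice E \<tau> by (rule assms)
  interpret \<tau>: dedekind_complete_uo_Lebesgue_lattice E \<tau> ..
  obtain u V where u: "0 \<preceq> u" and V: "\<tau>.solid_nbhd V"
    and uV: "\<And>x. x \<in> carrier E \<Longrightarrow> vabs E x \<sqinter> u \<in> V \<Longrightarrow> x \<in> U"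
    using \<tau>.unbounded_nbhd[OF U] by blast
  obtain W where W: "\<sigma>.solid_nbhd W" "\<And>x. x \<in> W \<Longrightarrow> 0 \<preceq> x \<Longrightarrow> x \<preceq> u \<Longrightarrow> x \<in> V"
    using nbhd_on_interval[OF assms(1,2) u V] by blast
  have "x \<in> U" if x: "x \<in> W" for x
  proof -
    have c: "x \<in> carrier E" "u \<in> carrier E" using x W(1) \<sigma>.solid_nbhd_subset u leq_carrier by auto
    have n: "0 \<preceq> vabs E x \<sqinter> u" using c u by (simp add: vabs_nonneg)
    have "vabs E x \<in> W" using x c solid_vabs_iff \<sigma>.solid_nbhd_solid[OF W(1)] by blast
    then have "vabs E x \<sqinter> u \<in> W"
      using solidD_nonneg[OF \<sigma>.solid_nbhd_solid[OF W(1)] _ n] c by (simp add: meet_leq1)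
    then have "vabs E x \<sqinter> u \<in> V" using W(2) n c by (simp add: meet_leq2)
    then show ?thesis using uV c by blast
  qed
  then show thesis using that W(1) by blast
qed

lemma (in dedekind_complete_vector_lattice) uo_Lebesgue_openin_mono:
  assumes "uo_Lebesgue_lattice E \<sigma>" "uo_Lebesgue_lattice E \<tau>" "openin \<tau> U"
  shows "openin \<sigma> U"
proof -
  interpret \<sigma>: uo_Lebesgue_lattice E \<sigma> by (rule assms)
  interpret \<tau>: uo_Lebesgue_lattice E \<tau> by (rule assms)
  show ?thesis unfolding \<sigma>.openin_iff_solid_nbhd
  proof (intro conjI ballI)
    show "U \<subseteq> carrier E" using assms(3) \<tau>.openin_iff_solid_nbhd by blast
    fix x assume "x \<in> U"
    then obtain V where V: "\<tau>.solid_nbhd V" "\<forall>w\<in>V. x + w \<in> U"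
      using assms(3) \<tau>.openin_iff_solid_nbhd by blast
    obtain W where "\<sigma>.solid_nbhd W" "W \<subseteq> V"
      by (rule uo_Lebesgue_nbhd_subset[OF assms(1,2) V(1)])
    then show "\<exists>W. \<sigma>.solid_nbhd W \<and> (\<forall>w\<in>W. x + w \<in> U)" using V(2) by blast
  qed
qed

lemma (in dedekind_complete_vector_lattice) uo_Lebesgue_unique:
  assumes "uo_Lebesgue_lattice E \<sigma>" "uo_Lebesgue_lattice E \<tau>"
  shows "\<sigma> = \<tau>"
  using uo_Lebesgue_openin_mono[OF assms] uo_Lebesgue_openin_mono[OF assms(2,1)]
  by (auto simp: topology_eq)

lemma (in dedekind_complete_vector_lattice) tau_hat_eqI:
  assumes "uo_Lebesgue_lattice E \<tau>"
  shows "tau_hat E = \<tau>"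
  unfolding tau_hat_def
proof (rule the_equality)
  show "uo_Lebesgue E \<tau> \<and> Hausdorff_space \<tau>"
    using assms by (auto simp: uo_Lebesgue_lattice_def uo_Lebesgue_lattice_axioms_def)
  show "\<sigma> = \<tau>" if "uo_Lebesgue E \<sigma> \<and> Hausdorff_space \<sigma>" for \<sigma>
    using that assms vector_lattice_axioms
    by (intro uo_Lebesgue_unique) (auto simp: uo_Lebesgue_lattice_def uo_Lebesgue_lattice_axioms_def)
qed

lemma (in dedekind_complete_vector_lattice) tau_hat_uo_Lebesgue:
  assumes "admits_Hausdorff_uo_Lebesgue E"
  shows "dedekind_complete_uo_Lebesgue_lattice E (tau_hat E)"
proof -
  obtain \<tau> where "uo_Lebesgue E \<tau>" "Hausdorff_space \<tau>"
    using assms by (auto simp: admits_Hausdorff_uo_Lebesgue_def)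
  then have \<tau>: "uo_Lebesgue_lattice E \<tau>"
    using vector_lattice_axioms by (simp add: uo_Lebesgue_lattice_def uo_Lebesgue_lattice_axioms_def)
  have "dedekind_complete_uo_Lebesgue_lattice E \<tau>"
    unfolding dedekind_complete_uo_Lebesgue_lattice_def using \<tau> dedekind_complete_vector_lattice_axioms by blast
  then show ?thesis using tau_hat_eqI[OF \<tau>] by simp
qed

section \<open>The lattice of order bounded operators\<close>

lemma scaleR_fun_apply [simp]: "(a *\<^sub>R f) x = a *\<^sub>R f x"
  by (simp add: scaleR_fun_def)

lemma LobD:
  assumes "T \<in> carrier (Lob E)"
  shows "x \<in> carrier E \<Longrightarrow> T x \<in> carrier E"
    "x \<in> carrier E \<Longrightarrow> y \<in> carrier E \<Longrightarrow> T (x + y) = T x + T y"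
    "x \<in> carrier E \<Longrightarrow> T (a *\<^sub>R x) = a *\<^sub>R T x"
    "x \<notin> carrier E \<Longrightarrow> T x = 0"
    "order_bounded E T"
  using assms by (auto simp: Lob_def linear_operators_def)

lemma Lob_le_iff: "S \<sqsubseteq>\<^bsub>Lob E\<^esub> T \<longleftrightarrow> (\<forall>x\<in>carrier E. 0 \<sqsubseteq>\<^bsub>E\<^esub> x \<longrightarrow> S x \<sqsubseteq>\<^bsub>E\<^esub> T x)"
  by (simp add: Lob_def)

context vector_lattice
begin

lemma LobI:
  assumes "\<And>x. x \<in> carrier E \<Longrightarrow> T x \<in> carrier E"
    "\<And>x y. x \<in> carrier E \<Longrightarrow> y \<in> carrier E \<Longrightarrow> T (x + y) = T x + T y"
    "\<And>a x. x \<in> carrier E \<Longrightarrow> T (a *\<^sub>R x) = a *\<^sub>R T x"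
    "\<And>x. x \<notin> carrier E \<Longrightarrow> T x = 0"
    "\<And>a b. a \<in> carrier E \<Longrightarrow> b \<in> carrier E \<Longrightarrow> \<exists>c d. \<forall>x. a \<preceq> x \<longrightarrow> x \<preceq> b \<longrightarrow> c \<preceq> T x \<and> T x \<preceq> d"
  shows "T \<in> carrier (Lob E)"
proof -
  have "\<exists>c\<in>carrier E. \<exists>d\<in>carrier E. T ` \<lbrace>a..b\<rbrace> \<subseteq> \<lbrace>c..d\<rbrace>" if ab: "a \<in> carrier E" "b \<in> carrier E" for a b
  proof (cases "a \<preceq> b")
    case True
    obtain c d where cd: "\<And>x. a \<preceq> x \<Longrightarrow> x \<preceq> b \<Longrightarrow> c \<preceq> T x \<and> T x \<preceq> d" using assms(5)[OF ab] by blast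
    have "c \<preceq> T a" "T a \<preceq> d" using cd[of a] True by auto
    then have c: "c \<in> carrier E" "d \<in> carrier E" using assms(1)[OF ab(1)] leq_closed by metis+
    have "T ` \<lbrace>a..b\<rbrace> \<subseteq> \<lbrace>c..d\<rbrace>"
      using cd ab c assms(1) by (auto simp: at_least_at_most_def leq_iff)
    then show ?thesis using c by blast
  next
    case False
    have "x \<notin> \<lbrace>a..b\<rbrace>" for x
    proof
      assume "x \<in> \<lbrace>a..b\<rbrace>"
      then have "a \<preceq> x" "x \<preceq> b" using ab by (auto simp: at_least_at_most_def leq_iff)
      then show False using False ord.order_trans by blast
    qed
    then have "\<lbrace>a..b\<rbrace> = {}" by blast
    then show ?thesis using ab by blast
  qed
  then show ?thesis using assms(1-4) by (auto simp: Lob_def linear_operators_def order_bounded_def)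
qed

lemma Lob_bounded:
  assumes T: "T \<in> carrier (Lob E)" and ab: "a \<in> carrier E" "b \<in> carrier E"
  obtains c d where "c \<in> carrier E" "d \<in> carrier E" "\<And>x. a \<preceq> x \<Longrightarrow> x \<preceq> b \<Longrightarrow> c \<preceq> T x \<and> T x \<preceq> d"
proof -
  obtain c d where cd: "c \<in> carrier E" "d \<in> carrier E" "T ` \<lbrace>a..b\<rbrace> \<subseteq> \<lbrace>c..d\<rbrace>"
    using LobD(5)[OF T, unfolded order_bounded_def, rule_format, OF ab] by (elim bexE)
  have "c \<preceq> T x \<and> T x \<preceq> d" if x: "a \<preceq> x" "x \<preceq> b" for x
  proof -
    have xc: "x \<in> carrier E" using leq_closed[OF x(1)] ab by simp
    then have "x \<in> \<lbrace>a..b\<rbrace>" using x ab by (simp add: at_least_at_most_def leq_iff)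
    then have "T x \<in> \<lbrace>c..d\<rbrace>" by (intro subsetD[OF cd(3)] imageI)
    then show ?thesis using cd(1,2) LobD(1)[OF T xc] by (simp add: at_least_at_most_def leq_iff)
  qed
  then show thesis by (rule that[OF cd(1,2)])
qed

lemma Lob_zero [simp]: "T \<in> carrier (Lob E) \<Longrightarrow> T 0 = 0"
  using LobD(3)[of T E 0 0] by simp

lemma Lob_minus: "T \<in> carrier (Lob E) \<Longrightarrow> x \<in> carrier E \<Longrightarrow> T (- x) = - T x"
  using LobD(3)[of T E x "-1"] by simp

lemma Lob_diff: "T \<in> carrier (Lob E) \<Longrightarrow> x \<in> carrier E \<Longrightarrow> y \<in> carrier E \<Longrightarrow> T (x - y) = T x - T y"
  using LobD(2)[of T E x "- y"] Lob_minus[of T y] by simp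

lemma positive_operator_Lob:
  assumes "T \<in> linear_operators E" "\<And>x. 0 \<preceq> x \<Longrightarrow> 0 \<preceq> T x"
  shows "T \<in> carrier (Lob E)"
proof (rule LobI)
  have T: "x \<in> carrier E \<Longrightarrow> T x \<in> carrier E" "x \<in> carrier E \<Longrightarrow> y \<in> carrier E \<Longrightarrow> T (x + y) = T x + T y"
    "x \<in> carrier E \<Longrightarrow> T (a *\<^sub>R x) = a *\<^sub>R T x" "x \<notin> carrier E \<Longrightarrow> T x = 0" for x y a
    using assms(1) by (auto simp: linear_operators_def)
  then show "x \<in> carrier E \<Longrightarrow> T x \<in> carrier E" "x \<in> carrier E \<Longrightarrow> y \<in> carrier E \<Longrightarrow> T (x + y) = T x + T y"
    "x \<in> carrier E \<Longrightarrow> T (a *\<^sub>R x) = a *\<^sub>R T x" "x \<notin> carrier E \<Longrightarrow> T x = 0" for x y a by blast+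
  fix a b assume ab: "a \<in> carrier E" "b \<in> carrier E"
  have mono: "T x \<preceq> T y" if "x \<preceq> y" "x \<in> carrier E" for x y
  proof -
    have "y \<in> carrier E" using leq_closed[OF that(1)] that(2) by simp
    then have "T y = T x + T (y - x)" using T(2)[of x "y - x"] that by simp
    moreover have "0 \<preceq> T (y - x)" using that by (intro assms(2)) simp
    ultimately show ?thesis by simp
  qed
  have "\<forall>x. a \<preceq> x \<longrightarrow> x \<preceq> b \<longrightarrow> T a \<preceq> T x \<and> T x \<preceq> T b"
    using mono ab leq_closed by metis
  then show "\<exists>c d. \<forall>x. a \<preceq> x \<longrightarrow> x \<preceq> b \<longrightarrow> c \<preceq> T x \<and> T x \<preceq> d" by blast
qed

lemma subspace_Lob: "subspace (carrier (Lob E))"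
proof (rule subspaceI)
  show "0 \<in> carrier (Lob E)" by (rule LobI) auto
next
  fix S T assume S: "S \<in> carrier (Lob E)" and T: "T \<in> carrier (Lob E)"
  show "S + T \<in> carrier (Lob E)"
  proof (rule LobI)
    fix a b assume ab: "a \<in> carrier E" "b \<in> carrier E"
    obtain c d where 1: "\<And>x. a \<preceq> x \<Longrightarrow> x \<preceq> b \<Longrightarrow> c \<preceq> S x \<and> S x \<preceq> d"
      using Lob_bounded[OF S ab] by metis
    obtain c' d' where 2: "\<And>x. a \<preceq> x \<Longrightarrow> x \<preceq> b \<Longrightarrow> c' \<preceq> T x \<and> T x \<preceq> d'"
      using Lob_bounded[OF T ab] by metis
    have "c + c' \<preceq> (S + T) x \<and> (S + T) x \<preceq> d + d'" if "a \<preceq> x" "x \<preceq> b" for x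
      using 1[OF that] 2[OF that] by (auto intro: ord.add_mono)
    then show "\<exists>c d. \<forall>x. a \<preceq> x \<longrightarrow> x \<preceq> b \<longrightarrow> c \<preceq> (S + T) x \<and> (S + T) x \<preceq> d" by blast
  qed (auto simp: LobD[OF S] LobD[OF T] scaleR_add_right)
next
  fix a :: real and T assume T: "T \<in> carrier (Lob E)"
  show "a *\<^sub>R T \<in> carrier (Lob E)"
  proof (rule LobI)
    fix l u assume lu: "l \<in> carrier E" "u \<in> carrier E"
    obtain c d where cd: "\<And>x. l \<preceq> x \<Longrightarrow> x \<preceq> u \<Longrightarrow> c \<preceq> T x \<and> T x \<preceq> d"
      using Lob_bounded[OF T lu] by metis
    show "\<exists>c d. \<forall>x. l \<preceq> x \<longrightarrow> x \<preceq> u \<longrightarrow> c \<preceq> (a *\<^sub>R T) x \<and> (a *\<^sub>R T) x \<preceq> d"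
    proof (cases "0 \<le> a")
      case True
      then have "a *\<^sub>R c \<preceq> (a *\<^sub>R T) x \<and> (a *\<^sub>R T) x \<preceq> a *\<^sub>R d" if "l \<preceq> x" "x \<preceq> u" for x
        using cd[OF that] by (auto simp: scaleR_fun_def intro: scaleR_mono)
      then show ?thesis by blast
    next
      case False
      then have "a *\<^sub>R d \<preceq> (a *\<^sub>R T) x \<and> (a *\<^sub>R T) x \<preceq> a *\<^sub>R c" if "l \<preceq> x" "x \<preceq> u" for x
        using cd[OF that] scaleR_mono[of c "T x" "- a"] scaleR_mono[of "T x" d "- a"]
        by (auto simp: scaleR_fun_def)
      then show ?thesis by blast
    qed
  qed (auto simp: LobD[OF T] scaleR_fun_def scaleR_add_right)
qed

lemma Lob_comp:
  assumes S: "S \<in> carrier (Lob E)" and T: "T \<in> carrier (Lob E)"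
  shows "T \<circ> S \<in> carrier (Lob E)"
proof (rule LobI)
  fix a b assume ab: "a \<in> carrier E" "b \<in> carrier E"
  obtain c d where 1: "c \<in> carrier E" "d \<in> carrier E" "\<And>x. a \<preceq> x \<Longrightarrow> x \<preceq> b \<Longrightarrow> c \<preceq> S x \<and> S x \<preceq> d"
    using Lob_bounded[OF S ab] by metis
  obtain c' d' where 2: "\<And>x. c \<preceq> x \<Longrightarrow> x \<preceq> d \<Longrightarrow> c' \<preceq> T x \<and> T x \<preceq> d'"
    using Lob_bounded[OF T 1(1,2)] by metis
  have "c' \<preceq> (T \<circ> S) x \<and> (T \<circ> S) x \<preceq> d'" if "a \<preceq> x" "x \<preceq> b" for x
    using 1(3)[OF that] 2[of "S x"] by simp
  then show "\<exists>c d. \<forall>x. a \<preceq> x \<longrightarrow> x \<preceq> b \<longrightarrow> c \<preceq> (T \<circ> S) x \<and> (T \<circ> S) x \<preceq> d" by blast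
qed (use assms in \<open>auto simp: LobD[OF S] LobD[OF T]\<close>)

text \<open>The extension is \<open>x \<mapsto> p (x\<^sup>+) - p (x\<^sup>-)\<close>; additivity on the cone gives \<open>p u - p v\<close> for every
  representation \<open>x = u - v\<close> with positive \<open>u\<close> and \<open>v\<close>.\<close>

lemma cone_extension:
  assumes c: "\<And>x. 0 \<preceq> x \<Longrightarrow> p x \<in> carrier E"
    and add: "\<And>x y. 0 \<preceq> x \<Longrightarrow> 0 \<preceq> y \<Longrightarrow> p (x + y) = p x + p y"
    and scale: "\<And>a x. 0 \<le> a \<Longrightarrow> 0 \<preceq> x \<Longrightarrow> p (a *\<^sub>R x) = a *\<^sub>R p x"
  obtains R where "R \<in> linear_operators E" "\<And>x. 0 \<preceq> x \<Longrightarrow> R x = p x"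
proof -
  define R where "R x = (if x \<in> carrier E then p (pp x) - p (pp (- x)) else 0)" for x
  have diff: "R (u - v) = p u - p v" if uv: "0 \<preceq> u" "0 \<preceq> v" for u v
  proof -
    have uvc: "u \<in> carrier E" "v \<in> carrier E" using uv leq_carrier by auto
    let ?x = "u - v"
    have x: "?x \<in> carrier E" using uvc by simp
    have "p (pp ?x + v) = p (pp (- ?x) + u)"
      using diff_pp[OF x] by (intro arg_cong[of _ _ p]) (simp add: algebra_simps)
    then have "p (pp ?x) + p v = p (pp (- ?x)) + p u"
      using add[OF pp_nonneg[OF x] uv(2)] add[OF pp_nonneg[of "- ?x"] uv(1)] x uvc by simp
    then show ?thesis using x by (simp add: R_def algebra_simps)
  qed
  have rep: "x = pp x - pp (- x)" "0 \<preceq> pp x" "0 \<preceq> pp (- x)" if "x \<in> carrier E" for x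
    using that diff_pp pp_nonneg by auto
  have p0: "p 0 = 0" using scale[of 0 0] by simp
  have "R x = p x" if "0 \<preceq> x" for x using diff[of x 0] that p0 by simp
  moreover have "R \<in> linear_operators E"
    unfolding linear_operators_def
  proof (intro CollectI conjI ballI allI impI)
    show "R \<in> carrier E \<rightarrow> carrier E" using c rep(2,3) by (auto simp: R_def)
    show "R x = 0" if "x \<notin> carrier E" for x using that by (simp add: R_def)
    fix x assume x: "x \<in> carrier E"
    have Rx: "R x = p (pp x) - p (pp (- x))" using x by (simp add: R_def)
    show "R (x + y) = R x + R y" if y: "y \<in> carrier E" for y
    proof -
      have "x + y = (pp x + pp y) - (pp (- x) + pp (- y))"
        using rep(1)[OF x] rep(1)[OF y] by (metis add_diff_add)
      then have "R (x + y) = p (pp x + pp y) - p (pp (- x) + pp (- y))"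
        using diff[of "pp x + pp y" "pp (- x) + pp (- y)"] rep(2,3)[OF x] rep(2,3)[OF y]
        by (metis ord.add_nonneg_nonneg)
      also have "\<dots> = (p (pp x) + p (pp y)) - (p (pp (- x)) + p (pp (- y)))"
        using add[OF rep(2)[OF x] rep(2)[OF y]] add[OF rep(3)[OF x] rep(3)[OF y]] by simp
      also have "\<dots> = R x + R y" using Rx y by (simp add: R_def)
      finally show ?thesis .
    qed
    show "R (a *\<^sub>R x) = a *\<^sub>R R x" for a
    proof (cases "0 \<le> a")
      case True
      have "a *\<^sub>R x = a *\<^sub>R pp x - a *\<^sub>R pp (- x)" using rep(1)[OF x] by (metis scaleR_diff_right)
      then have "R (a *\<^sub>R x) = p (a *\<^sub>R pp x) - p (a *\<^sub>R pp (- x))"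
        using diff[of "a *\<^sub>R pp x" "a *\<^sub>R pp (- x)"] rep(2,3)[OF x] True by (metis scaleR_nonneg)
      then show ?thesis using scale[OF True] rep(2,3)[OF x] Rx by (simp add: scaleR_diff_right)
    next
      case False
      then have a: "0 \<le> - a" by simp
      have "a *\<^sub>R x = (- a) *\<^sub>R pp (- x) - (- a) *\<^sub>R pp x"
        using rep(1)[OF x] by (metis minus_diff_eq scaleR_diff_right scaleR_minus_left scaleR_minus_right)
      then have "R (a *\<^sub>R x) = p ((- a) *\<^sub>R pp (- x)) - p ((- a) *\<^sub>R pp x)"
        using diff[of "(- a) *\<^sub>R pp (- x)" "(- a) *\<^sub>R pp x"] rep(2,3)[OF x] a by (metis scaleR_nonneg)
      then show ?thesis using scale[OF a] rep(2,3)[OF x] Rx by (simp add: scaleR_diff_right)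
    qed
  qed
  ultimately show thesis by (rule that[rotated])
qed

text \<open>The values \<open>\<Sum>i. T\<^sub>i x\<^sub>i\<close> with \<open>T\<^sub>i \<in> D\<close>, \<open>x\<^sub>i\<close> positive and \<open>\<Sum>i. x\<^sub>i = x\<close>; their supremum is the
  value at \<open>x\<close> of the supremum of \<open>D\<close>.\<close>

inductive split_sum :: "('a \<Rightarrow> 'a) set \<Rightarrow> 'a \<Rightarrow> 'a \<Rightarrow> bool" for D where
  single: "T \<in> D \<Longrightarrow> 0 \<preceq> x \<Longrightarrow> split_sum D x (T x)"
| add: "split_sum D x a \<Longrightarrow> split_sum D y b \<Longrightarrow> split_sum D (x + y) (a + b)"

lemma split_sum_nonneg: "split_sum D x a \<Longrightarrow> 0 \<preceq> x"
  by (induction rule: split_sum.induct) (auto intro: ord.add_nonneg_nonneg)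

lemma split_sum_closed: "split_sum D x a \<Longrightarrow> D \<subseteq> carrier (Lob E) \<Longrightarrow> a \<in> carrier E"
  by (induction rule: split_sum.induct) (auto intro: LobD(1) leq_carrier)

lemma split_sum_scale:
  assumes "split_sum D x a" "0 \<le> c" "D \<subseteq> carrier (Lob E)"
  shows "split_sum D (c *\<^sub>R x) (c *\<^sub>R a)"
  using assms
proof (induction rule: split_sum.induct)
  case (single T x)
  then have "c *\<^sub>R T x = T (c *\<^sub>R x)" using LobD(3)[of T E x c] leq_carrier by auto
  then show ?case using split_sum.single[of T D "c *\<^sub>R x"] single by (simp add: scaleR_nonneg)
next
  case (add x a y b)
  then show ?case using split_sum.add[of D "c *\<^sub>R x" "c *\<^sub>R a" "c *\<^sub>R y" "c *\<^sub>R b"] by (simp add: scaleR_add_right)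
qed

lemma split_sum_split:
  assumes "split_sum D w a" "D \<subseteq> carrier (Lob E)" "0 \<preceq> x" "0 \<preceq> y" "w = x + y"
  shows "\<exists>b c. split_sum D x b \<and> split_sum D y c \<and> a = b + c"
  using assms
proof (induction arbitrary: x y rule: split_sum.induct)
  case (single T w)
  then have "T w = T x + T y" using LobD(2)[of T E x y] leq_carrier by auto
  then show ?case using split_sum.single single by blast
next
  case (add w1 a1 w2 a2)
  obtain p q r s where "0 \<preceq> p" "0 \<preceq> q" "0 \<preceq> r" "0 \<preceq> s"
    "w1 = p + q" "w2 = r + s" and xy: "x = p + r" "y = q + s"
    by (rule Riesz_decomposition[OF split_sum_nonneg[OF add.hyps(1)] split_sum_nonneg[OF add.hyps(2)]
          add.prems(2,3,4)])
  then obtain b1 c1 b2 c2 where "split_sum D p b1" "split_sum D q c1" "a1 = b1 + c1"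
    "split_sum D r b2" "split_sum D s c2" "a2 = b2 + c2"
    using add.IH(1)[OF add.prems(1), of p q] add.IH(2)[OF add.prems(1), of r s] by blast
  then have "split_sum D x (b1 + b2) \<and> split_sum D y (c1 + c2) \<and> a1 + a2 = (b1 + b2) + (c1 + c2)"
    unfolding xy by (auto intro: split_sum.add)
  then show ?case by blast
qed

end

context dedekind_complete_vector_lattice
begin

text \<open>The Riesz--Kantorovich theorem. The sums over a decomposition of \<open>x + y\<close> are sums over
  decompositions of \<open>x\<close> and of \<open>y\<close> by the Riesz decomposition property, so the suprema are additive.\<close>

lemma Riesz_Kantorovich:
  assumes D: "D \<subseteq> carrier (Lob E)" "D \<noteq> {}"
    and bdd: "\<And>x. 0 \<preceq> x \<Longrightarrow> \<exists>c. \<forall>a. split_sum D x a \<longrightarrow> a \<preceq> c"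
  obtains R where "R \<in> carrier (Lob E)" "\<And>x. 0 \<preceq> x \<Longrightarrow> is_sup {a. split_sum D x a} (R x)"
proof -
  obtain T0 where T0: "T0 \<in> D" using D by blast
  have ne: "split_sum D x (T0 x)" if "0 \<preceq> x" for x by (rule split_sum.single[OF T0 that])
  define p where "p x = (SOME s. is_sup {a. split_sum D x a} s)" for x
  have p: "is_sup {a. split_sum D x a} (p x)" if x: "0 \<preceq> x" for x
  proof -
    have "{a. split_sum D x a} \<subseteq> carrier E" using split_sum_closed D by blast
    moreover have "{a. split_sum D x a} \<noteq> {}" using ne[OF x] by blast
    ultimately have "\<exists>s. is_sup {a. split_sum D x a} s" using bdd[OF x] ex_is_sup by blast
    then show ?thesis unfolding p_def by (rule someI_ex)
  qed
  have le_p: "a \<preceq> p x" if "split_sum D x a" for a x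
    using is_supD(1)[OF p[OF split_sum_nonneg[OF that]]] that by blast
  have p_le: "p x \<preceq> u" if "0 \<preceq> x" "\<And>a. split_sum D x a \<Longrightarrow> a \<preceq> u" for u x
    using is_supD(2)[OF p[OF that(1)]] that(2) by blast
  have pc: "p x \<in> carrier E" if "0 \<preceq> x" for x
    using le_p[OF ne[OF that]] split_sum_closed[OF ne[OF that] D(1)] leq_closed by blast
  have add: "p (x + y) = p x + p y" if xy: "0 \<preceq> x" "0 \<preceq> y" for x y
  proof (rule ord.order.antisym)
    show "p (x + y) \<preceq> p x + p y"
    proof (rule p_le)
      fix a assume "split_sum D (x + y) a"
      then obtain b c where "split_sum D x b" "split_sum D y c" "a = b + c"
        using split_sum_split[OF _ D(1) xy] by blast
      then show "a \<preceq> p x + p y" using le_p by (auto intro: ord.add_mono)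
    qed (use xy in \<open>simp add: ord.add_nonneg_nonneg\<close>)
    have "p x \<preceq> p (x + y) - p y"
    proof (rule p_le[OF xy(1)])
      fix a assume a: "split_sum D x a"
      have "p y \<preceq> p (x + y) - a"
      proof (rule p_le[OF xy(2)])
        fix b assume "split_sum D y b"
        then have "a + b \<preceq> p (x + y)" by (intro le_p split_sum.add[OF a])
        then show "b \<preceq> p (x + y) - a" by (simp add: ord.le_diff_eq add.commute)
      qed
      then show "a \<preceq> p (x + y) - p y" by (simp add: ord.le_diff_eq add.commute)
    qed
    then show "p x + p y \<preceq> p (x + y)" by (simp add: ord.le_diff_eq)
  qed
  have scale_le: "a *\<^sub>R p x \<preceq> p (a *\<^sub>R x)" if a: "0 < a" and x: "0 \<preceq> x" for a x
  proof -
    have "p x \<preceq> inverse a *\<^sub>R p (a *\<^sub>R x)"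
    proof (rule p_le[OF x])
      fix b assume "split_sum D x b"
      then have "a *\<^sub>R b \<preceq> p (a *\<^sub>R x)" using split_sum_scale[of D x b a] a D(1) le_p by simp
      from scaleR_mono[OF this, of "inverse a"] show "b \<preceq> inverse a *\<^sub>R p (a *\<^sub>R x)" using a by simp
    qed
    from scaleR_mono[OF this, of a] show ?thesis using a by simp
  qed
  have scale: "p (a *\<^sub>R x) = a *\<^sub>R p x" if a: "0 \<le> a" and x: "0 \<preceq> x" for a x
  proof (cases "a = 0")
    case True
    then show ?thesis using add[of 0 0] by simp
  next
    case False
    then have "inverse a *\<^sub>R p (a *\<^sub>R x) \<preceq> p x"
      using scale_le[of "inverse a" "a *\<^sub>R x"] a x by (simp add: scaleR_nonneg)
    from scaleR_mono[OF this, of a] have "p (a *\<^sub>R x) \<preceq> a *\<^sub>R p x" using a False by simp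
    then show ?thesis using scale_le[of a x] a x False by (simp add: ord.order.antisym)
  qed
  have "\<exists>R. R \<in> linear_operators E \<and> (\<forall>x. 0 \<preceq> x \<longrightarrow> R x = p x)"
    by (rule cone_extension[of p]) (use pc add scale in blast)+
  then obtain R where R: "R \<in> linear_operators E" "\<And>x. 0 \<preceq> x \<Longrightarrow> R x = p x" by blast
  have T0L: "T0 \<in> carrier (Lob E)" using T0 D by blast
  have "R - T0 \<in> carrier (Lob E)"
  proof (rule positive_operator_Lob)
    show "R - T0 \<in> linear_operators E"
      using R(1) LobD(1-4)[OF T0L] diff_closed
      by (auto simp: linear_operators_def scaleR_diff_right Pi_iff)
    show "0 \<preceq> (R - T0) x" if "0 \<preceq> x" for x using R(2)[OF that] le_p[OF ne[OF that]] by simp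
  qed
  then have "(R - T0) + T0 \<in> carrier (Lob E)" using T0L subspace_add[OF subspace_Lob] by blast
  then show thesis using that[of R] R(2) p by simp
qed

lemma split_sum_bounded:
  assumes "split_sum D x a" "\<And>T x. T \<in> D \<Longrightarrow> 0 \<preceq> x \<Longrightarrow> T x \<preceq> U x" "U \<in> carrier (Lob E)"
  shows "a \<preceq> U x"
  using assms
proof (induction rule: split_sum.induct)
  case (add x a y b)
  then have "U (x + y) = U x + U y"
    using LobD(2)[OF assms(3)] split_sum_nonneg leq_carrier by blast
  then show ?case using add by (auto intro: ord.add_mono)
qed auto

lemma split_sum_pair:
  assumes "split_sum {S, T} x a" "S \<in> carrier (Lob E)" "T \<in> carrier (Lob E)"
  shows "\<exists>y. 0 \<preceq> y \<and> y \<preceq> x \<and> a = S y + T (x - y)"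
  using assms(1)
proof (induction rule: split_sum.induct)
  case (single R x)
  then consider "R = S" | "R = T" by blast
  then show ?case
  proof cases
    case 1 then show ?thesis using single assms by (intro exI[of _ x]) simp
  next
    case 2 then show ?thesis using single assms by (intro exI[of _ 0]) simp
  qed
next
  case (add x a x' a')
  then obtain y y' where y: "0 \<preceq> y" "y \<preceq> x" "a = S y + T (x - y)" "0 \<preceq> y'" "y' \<preceq> x'" "a' = S y' + T (x' - y')"
    by blast
  have c: "x \<in> carrier E" "x' \<in> carrier E" "y \<in> carrier E" "y' \<in> carrier E"
    using y add(1,2) split_sum_nonneg leq_carrier by blast+
  have "S (y + y') + T ((x + x') - (y + y')) = a + a'"
    using LobD(2)[OF assms(2) c(3,4)] LobD(2)[OF assms(3), of "x - y" "x' - y'"] c y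
    by (simp add: algebra_simps)
  then show ?case using y by (intro exI[of _ "y + y'"]) (auto intro: ord.add_nonneg_nonneg ord.add_mono)
qed

lemma split_sum_pairI:
  assumes "S \<in> carrier (Lob E)" "T \<in> carrier (Lob E)" "0 \<preceq> y" "y \<preceq> x"
  shows "split_sum {S, T} x (S y + T (x - y))"
  using split_sum.add[OF split_sum.single[of S "{S, T}" y] split_sum.single[of T "{S, T}" "x - y"]] assms
  by simp

lemma Lob_pair_sup:
  assumes S: "S \<in> carrier (Lob E)" and T: "T \<in> carrier (Lob E)"
  obtains R where "R \<in> carrier (Lob E)"
    "\<And>x. 0 \<preceq> x \<Longrightarrow> is_sup {S y + T (x - y) | y. 0 \<preceq> y \<and> y \<preceq> x} (R x)"
proof -
  have eq: "{a. split_sum {S, T} x a} = {S y + T (x - y) | y. 0 \<preceq> y \<and> y \<preceq> x}" for x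
    using split_sum_pair[OF _ S T] split_sum_pairI[OF S T] by blast
  have "\<exists>c. \<forall>a. split_sum {S, T} x a \<longrightarrow> a \<preceq> c" if x: "0 \<preceq> x" for x
  proof -
    have xc: "x \<in> carrier E" using x leq_carrier by blast
    obtain c d where 1: "\<And>y. 0 \<preceq> y \<Longrightarrow> y \<preceq> x \<Longrightarrow> c \<preceq> S y \<and> S y \<preceq> d"
      using Lob_bounded[OF S zero_closed xc] by metis
    obtain c' d' where 2: "\<And>y. 0 \<preceq> y \<Longrightarrow> y \<preceq> x \<Longrightarrow> c' \<preceq> T y \<and> T y \<preceq> d'"
      using Lob_bounded[OF T zero_closed xc] by metis
    have "a \<preceq> d + d'" if a: "split_sum {S, T} x a" for a
    proof -
      obtain y where y: "0 \<preceq> y" "y \<preceq> x" "a = S y + T (x - y)" using split_sum_pair[OF a S T] by blast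
      then show ?thesis using 1[of y] 2[of "x - y"] by (auto intro: ord.add_mono simp: ord.diff_le_eq)
    qed
    then show ?thesis by blast
  qed
  then obtain R where "R \<in> carrier (Lob E)" "\<And>x. 0 \<preceq> x \<Longrightarrow> is_sup {a. split_sum {S, T} x a} (R x)"
    using Riesz_Kantorovich[of "{S, T}"] S T by blast
  then show thesis using that unfolding eq by blast
qed

lemma Lob_le_leq: "S \<in> carrier (Lob E) \<Longrightarrow> T \<in> carrier (Lob E) \<Longrightarrow>
    S \<sqsubseteq>\<^bsub>Lob E\<^esub> T \<longleftrightarrow> (\<forall>x. 0 \<preceq> x \<longrightarrow> S x \<preceq> T x)"
  using leq_carrier by (auto simp: Lob_le_iff leq_iff LobD(1))

lemma Lob_eqI:
  assumes "S \<in> carrier (Lob E)" "T \<in> carrier (Lob E)" "\<And>x. 0 \<preceq> x \<Longrightarrow> S x = T x"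
  shows "S = T"
proof
  fix x show "S x = T x"
  proof (cases "x \<in> carrier E")
    case True
    then have "S x = S (pp x) - S (pp (- x))" "T x = T (pp x) - T (pp (- x))"
      using Lob_diff[OF assms(1), of "pp x" "pp (- x)"] Lob_diff[OF assms(2), of "pp x" "pp (- x)"] diff_pp[of x]
      by auto
    then show ?thesis using assms(3) True pp_nonneg by simp
  qed (use assms LobD(4) in metis)
qed

lemma Lob_partial_order: "partial_order (Lob E)"
proof
  fix S T U assume S: "S \<in> carrier (Lob E)" and T: "T \<in> carrier (Lob E)" and U: "U \<in> carrier (Lob E)"
  show "S \<sqsubseteq>\<^bsub>Lob E\<^esub> S" using S by (simp add: Lob_le_leq)
  show "S \<sqsubseteq>\<^bsub>Lob E\<^esub> U" if "S \<sqsubseteq>\<^bsub>Lob E\<^esub> T" "T \<sqsubseteq>\<^bsub>Lob E\<^esub> U"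
    using that S T U by (auto simp: Lob_le_leq intro: ord.order_trans)
  show "S .=\<^bsub>Lob E\<^esub> T" if "S \<sqsubseteq>\<^bsub>Lob E\<^esub> T" "T \<sqsubseteq>\<^bsub>Lob E\<^esub> S"
  proof -
    have "S = T" using that S T by (intro Lob_eqI) (auto simp: Lob_le_leq intro: ord.order.antisym)
    then show ?thesis by (simp add: Lob_def)
  qed
qed (auto simp: Lob_def)

lemma pair_sup_least:
  assumes S: "S \<in> carrier (Lob E)" and T: "T \<in> carrier (Lob E)" and R: "R \<in> carrier (Lob E)"
    and sup: "\<And>x. 0 \<preceq> x \<Longrightarrow> is_sup {S y + T (x - y) | y. 0 \<preceq> y \<and> y \<preceq> x} (R x)"
  shows "least (Lob E) R (Upper (Lob E) {S, T})"
proof -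
  have "S x \<preceq> R x" "T x \<preceq> R x" if x: "0 \<preceq> x" for x
  proof -
    have "\<exists>y. S x = S y + T (x - y) \<and> 0 \<preceq> y \<and> y \<preceq> x" "\<exists>y. T x = S y + T (x - y) \<and> 0 \<preceq> y \<and> y \<preceq> x"
      using x S T by (auto intro: exI[of _ x] exI[of _ 0])
    then show "S x \<preceq> R x" "T x \<preceq> R x" using is_supD(1)[OF sup[OF x]] by auto
  qed
  then have "R \<in> Upper (Lob E) {S, T}" using S T R by (auto simp: Upper_def Lob_le_leq)
  moreover have "R \<sqsubseteq>\<^bsub>Lob E\<^esub> U" if "U \<in> Upper (Lob E) {S, T}" for U
  proof -
    have U: "U \<in> carrier (Lob E)" and SU: "\<And>x. 0 \<preceq> x \<Longrightarrow> S x \<preceq> U x" and TU: "\<And>x. 0 \<preceq> x \<Longrightarrow> T x \<preceq> U x"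
      using that S T by (auto simp: Upper_def Lob_le_leq)
    have "R x \<preceq> U x" if x: "0 \<preceq> x" for x
    proof (rule is_supD(2)[OF sup[OF x]])
      fix a assume "a \<in> {S y + T (x - y) | y. 0 \<preceq> y \<and> y \<preceq> x}"
      then obtain y where y: "0 \<preceq> y" "y \<preceq> x" "a = S y + T (x - y)" by blast
      have "x \<in> carrier E" "y \<in> carrier E" using x y leq_carrier by auto
      then have "U x = U y + U (x - y)" using LobD(2)[OF U, of y "x - y"] by simp
      then show "a \<preceq> U x" using y SU[of y] TU[of "x - y"] by (auto intro: ord.add_mono)
    qed
    then show ?thesis using R U by (simp add: Lob_le_leq)
  qed
  ultimately show ?thesis unfolding least_def by (auto simp: Upper_def)
qed

lemma Lob_neg_closed: "S \<in> carrier (Lob E) \<Longrightarrow> - S \<in> carrier (Lob E)"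
  by (rule subspace_neg[OF subspace_Lob])

lemma pair_inf_greatest:
  assumes S: "S \<in> carrier (Lob E)" and T: "T \<in> carrier (Lob E)"
    and R: "least (Lob E) R (Upper (Lob E) {- S, - T})"
  shows "greatest (Lob E) (- R) (Lower (Lob E) {S, T})"
proof -
  have Rc: "R \<in> carrier (Lob E)" using R by (simp add: least_def Upper_def)
  have "- R \<in> Lower (Lob E) {S, T}"
    using R S T Rc by (auto simp: least_def Upper_def Lower_def Lob_le_leq Lob_neg_closed ord.minus_le_iff)
  moreover have "U \<sqsubseteq>\<^bsub>Lob E\<^esub> - R" if "U \<in> Lower (Lob E) {S, T}" for U
  proof -
    have U: "U \<in> carrier (Lob E)" "- U \<in> Upper (Lob E) {- S, - T}"
      using that S T by (auto simp: Upper_def Lower_def Lob_le_leq Lob_neg_closed)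
    then have "R \<sqsubseteq>\<^bsub>Lob E\<^esub> - U" using R by (simp add: least_def)
    then show ?thesis using U Rc by (simp add: Lob_le_leq Lob_neg_closed) (metis ord.le_minus_iff)
  qed
  ultimately show ?thesis unfolding greatest_def by (auto simp: Lower_def)
qed

lemma Lob_dedekind_complete: "dedekind_complete_vector_lattice (Lob E)"
proof -
  interpret L: partial_order "Lob E" by (rule Lob_partial_order)
  have sup2: "\<exists>s. least (Lob E) s (Upper (Lob E) {S, T})"
    if S: "S \<in> carrier (Lob E)" and T: "T \<in> carrier (Lob E)" for S T
  proof -
    obtain R where "R \<in> carrier (Lob E)"
      "\<And>x. 0 \<preceq> x \<Longrightarrow> is_sup {S y + T (x - y) | y. 0 \<preceq> y \<and> y \<preceq> x} (R x)"
      by (rule Lob_pair_sup[OF S T]) (rule that; blast)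
    then show ?thesis using pair_sup_least[OF S T] by blast
  qed
  interpret L: lattice "Lob E"
  proof
    show "\<exists>s. least (Lob E) s (Upper (Lob E) {S, T})"
      if "S \<in> carrier (Lob E)" "T \<in> carrier (Lob E)" for S T by (rule sup2[OF that])
    show "\<exists>s. greatest (Lob E) s (Lower (Lob E) {S, T})"
      if S: "S \<in> carrier (Lob E)" and T: "T \<in> carrier (Lob E)" for S T
      using sup2[OF Lob_neg_closed[OF S] Lob_neg_closed[OF T]] pair_inf_greatest[OF S T] by blast
  qed
  show ?thesis
  proof
    show "subspace (carrier (Lob E))" by (rule subspace_Lob)
    note cl = subspace_add[OF subspace_Lob] subspace_scale[OF subspace_Lob]
    show "S + U \<sqsubseteq>\<^bsub>Lob E\<^esub> T + U" if "S \<in> carrier (Lob E)" "T \<in> carrier (Lob E)" "U \<in> carrier (Lob E)"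
      "S \<sqsubseteq>\<^bsub>Lob E\<^esub> T" for S T U using that by (simp add: Lob_le_leq cl)
    show "a *\<^sub>R S \<sqsubseteq>\<^bsub>Lob E\<^esub> a *\<^sub>R T" if "S \<in> carrier (Lob E)" "T \<in> carrier (Lob E)"
      "S \<sqsubseteq>\<^bsub>Lob E\<^esub> T" "0 \<le> a" for S T a
      using that by (simp add: Lob_le_leq cl scaleR_mono)
    show "S = 0" if S: "S \<in> carrier (Lob E)" and T: "T \<in> carrier (Lob E)" and S0: "0 \<sqsubseteq>\<^bsub>Lob E\<^esub> S"
      and le: "\<And>n::nat. real n *\<^sub>R S \<sqsubseteq>\<^bsub>Lob E\<^esub> T" for S T
    proof (rule Lob_eqI[OF S subspace_0[OF subspace_Lob]])
      fix x assume x: "0 \<preceq> x"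
      have "0 \<preceq> S x" using S0 S x by (simp add: Lob_le_leq subspace_0[OF subspace_Lob])
      moreover have "real n *\<^sub>R S x \<preceq> T x" for n
        using le[of n] S T x by (simp add: Lob_le_leq cl)
      ultimately have "S x = 0" by (rule archimedeanD)
      then show "S x = 0 x" by simp
    qed
    fix D assume D: "D \<subseteq> carrier (Lob E)" "D \<noteq> {}" "Upper (Lob E) D \<noteq> {}"
    then obtain U where "U \<in> Upper (Lob E) D" by blast
    then have U: "U \<in> carrier (Lob E)" "\<And>T x. T \<in> D \<Longrightarrow> 0 \<preceq> x \<Longrightarrow> T x \<preceq> U x"
      using D(1) by (auto simp: Upper_def Lob_le_leq subset_iff)
    have "a \<preceq> U x" if "split_sum D x a" for x a
      using that U(2) U(1) by (rule split_sum_bounded)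
    then have "\<exists>c. \<forall>a. split_sum D x a \<longrightarrow> a \<preceq> c" for x by blast
    then obtain R where R: "R \<in> carrier (Lob E)" "\<And>x. 0 \<preceq> x \<Longrightarrow> is_sup {a. split_sum D x a} (R x)"
      using Riesz_Kantorovich[OF D(1,2)] by blast
    have "T x \<preceq> R x" if "T \<in> D" "0 \<preceq> x" for T x
      using is_supD(1)[OF R(2)[OF that(2)]] split_sum.single[OF that] by blast
    then have "R \<in> Upper (Lob E) D" using D R(1) by (auto simp: Upper_def Lob_le_leq subset_iff)
    moreover have "R \<sqsubseteq>\<^bsub>Lob E\<^esub> V" if "V \<in> Upper (Lob E) D" for V
    proof -
      have V: "V \<in> carrier (Lob E)" "\<And>T x. T \<in> D \<Longrightarrow> 0 \<preceq> x \<Longrightarrow> T x \<preceq> V x"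
        using that D(1) by (auto simp: Upper_def Lob_le_leq subset_iff)
      have "a \<preceq> V x" if "split_sum D x a" for x a
        using that V(2) V(1) by (rule split_sum_bounded)
      then have "R x \<preceq> V x" if "0 \<preceq> x" for x
        by (intro is_supD(2)[OF R(2)[OF that]]) blast
      then show ?thesis using V R(1) by (simp add: Lob_le_leq)
    qed
    ultimately show "\<exists>s. least (Lob E) s (Upper (Lob E) D)"
      unfolding least_def by (intro exI[of _ R]) (auto simp: Upper_def)
  qed
qed

end

section \<open>Order convergence of operators\<close>

context dedekind_complete_vector_lattice
begin

lemma Lob_leq_iff:
  assumes "S \<in> carrier (Lob E)" "T \<in> carrier (Lob E)"
  shows "vector_lattice.leq (Lob E) S T \<longleftrightarrow> (\<forall>x. 0 \<preceq> x \<longrightarrow> S x \<preceq> T x)"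
proof -
  interpret L: dedekind_complete_vector_lattice "Lob E" by (rule Lob_dedekind_complete)
  show ?thesis using L.leq_iff[OF assms] Lob_le_leq[OF assms] by simp
qed

lemma Lob_nonnegD:
  assumes "vector_lattice.leq (Lob E) 0 T"
  shows "T \<in> carrier (Lob E)" "0 \<preceq> x \<Longrightarrow> 0 \<preceq> T x"
    "x \<preceq> y \<Longrightarrow> x \<in> carrier E \<Longrightarrow> T x \<preceq> T y"
proof -
  interpret L: dedekind_complete_vector_lattice "Lob E" by (rule Lob_dedekind_complete)
  show T: "T \<in> carrier (Lob E)" using assms by (rule L.leq_carrier)
  show pos: "0 \<preceq> T x" if "0 \<preceq> x" for x using assms that T by (simp add: Lob_leq_iff)
  show "T x \<preceq> T y" if "x \<preceq> y" "x \<in> carrier E"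
  proof -
    have "y \<in> carrier E" using leq_closed[OF that(1)] that(2) by simp
    then show ?thesis using pos[of "y - x"] that Lob_diff[OF T, of y x] by simp
  qed
qed

lemma Lob_join_apply:
  assumes S: "S \<in> carrier (Lob E)" and T: "T \<in> carrier (Lob E)" and x: "0 \<preceq> x"
  shows "is_sup {S y + T (x - y) | y. 0 \<preceq> y \<and> y \<preceq> x} ((S \<squnion>\<^bsub>Lob E\<^esub> T) x)"
proof -
  interpret L: dedekind_complete_vector_lattice "Lob E" by (rule Lob_dedekind_complete)
  obtain R where R: "R \<in> carrier (Lob E)"
    "\<And>x. 0 \<preceq> x \<Longrightarrow> is_sup {S y + T (x - y) | y. 0 \<preceq> y \<and> y \<preceq> x} (R x)"
    by (rule Lob_pair_sup[OF S T]) (rule that; blast)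
  have "least (Lob E) R (Upper (Lob E) {S, T})" by (rule pair_sup_least[OF S T R(1)]) (rule R(2))
  then have "L.is_sup {S, T} R" using S T by (subst (asm) L.least_Upper_iff) auto
  moreover have "L.is_sup {S, T} (S \<squnion>\<^bsub>Lob E\<^esub> T)"
    using S T by (auto simp: L.is_sup_def L.join_leq1 L.join_leq2)
  ultimately have "R = S \<squnion>\<^bsub>Lob E\<^esub> T" by (rule L.is_sup_unique)
  then show ?thesis using R(2)[OF x] by simp
qed

lemma Lob_meet_apply:
  assumes S: "S \<in> carrier (Lob E)" and T: "T \<in> carrier (Lob E)" and x: "0 \<preceq> x"
  shows "is_inf {S y + T (x - y) | y. 0 \<preceq> y \<and> y \<preceq> x} ((S \<sqinter>\<^bsub>Lob E\<^esub> T) x)"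
proof -
  interpret L: dedekind_complete_vector_lattice "Lob E" by (rule Lob_dedekind_complete)
  have "uminus ` {S y + T (x - y) | y. 0 \<preceq> y \<and> y \<preceq> x} = {(- S) y + (- T) (x - y) | y. 0 \<preceq> y \<and> y \<preceq> x}"
    by (simp add: setcompr_eq_image image_image)
  moreover have "- ((S \<sqinter>\<^bsub>Lob E\<^esub> T) x) = ((- S) \<squnion>\<^bsub>Lob E\<^esub> (- T)) x"
    by (simp flip: L.neg_meet[OF S T])
  ultimately show ?thesis
    using Lob_join_apply[OF L.uminus_closed[OF S] L.uminus_closed[OF T] x] by (simp flip: is_sup_neg)
qed

lemma vabs_apply_leq:
  assumes T: "T \<in> carrier (Lob E)" and x: "x \<in> carrier E"
  shows "vabs E (T x) \<preceq> vabs (Lob E) T (vabs E x)"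
proof -
  interpret L: dedekind_complete_vector_lattice "Lob E" by (rule Lob_dedekind_complete)
  let ?M = "vabs (Lob E) T"
  have M: "?M \<in> carrier (Lob E)" using T by simp
  have le: "T z \<preceq> ?M z" "- T z \<preceq> ?M z" if "0 \<preceq> z" for z
    using L.leq_vabs[OF T] L.neg_leq_vabs[OF T] that T M by (auto simp: Lob_leq_iff)
  have Tx: "T x = T (pp x) - T (pp (- x))"
    using Lob_diff[OF T, of "pp x" "pp (- x)"] diff_pp[OF x] x by simp
  have Mx: "?M (vabs E x) = ?M (pp x) + ?M (pp (- x))"
    using LobD(2)[OF M, of "pp x" "pp (- x)"] add_pp[OF x] x by simp
  have "T x \<preceq> ?M (vabs E x)" unfolding Tx Mx
    using ord.add_mono[OF le(1)[OF pp_nonneg[OF x]] le(2)[OF pp_nonneg[of "- x"]]] x by simp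
  moreover have "- T x \<preceq> ?M (vabs E x)" unfolding Tx Mx
    using ord.add_mono[OF le(2)[OF pp_nonneg[OF x]] le(1)[OF pp_nonneg[of "- x"]]] x by simp
  ultimately show ?thesis using LobD(1)[OF T x] by (simp add: vabs_leq_iff)
qed

lemma vabs_comp_leq:
  assumes T: "T \<in> carrier (Lob E)" and S: "S \<in> carrier (Lob E)"
    and P: "vector_lattice.leq (Lob E) (vabs (Lob E) T) P"
  shows "vector_lattice.leq (Lob E) (vabs (Lob E) (T \<circ> S)) (P \<circ> vabs (Lob E) S)"
proof -
  interpret L: dedekind_complete_vector_lattice "Lob E" by (rule Lob_dedekind_complete)
  have c: "vabs (Lob E) T \<in> carrier (Lob E)" "vabs (Lob E) S \<in> carrier (Lob E)" using S T by simp_all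
  have Pc: "P \<in> carrier (Lob E)" using L.leq_closed[OF P] c by simp
  have TS: "T \<circ> S \<in> carrier (Lob E)" and PS: "P \<circ> vabs (Lob E) S \<in> carrier (Lob E)"
    using Lob_comp S T Pc c by auto
  have "vabs E (T (S x)) \<preceq> P (vabs (Lob E) S x)" if x: "0 \<preceq> x" for x
  proof -
    have xc: "x \<in> carrier E" "S x \<in> carrier E" using x leq_carrier LobD(1)[OF S] by auto
    have T0: "L.leq 0 (vabs (Lob E) T)" using T by (rule L.vabs_nonneg)
    have Sx: "vabs E (S x) \<preceq> vabs (Lob E) S x" using vabs_apply_leq[OF S xc(1)] x by (simp add: vabs_of_nonneg)
    have "vabs E (T (S x)) \<preceq> vabs (Lob E) T (vabs E (S x))" by (rule vabs_apply_leq[OF T xc(2)])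
    also have "\<dots> \<preceq> vabs (Lob E) T (vabs (Lob E) S x)"
      using xc by (intro Lob_nonnegD(3)[OF T0 Sx]) auto
    also have "\<dots> \<preceq> P (vabs (Lob E) S x)"
    proof -
      have "0 \<preceq> vabs (Lob E) S x" using Sx vabs_nonneg[OF xc(2)] ord.order_trans by blast
      then show ?thesis using P c Pc by (simp add: Lob_leq_iff)
    qed
    finally (ord.order_trans) show ?thesis .
  qed
  then have "T (S x) \<preceq> P (vabs (Lob E) S x) \<and> - T (S x) \<preceq> P (vabs (Lob E) S x)" if "0 \<preceq> x" for x
    using that LobD(1)[OF T LobD(1)[OF S]] leq_carrier by (simp add: vabs_leq_iff)
  then have "L.leq (T \<circ> S) (P \<circ> vabs (Lob E) S)" "L.leq (- (T \<circ> S)) (P \<circ> vabs (Lob E) S)"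
    using TS PS L.uminus_closed[OF TS] by (simp_all add: Lob_leq_iff)
  then show ?thesis using TS by (simp add: L.vabs_leq_iff)
qed

text \<open>Over a directed set, each Riesz--Kantorovich sum for the operators \<open>- R b\<close> is dominated by the value of a
  single one of them. Hence their supremum, which is zero, is computed pointwise on the positive cone.\<close>

lemma Lob_decreasing_to_zeroD:
  assumes dec: "decreasing_to_zero (Lob E) B s R" and x: "0 \<preceq> x"
  shows "decreasing_to_zero E B s (\<lambda>b. R b x)"
proof -
  interpret L: dedekind_complete_vector_lattice "Lob E" by (rule Lob_dedekind_complete)
  note D = L.decreasing_to_zeroD[OF dec]
  have R0: "0 \<preceq> R b x" if "b \<in> B" "0 \<preceq> x" for b x using Lob_nonnegD(2)[OF D(5)] that by blast
  have mono: "R c x \<preceq> R b x" if "b \<in> B" "c \<in> B" "s b c" "0 \<preceq> x" for b c x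
    using D(3)[OF that(1-3)] D(2) that by (simp add: Lob_leq_iff)
  let ?D = "(\<lambda>b. - R b) ` B"
  have split: "\<exists>b\<in>B. a \<preceq> - R b x" if "split_sum ?D x a" for a x
    using that
  proof (induction rule: split_sum.induct)
    case (add x a x' a')
    then obtain b b' where b: "b \<in> B" "a \<preceq> - R b x" "b' \<in> B" "a' \<preceq> - R b' x'" by blast
    obtain c where c: "c \<in> B" "s b c" "s b' c" using directed_byD(4)[OF D(1) b(1,3)] by blast
    have x: "0 \<preceq> x" "0 \<preceq> x'" using add split_sum_nonneg by blast+
    have "a \<preceq> - R c x" using b mono[OF b(1) c(1,2) x(1)] ord.order_trans[of a "- R b x"] by simp
    moreover have "a' \<preceq> - R c x'" using b mono[OF b(3) c(1,3) x(2)] ord.order_trans[of a' "- R b' x'"] by simp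
    ultimately have "a + a' \<preceq> - R c x + - R c x'" by (rule ord.add_mono)
    also have "- R c x + - R c x' = - R c (x + x')"
      using LobD(2)[OF D(2)[OF c(1)]] x leq_carrier by simp
    finally show ?case using c(1) by blast
  qed auto
  have "\<exists>c. \<forall>a. split_sum ?D x a \<longrightarrow> a \<preceq> c" if "0 \<preceq> x" for x
  proof (intro exI allI impI)
    fix a assume "split_sum ?D x a"
    then obtain b where "b \<in> B" "a \<preceq> - R b x" using split by blast
    then show "a \<preceq> 0" using R0[OF _ that] ord.order_trans[of a "- R b x" 0] by simp
  qed
  moreover have "?D \<subseteq> carrier (Lob E)" using D(2) by auto
  moreover have "?D \<noteq> {}" using directed_byD(1)[OF D(1)] by auto
  ultimately obtain Q where Q: "Q \<in> carrier (Lob E)" "\<And>x. 0 \<preceq> x \<Longrightarrow> is_sup {a. split_sum ?D x a} (Q x)"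
    using Riesz_Kantorovich[of ?D] by blast
  have "- R b x \<preceq> Q x" if "b \<in> B" "0 \<preceq> x" for b x
    using is_supD(1)[OF Q(2)[OF that(2)]] split_sum.single[of "- R b" ?D x] that by auto
  then have "L.leq (- Q) (R b)" if "b \<in> B" for b
    using that D(2) Q(1) by (simp add: Lob_leq_iff ord.minus_le_iff)
  then have "L.leq (- Q) 0" using L.is_infD(2)[OF D(4)] by blast
  then have Q0: "0 \<preceq> Q x" if "0 \<preceq> x" for x using Q(1) that by (simp add: Lob_leq_iff)
  show ?thesis
  proof (rule decreasing_to_zeroI[OF D(1)])
    show "R c x \<preceq> R b x" if "b \<in> B" "c \<in> B" "s b c" for b c using mono that x by blast
    show "is_inf ((\<lambda>b. R b x) ` B) 0" unfolding is_inf_def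
    proof (intro conjI ballI allI impI)
      show "0 \<preceq> d" if "d \<in> (\<lambda>b. R b x) ` B" for d using that R0 x by auto
      fix z assume z: "\<forall>d\<in>(\<lambda>b. R b x) ` B. z \<preceq> d"
      have "Q x \<preceq> - z"
      proof (rule is_supD(2)[OF Q(2)[OF x]])
        fix a assume "a \<in> {a. split_sum ?D x a}"
        then obtain b where b: "b \<in> B" "a \<preceq> - R b x" using split by blast
        moreover have "- R b x \<preceq> - z" using z b by simp
        ultimately show "a \<preceq> - z" using ord.order_trans by blast
      qed
      then have "0 \<preceq> - z" using Q0[OF x] ord.order_trans by blast
      then show "z \<preceq> 0" by simp
    qed
  qed
qed

lemma Lob_decreasing_to_zeroI:
  assumes B: "directed_by B s" and R: "\<And>b. b \<in> B \<Longrightarrow> R b \<in> carrier (Lob E)"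
    and dec: "\<And>x. 0 \<preceq> x \<Longrightarrow> decreasing_to_zero E B s (\<lambda>b. R b x)"
  shows "decreasing_to_zero (Lob E) B s R"
proof -
  interpret L: dedekind_complete_vector_lattice "Lob E" by (rule Lob_dedekind_complete)
  note D = decreasing_to_zeroD[OF dec]
  show ?thesis
  proof (rule L.decreasing_to_zeroI[OF B])
    show "L.leq (R c) (R b)" if "b \<in> B" "c \<in> B" "s b c" for b c
      using that R D(3) by (simp add: Lob_leq_iff)
    show "L.is_inf (R ` B) 0" unfolding L.is_inf_def
    proof (intro conjI ballI allI impI)
      show "L.leq 0 U" if "U \<in> R ` B" for U using that R D(5) by (auto simp: Lob_leq_iff)
      fix U assume U: "\<forall>V\<in>R ` B. L.leq U V"
      obtain b where b: "b \<in> B" using directed_byD(1)[OF B] by blast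
      have "L.leq U (R b)" using U b by blast
      then have Uc: "U \<in> carrier (Lob E)" using L.leq_closed R[OF b] by metis
      have "U x \<preceq> 0" if x: "0 \<preceq> x" for x
      proof (rule is_infD(2)[OF D(4)[OF x]])
        fix d assume "d \<in> (\<lambda>b. R b x) ` B"
        then show "U x \<preceq> d" using U Uc R x by (auto simp: Lob_leq_iff)
      qed
      then show "L.leq U 0" using Uc by (simp add: Lob_leq_iff)
    qed
  qed
qed

lemma Lob_order_conv_pointwise:
  assumes conv: "order_conv (Lob E) A r S L" and S: "\<And>\<alpha>. \<alpha> \<in> A \<Longrightarrow> S \<alpha> \<in> carrier (Lob E)"
    and L: "L \<in> carrier (Lob E)" and x: "x \<in> carrier E"
  shows "order_conv E A r (\<lambda>\<alpha>. S \<alpha> x) (L x)"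
proof -
  interpret L: dedekind_complete_vector_lattice "Lob E" by (rule Lob_dedekind_complete)
  obtain B :: "('a \<Rightarrow> 'a) set" and s R where dec: "decreasing_to_zero (Lob E) B s R"
    and dom: "\<And>b. b \<in> B \<Longrightarrow> \<exists>\<alpha>\<^sub>0\<in>A. \<forall>\<alpha>\<in>A. r \<alpha>\<^sub>0 \<alpha> \<longrightarrow> L.leq (vabs (Lob E) (L - S \<alpha>)) (R b)"
    using L.order_conv_leqE[OF conv S L] by blast
  show ?thesis
  proof (rule order_conv_leqI[OF Lob_decreasing_to_zeroD[OF dec vabs_nonneg[OF x]]])
    fix b assume b: "b \<in> B"
    obtain \<alpha>\<^sub>0 where a0: "\<alpha>\<^sub>0 \<in> A" "\<forall>\<alpha>\<in>A. r \<alpha>\<^sub>0 \<alpha> \<longrightarrow> L.leq (vabs (Lob E) (L - S \<alpha>)) (R b)"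
      using dom[OF b] by blast
    have "vabs E (L x - S \<alpha> x) \<preceq> R b (vabs E x)" if a: "\<alpha> \<in> A" "r \<alpha>\<^sub>0 \<alpha>" for \<alpha>
    proof -
      have d: "L - S \<alpha> \<in> carrier (Lob E)" using S[OF a(1)] L by simp
      have "vabs E ((L - S \<alpha>) x) \<preceq> vabs (Lob E) (L - S \<alpha>) (vabs E x)" by (rule vabs_apply_leq[OF d x])
      also have "\<dots> \<preceq> R b (vabs E x)"
      proof -
        have "L.leq (vabs (Lob E) (L - S \<alpha>)) (R b)" using a0(2) a by blast
        then show ?thesis
          using L.vabs_closed[OF d] L.decreasing_to_zeroD(2)[OF dec b] vabs_nonneg[OF x]
          by (simp add: Lob_leq_iff)
      qed
      finally (ord.order_trans) show ?thesis by simp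
    qed
    then show "\<exists>\<alpha>\<^sub>0\<in>A. \<forall>\<alpha>\<in>A. r \<alpha>\<^sub>0 \<alpha> \<longrightarrow> vabs E (L x - S \<alpha> x) \<preceq> R b (vabs E x)" using a0(1) by blast
  qed
qed

end

section \<open>Orthomorphisms\<close>

text \<open>Band preservation of a positive operator, in terms of disjointness. The locale is used for
  operators on \<open>E\<close> and for their left multiplications on \<open>Lob E\<close>.\<close>

locale positive_orthomorphism = vector_lattice +
  fixes \<pi> :: "'a \<Rightarrow> 'a"
  assumes closed [simp, intro]: "x \<in> carrier E \<Longrightarrow> \<pi> x \<in> carrier E"
    and add: "x \<in> carrier E \<Longrightarrow> y \<in> carrier E \<Longrightarrow> \<pi> (x + y) = \<pi> x + \<pi> y"
    and scale: "x \<in> carrier E \<Longrightarrow> \<pi> (a *\<^sub>R x) = a *\<^sub>R \<pi> x"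
    and nonneg: "0 \<preceq> x \<Longrightarrow> 0 \<preceq> \<pi> x"
    and disjoint: "0 \<preceq> x \<Longrightarrow> 0 \<preceq> y \<Longrightarrow> x \<sqinter> y = 0 \<Longrightarrow> \<pi> x \<sqinter> y = 0"
begin

lemma diff: "x \<in> carrier E \<Longrightarrow> y \<in> carrier E \<Longrightarrow> \<pi> (x - y) = \<pi> x - \<pi> y"
  using add[of "x - y" y] by simp

lemma mono: "x \<preceq> y \<Longrightarrow> x \<in> carrier E \<Longrightarrow> \<pi> x \<preceq> \<pi> y"
  using nonneg[of "y - x"] diff[of y x] leq_closed[of x y] by simp

lemma plus_identity: "positive_orthomorphism E (\<lambda>x. x + \<pi> x)"
proof
  show "(x + \<pi> x) \<sqinter> y = 0" if "0 \<preceq> x" "0 \<preceq> y" "x \<sqinter> y = 0" for x y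
  proof -
    have c: "x \<in> carrier E" "y \<in> carrier E" using that leq_carrier by auto
    have "y \<sqinter> (x + \<pi> x) = 0"
      using that disjoint[OF that] nonneg[OF that(1)] c by (intro disjoint_add) (auto simp: meet_commute)
    then show ?thesis using c by (simp add: meet_commute)
  qed
qed (auto simp: add scale scaleR_add_right intro: ord.add_nonneg_nonneg nonneg)

text \<open>For multiplication by a positive number \<open>m\<close> this is \<open>min (m x) y \<le> (1 + m) min x y\<close>. It transports smallness
  of truncations through \<open>\<pi>\<close> although \<open>\<pi>\<close> need not be bounded by a multiple of the identity.\<close>

lemma meet_leq:
  assumes x: "0 \<preceq> x" and y: "0 \<preceq> y"
  shows "\<pi> x \<sqinter> y \<preceq> x \<sqinter> y + \<pi> (x \<sqinter> y)"
proof -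
  let ?m = "x \<sqinter> y"
  have c: "x \<in> carrier E" "y \<in> carrier E" using x y leq_carrier by auto
  have m: "0 \<preceq> ?m" "?m \<preceq> x" "?m \<preceq> y" using x y c by (auto simp: meet_leq1 meet_leq2)
  have "(x - ?m) \<sqinter> (y - ?m) = 0" using add_meet[of x y "- ?m"] c by simp
  then have d: "\<pi> (x - ?m) \<sqinter> (y - ?m) = 0" using m by (intro disjoint) auto
  have "\<pi> x = \<pi> ?m + \<pi> (x - ?m)" using add[of ?m "x - ?m"] c by simp
  then have 1: "\<pi> x \<preceq> \<pi> (x - ?m) + (?m + \<pi> ?m)" using m by (simp add: algebra_simps)
  have 2: "y \<preceq> (y - ?m) + (?m + \<pi> ?m)" using nonneg[OF m(1)] by simp
  have "\<pi> x \<sqinter> y \<preceq> (\<pi> (x - ?m) + (?m + \<pi> ?m)) \<sqinter> ((y - ?m) + (?m + \<pi> ?m))"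
    by (rule meet_mono[OF 1 2]) (use c in auto)
  also have "\<dots> = ?m + \<pi> ?m" using add_meet[of "\<pi> (x - ?m)" "y - ?m" "?m + \<pi> ?m"] c d by simp
  finally show ?thesis .
qed

text \<open>Where \<open>\<pi> u\<close> exceeds every multiple of \<open>u\<close>, the element \<open>u\<close> vanishes and hence so does \<open>\<pi> u\<close>. This replaces
  a bound of \<open>\<pi>\<close> by a multiple of the identity, up to a small error.\<close>

lemma excess_decreasing:
  assumes u: "0 \<preceq> u"
  shows "decreasing_to_zero E UNIV (\<le>) (\<lambda>n::nat. pp (\<pi> u - real n *\<^sub>R u))"
proof (rule decreasing_to_zeroI[OF directed_by_nat])
  have uc: "u \<in> carrier E" using u leq_carrier by blast
  have pu: "0 \<preceq> \<pi> u" using u nonneg by blast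
  show "pp (\<pi> u - real n *\<^sub>R u) \<preceq> pp (\<pi> u - real m *\<^sub>R u)" if "m \<le> n" for m n :: nat
    using that u uc by (intro pp_mono) (auto intro!: ord.diff_left_mono scaleR_mono_left)
  show "is_inf (range (\<lambda>n::nat. pp (\<pi> u - real n *\<^sub>R u))) 0" unfolding is_inf_def
  proof (intro conjI ballI allI impI)
    show "0 \<preceq> d" if "d \<in> range (\<lambda>n::nat. pp (\<pi> u - real n *\<^sub>R u))" for d
      using that uc by (auto intro: pp_nonneg)
    fix w assume w: "\<forall>d\<in>range (\<lambda>n::nat. pp (\<pi> u - real n *\<^sub>R u)). w \<preceq> d"
    have "w \<preceq> pp (\<pi> u - real 0 *\<^sub>R u)" using w by blast
    then have wc: "w \<in> carrier E" using leq_closed[of w] uc by simp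
    define v where "v = pp w"
    have v0: "0 \<preceq> v" and vc: "v \<in> carrier E" using pp_nonneg wc by (auto simp: v_def)
    have v_le: "v \<preceq> pp (\<pi> u - real n *\<^sub>R u)" for n :: nat
      using w pp_nonneg[of "\<pi> u - real n *\<^sub>R u"] wc uc by (auto simp: v_def)
    have "v \<sqinter> u \<preceq> inverse (real (Suc n)) *\<^sub>R \<pi> u" for n :: nat
    proof -
      let ?N = "real (Suc n)"
      have "pp (\<pi> u - ?N *\<^sub>R u) \<sqinter> pp (?N *\<^sub>R u - \<pi> u) = 0"
        using pp_meet_pp[of "\<pi> u - ?N *\<^sub>R u"] uc by simp
      then have "v \<sqinter> pp (?N *\<^sub>R u - \<pi> u) = 0"
        by (rule disjoint_mono) (use v0 v_le[of "Suc n"] uc in \<open>auto intro: pp_nonneg\<close>)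
      then have d: "v \<sqinter> (inverse ?N *\<^sub>R pp (?N *\<^sub>R u - \<pi> u)) = 0"
        using v0 uc by (intro disjoint_scaleR) (auto intro: pp_nonneg)
      have "inverse ?N *\<^sub>R (?N *\<^sub>R u) \<preceq> inverse ?N *\<^sub>R (pp (?N *\<^sub>R u - \<pi> u) + \<pi> u)"
      proof (rule scaleR_mono)
        have "?N *\<^sub>R u - \<pi> u \<preceq> pp (?N *\<^sub>R u - \<pi> u)" using uc by (intro leq_pp) auto
        then show "?N *\<^sub>R u \<preceq> pp (?N *\<^sub>R u - \<pi> u) + \<pi> u" by (simp only: ord.diff_le_eq)
      qed simp
      then have "u \<preceq> inverse ?N *\<^sub>R pp (?N *\<^sub>R u - \<pi> u) + inverse ?N *\<^sub>R \<pi> u"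
        by (simp add: scaleR_add_right)
      then have "v \<sqinter> u \<preceq> v \<sqinter> (inverse ?N *\<^sub>R pp (?N *\<^sub>R u - \<pi> u) + inverse ?N *\<^sub>R \<pi> u)"
        using vc uc by (intro meet_mono) auto
      also have "\<dots> \<preceq> v \<sqinter> (inverse ?N *\<^sub>R pp (?N *\<^sub>R u - \<pi> u)) + v \<sqinter> (inverse ?N *\<^sub>R \<pi> u)"
        using v0 pu uc by (intro meet_add_leq scaleR_nonneg pp_nonneg) auto
      also have "\<dots> \<preceq> inverse ?N *\<^sub>R \<pi> u" using vc uc d meet_leq2[of v "inverse ?N *\<^sub>R \<pi> u"] by simp
      finally (ord.order_trans) show ?thesis .
    qed
    then have "v \<sqinter> u = 0" using v0 u by (intro archimedean_inverse[of _ "\<pi> u"]) (auto intro: meet_nonneg)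
    then have "\<pi> u \<sqinter> v = 0" using disjoint[OF u v0] vc uc by (simp add: meet_commute)
    moreover have "v \<preceq> \<pi> u" using v_le[of 0] pu by (simp add: pp_of_nonneg)
    ultimately have "v = 0" using uc by (metis closed meet_absorb2)
    then show "w \<preceq> 0" using leq_pp[OF wc] by (simp add: v_def)
  qed
qed

text \<open>Let \<open>y \<preceq> \<pi> a\<close> for all \<open>a \<in> A\<close>, and fix \<open>x \<in> A\<close> and \<open>e > 0\<close>. The part \<open>z\<close> of \<open>y\<close> above \<open>e \<pi> x\<close> is at most
  \<open>\<pi> ((a - e x)\<^sup>+)\<close>, hence disjoint from \<open>(e x - a)\<^sup>+\<close>. The supremum over \<open>a\<close> shows that \<open>z\<close> is disjoint
  from \<open>x\<close>, hence from \<open>\<pi> x \<succeq> z\<close>, and vanishes. The set \<open>A\<close> is not assumed to be directed because the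
  Riesz--Kantorovich sums, to which this is applied, do not form a directed set.\<close>

lemma inf_zero:
  assumes A: "is_inf A 0" "A \<noteq> {}"
  shows "is_inf (\<pi> ` A) 0"
  unfolding is_inf_def
proof (intro conjI ballI allI impI)
  have A0: "0 \<preceq> a" and Ac: "a \<in> carrier E" if "a \<in> A" for a using is_infD(1)[OF A(1) that] leq_carrier by auto
  show "0 \<preceq> d" if "d \<in> \<pi> ` A" for d using that A0 nonneg by auto
  fix w assume w: "\<forall>d\<in>\<pi> ` A. w \<preceq> d"
  obtain x where x: "x \<in> A" using A(2) by blast
  have x0: "0 \<preceq> x" and xc: "x \<in> carrier E" using A0 Ac x by auto
  have "w \<preceq> \<pi> x" using w x by blast
  then have wc: "w \<in> carrier E" using leq_closed[of w] xc by simp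
  define y where "y = pp w"
  have y0: "0 \<preceq> y" and yc: "y \<in> carrier E" using pp_nonneg wc by (auto simp: y_def)
  have y_le: "y \<preceq> \<pi> a" if "a \<in> A" for a using w that nonneg[OF A0[OF that]] wc by (auto simp: y_def)
  have "y \<preceq> inverse (real (Suc n)) *\<^sub>R \<pi> x" for n :: nat
  proof -
    define e where "e = inverse (real (Suc n))"
    have e: "0 < e" by (simp add: e_def)
    define z where "z = pp (y - e *\<^sub>R \<pi> x)"
    have zc: "z \<in> carrier E" and z0: "0 \<preceq> z" using yc xc pp_nonneg by (auto simp: z_def)
    have zy: "z \<preceq> y" using y0 e nonneg[OF x0] yc xc by (simp add: z_def ord.diff_le_eq scaleR_nonneg)
    have z_le: "z \<preceq> \<pi> (pp (a - e *\<^sub>R x))" if a: "a \<in> A" for a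
    proof -
      have ac: "a \<in> carrier E" using Ac a by blast
      have "a - e *\<^sub>R x \<preceq> pp (a - e *\<^sub>R x)" using ac xc by (intro leq_pp) auto
      then have "\<pi> (a - e *\<^sub>R x) \<preceq> \<pi> (pp (a - e *\<^sub>R x))" using ac xc by (intro mono) auto
      then have "\<pi> a - e *\<^sub>R \<pi> x \<preceq> \<pi> (pp (a - e *\<^sub>R x))" using ac xc by (simp add: diff scale)
      then have "y - e *\<^sub>R \<pi> x \<preceq> \<pi> (pp (a - e *\<^sub>R x))"
        using ord.diff_right_mono[OF y_le[OF a]] ord.order_trans by blast
      moreover have "0 \<preceq> \<pi> (pp (a - e *\<^sub>R x))" using ac xc by (intro nonneg pp_nonneg) auto
      ultimately show ?thesis using yc xc by (simp add: z_def)
    qed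
    have "e *\<^sub>R x \<sqinter> z \<preceq> 0"
    proof (rule is_sup_disjoint)
      show "is_sup ((\<lambda>a. e *\<^sub>R x - a) ` A) (e *\<^sub>R x)" using is_sup_diff[OF A(1), of "e *\<^sub>R x"] by simp
      show "(\<lambda>a. e *\<^sub>R x - a) ` A \<noteq> {}" using A(2) by blast
      show "(\<lambda>a. e *\<^sub>R x - a) ` A \<subseteq> carrier E" using Ac xc by auto
      fix d assume "d \<in> (\<lambda>a. e *\<^sub>R x - a) ` A"
      then obtain a where a: "a \<in> A" "d = e *\<^sub>R x - a" by blast
      have ac: "a \<in> carrier E" using Ac a by blast
      have "pp (a - e *\<^sub>R x) \<sqinter> pp (e *\<^sub>R x - a) = 0" using pp_meet_pp[of "a - e *\<^sub>R x"] ac xc by simp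
      then have "\<pi> (pp (a - e *\<^sub>R x)) \<sqinter> pp (e *\<^sub>R x - a) = 0" using ac xc by (intro disjoint pp_nonneg) auto
      then have "z \<sqinter> pp (e *\<^sub>R x - a) = 0"
        by (rule disjoint_mono) (use z0 z_le[OF a(1)] ac xc in \<open>auto intro: pp_nonneg\<close>)
      moreover have "d \<sqinter> z \<preceq> pp (e *\<^sub>R x - a) \<sqinter> z"
        unfolding a(2) using ac xc zc by (intro meet_mono leq_pp) auto
      ultimately show "d \<sqinter> z \<preceq> 0" using ac xc zc by (simp add: meet_commute)
    qed (rule zc)
    then have "z \<sqinter> (e *\<^sub>R x) = 0"
      using meet_nonneg[OF z0, of "e *\<^sub>R x"] x0 e xc zc
      by (auto simp: meet_commute scaleR_nonneg intro: ord.order.antisym)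
    then have "z \<sqinter> (inverse e *\<^sub>R (e *\<^sub>R x)) = 0"
      using z0 x0 e by (rule_tac disjoint_scaleR) (auto intro: scaleR_nonneg)
    then have "\<pi> x \<sqinter> z = 0" using e x0 z0 xc zc by (intro disjoint) (simp_all add: meet_commute)
    moreover have "z \<preceq> \<pi> x" using ord.order_trans[OF zy y_le[OF x]] .
    ultimately have "z = 0" using xc by (metis closed meet_absorb2)
    then have "y - e *\<^sub>R \<pi> x \<preceq> 0" using leq_pp[of "y - e *\<^sub>R \<pi> x"] yc xc by (simp add: z_def)
    then show ?thesis by (simp add: e_def)
  qed
  then have "y = 0" using y0 archimedean_inverse by blast
  then show "w \<preceq> 0" using leq_pp[OF wc] by (simp add: y_def)
qed

lemma decreasing_to_zero:
  assumes "decreasing_to_zero E B s y"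
  shows "decreasing_to_zero E B s (\<lambda>b. \<pi> (y b))"
proof -
  note D = decreasing_to_zeroD[OF assms]
  show ?thesis
  proof (rule decreasing_to_zeroI[OF D(1)])
    show "\<pi> (y c) \<preceq> \<pi> (y b)" if "b \<in> B" "c \<in> B" "s b c" for b c using mono D that by blast
    show "is_inf ((\<lambda>b. \<pi> (y b)) ` B) 0"
      using inf_zero[OF D(4)] directed_byD(1)[OF D(1)] by (simp add: image_image)
  qed
qed

text \<open>By \<open>meet_leq\<close>, if \<open>y b\<close> dominates \<open>\<bar>x \<alpha>\<bar> \<sqinter> u\<close>, then \<open>y b + \<pi> (y b)\<close> dominates \<open>\<bar>z \<alpha>\<bar> \<sqinter> u\<close>.\<close>

lemma uo_conv_null:
  assumes conv: "uo_conv E A r x 0" and x: "\<And>\<alpha>. \<alpha> \<in> A \<Longrightarrow> x \<alpha> \<in> carrier E"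
    and z: "\<And>\<alpha>. \<alpha> \<in> A \<Longrightarrow> z \<alpha> \<in> carrier E" "\<And>\<alpha>. \<alpha> \<in> A \<Longrightarrow> vabs E (z \<alpha>) \<preceq> \<pi> (vabs E (x \<alpha>))"
  shows "uo_conv E A r z 0"
proof (rule uo_convI)
  interpret \<sigma>: positive_orthomorphism E "\<lambda>x. x + \<pi> x" by (rule plus_identity)
  fix u assume u: "0 \<preceq> u"
  then have uc: "u \<in> carrier E" by (rule leq_carrier)
  have 0: "order_conv E A r (\<lambda>\<alpha>. vabs E (x \<alpha> - 0) \<sqinter> u) 0" by (rule uo_convD[OF conv u])
  have m0: "0 \<preceq> vabs E v \<sqinter> u" if "v \<in> carrier E" for v using that u uc by (simp add: vabs_nonneg)
  obtain B :: "'a set" and s y where dec: "decreasing_to_zero E B s y"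
    and dom: "\<And>b. b \<in> B \<Longrightarrow> \<exists>\<alpha>\<^sub>0\<in>A. \<forall>\<alpha>\<in>A. r \<alpha>\<^sub>0 \<alpha> \<longrightarrow> vabs E (0 - vabs E (x \<alpha> - 0) \<sqinter> u) \<preceq> y b"
    using order_conv_leqE[OF 0] x uc by auto
  show "order_conv E A r (\<lambda>\<alpha>. vabs E (z \<alpha> - 0) \<sqinter> u) 0"
  proof (rule order_conv_leqI[OF \<sigma>.decreasing_to_zero[OF dec]])
    fix b assume "b \<in> B"
    then obtain \<alpha>\<^sub>0 where a0: "\<alpha>\<^sub>0 \<in> A" "\<forall>\<alpha>\<in>A. r \<alpha>\<^sub>0 \<alpha> \<longrightarrow> vabs E (0 - vabs E (x \<alpha> - 0) \<sqinter> u) \<preceq> y b"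
      using dom by blast
    have "vabs E (0 - vabs E (z \<alpha> - 0) \<sqinter> u) \<preceq> y b + \<pi> (y b)" if a: "\<alpha> \<in> A" "r \<alpha>\<^sub>0 \<alpha>" for \<alpha>
    proof -
      have xc: "x \<alpha> \<in> carrier E" and zc: "z \<alpha> \<in> carrier E" using x z(1) a by auto
      have "vabs E (0 - vabs E (x \<alpha> - 0) \<sqinter> u) \<preceq> y b" using a0(2) a by blast
      then have le: "vabs E (x \<alpha>) \<sqinter> u \<preceq> y b" using m0[OF xc] xc uc by (simp add: vabs_of_nonneg)
      have "vabs E (z \<alpha>) \<sqinter> u \<preceq> \<pi> (vabs E (x \<alpha>)) \<sqinter> u"
        using z(2)[OF a(1)] zc uc by (intro meet_mono) auto
      also have "\<dots> \<preceq> vabs E (x \<alpha>) \<sqinter> u + \<pi> (vabs E (x \<alpha>) \<sqinter> u)"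
        using xc u by (intro meet_leq vabs_nonneg)
      also have "\<dots> \<preceq> y b + \<pi> (y b)" using le xc uc by (intro \<sigma>.mono) auto
      finally (ord.order_trans) show ?thesis using m0[OF zc] zc uc by (simp add: vabs_of_nonneg)
    qed
    then show "\<exists>\<alpha>\<^sub>0\<in>A. \<forall>\<alpha>\<in>A. r \<alpha>\<^sub>0 \<alpha> \<longrightarrow> vabs E (0 - vabs E (z \<alpha> - 0) \<sqinter> u) \<preceq> y b + \<pi> (y b)"
      using a0(1) by blast
  qed
qed

end

locale positive_orthomorphism_uo_Lebesgue =
  dedekind_complete_uo_Lebesgue_lattice E \<tau> + positive_orthomorphism E \<pi> for E (structure) and \<tau> \<pi>
begin

text \<open>The element \<open>\<pi> z\<close> is at most \<open>e \<pi> u\<close>, which is small for small \<open>e\<close>, plus \<open>c = \<pi> ((z - e u)\<^sup>+)\<close>. Since \<open>c\<close> is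
  disjoint from \<open>(e u - z)\<^sup>+\<close>, its truncation \<open>c \<sqinter> e u\<close> is at most \<open>z\<close>, and \<open>c \<sqinter> k u \<preceq> N z\<close> for a large
  constant \<open>N\<close>. The rest of \<open>c\<close> is at most the excess of \<open>\<pi> u\<close> over \<open>k u\<close>, which is small for large \<open>k\<close> by
  \<open>excess_decreasing\<close>.\<close>

lemma continuous_on_interval:
  assumes u: "0 \<preceq> u" and U: "solid_nbhd U"
  obtains W where "solid_nbhd W" "\<And>z. z \<in> W \<Longrightarrow> 0 \<preceq> z \<Longrightarrow> z \<preceq> u \<Longrightarrow> \<pi> z \<in> U"
proof -
  have uc: "u \<in> carrier E" using u leq_carrier by blast
  have pu: "0 \<preceq> \<pi> u" using nonneg u by blast
  obtain V1 where V1: "solid_nbhd V1" "\<And>x y. x \<in> V1 \<Longrightarrow> y \<in> V1 \<Longrightarrow> x + y \<in> U"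
    using solid_nbhd_half[OF U] by blast
  obtain V2 where V2: "solid_nbhd V2" "\<And>x y. x \<in> V2 \<Longrightarrow> y \<in> V2 \<Longrightarrow> x + y \<in> V1"
    using solid_nbhd_half[OF V1(1)] by blast
  obtain k :: nat where k: "pp (\<pi> u - real k *\<^sub>R u) \<in> V2"
    using decreasing_to_zero_in_solid_nbhd[OF excess_decreasing[OF u] V2(1)] by blast
  obtain e where e: "0 < e" "e *\<^sub>R \<pi> u \<in> V1" using solid_nbhd_absorbing[OF V1(1)] uc by blast
  \<comment> \<open>\<open>N\<close> enlarges the interval \<open>[0, e u]\<close> to contain \<open>k u\<close>.\<close>
  define N where "N = max 1 (real k / e)"
  have N: "1 \<le> N" "real k \<le> N * e" using e by (auto simp: N_def max_def field_simps)
  obtain W where W: "solid_nbhd W" "\<And>x. x \<in> W \<Longrightarrow> N *\<^sub>R x \<in> V2" using solid_nbhd_scale[OF V2(1)] by blast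
  have "\<pi> z \<in> U" if z: "z \<in> W" "0 \<preceq> z" "z \<preceq> u" for z
  proof -
    have zc: "z \<in> carrier E" using z leq_carrier by blast
    define c where "c = \<pi> (pp (z - e *\<^sub>R u))"
    have c0: "0 \<preceq> c" and cc: "c \<in> carrier E" unfolding c_def using zc uc by (auto intro!: nonneg pp_nonneg)
    have "z - e *\<^sub>R u \<preceq> u" using z(3) u e ord.order_trans[of z u "u + e *\<^sub>R u"]
      by (simp add: ord.diff_le_eq scaleR_nonneg)
    then have c_le: "c \<preceq> \<pi> u" unfolding c_def using u zc uc by (intro mono) auto
    have "pp (z - e *\<^sub>R u) \<sqinter> pp (e *\<^sub>R u - z) = 0" using pp_meet_pp[of "z - e *\<^sub>R u"] zc uc by simp
    then have d: "c \<sqinter> pp (e *\<^sub>R u - z) = 0" unfolding c_def using zc uc by (intro disjoint pp_nonneg) auto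
    have "e *\<^sub>R u - z \<preceq> pp (e *\<^sub>R u - z)" using zc uc by (intro leq_pp) auto
    then have "e *\<^sub>R u \<preceq> pp (e *\<^sub>R u - z) + z" by (simp only: ord.diff_le_eq)
    then have "c \<sqinter> (e *\<^sub>R u) \<preceq> c \<sqinter> (pp (e *\<^sub>R u - z) + z)" using cc uc by (intro meet_mono) auto
    also have "\<dots> \<preceq> c \<sqinter> pp (e *\<^sub>R u - z) + c \<sqinter> z"
      using c0 z(2) zc uc by (intro meet_add_leq pp_nonneg) auto
    also have "\<dots> \<preceq> z" using d cc zc meet_leq2[of c z] by simp
    finally (ord.order_trans) have ce: "c \<sqinter> (e *\<^sub>R u) \<preceq> z" .
    have "c \<sqinter> (real k *\<^sub>R u) \<preceq> (N *\<^sub>R c) \<sqinter> (N *\<^sub>R (e *\<^sub>R u))"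
      using scaleR_mono_left[OF N(1) c0] scaleR_mono_left[OF N(2) u] cc uc by (intro meet_mono) auto
    also have "\<dots> = N *\<^sub>R (c \<sqinter> (e *\<^sub>R u))" using scaleR_meet[of c "e *\<^sub>R u" N] N cc uc by simp
    also have "\<dots> \<preceq> N *\<^sub>R z" using ce N by (intro scaleR_mono) auto
    finally have ck: "c \<sqinter> (real k *\<^sub>R u) \<preceq> N *\<^sub>R z" .
    have "c - c \<sqinter> (real k *\<^sub>R u) = pp (c - real k *\<^sub>R u)" using pp_diff cc uc by simp
    also have "\<dots> \<preceq> pp (\<pi> u - real k *\<^sub>R u)"
      using c_le cc uc by (intro pp_mono) (auto intro: ord.diff_right_mono)
    finally have "c \<preceq> pp (\<pi> u - real k *\<^sub>R u) + c \<sqinter> (real k *\<^sub>R u)" by (simp add: ord.diff_le_eq)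
    also have "\<dots> \<preceq> pp (\<pi> u - real k *\<^sub>R u) + N *\<^sub>R z" using ck by simp
    finally (ord.order_trans) have "c \<preceq> pp (\<pi> u - real k *\<^sub>R u) + N *\<^sub>R z" .
    moreover have "pp (\<pi> u - real k *\<^sub>R u) + N *\<^sub>R z \<in> V1" using V2(2) k W(2) z by blast
    ultimately have "c \<in> V1" using solidD_nonneg[OF solid_nbhd_solid[OF V1(1)] _ c0] by blast
    then have s: "c + e *\<^sub>R \<pi> u \<in> U" using V1(2) e by blast
    have "z - e *\<^sub>R u \<preceq> pp (z - e *\<^sub>R u)" using zc uc by (intro leq_pp) auto
    then have "\<pi> (z - e *\<^sub>R u) \<preceq> c" unfolding c_def using zc uc by (intro mono) auto
    then have "\<pi> z \<preceq> c + e *\<^sub>R \<pi> u" using zc uc by (simp add: diff scale ord.diff_le_eq)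
    then show ?thesis using solidD_nonneg[OF solid_nbhd_solid[OF U] s nonneg[OF z(2)]] by blast
  qed
  then show thesis using that W(1) by blast
qed

text \<open>By \<open>unbounded_nbhd\<close> only truncations matter, and by \<open>meet_leq\<close> these are controlled by the values of
  \<open>1 + \<pi>\<close> on an order interval.\<close>

lemma limitin_null:
  assumes A: "directed_by A r" and conv: "limitin \<tau> x 0 (tail_filter A r)"
    and x: "x \<in> A \<rightarrow> carrier E" and z: "z \<in> A \<rightarrow> carrier E"
    and dom: "\<And>\<alpha>. \<alpha> \<in> A \<Longrightarrow> vabs E (z \<alpha>) \<preceq> \<pi> (vabs E (x \<alpha>))"
  shows "limitin \<tau> z 0 (tail_filter A r)"
  unfolding limitin_iff_solid_nbhd[OF A z zero_closed]
proof (intro allI impI)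
  interpret \<sigma>: positive_orthomorphism E "\<lambda>x. x + \<pi> x" by (rule plus_identity)
  interpret \<sigma>: positive_orthomorphism_uo_Lebesgue E \<tau> "\<lambda>x. x + \<pi> x" ..
  fix U assume U: "solid_nbhd U"
  obtain u V where u: "0 \<preceq> u" and V: "solid_nbhd V"
    and uV: "\<And>x. x \<in> carrier E \<Longrightarrow> vabs E x \<sqinter> u \<in> V \<Longrightarrow> x \<in> U"
    using unbounded_nbhd[OF U] by blast
  have uc: "u \<in> carrier E" using u leq_carrier by blast
  obtain W where W: "solid_nbhd W" "\<And>v. v \<in> W \<Longrightarrow> 0 \<preceq> v \<Longrightarrow> v \<preceq> u \<Longrightarrow> v + \<pi> v \<in> V"
    using \<sigma>.continuous_on_interval[OF u V] by blast
  obtain \<alpha>\<^sub>0 where a0: "\<alpha>\<^sub>0 \<in> A" "\<forall>\<alpha>\<in>A. r \<alpha>\<^sub>0 \<alpha> \<longrightarrow> x \<alpha> - 0 \<in> W"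
    using conv W(1) unfolding limitin_iff_solid_nbhd[OF A x zero_closed] by blast
  have "z \<alpha> - 0 \<in> U" if a: "\<alpha> \<in> A" "r \<alpha>\<^sub>0 \<alpha>" for \<alpha>
  proof -
    have xc: "x \<alpha> \<in> carrier E" and zc: "z \<alpha> \<in> carrier E" using x z a by auto
    have m0: "0 \<preceq> vabs E v \<sqinter> u" if "v \<in> carrier E" for v using that u uc by (simp add: vabs_nonneg)
    have "x \<alpha> \<in> W" using a0 a by simp
    then have "vabs E (x \<alpha>) \<in> W" using solid_vabs_iff[OF solid_nbhd_solid[OF W(1)] xc] by simp
    then have "vabs E (x \<alpha>) \<sqinter> u \<in> W"
      using solidD_nonneg[OF solid_nbhd_solid[OF W(1)] _ m0[OF xc]] xc uc by (simp add: meet_leq1)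
    then have s: "vabs E (x \<alpha>) \<sqinter> u + \<pi> (vabs E (x \<alpha>) \<sqinter> u) \<in> V"
      using W(2) m0[OF xc] xc uc by (simp add: meet_leq2)
    have "vabs E (z \<alpha>) \<sqinter> u \<preceq> \<pi> (vabs E (x \<alpha>)) \<sqinter> u"
      using dom[OF a(1)] zc uc by (intro meet_mono) auto
    also have "\<dots> \<preceq> vabs E (x \<alpha>) \<sqinter> u + \<pi> (vabs E (x \<alpha>) \<sqinter> u)"
      using xc u by (intro meet_leq vabs_nonneg)
    finally (ord.order_trans) have "vabs E (z \<alpha>) \<sqinter> u \<in> V"
      using solidD_nonneg[OF solid_nbhd_solid[OF V] s m0[OF zc]] by blast
    then show ?thesis using uV zc by simp
  qed
  then show "\<exists>\<alpha>\<^sub>0\<in>A. \<forall>\<alpha>\<in>A. r \<alpha>\<^sub>0 \<alpha> \<longrightarrow> z \<alpha> - 0 \<in> U" using a0(1) by blast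
qed

end

context vector_lattice
begin

lemma polar_band:
  assumes y: "0 \<preceq> y"
  shows "band E {x \<in> carrier E. vabs E x \<sqinter> y = 0}" (is "band E ?B")
  unfolding band_def
proof (intro conjI allI impI)
  have yc: "y \<in> carrier E" using y leq_carrier by blast
  have in_B: "x \<in> ?B" if "x \<in> carrier E" "vabs E x \<sqinter> y \<preceq> 0" for x
    using that y meet_nonneg[OF vabs_nonneg[OF that(1)] y] by (auto intro: ord.order.antisym)
  show "subspace ?B"
  proof (rule subspaceI)
    show "0 \<in> ?B" using y by (simp add: meet_absorb1)
    fix x z assume x: "x \<in> ?B" and z: "z \<in> ?B"
    show "x + z \<in> ?B" using meet_triangle[of x z y] x z y by (intro in_B) auto
  next
    fix c :: real and x assume x: "x \<in> ?B"
    have "y \<sqinter> (\<bar>c\<bar> *\<^sub>R vabs E x) = 0"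
      using x y yc by (intro disjoint_scaleR) (auto simp: meet_commute vabs_nonneg)
    moreover have "vabs E (c *\<^sub>R x) \<sqinter> y \<preceq> (\<bar>c\<bar> *\<^sub>R vabs E x) \<sqinter> y"
      using x yc by (intro meet_mono vabs_scaleR_leq) auto
    ultimately show "c *\<^sub>R x \<in> ?B" using x yc by (intro in_B) (auto simp: meet_commute)
  qed
  show "solid E ?B"
  proof (rule solidI)
    fix x z assume x: "x \<in> carrier E" and z: "z \<in> ?B" and le: "vabs E x \<preceq> vabs E z"
    have "vabs E x \<sqinter> y \<preceq> vabs E z \<sqinter> y" using x le yc by (intro meet_mono) auto
    then show "x \<in> ?B" using x z by (intro in_B) auto
  qed auto
  fix D s assume D: "D \<subseteq> ?B \<and> least E s (Upper E D)"
  show "s \<in> ?B"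
  proof (cases "D = {}")
    case True
    then have s: "s \<in> carrier E" "\<And>x. x \<in> carrier E \<Longrightarrow> s \<sqsubseteq> x" using D by (auto simp: least_def Upper_def)
    have "s \<preceq> 0" "s \<preceq> s + s"
      using s(2)[of 0] s(2)[of "s + s"] leq_iff[of s 0] leq_iff[of s "s + s"] s(1) by blast+
    then have "s = 0" by (auto intro: ord.order.antisym)
    then show ?thesis using y by (simp add: meet_absorb1)
  next
    case False
    have Dc: "D \<subseteq> carrier E" using D by blast
    have sup: "is_sup D s" using D least_Upper_iff[OF Dc False] by blast
    have sc: "s \<in> carrier E" using is_sup_carrier[OF sup False Dc] .
    have d_disj: "vabs E d \<sqinter> y = 0" if "d \<in> D" for d using D that by blast
    have sy: "s \<sqinter> y \<preceq> 0"
    proof (rule is_sup_disjoint[OF sup False Dc yc])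
      fix d assume d: "d \<in> D"
      have "d \<sqinter> y \<preceq> vabs E d \<sqinter> y" using d Dc yc by (intro meet_mono leq_vabs) auto
      then show "d \<sqinter> y \<preceq> 0" using d_disj[OF d] by simp
    qed
    have 1: "pp s \<sqinter> y \<preceq> 0"
    proof (rule is_sup_disjoint[of "{s, 0}"])
      show "is_sup {s, 0} (pp s)" using sc by (simp add: is_sup_def join_leq1 join_leq2)
      show "d \<sqinter> y \<preceq> 0" if "d \<in> {s, 0}" for d using that sy y by (auto simp: meet_absorb1)
    qed (use sc yc in auto)
    obtain d where d: "d \<in> D" using False by blast
    have dc: "d \<in> carrier E" using d Dc by blast
    have "pp (- s) \<preceq> pp (- d)" using is_supD(1)[OF sup d] sc by (intro pp_mono) auto
    also have "\<dots> \<preceq> vabs E d" using pp_leq_vabs[of "- d"] dc by simp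
    finally (ord.order_trans) have "pp (- s) \<sqinter> y \<preceq> vabs E d \<sqinter> y" using sc yc by (intro meet_mono) auto
    then have 2: "pp (- s) \<sqinter> y \<preceq> 0" using d_disj[OF d] by simp
    have "y \<sqinter> (pp s + pp (- s)) \<preceq> y \<sqinter> pp s + y \<sqinter> pp (- s)"
      using y sc by (intro meet_add_leq pp_nonneg) auto
    also have "\<dots> \<preceq> 0 + 0" using 1 2 sc yc by (intro ord.add_mono) (auto simp: meet_commute)
    finally (ord.order_trans) show ?thesis using sc yc by (intro in_B) (auto simp: add_pp meet_commute)
  qed
qed

end

context dedekind_complete_vector_lattice
begin

text \<open>The elements that are disjoint from \<open>y\<close> form a band. It is invariant under \<open>T\<close>, so it contains the
  Riesz--Kantorovich sums whose supremum is \<open>\<bar>T\<bar> x\<close>.\<close>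

lemma Orth_modulus:
  assumes T: "T \<in> Orth E"
  shows "positive_orthomorphism E (vabs (Lob E) T)"
proof -
  interpret L: dedekind_complete_vector_lattice "Lob E" by (rule Lob_dedekind_complete)
  have Tc: "T \<in> carrier (Lob E)" and band: "\<And>B. band E B \<Longrightarrow> T ` B \<subseteq> B" using T by (auto simp: Orth_def)
  have M: "vabs (Lob E) T \<in> carrier (Lob E)" using Tc by simp
  show ?thesis
  proof
    show "0 \<preceq> vabs (Lob E) T x" if "0 \<preceq> x" for x
      using Lob_nonnegD(2)[OF L.vabs_nonneg[OF Tc] that] .
    fix x y assume x: "0 \<preceq> x" and y: "0 \<preceq> y" and xy: "x \<sqinter> y = 0"
    have xc: "x \<in> carrier E" and yc: "y \<in> carrier E" using x y leq_carrier by auto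
    let ?B = "{z \<in> carrier E. vabs E z \<sqinter> y = 0}"
    have sub: "subspace ?B" using polar_band[OF y] unfolding band_def by (rule conjunct1)
    have T_B: "T z \<in> ?B" if "z \<in> ?B" for z
      by (rule subsetD[OF band[OF polar_band[OF y]] imageI[OF that]])
    have in_B: "z \<in> ?B" if "0 \<preceq> z" "z \<preceq> x" for z
      using that disjoint_mono[OF xy, of z y] y leq_carrier by (auto simp: vabs_of_nonneg)
    have "vabs (Lob E) T x \<sqinter> y \<preceq> 0"
    proof (rule is_sup_disjoint)
      show "is_sup {T z + (- T) (x - z) | z. 0 \<preceq> z \<and> z \<preceq> x} (vabs (Lob E) T x)"
        using Lob_join_apply[OF Tc L.uminus_closed[OF Tc] x] by (simp add: vabs_def)
      have *: "d \<in> ?B" if "d \<in> {T z + (- T) (x - z) | z. 0 \<preceq> z \<and> z \<preceq> x}" for d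
      proof -
        from that obtain z where z: "0 \<preceq> z" "z \<preceq> x" "d = T z + (- T) (x - z)" by blast
        have "z \<in> ?B" using z(1,2) by (rule in_B)
        moreover have "x - z \<in> ?B" by (rule in_B) (use z in \<open>simp_all add: ord.diff_le_eq\<close>)
        ultimately have "T z - T (x - z) \<in> ?B"
          by (rule subspace_diff[OF sub T_B T_B])
        then show ?thesis using z(3) by simp
      qed
      then show "{T z + (- T) (x - z) | z. 0 \<preceq> z \<and> z \<preceq> x} \<subseteq> carrier E" by blast
      show "{T z + (- T) (x - z) | z. 0 \<preceq> z \<and> z \<preceq> x} \<noteq> {}" using x by blast
      show "d \<sqinter> y \<preceq> 0" if "d \<in> {T z + (- T) (x - z) | z. 0 \<preceq> z \<and> z \<preceq> x}" for d
      proof -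
        have d: "d \<in> carrier E" "vabs E d \<sqinter> y = 0" using *[OF that] by auto
        then show ?thesis using meet_mono[OF leq_vabs[OF d(1)], of y y] yc by simp
      qed
    qed (rule yc)
    moreover have "0 \<preceq> vabs (Lob E) T x \<sqinter> y"
      using Lob_nonnegD(2)[OF L.vabs_nonneg[OF Tc] x] y by (rule meet_nonneg)
    ultimately show "vabs (Lob E) T x \<sqinter> y = 0" by (rule ord.order.antisym)
  qed (use LobD[OF M] in auto)
qed

text \<open>If \<open>S\<close> and \<open>R\<close> are disjoint, the sums \<open>S y + R (x - y)\<close> have infimum zero, and this remains true after
  applying \<open>1 + \<pi>\<close>. The results dominate \<open>\<pi> (S y) + R (x - y)\<close>, so \<open>\<pi> \<circ> S\<close> and \<open>R\<close> are disjoint.\<close>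

lemma Lob_positive_orthomorphism:
  assumes "positive_orthomorphism E \<pi>" and \<pi>: "\<pi> \<in> carrier (Lob E)"
  shows "positive_orthomorphism (Lob E) (\<lambda>S. \<pi> \<circ> S)"
proof -
  interpret \<pi>: positive_orthomorphism E \<pi> by (rule assms)
  interpret \<sigma>: positive_orthomorphism E "\<lambda>x. x + \<pi> x" by (rule \<pi>.plus_identity)
  interpret L: dedekind_complete_vector_lattice "Lob E" by (rule Lob_dedekind_complete)
  have L0: "L.leq 0 (\<pi> \<circ> S)" if "L.leq 0 S" for S
    using that Lob_comp[OF _ \<pi>] Lob_nonnegD[OF that] by (auto simp: Lob_leq_iff \<pi>.nonneg)
  show ?thesis
  proof
    show "\<pi> \<circ> S \<in> carrier (Lob E)" if "S \<in> carrier (Lob E)" for S using Lob_comp[OF that \<pi>] .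
    show "\<pi> \<circ> (S + T) = (\<pi> \<circ> S) + (\<pi> \<circ> T)" if "S \<in> carrier (Lob E)" "T \<in> carrier (Lob E)" for S T
    proof (rule ext)
      fix x show "(\<pi> \<circ> (S + T)) x = ((\<pi> \<circ> S) + (\<pi> \<circ> T)) x"
        using LobD(1,4)[OF that(1)] LobD(1,4)[OF that(2)] \<pi>.add[of "S x" "T x"] Lob_zero[OF \<pi>]
        by (cases "x \<in> carrier E") auto
    qed
    show "\<pi> \<circ> (a *\<^sub>R S) = a *\<^sub>R (\<pi> \<circ> S)" if "S \<in> carrier (Lob E)" for S a
    proof (rule ext)
      fix x show "(\<pi> \<circ> (a *\<^sub>R S)) x = (a *\<^sub>R (\<pi> \<circ> S)) x"
        using LobD(1,4)[OF that] \<pi>.scale[of "S x" a] Lob_zero[OF \<pi>] by (cases "x \<in> carrier E") auto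
    qed
    show "L.leq 0 (\<pi> \<circ> S)" if "L.leq 0 S" for S by (rule L0[OF that])
    fix S R assume S0: "L.leq 0 S" and R0: "L.leq 0 R" and SR: "S \<sqinter>\<^bsub>Lob E\<^esub> R = 0"
    note S = Lob_nonnegD[OF S0] and R = Lob_nonnegD[OF R0]
    have PS: "\<pi> \<circ> S \<in> carrier (Lob E)" using Lob_comp[OF S(1) \<pi>] .
    have "((\<pi> \<circ> S) \<sqinter>\<^bsub>Lob E\<^esub> R) x \<preceq> 0" if x: "0 \<preceq> x" for x
    proof -
      let ?A = "{S y + R (x - y) | y. 0 \<preceq> y \<and> y \<preceq> x}"
      have xc: "x \<in> carrier E" using x leq_carrier by blast
      have "is_inf ?A 0" using Lob_meet_apply[OF S(1) R(1) x] SR by simp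
      moreover have "?A \<noteq> {}" using x by blast
      ultimately have inf: "is_inf ((\<lambda>x. x + \<pi> x) ` ?A) 0" by (rule \<sigma>.inf_zero)
      show ?thesis
      proof (rule is_infD(2)[OF inf])
        fix d assume "d \<in> (\<lambda>x. x + \<pi> x) ` ?A"
        then obtain y where y: "0 \<preceq> y" "y \<preceq> x" "d = S y + R (x - y) + \<pi> (S y + R (x - y))" by blast
        have yc: "y \<in> carrier E" using y leq_carrier by blast
        have Sy: "0 \<preceq> S y" and Ry: "0 \<preceq> R (x - y)" using S(2) R(2) y by auto
        have "((\<pi> \<circ> S) \<sqinter>\<^bsub>Lob E\<^esub> R) x \<preceq> (\<pi> \<circ> S) y + R (x - y)"
          by (rule is_infD(1)[OF Lob_meet_apply[OF PS R(1) x]]) (use y in blast)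
        also have "\<dots> \<preceq> R (x - y) + \<pi> (S y + R (x - y))"
        proof -
          have "\<pi> (S y) \<preceq> \<pi> (S y + R (x - y))" using Ry leq_carrier[OF Sy] by (intro \<pi>.mono) auto
          then have "R (x - y) + \<pi> (S y) \<preceq> R (x - y) + \<pi> (S y + R (x - y))" by simp
          then show ?thesis by (simp add: add.commute[of "\<pi> (S y)"])
        qed
        also have "\<dots> \<preceq> d" using Sy y(3) by (simp add: add.assoc)
        finally (ord.order_trans) show "((\<pi> \<circ> S) \<sqinter>\<^bsub>Lob E\<^esub> R) x \<preceq> d" .
      qed
    qed
    then have "L.leq ((\<pi> \<circ> S) \<sqinter>\<^bsub>Lob E\<^esub> R) 0" using PS R(1) by (simp add: Lob_leq_iff)
    moreover have "L.leq 0 ((\<pi> \<circ> S) \<sqinter>\<^bsub>Lob E\<^esub> R)" using L0[OF S0] R0 by (rule L.meet_nonneg)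
    ultimately show "(\<pi> \<circ> S) \<sqinter>\<^bsub>Lob E\<^esub> R = 0" by (rule L.ord.order.antisym)
  qed
qed

end

section \<open>The Hausdorff uo-Lebesgue topology on operators\<close>

lemma (in locally_solid_lattice) limitin_null_iff:
  assumes A: "directed_by A r" and f: "f \<in> A \<rightarrow> carrier E" and l: "l \<in> carrier E"
  shows "limitin \<tau> f l (tail_filter A r) \<longleftrightarrow> limitin \<tau> (\<lambda>\<alpha>. f \<alpha> - l) 0 (tail_filter A r)"
proof -
  have "(\<lambda>\<alpha>. f \<alpha> - l) \<in> A \<rightarrow> carrier E" using f l by auto
  then show ?thesis by (simp add: limitin_iff_solid_nbhd[OF A f l] limitin_iff_solid_nbhd[OF A])
qed

lemma (in locally_solid_lattice) limitin_const:
  assumes H: "Hausdorff_space \<tau>" and A: "directed_by A r" and x: "x \<in> carrier E"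
    and lim: "limitin \<tau> (\<lambda>_. x) 0 (tail_filter A r)"
  shows "x = 0"
proof (rule Hausdorff_solid_nbhd[OF H x])
  have "(\<lambda>_. x) \<in> A \<rightarrow> carrier E" using x by auto
  then have *: "\<forall>W. solid_nbhd W \<longrightarrow> (\<exists>\<alpha>\<^sub>0\<in>A. \<forall>\<alpha>\<in>A. r \<alpha>\<^sub>0 \<alpha> \<longrightarrow> x - 0 \<in> W)"
    using lim limitin_iff_solid_nbhd[OF A _ zero_closed] by blast
  fix W assume "solid_nbhd W"
  then show "x \<in> W" using * directed_byD(2)[OF A] by fastforce
qed

text \<open>The conditions under which a family of solid sets is a base of neighbourhoods of zero of a Hausdorff
  uo-Lebesgue topology; as that topology is unique, this is the way to compute with it.\<close>

locale uo_Lebesgue_base = vector_lattice +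
  fixes \<B> :: "'a set set"
  assumes nonempty: "\<B> \<noteq> {}"
    and solid: "W \<in> \<B> \<Longrightarrow> solid E W"
    and zero_in: "W \<in> \<B> \<Longrightarrow> 0 \<in> W"
    and inter: "V \<in> \<B> \<Longrightarrow> W \<in> \<B> \<Longrightarrow> \<exists>X\<in>\<B>. X \<subseteq> V \<inter> W"
    and half: "W \<in> \<B> \<Longrightarrow> \<exists>V\<in>\<B>. \<forall>x\<in>V. \<forall>y\<in>V. x + y \<in> W"
    and absorbing: "W \<in> \<B> \<Longrightarrow> x \<in> carrier E \<Longrightarrow> \<exists>c>0. c *\<^sub>R x \<in> W"
    and separating: "x \<in> carrier E \<Longrightarrow> (\<And>W. W \<in> \<B> \<Longrightarrow> x \<in> W) \<Longrightarrow> x = 0"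
    and uo_null: "\<And>(A :: 'a net_index set) r x W. directed_by A r \<Longrightarrow> x \<in> A \<rightarrow> carrier E \<Longrightarrow>
      uo_conv E A r x 0 \<Longrightarrow> W \<in> \<B> \<Longrightarrow> \<exists>\<alpha>\<^sub>0\<in>A. \<forall>\<alpha>\<in>A. r \<alpha>\<^sub>0 \<alpha> \<longrightarrow> x \<alpha> \<in> W"
begin

definition base_open :: "'a set \<Rightarrow> bool"
  where "base_open U \<longleftrightarrow> U \<subseteq> carrier E \<and> (\<forall>x\<in>U. \<exists>W\<in>\<B>. \<forall>w\<in>W. x + w \<in> U)"

definition base_topology :: "'a topology"
  where "base_topology = topology base_open"

lemma openin_base: "openin base_topology = base_open"
  unfolding base_topology_def
proof (rule topology_inverse', unfold istopology_def, intro conjI allI impI)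
  fix S T assume S: "base_open S" and T: "base_open T"
  show "base_open (S \<inter> T)" unfolding base_open_def
  proof (intro conjI ballI)
    show "S \<inter> T \<subseteq> carrier E" using S by (auto simp: base_open_def)
    fix x assume "x \<in> S \<inter> T"
    then obtain V W where "V \<in> \<B>" "\<forall>w\<in>V. x + w \<in> S" "W \<in> \<B>" "\<forall>w\<in>W. x + w \<in> T"
      using S T unfolding base_open_def by blast
    then show "\<exists>X\<in>\<B>. \<forall>w\<in>X. x + w \<in> S \<inter> T" using inter[of V W] by blast
  qed
next
  fix K assume K: "\<forall>S\<in>K. base_open S"
  show "base_open (\<Union> K)" unfolding base_open_def
  proof (intro conjI ballI)
    show "\<Union> K \<subseteq> carrier E" using K by (auto simp: base_open_def)
    fix x assume "x \<in> \<Union> K"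
    then obtain S where S: "S \<in> K" "x \<in> S" by blast
    then obtain W where "W \<in> \<B>" "\<forall>w\<in>W. x + w \<in> S" using K unfolding base_open_def by blast
    then show "\<exists>W\<in>\<B>. \<forall>w\<in>W. x + w \<in> \<Union> K" using S by blast
  qed
qed

lemma base_subset: "W \<in> \<B> \<Longrightarrow> W \<subseteq> carrier E"
  using solid by (auto simp: solid_def)

lemma topspace_base: "topspace base_topology = carrier E"
proof -
  have "base_open (carrier E)"
    unfolding base_open_def using nonempty base_subset by blast
  then show ?thesis unfolding topspace_def openin_base by (auto simp: base_open_def)
qed

text \<open>The interior of a basic set.\<close>

definition core :: "'a set \<Rightarrow> 'a set"
  where "core W = {x \<in> carrier E. \<exists>V\<in>\<B>. \<forall>v\<in>V. x + v \<in> W}"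

lemma core_open: "base_open (core W)"
  unfolding base_open_def
proof (intro conjI ballI)
  show "core W \<subseteq> carrier E" by (auto simp: core_def)
  fix x assume "x \<in> core W"
  then obtain V where x: "x \<in> carrier E" and V: "V \<in> \<B>" "\<forall>v\<in>V. x + v \<in> W" by (auto simp: core_def)
  obtain X where X: "X \<in> \<B>" "\<forall>v\<in>X. \<forall>w\<in>X. v + w \<in> V" using half[OF V(1)] by blast
  have "x + v \<in> core W" if v: "v \<in> X" for v
  proof -
    have "x + v \<in> carrier E" using x v base_subset[OF X(1)] by blast
    moreover have "\<forall>w\<in>X. (x + v) + w \<in> W" using X(2) V(2) v by (simp add: add.assoc)
    ultimately show ?thesis using X(1) by (auto simp: core_def)
  qed
  then show "\<exists>X\<in>\<B>. \<forall>w\<in>X. x + w \<in> core W" using X(1) by blast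
qed

lemma core_subset: "core W \<subseteq> W"
  using zero_in by (force simp: core_def)

lemma zero_in_core: "W \<in> \<B> \<Longrightarrow> 0 \<in> core W"
  by (auto simp: core_def)

lemma translate_open: "base_open U \<Longrightarrow> a \<in> carrier E \<Longrightarrow> base_open {z \<in> carrier E. z - a \<in> U}"
  unfolding base_open_def
proof (intro conjI ballI)
  assume U: "U \<subseteq> carrier E \<and> (\<forall>x\<in>U. \<exists>W\<in>\<B>. \<forall>w\<in>W. x + w \<in> U)" and a: "a \<in> carrier E"
  fix x assume x: "x \<in> {z \<in> carrier E. z - a \<in> U}"
  then obtain W where W: "W \<in> \<B>" "\<forall>w\<in>W. (x - a) + w \<in> U" using U by blast
  then have "\<forall>w\<in>W. x + w \<in> {z \<in> carrier E. z - a \<in> U}"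
    using x base_subset[OF W(1)] by (auto simp: algebra_simps)
  then show "\<exists>W\<in>\<B>. \<forall>w\<in>W. x + w \<in> {z \<in> carrier E. z - a \<in> U}" using W(1) by blast
qed auto

lemma open_neighbourhood:
  assumes "W \<in> \<B>" "x \<in> carrier E"
  shows "\<exists>U. openin base_topology U \<and> x \<in> U \<and> (\<forall>y\<in>U. y \<in> carrier E \<and> y - x \<in> W)"
proof (intro exI conjI ballI)
  show "openin base_topology {z \<in> carrier E. z - x \<in> core W}"
    unfolding openin_base by (rule translate_open[OF core_open assms(2)])
  show "x \<in> {z \<in> carrier E. z - x \<in> core W}" using assms zero_in_core by simp
qed (use core_subset in auto)

lemma dilate: "W \<in> \<B> \<Longrightarrow> \<exists>V\<in>\<B>. \<forall>v\<in>V. (2 ^ k) *\<^sub>R v \<in> W"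
proof (induction k arbitrary: W)
  case 0
  then show ?case by auto
next
  case (Suc k)
  obtain X where X: "X \<in> \<B>" "\<forall>x\<in>X. \<forall>y\<in>X. x + y \<in> W" using half[OF Suc.prems] by blast
  obtain V where V: "V \<in> \<B>" "\<forall>v\<in>V. (2 ^ k) *\<^sub>R v \<in> X" using Suc.IH[OF X(1)] by blast
  have "(2 ^ Suc k) *\<^sub>R v \<in> W" if "v \<in> V" for v
  proof -
    have "(2 ^ k) *\<^sub>R v + (2 ^ k) *\<^sub>R v \<in> W" using X(2) V(2) that by blast
    then show ?thesis by (simp flip: scaleR_left_distrib)
  qed
  then show ?case using V(1) by blast
qed

lemma base_addition: "continuous_map (prod_topology base_topology base_topology) base_topology (\<lambda>(x, y). x + y)"
  unfolding continuous_map_def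
proof (intro conjI allI impI)
  show "(\<lambda>(x, y). x + y) \<in> topspace (prod_topology base_topology base_topology) \<rightarrow> topspace base_topology"
    by (auto simp: topspace_base)
  fix U assume U: "openin base_topology U"
  let ?P = "{z \<in> topspace (prod_topology base_topology base_topology). (\<lambda>(x, y). x + y) z \<in> U}"
  show "openin (prod_topology base_topology base_topology) ?P"
    unfolding openin_prod_topology_alt
  proof (intro allI impI)
    fix x y assume "(x, y) \<in> ?P"
    then have xy: "x \<in> carrier E" "y \<in> carrier E" "x + y \<in> U" by (auto simp: topspace_base)
    then obtain W where W: "W \<in> \<B>" "\<forall>w\<in>W. x + y + w \<in> U"
      using U unfolding openin_base base_open_def by blast
    obtain V where V: "V \<in> \<B>" "\<forall>v\<in>V. \<forall>w\<in>V. v + w \<in> W" using half[OF W(1)] by blast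
    obtain X where X: "openin base_topology X" "x \<in> X" "\<And>z. z \<in> X \<Longrightarrow> z \<in> carrier E \<and> z - x \<in> V"
      using open_neighbourhood[OF V(1) xy(1)] by blast
    obtain Y where Y: "openin base_topology Y" "y \<in> Y" "\<And>z. z \<in> Y \<Longrightarrow> z \<in> carrier E \<and> z - y \<in> V"
      using open_neighbourhood[OF V(1) xy(2)] by blast
    have "p + q \<in> U" if pq: "p \<in> X" "q \<in> Y" for p q
    proof -
      have "x + y + ((p - x) + (q - y)) \<in> U" using pq X(3) Y(3) V(2) W(2) by blast
      then show ?thesis by (simp add: algebra_simps)
    qed
    then have "(p, q) \<in> ?P" if "p \<in> X" "q \<in> Y" for p q
      using that X(3)[of p] Y(3)[of q] by (simp add: topspace_base)
    then have "X \<times> Y \<subseteq> ?P" by blast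
    then show "\<exists>X Y. openin base_topology X \<and> openin base_topology Y \<and> x \<in> X \<and> y \<in> Y \<and> X \<times> Y \<subseteq> ?P"
      using X(1,2) Y(1,2) by blast
  qed
qed

lemma base_scaling: "continuous_map (prod_topology euclideanreal base_topology) base_topology (\<lambda>(a, x). a *\<^sub>R x)"
  unfolding continuous_map_def
proof (intro conjI allI impI)
  show "(\<lambda>(a, x). a *\<^sub>R x) \<in> topspace (prod_topology euclideanreal base_topology) \<rightarrow> topspace base_topology"
    by (auto simp: topspace_base)
  fix U assume U: "openin base_topology U"
  let ?P = "{z \<in> topspace (prod_topology euclideanreal base_topology). (\<lambda>(a, x). a *\<^sub>R x) z \<in> U}"
  show "openin (prod_topology euclideanreal base_topology) ?P"
    unfolding openin_prod_topology_alt
  proof (intro allI impI)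
    fix a x assume "(a, x) \<in> ?P"
    then have x: "x \<in> carrier E" "a *\<^sub>R x \<in> U" by (auto simp: topspace_base)
    then obtain W where W: "W \<in> \<B>" "\<forall>w\<in>W. a *\<^sub>R x + w \<in> U"
      using U unfolding openin_base base_open_def by blast
    obtain V where V: "V \<in> \<B>" "\<forall>v\<in>V. \<forall>w\<in>V. v + w \<in> W" using half[OF W(1)] by blast
    obtain c where c: "c > 0" "c *\<^sub>R x \<in> V" using absorbing[OF V(1) x(1)] by blast
    obtain k :: nat where k: "\<bar>a\<bar> + c < 2 ^ k" using real_arch_pow[of 2 "\<bar>a\<bar> + c"] by auto
    obtain X where X: "X \<in> \<B>" "\<forall>v\<in>X. (2 ^ k) *\<^sub>R v \<in> V" using dilate[OF V(1)] by blast
    obtain Y where Y: "openin base_topology Y" "x \<in> Y" "\<And>z. z \<in> Y \<Longrightarrow> z \<in> carrier E \<and> z - x \<in> X"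
      using open_neighbourhood[OF X(1) x(1)] by blast
    have shrink: "b *\<^sub>R v \<in> V" if "\<bar>b\<bar> \<le> d" "d *\<^sub>R v \<in> V" "0 \<le> d" "v \<in> carrier E" for b d v
    proof (rule solidD[OF solid[OF V(1)] that(2)])
      have "vabs E (b *\<^sub>R v) \<preceq> \<bar>b\<bar> *\<^sub>R vabs E v" using that by (intro vabs_scaleR_leq)
      also have "\<dots> \<preceq> d *\<^sub>R vabs E v" using that by (intro scaleR_mono_left vabs_nonneg)
      also have "\<dots> \<preceq> vabs E (d *\<^sub>R v)"
      proof (cases "d = 0")
        case False
        then have "vabs E (inverse d *\<^sub>R (d *\<^sub>R v)) \<preceq> inverse d *\<^sub>R vabs E (d *\<^sub>R v)"
          using vabs_scaleR_leq[of "d *\<^sub>R v" "inverse d"] that by simp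
        then have "vabs E v \<preceq> inverse d *\<^sub>R vabs E (d *\<^sub>R v)" using False by simp
        from scaleR_mono[OF this that(3)] show ?thesis using False by simp
      qed simp
      finally (ord.order_trans) show "vabs E (b *\<^sub>R v) \<preceq> vabs E (d *\<^sub>R v)" .
    qed (use that in auto)
    have "b *\<^sub>R y \<in> U" if b: "b \<in> ball a c" and y: "y \<in> Y" for b y
    proof -
      have d: "\<bar>b - a\<bar> \<le> c" "\<bar>b\<bar> \<le> 2 ^ k" using b k by (auto simp: dist_real_def)
      \<comment> \<open>Here \<open>b y = a x + (b - a) x + b (y - x)\<close>.\<close>
      have "(b - a) *\<^sub>R x \<in> V" using shrink[OF d(1)] c x by simp
      moreover have "b *\<^sub>R (y - x) \<in> V" using shrink[OF d(2)] X(2) Y(3)[OF y] x by auto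
      ultimately have "a *\<^sub>R x + ((b - a) *\<^sub>R x + b *\<^sub>R (y - x)) \<in> U" using V(2) W(2) by blast
      then show ?thesis by (simp add: algebra_simps)
    qed
    then have "(b, y) \<in> ?P" if "b \<in> ball a c" "y \<in> Y" for b y
      using that Y(3)[of y] by (simp add: topspace_base)
    then have "ball a c \<times> Y \<subseteq> ?P" by blast
    then show "\<exists>X Y. openin euclideanreal X \<and> openin base_topology Y \<and> a \<in> X \<and> x \<in> Y \<and> X \<times> Y \<subseteq> ?P"
      using Y(1,2) c by (intro exI[of _ "ball a c"] exI[of _ Y]) auto
  qed
qed

lemma uo_Lebesgue_lattice_base: "uo_Lebesgue_lattice E base_topology"
proof
  have "locally_solid E base_topology"
    unfolding locally_solid_def linear_topology_def
  proof (intro conjI allI impI)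
    fix U assume "openin base_topology U \<and> 0 \<in> U"
    then obtain W where W: "W \<in> \<B>" "\<forall>w\<in>W. 0 + w \<in> U" unfolding openin_base base_open_def by blast
    then show "\<exists>V W. openin base_topology V \<and> 0 \<in> V \<and> V \<subseteq> W \<and> W \<subseteq> U \<and> solid E W"
      using core_open core_subset zero_in_core solid unfolding openin_base
      by (intro exI[of _ "core W"] exI[of _ W]) auto
  qed (use topspace_base base_addition base_scaling in auto)
  moreover have "limitin base_topology x 0 (tail_filter A r)"
    if *: "directed_by A r \<and> x \<in> A \<rightarrow> carrier E \<and> uo_conv E A r x 0" for A :: "'a net_index set" and r x
    unfolding limitin_def eventually_tail_filter[OF conjunct1[OF *]]
  proof (intro conjI allI impI)
    fix U assume "openin base_topology U \<and> 0 \<in> U"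
    then obtain W where W: "W \<in> \<B>" "\<forall>w\<in>W. 0 + w \<in> U" unfolding openin_base base_open_def by blast
    then obtain \<alpha>\<^sub>0 where "\<alpha>\<^sub>0 \<in> A" "\<forall>\<alpha>\<in>A. r \<alpha>\<^sub>0 \<alpha> \<longrightarrow> x \<alpha> \<in> W" using uo_null * by meson
    then show "\<exists>\<alpha>\<^sub>0\<in>A. \<forall>\<alpha>\<in>A. r \<alpha>\<^sub>0 \<alpha> \<longrightarrow> x \<alpha> \<in> U" using W(2) by auto
  qed (simp add: topspace_base)
  ultimately show "uo_Lebesgue E base_topology" unfolding uo_Lebesgue_def by blast
  show "Hausdorff_space base_topology"
    unfolding Hausdorff_space_def topspace_base
  proof (intro allI impI)
    fix x y assume xy: "x \<in> carrier E \<and> y \<in> carrier E \<and> x \<noteq> y"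
    then obtain W where W: "W \<in> \<B>" "x - y \<notin> W" using separating[of "x - y"] by auto
    obtain V where V: "V \<in> \<B>" "\<forall>v\<in>V. \<forall>w\<in>V. v + w \<in> W" using half[OF W(1)] by blast
    obtain X where X: "openin base_topology X" "x \<in> X" "\<And>z. z \<in> X \<Longrightarrow> z \<in> carrier E \<and> z - x \<in> V"
      using open_neighbourhood[OF V(1), of x] xy by blast
    obtain Y where Y: "openin base_topology Y" "y \<in> Y" "\<And>z. z \<in> Y \<Longrightarrow> z \<in> carrier E \<and> z - y \<in> V"
      using open_neighbourhood[OF V(1), of y] xy by blast
    have "z \<notin> Y" if z: "z \<in> X" for z
    proof
      assume "z \<in> Y"
      then have "z - x \<in> V" "z - y \<in> V" using X(3) Y(3) z by auto
      moreover from this have "- (z - x) \<in> V"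
        using solidD[OF solid[OF V(1)], of "z - x" "- (z - x)"] X(3) z xy vabs_minus_commute[of x z] by auto
      ultimately have "- (z - x) + (z - y) \<in> W" using V(2) by blast
      then show False using W(2) by simp
    qed
    then show "\<exists>U V. openin base_topology U \<and> openin base_topology V \<and> x \<in> U \<and> y \<in> V \<and> disjnt U V"
      using X(1,2) Y(1,2) by (auto simp: disjnt_iff)
  qed
qed

lemma solid_nbhd_base:
  "locally_solid_lattice.solid_nbhd E base_topology U \<Longrightarrow> \<exists>W\<in>\<B>. W \<subseteq> U"
proof -
  interpret uo_Lebesgue_lattice E base_topology by (rule uo_Lebesgue_lattice_base)
  assume "solid_nbhd U"
  then obtain V where "openin base_topology V" "0 \<in> V" "V \<subseteq> U" by (auto simp: solid_nbhd_def)
  then obtain W where "W \<in> \<B>" "\<forall>w\<in>W. 0 + w \<in> V" unfolding openin_base base_open_def by blast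
  then show ?thesis using \<open>V \<subseteq> U\<close> by auto
qed

lemma limitin_null_baseI:
  assumes A: "directed_by A r" and x: "x \<in> A \<rightarrow> carrier E"
    and ev: "\<And>W. W \<in> \<B> \<Longrightarrow> \<exists>\<alpha>\<^sub>0\<in>A. \<forall>\<alpha>\<in>A. r \<alpha>\<^sub>0 \<alpha> \<longrightarrow> x \<alpha> \<in> W"
  shows "limitin base_topology x 0 (tail_filter A r)"
proof -
  interpret uo_Lebesgue_lattice E base_topology by (rule uo_Lebesgue_lattice_base)
  show ?thesis unfolding limitin_iff_solid_nbhd[OF A x zero_closed]
  proof (intro allI impI)
    fix U assume "solid_nbhd U"
    then obtain W where "W \<in> \<B>" "W \<subseteq> U" using solid_nbhd_base by blast
    then show "\<exists>\<alpha>\<^sub>0\<in>A. \<forall>\<alpha>\<in>A. r \<alpha>\<^sub>0 \<alpha> \<longrightarrow> x \<alpha> - 0 \<in> U" using ev[of W] by fastforce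
  qed
qed

end

context dedekind_complete_uo_Lebesgue_lattice
begin

text \<open>Pointwise smallness on truncations: \<open>S\<close> is small if \<open>\<bar>S\<bar> \<sqinter> R\<close> is small at \<open>x\<close>. The truncation by \<open>R\<close> turns
  unbounded order convergence into order convergence in \<open>Lob E\<close>, which implies pointwise order convergence.\<close>

definition Lob_base :: "('a \<Rightarrow> 'a) set set"
  where "Lob_base = {{S \<in> carrier (Lob E). (vabs (Lob E) S \<sqinter>\<^bsub>Lob E\<^esub> R) x \<in> U} | R x U.
    vector_lattice.leq (Lob E) 0 R \<and> 0 \<preceq> x \<and> solid_nbhd U}"

lemma Lob_uo_Lebesgue_base: "uo_Lebesgue_base (Lob E) Lob_base"
proof -
  interpret L: dedekind_complete_vector_lattice "Lob E" by (rule Lob_dedekind_complete)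
  let ?N = "\<lambda>R x U. {S \<in> carrier (Lob E). (vabs (Lob E) S \<sqinter>\<^bsub>Lob E\<^esub> R) x \<in> U}"
  have in_base: "?N R x U \<in> Lob_base" if "L.leq 0 R" "0 \<preceq> x" "solid_nbhd U" for R x U
    using that unfolding Lob_base_def by blast
  have base: thesis if "W \<in> Lob_base"
    "\<And>R x U. W = ?N R x U \<Longrightarrow> L.leq 0 R \<Longrightarrow> 0 \<preceq> x \<Longrightarrow> solid_nbhd U \<Longrightarrow> thesis" for W thesis
    using that unfolding Lob_base_def by blast
  have tr: "L.leq 0 (vabs (Lob E) S \<sqinter>\<^bsub>Lob E\<^esub> R)" if "L.leq 0 R" "S \<in> carrier (Lob E)" for S R
    using that L.vabs_nonneg by (intro L.meet_nonneg) auto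
  have smaller: "S x \<in> U" if "L.leq 0 S" "L.leq S T" "0 \<preceq> x" "x \<preceq> y" "T y \<in> U" "solid_nbhd U" for S T x y U
  proof (rule solidD_nonneg[OF solid_nbhd_solid[OF that(6)] that(5)])
    have T: "L.leq 0 T" using that(1,2) by (rule L.ord.order_trans)
    show "0 \<preceq> S x" using that by (rule_tac Lob_nonnegD(2))
    have "S x \<preceq> T x" using that Lob_nonnegD(1)[OF T] Lob_nonnegD(1)[OF that(1)] by (simp add: Lob_leq_iff)
    also have "T x \<preceq> T y" using Lob_nonnegD(3)[OF T that(4) leq_carrier[OF that(3)]] .
    finally (ord.order_trans) show "S x \<preceq> T y" .
  qed
  show ?thesis
  proof
    show "Lob_base \<noteq> {}"
      using in_base[of 0 0] ex_solid_nbhd[OF openin_topspace] topspace_eq by auto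
  next
    fix W assume W: "W \<in> Lob_base"
    from W show "solid (Lob E) W"
    proof (rule base)
      fix R x U assume N: "W = ?N R x U" and R: "L.leq 0 R" and x: "0 \<preceq> x" and U: "solid_nbhd U"
      show ?thesis unfolding N
      proof (rule L.solidI)
        fix S T assume S: "S \<in> carrier (Lob E)" and T: "T \<in> ?N R x U"
          and le: "L.leq (vabs (Lob E) S) (vabs (Lob E) T)"
        have "L.leq (vabs (Lob E) S \<sqinter>\<^bsub>Lob E\<^esub> R) (vabs (Lob E) T \<sqinter>\<^bsub>Lob E\<^esub> R)"
          using le S R L.leq_carrier by (intro L.meet_mono) auto
        then show "S \<in> ?N R x U" using smaller[OF tr[OF R S] _ x, of _ x U] T S U by auto
      qed auto
    qed
    from W show "0 \<in> W"
    proof (rule base)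
      fix R x U assume N: "W = ?N R x U" and R: "L.leq 0 R" and x: "0 \<preceq> x" and U: "solid_nbhd U"
      show ?thesis unfolding N using R zero_in_solid_nbhd[OF U] by (simp add: L.meet_absorb1)
    qed
    from W show "\<exists>V\<in>Lob_base. \<forall>S\<in>V. \<forall>T\<in>V. S + T \<in> W"
    proof (rule base)
      fix R x U assume N: "W = ?N R x U" and R: "L.leq 0 R" and x: "0 \<preceq> x" and U: "solid_nbhd U"
      obtain V where V: "solid_nbhd V" "\<And>x y. x \<in> V \<Longrightarrow> y \<in> V \<Longrightarrow> x + y \<in> U"
        using solid_nbhd_half[OF U] by blast
      have "S + T \<in> W" if S: "S \<in> ?N R x V" and T: "T \<in> ?N R x V" for S T
      proof -
        have "L.leq (vabs (Lob E) (S + T) \<sqinter>\<^bsub>Lob E\<^esub> R) (vabs (Lob E) S \<sqinter>\<^bsub>Lob E\<^esub> R + vabs (Lob E) T \<sqinter>\<^bsub>Lob E\<^esub> R)"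
          using S T R by (intro L.meet_triangle) auto
        moreover have "(vabs (Lob E) S \<sqinter>\<^bsub>Lob E\<^esub> R + vabs (Lob E) T \<sqinter>\<^bsub>Lob E\<^esub> R) x \<in> U"
          using V(2) S T by simp
        ultimately show ?thesis unfolding N using S T smaller[OF tr[OF R, of "S + T"] _ x, of _ x U] U by auto
      qed
      then show ?thesis using in_base[OF R x V(1)] by blast
    qed
    show "\<exists>c>0. c *\<^sub>R S \<in> W" if S: "S \<in> carrier (Lob E)" for S
      using W
    proof (rule base)
      fix R x U assume N: "W = ?N R x U" and R: "L.leq 0 R" and x: "0 \<preceq> x" and U: "solid_nbhd U"
      let ?y = "vabs (Lob E) S x"
      have "?y \<in> carrier E" using LobD(1)[OF L.vabs_closed[OF S]] x leq_carrier by blast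
      then obtain c where c: "0 < c" "c *\<^sub>R ?y \<in> U" using solid_nbhd_absorbing[OF U] by blast
      have cS: "c *\<^sub>R S \<in> carrier (Lob E)" using S by simp
      have "L.leq (vabs (Lob E) (c *\<^sub>R S) \<sqinter>\<^bsub>Lob E\<^esub> R) (vabs (Lob E) (c *\<^sub>R S))"
        using cS R L.leq_carrier by (intro L.meet_leq1) auto
      also have "L.leq (vabs (Lob E) (c *\<^sub>R S)) (c *\<^sub>R vabs (Lob E) S)"
        using L.vabs_scaleR_leq[OF S, of c] c by simp
      finally (L.ord.order_trans) have "c *\<^sub>R S \<in> W"
        unfolding N using smaller[OF tr[OF R cS] _ x, of _ x U] c U cS by auto
      then show ?thesis using c by blast
    qed
    show "\<exists>X\<in>Lob_base. X \<subseteq> V \<inter> W" if V: "V \<in> Lob_base" for V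
      using W
    proof (rule base)
      fix R x U assume N: "W = ?N R x U" and R: "L.leq 0 R" and x: "0 \<preceq> x" and U: "solid_nbhd U"
      from V show ?thesis
      proof (rule base)
        fix R' x' U' assume N': "V = ?N R' x' U'" and R': "L.leq 0 R'" and x': "0 \<preceq> x'" and U': "solid_nbhd U'"
        let ?X = "?N (R + R') (x + x') (U \<inter> U')"
        have "S \<in> V \<inter> W" if S: "S \<in> ?X" for S
        proof -
          have Sc: "S \<in> carrier (Lob E)" using S by blast
          have "L.leq (vabs (Lob E) S \<sqinter>\<^bsub>Lob E\<^esub> R) (vabs (Lob E) S \<sqinter>\<^bsub>Lob E\<^esub> (R + R'))"
            "L.leq (vabs (Lob E) S \<sqinter>\<^bsub>Lob E\<^esub> R') (vabs (Lob E) S \<sqinter>\<^bsub>Lob E\<^esub> (R + R'))"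
            using Sc R R' L.leq_carrier by (intro L.meet_mono; simp)+
          moreover have "x \<preceq> x + x'" "x' \<preceq> x + x'" using x x' by simp_all
          ultimately show ?thesis unfolding N N'
            using S smaller[OF tr[OF R Sc] _ x, of _ "x + x'" U] smaller[OF tr[OF R' Sc] _ x', of _ "x + x'" U'] U U'
            by auto
        qed
        moreover have "?X \<in> Lob_base"
          using R R' x x' U U' by (intro in_base solid_nbhd_Int) (auto intro: L.ord.add_nonneg_nonneg ord.add_nonneg_nonneg)
        ultimately show ?thesis by blast
      qed
    qed
    show "\<exists>\<alpha>\<^sub>0\<in>A. \<forall>\<alpha>\<in>A. r \<alpha>\<^sub>0 \<alpha> \<longrightarrow> S \<alpha> \<in> W"
      if A: "directed_by A r" and S: "S \<in> A \<rightarrow> carrier (Lob E)" and uo: "uo_conv (Lob E) A r S 0"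
      for A :: "('a \<Rightarrow> 'a) net_index set" and r S
      using W
    proof (rule base)
      fix R x U assume N: "W = ?N R x U" and R: "L.leq 0 R" and x: "0 \<preceq> x" and U: "solid_nbhd U"
      have Sc: "S \<alpha> \<in> carrier (Lob E)" if "\<alpha> \<in> A" for \<alpha> using S that by auto
      let ?T = "\<lambda>\<alpha>. vabs (Lob E) (S \<alpha>) \<sqinter>\<^bsub>Lob E\<^esub> R"
      have Tc: "?T \<alpha> \<in> carrier (Lob E)" if "\<alpha> \<in> A" for \<alpha> using Sc[OF that] R L.leq_carrier by simp
      have xc: "x \<in> carrier E" using x leq_carrier by blast
      have "order_conv (Lob E) A r ?T 0" using L.uo_convD[OF uo R] by simp
      then have "order_conv E A r (\<lambda>\<alpha>. ?T \<alpha> x) (0 x)"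
        by (rule Lob_order_conv_pointwise) (use Tc xc in auto)
      then have "uo_conv E A r (\<lambda>\<alpha>. ?T \<alpha> x) 0"
        by (intro order_conv_imp_uo_conv) (use LobD(1)[OF Tc] xc in auto)
      then have "limitin \<tau> (\<lambda>\<alpha>. ?T \<alpha> x) 0 (tail_filter A r)"
        using LobD(1)[OF Tc] xc by (intro uo_conv_imp_limitin[OF A]) auto
      then obtain \<alpha>\<^sub>0 where "\<alpha>\<^sub>0 \<in> A" "\<forall>\<alpha>\<in>A. r \<alpha>\<^sub>0 \<alpha> \<longrightarrow> ?T \<alpha> x - 0 \<in> U"
        using U LobD(1)[OF Tc] xc by (subst (asm) limitin_iff_solid_nbhd[OF A]) auto
      then show ?thesis unfolding N using Sc by (intro bexI[of _ \<alpha>\<^sub>0]) auto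
    qed
  next
    fix S assume S: "S \<in> carrier (Lob E)" and all: "\<And>W. W \<in> Lob_base \<Longrightarrow> S \<in> W"
    have M: "vabs (Lob E) S \<in> carrier (Lob E)" and M0: "L.leq 0 (vabs (Lob E) S)"
      using S L.vabs_nonneg by auto
    have "vabs (Lob E) S x = 0" if x: "0 \<preceq> x" for x
    proof (rule Hausdorff_solid_nbhd[OF Hausdorff])
      show "vabs (Lob E) S x \<in> carrier E" using LobD(1)[OF M] x leq_carrier by blast
      show "vabs (Lob E) S x \<in> U" if "solid_nbhd U" for U
        using all[OF in_base[OF M0 x that]] M by (simp add: L.meet_absorb1)
    qed
    then have "vabs (Lob E) S = 0" using M by (intro Lob_eqI) auto
    then show "S = 0" using L.vabs_eq_zero[OF S] by simp
  qed
qed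

lemma tau_hat_Lob: "tau_hat (Lob E) = uo_Lebesgue_base.base_topology (Lob E) Lob_base"
  and Lob_uo_Lebesgue: "dedekind_complete_uo_Lebesgue_lattice (Lob E) (tau_hat (Lob E))"
proof -
  interpret L: dedekind_complete_vector_lattice "Lob E" by (rule Lob_dedekind_complete)
  interpret B: uo_Lebesgue_base "Lob E" Lob_base by (rule Lob_uo_Lebesgue_base)
  show eq: "tau_hat (Lob E) = B.base_topology" by (rule L.tau_hat_eqI[OF B.uo_Lebesgue_lattice_base])
  show "dedekind_complete_uo_Lebesgue_lattice (Lob E) (tau_hat (Lob E))"
    unfolding eq dedekind_complete_uo_Lebesgue_lattice_def
    using B.uo_Lebesgue_lattice_base L.dedekind_complete_vector_lattice_axioms by blast
qed

lemma Lob_limitin_nullI: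
  assumes A: "directed_by A r" and S: "\<And>\<alpha>. \<alpha> \<in> A \<Longrightarrow> vector_lattice.leq (Lob E) 0 (S \<alpha>)"
    and lim: "\<And>x. 0 \<preceq> x \<Longrightarrow> limitin \<tau> (\<lambda>\<alpha>. S \<alpha> x) 0 (tail_filter A r)"
  shows "limitin (tau_hat (Lob E)) S 0 (tail_filter A r)"
proof -
  interpret L: dedekind_complete_vector_lattice "Lob E" by (rule Lob_dedekind_complete)
  interpret B: uo_Lebesgue_base "Lob E" Lob_base by (rule Lob_uo_Lebesgue_base)
  have Sc: "S \<alpha> \<in> carrier (Lob E)" if "\<alpha> \<in> A" for \<alpha> using S[OF that] L.leq_carrier by blast
  show ?thesis unfolding tau_hat_Lob
  proof (rule B.limitin_null_baseI[OF A])
    show "S \<in> A \<rightarrow> carrier (Lob E)" using Sc by blast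
    fix W assume "W \<in> Lob_base"
    then obtain R x U where N: "W = {S \<in> carrier (Lob E). (vabs (Lob E) S \<sqinter>\<^bsub>Lob E\<^esub> R) x \<in> U}"
      and R: "L.leq 0 R" and x: "0 \<preceq> x" and U: "solid_nbhd U"
      unfolding Lob_base_def by blast
    have xc: "x \<in> carrier E" and Rc: "R \<in> carrier (Lob E)" using x R leq_carrier L.leq_carrier by auto
    have c: "(\<lambda>\<alpha>. S \<alpha> x) \<in> A \<rightarrow> carrier E" using LobD(1)[OF Sc xc] by auto
    obtain \<alpha>\<^sub>0 where a0: "\<alpha>\<^sub>0 \<in> A" "\<forall>\<alpha>\<in>A. r \<alpha>\<^sub>0 \<alpha> \<longrightarrow> S \<alpha> x - 0 \<in> U"
      using lim[OF x] U unfolding limitin_iff_solid_nbhd[OF A c zero_closed] by blast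
    have "S \<alpha> \<in> W" if a: "\<alpha> \<in> A" "r \<alpha>\<^sub>0 \<alpha>" for \<alpha>
    proof -
      have "L.leq 0 (S \<alpha> \<sqinter>\<^bsub>Lob E\<^esub> R)" using S[OF a(1)] R by (rule L.meet_nonneg)
      then have 0: "0 \<preceq> (S \<alpha> \<sqinter>\<^bsub>Lob E\<^esub> R) x" using x by (rule Lob_nonnegD(2))
      have "L.leq (S \<alpha> \<sqinter>\<^bsub>Lob E\<^esub> R) (S \<alpha>)" using Sc[OF a(1)] Rc by (rule L.meet_leq1)
      then have "(S \<alpha> \<sqinter>\<^bsub>Lob E\<^esub> R) x \<preceq> S \<alpha> x" using Sc[OF a(1)] Rc x by (simp add: Lob_leq_iff)
      moreover have "S \<alpha> x \<in> U" using a0(2) a by simp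
      ultimately have "(S \<alpha> \<sqinter>\<^bsub>Lob E\<^esub> R) x \<in> U"
        using solidD_nonneg[OF solid_nbhd_solid[OF U] _ 0] by blast
      then show ?thesis unfolding N using Sc[OF a(1)] S[OF a(1)] by (simp add: L.vabs_of_nonneg)
    qed
    then show "\<exists>\<alpha>\<^sub>0\<in>A. \<forall>\<alpha>\<in>A. r \<alpha>\<^sub>0 \<alpha> \<longrightarrow> S \<alpha> \<in> W" using a0(1) by blast
  qed
qed

end

section \<open>Order continuous operators\<close>

context vector_lattice
begin

lemma decreasing_to_zero_add:
  assumes p: "decreasing_to_zero E B s p" and q: "decreasing_to_zero E B s q"
  shows "decreasing_to_zero E B s (\<lambda>b. p b + q b)"
proof -
  note P = decreasing_to_zeroD[OF p] and Q = decreasing_to_zeroD[OF q]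
  show ?thesis
  proof (rule decreasing_to_zeroI[OF P(1)])
    show "p c + q c \<preceq> p b + q b" if "b \<in> B" "c \<in> B" "s b c" for b c
      using P(3)[OF that] Q(3)[OF that] by (rule ord.add_mono)
    show "is_inf ((\<lambda>b. p b + q b) ` B) 0" unfolding is_inf_def
    proof (intro conjI ballI allI impI)
      show "0 \<preceq> d" if "d \<in> (\<lambda>b. p b + q b) ` B" for d
        using that P(5) Q(5) by (auto intro: ord.add_nonneg_nonneg)
      fix z assume z: "\<forall>d\<in>(\<lambda>b. p b + q b) ` B. z \<preceq> d"
      have "z \<preceq> p b + q c" if bc: "b \<in> B" "c \<in> B" for b c
      proof -
        obtain d where d: "d \<in> B" "s b d" "s c d" using directed_byD(4)[OF P(1) bc] by blast
        have "z \<preceq> p d + q d" using z d(1) by blast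
        also have "\<dots> \<preceq> p b + q c" using P(3)[OF bc(1) d(1,2)] Q(3)[OF bc(2) d(1,3)] by (rule ord.add_mono)
        finally (ord.order_trans) show ?thesis .
      qed
      then have *: "z - q c \<preceq> p b" if "b \<in> B" "c \<in> B" for b c using that by (simp add: ord.diff_le_eq)
      have "z \<preceq> q c" if c: "c \<in> B" for c
      proof -
        have "z - q c \<preceq> 0" by (rule is_infD(2)[OF P(4)]) (use * c in auto)
        then show ?thesis by simp
      qed
      then show "z \<preceq> 0" by (intro is_infD(2)[OF Q(4)]) auto
    qed
  qed
qed

lemma inverse_decreasing:
  assumes u: "0 \<preceq> u"
  shows "decreasing_to_zero E UNIV (\<le>) (\<lambda>n::nat. inverse (real (Suc n)) *\<^sub>R u)"
proof (rule decreasing_to_zeroI[OF directed_by_nat])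
  show "inverse (real (Suc n)) *\<^sub>R u \<preceq> inverse (real (Suc m)) *\<^sub>R u" if "m \<le> n" for m n :: nat
    using that u by (intro scaleR_mono_left) (auto intro: le_imp_inverse_le)
  show "is_inf (range (\<lambda>n::nat. inverse (real (Suc n)) *\<^sub>R u)) 0" unfolding is_inf_def
  proof (intro conjI ballI allI impI)
    show nn: "0 \<preceq> d" if "d \<in> range (\<lambda>n::nat. inverse (real (Suc n)) *\<^sub>R u)" for d
    proof -
      from that obtain n :: nat where d: "d = inverse (real (Suc n)) *\<^sub>R u" by blast
      show ?thesis unfolding d using u by (rule scaleR_nonneg) simp
    qed
    fix z assume z: "\<forall>d\<in>range (\<lambda>n::nat. inverse (real (Suc n)) *\<^sub>R u). z \<preceq> d"
    have "z \<preceq> inverse (real (Suc 0)) *\<^sub>R u" using z by blast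
    then have zc: "z \<in> carrier E" using leq_closed u leq_carrier by force
    have "pp z = 0"
    proof (rule archimedean_inverse[of _ u])
      show "0 \<preceq> pp z" by (rule pp_nonneg[OF zc])
      fix n :: nat
      have "z \<preceq> inverse (real (Suc n)) *\<^sub>R u" "0 \<preceq> inverse (real (Suc n)) *\<^sub>R u" using z nn by blast+
      then show "pp z \<preceq> inverse (real (Suc n)) *\<^sub>R u" using join_leq_iff[OF zc zero_closed] by blast
    qed
    then show "z \<preceq> 0" using leq_pp[OF zc] by simp
  qed
qed

text \<open>Order continuous operators are order bounded: the net \<open>y / n\<close>, indexed by all pairs of \<open>n\<close> and
  \<open>y\<close> in an order interval and directed by \<open>n\<close> alone, is order null, so that the images of one of its
  tails are order bounded.\<close>

lemma Loc_subset_Lob: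
  assumes T: "T \<in> Loc E"
  shows "T \<in> carrier (Lob E)"
proof (rule LobI)
  have lin: "T \<in> linear_operators E" using T by (simp add: Loc_def)
  show Tc: "T x \<in> carrier E" if "x \<in> carrier E" for x using lin that by (auto simp: linear_operators_def)
  show "T (x + y) = T x + T y" if "x \<in> carrier E" "y \<in> carrier E" for x y
    using lin that by (simp add: linear_operators_def)
  show hom: "T (a *\<^sub>R x) = a *\<^sub>R T x" if "x \<in> carrier E" for a x
    using lin that by (simp add: linear_operators_def)
  show "T x = 0" if "x \<notin> carrier E" for x using lin that by (simp add: linear_operators_def)
  fix a b assume ab: "a \<in> carrier E" "b \<in> carrier E"
  define u where "u = vabs E a + vabs E b"
  have u0: "0 \<preceq> u" using ab by (simp add: u_def vabs_nonneg ord.add_nonneg_nonneg)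
  have uc: "u \<in> carrier E" using u0 leq_carrier by blast
  have bound: "vabs E x \<preceq> u" and xc: "x \<in> carrier E" if x: "a \<preceq> x" "x \<preceq> b" for x
  proof -
    show xc: "x \<in> carrier E" using leq_closed[OF x(1)] ab by simp
    have "x \<preceq> vabs E b" using ord.order_trans[OF x(2) leq_vabs[OF ab(2)]] .
    also have "\<dots> \<preceq> u" using ab by (simp add: u_def vabs_nonneg)
    finally (ord.order_trans) have 1: "x \<preceq> u" .
    have "- x \<preceq> - a" using x(1) by simp
    also have "\<dots> \<preceq> vabs E a" using ab by (simp add: neg_leq_vabs)
    also have "\<dots> \<preceq> u" using ab by (simp add: u_def vabs_nonneg)
    finally (ord.order_trans) have 2: "- x \<preceq> u" .
    show "vabs E x \<preceq> u" using 1 2 xc by (simp add: vabs_leq_iff)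
  qed
  define A where "A = (UNIV :: nat set) \<times> {x. vabs E x \<preceq> u \<and> x \<in> carrier E}"
  define r where "r p q \<longleftrightarrow> fst p \<le> fst q" for p q :: "nat \<times> 'a"
  define x where "x p = inverse (real (Suc (fst p))) *\<^sub>R snd p" for p :: "nat \<times> 'a"
  have A: "directed_by A r"
  proof -
    have "(0, 0) \<in> A" using u0 by (simp add: A_def)
    moreover have "\<exists>q\<in>A. r p q \<and> r p' q" if "p \<in> A" "p' \<in> A" for p p'
      using that by (intro bexI[of _ "(max (fst p) (fst p'), snd p)"]) (auto simp: A_def r_def)
    ultimately show ?thesis unfolding directed_by_def by (auto simp: r_def)
  qed
  have x: "x \<in> A \<rightarrow> carrier E" by (auto simp: A_def x_def)
  have "order_conv E A r x 0"
  proof (rule order_conv_leqI[OF inverse_decreasing[OF u0]])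
    fix n :: nat
    have "vabs E (0 - x p) \<preceq> inverse (real (Suc n)) *\<^sub>R u" if p: "p \<in> A" "r (n, 0) p" for p
    proof -
      have s: "snd p \<in> carrier E" "vabs E (snd p) \<preceq> u" using p by (auto simp: A_def)
      have "vabs E (0 - x p) = vabs E (x p)" using s by (simp add: x_def)
      also have "vabs E (x p) \<preceq> \<bar>inverse (real (Suc (fst p)))\<bar> *\<^sub>R vabs E (snd p)"
        unfolding x_def by (rule vabs_scaleR_leq[OF s(1)])
      also have "\<dots> \<preceq> inverse (real (Suc n)) *\<^sub>R vabs E (snd p)"
        using p(2) by (intro scaleR_mono_left vabs_nonneg[OF s(1)]) (auto simp: r_def intro: le_imp_inverse_le)
      also have "\<dots> \<preceq> inverse (real (Suc n)) *\<^sub>R u" by (rule scaleR_mono[OF s(2)]) simp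
      finally (ord.order_trans) show ?thesis .
    qed
    moreover have "(n, 0) \<in> A" using u0 by (simp add: A_def)
    ultimately show "\<exists>\<alpha>\<^sub>0\<in>A. \<forall>\<alpha>\<in>A. r \<alpha>\<^sub>0 \<alpha> \<longrightarrow> vabs E (0 - x \<alpha>) \<preceq> inverse (real (Suc n)) *\<^sub>R u" by blast
  qed
  then have oc: "order_conv E A r (\<lambda>p. T (x p)) 0" using LocD[OF T A x] by blast
  have cc: "T (x p) \<in> carrier E" if "p \<in> A" for p using Tc x that by blast
  obtain B :: "'a set" and s y where dec: "decreasing_to_zero E B s y"
    and dom: "\<And>b. b \<in> B \<Longrightarrow> \<exists>\<alpha>\<^sub>0\<in>A. \<forall>\<alpha>\<in>A. r \<alpha>\<^sub>0 \<alpha> \<longrightarrow> vabs E (0 - T (x \<alpha>)) \<preceq> y b"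
    using order_conv_leqE[OF oc cc zero_closed] by blast
  obtain b0 where "b0 \<in> B" using directed_byD(1)[OF decreasing_to_zeroD(1)[OF dec]] by blast
  then obtain p0 where p0: "p0 \<in> A" "\<forall>p\<in>A. r p0 p \<longrightarrow> vabs E (0 - T (x p)) \<preceq> y b0" using dom by blast
  let ?N = "real (Suc (fst p0))"
  have "- (?N *\<^sub>R y b0) \<preceq> T z \<and> T z \<preceq> ?N *\<^sub>R y b0" if z: "a \<preceq> z" "z \<preceq> b" for z
  proof -
    have zc: "z \<in> carrier E" "vabs E z \<preceq> u" using bound xc z by auto
    have "(fst p0, z) \<in> A" "r p0 (fst p0, z)" using zc by (auto simp: A_def r_def)
    then have "vabs E (0 - T (x (fst p0, z))) \<preceq> y b0" using p0(2) by blast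
    then have le: "vabs E (inverse ?N *\<^sub>R T z) \<preceq> y b0" using zc Tc by (simp add: x_def hom)
    have "inverse ?N *\<^sub>R T z \<preceq> y b0" "- (inverse ?N *\<^sub>R T z) \<preceq> y b0"
      using le zc Tc by (auto simp: vabs_leq_iff)
    from scaleR_mono[OF this(1), of ?N] scaleR_mono[OF this(2), of ?N]
    show ?thesis by (simp add: ord.minus_le_iff)
  qed
  then show "\<exists>c d. \<forall>x. a \<preceq> x \<longrightarrow> x \<preceq> b \<longrightarrow> c \<preceq> T x \<and> T x \<preceq> d" by blast
qed

end

context dedekind_complete_vector_lattice
begin

text \<open>Let \<open>z \<preceq> T\<^sup>+ y\<^sub>b\<close> for all \<open>b\<close>, and let \<open>x\<close> be one of the \<open>y\<^sub>b\<close>. For \<open>0 \<preceq> v \<preceq> x\<close> and \<open>y\<^sub>b \<preceq> x\<close>, the part of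
  \<open>v\<close> above \<open>y\<^sub>b\<close> is at most \<open>x - y\<^sub>b\<close>, so that \<open>T v\<close> exceeds \<open>T (v \<sqinter> y\<^sub>b)\<close> by at most
  \<open>T\<^sup>+ x - T\<^sup>+ y\<^sub>b \<preceq> T\<^sup>+ x - z\<close>. As \<open>T (v \<sqinter> y\<^sub>b)\<close> tends to zero in order, \<open>T v \<preceq> T\<^sup>+ x - z\<close>, and the
  supremum over \<open>v\<close> gives \<open>z \<preceq> 0\<close>.\<close>

lemma Loc_positive_part:
  assumes T: "T \<in> Loc E" and y: "decreasing_to_zero E B s y"
  shows "decreasing_to_zero E B s (\<lambda>b. (T \<squnion>\<^bsub>Lob E\<^esub> 0) (y b))"
proof -
  interpret L: dedekind_complete_vector_lattice "Lob E" by (rule Lob_dedekind_complete)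
  have Tc: "T \<in> carrier (Lob E)" using T by (rule Loc_subset_Lob)
  let ?P = "T \<squnion>\<^bsub>Lob E\<^esub> 0"
  have P0: "L.leq 0 ?P" by (rule L.pp_nonneg[OF Tc])
  note P = Lob_nonnegD[OF P0]
  have sup: "is_sup {T v | v. 0 \<preceq> v \<and> v \<preceq> x} (?P x)" if "0 \<preceq> x" for x
    using Lob_join_apply[OF Tc L.zero_closed that] by simp
  have T_le: "T v \<preceq> ?P x" if "0 \<preceq> v" "v \<preceq> x" for v x
    using is_supD(1)[OF sup[OF ord.order_trans[OF that]]] that by blast
  note Y = decreasing_to_zeroD[OF y]
  show ?thesis
  proof (rule decreasing_to_zeroI[OF Y(1)])
    show "?P (y c) \<preceq> ?P (y b)" if "b \<in> B" "c \<in> B" "s b c" for b c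
      using P(3)[OF Y(3)[OF that] Y(2)[OF that(2)]] .
    show "is_inf ((\<lambda>b. ?P (y b)) ` B) 0" unfolding is_inf_def
    proof (intro conjI ballI allI impI)
      show "0 \<preceq> d" if "d \<in> (\<lambda>b. ?P (y b)) ` B" for d using that P(2) Y(5) by auto
      fix z assume z: "\<forall>d\<in>(\<lambda>b. ?P (y b)) ` B. z \<preceq> d"
      obtain b0 where b0: "b0 \<in> B" using directed_byD(1)[OF Y(1)] by blast
      let ?x = "y b0"
      have x0: "0 \<preceq> ?x" and xc: "?x \<in> carrier E" using Y(2,5) b0 by auto
      have "T v \<preceq> ?P ?x - z" if v: "0 \<preceq> v" "v \<preceq> ?x" for v
      proof -
        have vc: "v \<in> carrier E" using v leq_carrier by blast
        have mc: "v \<sqinter> y b \<in> carrier E" if "b \<in> B" for b using vc Y(2)[OF that] by simp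
        have "order_conv E B s (\<lambda>b. v \<sqinter> y b) 0"
        proof (rule order_conv_null_mono[OF decreasing_to_zero_order_conv[OF y]])
          show "0 \<preceq> v \<sqinter> y b" if "b \<in> B" for b using v Y(5)[OF that] by (intro meet_nonneg)
          show "v \<sqinter> y b \<preceq> y b" if "b \<in> B" for b using vc Y(2)[OF that] by (rule meet_leq2)
        qed
        then have oc: "order_conv E B s (\<lambda>b. T (v \<sqinter> y b)) 0" using mc by (intro LocD[OF T Y(1)]) auto
        have cc: "T (v \<sqinter> y b) \<in> carrier E" if "b \<in> B" for b using LobD(1)[OF Tc mc[OF that]] .
        obtain B' :: "'a set" and s' y' where dec: "decreasing_to_zero E B' s' y'"
          and dom: "\<And>b'. b' \<in> B' \<Longrightarrow> \<exists>b1\<in>B. \<forall>b\<in>B. s b1 b \<longrightarrow> vabs E (0 - T (v \<sqinter> y b)) \<preceq> y' b'"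
          using order_conv_leqE[OF oc cc zero_closed] by blast
        have "z - ?P ?x + T v \<preceq> 0"
        proof (rule is_infD(2)[OF decreasing_to_zeroD(4)[OF dec]])
          fix d assume "d \<in> y' ` B'"
          then obtain b' where b': "b' \<in> B'" "d = y' b'" by blast
          obtain b1 where b1: "b1 \<in> B" "\<forall>b\<in>B. s b1 b \<longrightarrow> vabs E (0 - T (v \<sqinter> y b)) \<preceq> y' b'"
            using dom[OF b'(1)] by blast
          obtain b where b: "b \<in> B" "s b0 b" "s b1 b" using directed_byD(4)[OF Y(1) b0 b1(1)] by blast
          have bc: "y b \<in> carrier E" using Y(2)[OF b(1)] .
          have yx: "y b \<preceq> ?x" using Y(3)[OF b0 b(1,2)] .
          have 1: "T (v \<sqinter> y b) \<preceq> y' b'"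
          proof -
            have "vabs E (0 - T (v \<sqinter> y b)) \<preceq> y' b'" using b1(2) b by blast
            then show ?thesis
              using LobD(1)[OF Tc mc[OF b(1)]] by (simp add: vabs_leq_iff)
          qed
          have "v - v \<sqinter> y b = pp (v - y b)" using pp_diff[OF vc bc] by simp
          also have "pp (v - y b) \<preceq> pp (?x - y b)"
            using v vc bc by (intro pp_mono ord.diff_right_mono) auto
          also have "pp (?x - y b) = ?x - y b" using yx by (intro pp_of_nonneg) simp
          finally have "v - v \<sqinter> y b \<preceq> ?x - y b" .
          then have "T (v - v \<sqinter> y b) \<preceq> ?P (?x - y b)"
            using vc bc by (intro T_le) (auto simp: meet_leq1)
          then have 2: "T v - T (v \<sqinter> y b) \<preceq> ?P ?x - ?P (y b)"
            using Lob_diff[OF Tc vc mc[OF b(1)]] Lob_diff[OF P(1) xc bc] by simp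
          have 3: "z \<preceq> ?P (y b)" using z b(1) by blast
          have "z - ?P ?x + T v = z + (T v - T (v \<sqinter> y b)) - ?P ?x + T (v \<sqinter> y b)" by (simp add: algebra_simps)
          also have "\<dots> \<preceq> ?P (y b) + (?P ?x - ?P (y b)) - ?P ?x + y' b'"
            using 1 2 3 by (intro ord.add_mono ord.diff_right_mono)
          also have "\<dots> = d" using b'(2) by simp
          finally show "z - ?P ?x + T v \<preceq> d" .
        qed
        then show ?thesis by (simp add: algebra_simps)
      qed
      then have "?P ?x \<preceq> ?P ?x - z" by (intro is_supD(2)[OF sup[OF x0]]) auto
      then show "z \<preceq> 0" by (simp add: ord.le_diff_eq)
    qed
  qed
qed

lemma Loc_uminus:
  assumes T: "T \<in> Loc E"
  shows "- T \<in> Loc E"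
  unfolding Loc_def
proof (intro CollectI conjI allI impI)
  have Tc: "T \<in> carrier (Lob E)" using T by (rule Loc_subset_Lob)
  show "- T \<in> linear_operators E" using Lob_neg_closed[OF Tc] by (simp add: Lob_def)
  fix A :: "'a net_index set" and r x
  assume *: "directed_by A r \<and> x \<in> A \<rightarrow> carrier E \<and> order_conv E A r x 0"
  have c: "T (x \<alpha>) \<in> carrier E" if "\<alpha> \<in> A" for \<alpha> using LobD(1)[OF Tc] * that by blast
  show "order_conv E A r (\<lambda>\<alpha>. (- T) (x \<alpha>)) 0"
  proof (rule order_conv_mono)
    show "order_conv E A r (\<lambda>\<alpha>. T (x \<alpha>)) 0" using LocD[OF T] * by blast
  qed (use c in auto)
qed

text \<open>Ogasawara's theorem, from \<open>\<bar>T\<bar> = T\<^sup>+ + (- T)\<^sup>+\<close>.\<close>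

lemma Loc_modulus:
  assumes T: "T \<in> Loc E" and y: "decreasing_to_zero E B s y"
  shows "decreasing_to_zero E B s (\<lambda>b. vabs (Lob E) T (y b))"
proof -
  interpret L: dedekind_complete_vector_lattice "Lob E" by (rule Lob_dedekind_complete)
  have Tc: "T \<in> carrier (Lob E)" using T by (rule Loc_subset_Lob)
  have "decreasing_to_zero E B s (\<lambda>b. (T \<squnion>\<^bsub>Lob E\<^esub> 0) (y b) + ((- T) \<squnion>\<^bsub>Lob E\<^esub> 0) (y b))"
    by (intro decreasing_to_zero_add Loc_positive_part T Loc_uminus y)
  moreover have "(T \<squnion>\<^bsub>Lob E\<^esub> 0) v + ((- T) \<squnion>\<^bsub>Lob E\<^esub> 0) v = vabs (Lob E) T v" for v
    using L.add_pp[OF Tc] by (metis plus_fun_apply)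
  ultimately show ?thesis by simp
qed

lemma comp_diff:
  assumes T: "T \<in> carrier (Lob E)" and R: "R \<in> carrier (Lob E)" and S: "S \<in> carrier (Lob E)"
  shows "(T \<circ> R) - (T \<circ> S) = T \<circ> (R - S)"
proof (rule ext)
  fix x show "((T \<circ> R) - (T \<circ> S)) x = (T \<circ> (R - S)) x"
    using LobD(1,4)[OF R, of x] LobD(1,4)[OF S, of x] Lob_diff[OF T, of "R x" "S x"] Lob_zero[OF T]
    by (cases "x \<in> carrier E") auto
qed

section \<open>Continuity of left multiplication\<close>

lemma left_mult_diff_closed:
  assumes "T \<in> carrier (Lob E)" "S \<in> carrier (Lob E)" "L \<in> carrier (Lob E)"
  shows "left_mult T S - left_mult T L \<in> carrier (Lob E)"
  unfolding left_mult_def by (intro subspace_diff[OF subspace_Lob] Lob_comp assms)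

lemma left_mult_diff_leq:
  assumes T: "T \<in> carrier (Lob E)" and S: "S \<in> carrier (Lob E)" and L: "L \<in> carrier (Lob E)"
  shows "vector_lattice.leq (Lob E) (vabs (Lob E) (left_mult T S - left_mult T L))
    (vabs (Lob E) T \<circ> vabs (Lob E) (S - L))"
proof -
  interpret L: dedekind_complete_vector_lattice "Lob E" by (rule Lob_dedekind_complete)
  show ?thesis unfolding left_mult_def comp_diff[OF T S L]
    by (rule vabs_comp_leq[OF T L.diff_closed[OF S L] L.ord.order_refl])
qed

lemma left_mult_o_o:
  assumes T: "T \<in> Loc E" and S: "\<And>\<alpha>. \<alpha> \<in> A \<Longrightarrow> S \<alpha> \<in> carrier (Lob E)" and L: "L \<in> carrier (Lob E)"
    and conv: "order_conv (Lob E) A r S L"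
  shows "order_conv (Lob E) A r (\<lambda>\<alpha>. left_mult T (S \<alpha>)) (left_mult T L)"
proof -
  interpret L: dedekind_complete_vector_lattice "Lob E" by (rule Lob_dedekind_complete)
  have Tc: "T \<in> carrier (Lob E)" using T by (rule Loc_subset_Lob)
  let ?M = "vabs (Lob E) T"
  have M: "?M \<in> carrier (Lob E)" and M0: "L.leq 0 ?M" using Tc L.vabs_nonneg by auto
  obtain B :: "('a \<Rightarrow> 'a) set" and s R where dec: "decreasing_to_zero (Lob E) B s R"
    and dom: "\<And>b. b \<in> B \<Longrightarrow> \<exists>\<alpha>\<^sub>0\<in>A. \<forall>\<alpha>\<in>A. r \<alpha>\<^sub>0 \<alpha> \<longrightarrow> L.leq (vabs (Lob E) (L - S \<alpha>)) (R b)"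
    using L.order_conv_leqE[OF conv S L] by blast
  note D = L.decreasing_to_zeroD[OF dec]
  have dec': "decreasing_to_zero (Lob E) B s (\<lambda>b. ?M \<circ> R b)"
  proof (rule Lob_decreasing_to_zeroI[OF D(1)])
    show "?M \<circ> R b \<in> carrier (Lob E)" if "b \<in> B" for b using Lob_comp[OF D(2)[OF that] M] .
    show "decreasing_to_zero E B s (\<lambda>b. (?M \<circ> R b) x)" if "0 \<preceq> x" for x
      using Loc_modulus[OF T Lob_decreasing_to_zeroD[OF dec that]] by simp
  qed
  show ?thesis
  proof (rule L.order_conv_leqI[OF dec'])
    fix b assume b: "b \<in> B"
    obtain \<alpha>\<^sub>0 where a0: "\<alpha>\<^sub>0 \<in> A" "\<forall>\<alpha>\<in>A. r \<alpha>\<^sub>0 \<alpha> \<longrightarrow> L.leq (vabs (Lob E) (L - S \<alpha>)) (R b)"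
      using dom[OF b] by blast
    have "L.leq (vabs (Lob E) (left_mult T L - left_mult T (S \<alpha>))) (?M \<circ> R b)" if a: "\<alpha> \<in> A" "r \<alpha>\<^sub>0 \<alpha>" for \<alpha>
    proof -
      have d: "L - S \<alpha> \<in> carrier (Lob E)" using S[OF a(1)] L by simp
      have "L.leq (vabs (Lob E) (left_mult T L - left_mult T (S \<alpha>))) (?M \<circ> vabs (Lob E) (L - S \<alpha>))"
        by (rule left_mult_diff_leq[OF Tc L S[OF a(1)]])
      moreover have "L.leq (?M \<circ> vabs (Lob E) (L - S \<alpha>)) (?M \<circ> R b)"
      proof -
        have V: "vabs (Lob E) (L - S \<alpha>) \<in> carrier (Lob E)" using d by simp
        have "L.leq (vabs (Lob E) (L - S \<alpha>)) (R b)" using a0(2) a by blast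
        then have "vabs (Lob E) (L - S \<alpha>) x \<preceq> R b x" if "0 \<preceq> x" for x
          using V D(2)[OF b] that by (simp add: Lob_leq_iff)
        then have "?M (vabs (Lob E) (L - S \<alpha>) x) \<preceq> ?M (R b x)" if "0 \<preceq> x" for x
          using that LobD(1)[OF V] leq_carrier by (intro Lob_nonnegD(3)[OF M0]) auto
        then show ?thesis using Lob_comp[OF V M] Lob_comp[OF D(2)[OF b] M] by (simp add: Lob_leq_iff)
      qed
      ultimately show ?thesis using L.ord.order_trans by metis
    qed
    then show "\<exists>\<alpha>\<^sub>0\<in>A. \<forall>\<alpha>\<in>A. r \<alpha>\<^sub>0 \<alpha> \<longrightarrow> L.leq (vabs (Lob E) (left_mult T L - left_mult T (S \<alpha>))) (?M \<circ> R b)"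
      using a0(1) by blast
  qed
qed

lemma left_mult_SO_SO:
  assumes T: "T \<in> Loc E" and A: "directed_by A r" and S: "\<And>\<alpha>. \<alpha> \<in> A \<Longrightarrow> S \<alpha> \<in> carrier (Lob E)"
    and L: "L \<in> carrier (Lob E)" and x: "x \<in> carrier E"
    and conv: "order_conv E A r (\<lambda>\<alpha>. S \<alpha> x) (L x)"
  shows "order_conv E A r (\<lambda>\<alpha>. left_mult T (S \<alpha>) x) (left_mult T L x)"
proof -
  have Tc: "T \<in> carrier (Lob E)" using T by (rule Loc_subset_Lob)
  have c: "S \<alpha> x \<in> carrier E" if "\<alpha> \<in> A" for \<alpha> using LobD(1)[OF S[OF that] x] .
  have Lx: "L x \<in> carrier E" using LobD(1)[OF L x] .
  have "order_conv E A r (\<lambda>\<alpha>. L x - S \<alpha> x) 0"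
    by (rule order_conv_mono[OF conv c Lx]) (use c Lx vabs_minus_commute[of "L x"] in auto)
  then have "order_conv E A r (\<lambda>\<alpha>. T (L x - S \<alpha> x)) 0" using c Lx by (intro LocD[OF T A]) auto
  then show ?thesis
  proof (rule order_conv_mono)
    show "T (L x - S \<alpha> x) \<in> carrier E" if "\<alpha> \<in> A" for \<alpha> using LobD(1)[OF Tc] c[OF that] Lx by simp
    show "vabs E (left_mult T L x - left_mult T (S \<alpha>) x) \<preceq> vabs E (0 - T (L x - S \<alpha> x))"
      if "\<alpha> \<in> A" for \<alpha>
      using c[OF that] Lx LobD(1)[OF Tc] Lob_diff[OF Tc Lx c[OF that]]
        vabs_minus_commute[of "T (L x)" "T (S \<alpha> x)"] by (simp add: left_mult_def)
  qed simp
qed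

lemma left_mult_uo_uo:
  assumes T: "T \<in> Orth E" and S: "\<And>\<alpha>. \<alpha> \<in> A \<Longrightarrow> S \<alpha> \<in> carrier (Lob E)" and L: "L \<in> carrier (Lob E)"
    and conv: "uo_conv (Lob E) A r S L"
  shows "uo_conv (Lob E) A r (\<lambda>\<alpha>. left_mult T (S \<alpha>)) (left_mult T L)"
proof -
  interpret L: dedekind_complete_vector_lattice "Lob E" by (rule Lob_dedekind_complete)
  have Tc: "T \<in> carrier (Lob E)" using T by (simp add: Orth_def)
  interpret \<pi>: positive_orthomorphism "Lob E" "\<lambda>S. vabs (Lob E) T \<circ> S"
    by (rule Lob_positive_orthomorphism[OF Orth_modulus[OF T] L.vabs_closed[OF Tc]])
  have "uo_conv (Lob E) A r (\<lambda>\<alpha>. S \<alpha> - L) 0" using conv by (simp add: L.uo_conv_null_iff)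
  then have "uo_conv (Lob E) A r (\<lambda>\<alpha>. left_mult T (S \<alpha>) - left_mult T L) 0"
    by (rule \<pi>.uo_conv_null) (use S L left_mult_diff_closed[OF Tc] left_mult_diff_leq[OF Tc] in auto)
  then show ?thesis by (simp add: L.uo_conv_null_iff)
qed

lemma left_mult_SUO_SUO:
  assumes T: "T \<in> Orth E" and S: "\<And>\<alpha>. \<alpha> \<in> A \<Longrightarrow> S \<alpha> \<in> carrier (Lob E)" and L: "L \<in> carrier (Lob E)"
    and x: "x \<in> carrier E" and conv: "uo_conv E A r (\<lambda>\<alpha>. S \<alpha> x) (L x)"
  shows "uo_conv E A r (\<lambda>\<alpha>. left_mult T (S \<alpha>) x) (left_mult T L x)"
proof -
  have Tc: "T \<in> carrier (Lob E)" using T by (simp add: Orth_def)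
  interpret \<pi>: positive_orthomorphism E "vabs (Lob E) T" by (rule Orth_modulus[OF T])
  have "uo_conv E A r (\<lambda>\<alpha>. S \<alpha> x - L x) 0" using conv by (simp add: uo_conv_null_iff)
  then have "uo_conv E A r (\<lambda>\<alpha>. left_mult T (S \<alpha>) x - left_mult T L x) 0"
  proof (rule \<pi>.uo_conv_null)
    fix \<alpha> assume a: "\<alpha> \<in> A"
    have c: "S \<alpha> x \<in> carrier E" "L x \<in> carrier E" using LobD(1)[OF S[OF a] x] LobD(1)[OF L x] .
    show "S \<alpha> x - L x \<in> carrier E" using c by simp
    show "left_mult T (S \<alpha>) x - left_mult T L x \<in> carrier E"
      "vabs E (left_mult T (S \<alpha>) x - left_mult T L x) \<preceq> vabs (Lob E) T (vabs E (S \<alpha> x - L x))"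
      using c Lob_diff[OF Tc c] vabs_apply_leq[OF Tc, of "S \<alpha> x - L x"] LobD(1)[OF Tc]
      by (simp_all add: left_mult_def)
  qed
  then show ?thesis by (simp add: uo_conv_null_iff)
qed

end

context dedekind_complete_uo_Lebesgue_lattice
begin

lemma left_mult_tau_tau:
  assumes T: "T \<in> Orth E" and A: "directed_by A r" and S: "S \<in> A \<rightarrow> carrier (Lob E)" and L: "L \<in> carrier (Lob E)"
    and conv: "limitin (tau_hat (Lob E)) S L (tail_filter A r)"
  shows "limitin (tau_hat (Lob E)) (\<lambda>\<alpha>. left_mult T (S \<alpha>)) (left_mult T L) (tail_filter A r)"
proof -
  interpret L: dedekind_complete_uo_Lebesgue_lattice "Lob E" "tau_hat (Lob E)" by (rule Lob_uo_Lebesgue)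
  have Tc: "T \<in> carrier (Lob E)" using T by (simp add: Orth_def)
  interpret \<pi>: positive_orthomorphism "Lob E" "\<lambda>S. vabs (Lob E) T \<circ> S"
    by (rule Lob_positive_orthomorphism[OF Orth_modulus[OF T] L.vabs_closed[OF Tc]])
  interpret \<pi>: positive_orthomorphism_uo_Lebesgue "Lob E" "tau_hat (Lob E)" "\<lambda>S. vabs (Lob E) T \<circ> S" ..
  have Sc: "S \<alpha> \<in> carrier (Lob E)" if "\<alpha> \<in> A" for \<alpha> using S that by blast
  have "limitin (tau_hat (Lob E)) (\<lambda>\<alpha>. left_mult T (S \<alpha>) - left_mult T L) 0 (tail_filter A r)"
  proof (rule \<pi>.limitin_null[OF A])
    show "limitin (tau_hat (Lob E)) (\<lambda>\<alpha>. S \<alpha> - L) 0 (tail_filter A r)"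
      using conv L.limitin_null_iff[OF A S L] by blast
  qed (use Sc L left_mult_diff_closed[OF Tc] left_mult_diff_leq[OF Tc] in auto)
  then show ?thesis
    using Lob_comp[OF Sc Tc] Lob_comp[OF L Tc] by (subst L.limitin_null_iff[OF A]) (auto simp: left_mult_def)
qed

lemma left_mult_Stau_Stau:
  assumes T: "T \<in> Orth E" and A: "directed_by A r" and S: "S \<in> A \<rightarrow> carrier (Lob E)" and L: "L \<in> carrier (Lob E)"
    and x: "x \<in> carrier E" and conv: "limitin \<tau> (\<lambda>\<alpha>. S \<alpha> x) (L x) (tail_filter A r)"
  shows "limitin \<tau> (\<lambda>\<alpha>. left_mult T (S \<alpha>) x) (left_mult T L x) (tail_filter A r)"
proof -
  have Tc: "T \<in> carrier (Lob E)" using T by (simp add: Orth_def)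
  interpret \<pi>: positive_orthomorphism E "vabs (Lob E) T" by (rule Orth_modulus[OF T])
  interpret \<pi>: positive_orthomorphism_uo_Lebesgue E \<tau> "vabs (Lob E) T" ..
  have c: "S \<alpha> x \<in> carrier E" if "\<alpha> \<in> A" for \<alpha> using LobD(1)[of "S \<alpha>" E x] S x that by blast
  have Lx: "L x \<in> carrier E" using LobD(1)[OF L x] .
  have "limitin \<tau> (\<lambda>\<alpha>. left_mult T (S \<alpha>) x - left_mult T L x) 0 (tail_filter A r)"
  proof (rule \<pi>.limitin_null[OF A])
    show "limitin \<tau> (\<lambda>\<alpha>. S \<alpha> x - L x) 0 (tail_filter A r)"
      using conv c Lx by (subst (asm) limitin_null_iff[OF A]) auto
    show "(\<lambda>\<alpha>. S \<alpha> x - L x) \<in> A \<rightarrow> carrier E" using c Lx by auto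
    show "(\<lambda>\<alpha>. left_mult T (S \<alpha>) x - left_mult T L x) \<in> A \<rightarrow> carrier E"
      using c Lx LobD(1)[OF Tc] by (auto simp: left_mult_def)
    show "vabs E (left_mult T (S \<alpha>) x - left_mult T L x) \<preceq> vabs (Lob E) T (vabs E (S \<alpha> x - L x))"
      if a: "\<alpha> \<in> A" for \<alpha>
      using c[OF a] Lx Lob_diff[OF Tc c[OF a] Lx] vabs_apply_leq[OF Tc, of "S \<alpha> x - L x"]
      by (simp add: left_mult_def)
  qed
  then show ?thesis
    using c Lx LobD(1)[OF Tc] by (subst limitin_null_iff[OF A]) (auto simp: left_mult_def)
qed

end

context dedekind_complete_vector_lattice
begin

lemma mode_o_imp_uo:
  assumes "S \<in> A \<rightarrow> carrier (Lob E)" "L \<in> carrier (Lob E)" "mode_conv Mode_o E A r S L"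
  shows "mode_conv Mode_uo E A r S L"
proof -
  interpret L: dedekind_complete_vector_lattice "Lob E" by (rule Lob_dedekind_complete)
  show ?thesis using assms by (auto intro!: L.order_conv_imp_uo_conv)
qed

lemma mode_uo_imp_tau:
  assumes "admits_Hausdorff_uo_Lebesgue E" "directed_by A r" "S \<in> A \<rightarrow> carrier (Lob E)"
    "L \<in> carrier (Lob E)" "mode_conv Mode_uo E A r S L"
  shows "mode_conv Mode_tau E A r S L"
proof -
  interpret E: dedekind_complete_uo_Lebesgue_lattice E "tau_hat E" by (rule tau_hat_uo_Lebesgue[OF assms(1)])
  interpret L: dedekind_complete_uo_Lebesgue_lattice "Lob E" "tau_hat (Lob E)" by (rule E.Lob_uo_Lebesgue)
  show ?thesis using assms by (simp add: L.uo_conv_imp_limitin)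
qed

lemma mode_o_imp_SO:
  assumes "S \<in> A \<rightarrow> carrier (Lob E)" "L \<in> carrier (Lob E)" "mode_conv Mode_o E A r S L"
  shows "mode_conv Mode_SO E A r S L"
  using assms Lob_order_conv_pointwise[of A r S L] by (auto simp: Pi_iff)

lemma mode_SO_imp_SUO:
  assumes "S \<in> A \<rightarrow> carrier (Lob E)" "L \<in> carrier (Lob E)" "mode_conv Mode_SO E A r S L"
  shows "mode_conv Mode_SUO E A r S L"
  using assms LobD(1) by (fastforce intro!: order_conv_imp_uo_conv)

lemma mode_SUO_imp_Stau:
  assumes "admits_Hausdorff_uo_Lebesgue E" "directed_by A r" "S \<in> A \<rightarrow> carrier (Lob E)"
    "L \<in> carrier (Lob E)" "mode_conv Mode_SUO E A r S L"
  shows "mode_conv Mode_Stau E A r S L"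
proof -
  interpret E: dedekind_complete_uo_Lebesgue_lattice E "tau_hat E" by (rule tau_hat_uo_Lebesgue[OF assms(1)])
  have "limitin (tau_hat E) (\<lambda>\<alpha>. S \<alpha> x) (L x) (tail_filter A r)" if x: "x \<in> carrier E" for x
  proof (rule E.uo_conv_imp_limitin[OF assms(2)])
    show "(\<lambda>\<alpha>. S \<alpha> x) \<in> A \<rightarrow> carrier E" using assms(3) LobD(1) x by blast
    show "L x \<in> carrier E" using LobD(1)[OF assms(4) x] .
    show "uo_conv E A r (\<lambda>\<alpha>. S \<alpha> x) (L x)" using assms(5) x by simp
  qed
  then show ?thesis by simp
qed

end

lemma Loc_mode_continuous:
  fixes E :: "'a::real_vector gorder"
  assumes "(c1, c2) \<in> {Mode_o} \<times> UNIV \<union> {Mode_SO} \<times> {Mode_SO, Mode_SUO, Mode_Stau}"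
    and adm: "admissible c1 c2 E" and T: "T \<in> Loc E"
  shows "mode_continuous c1 c2 E (left_mult T)"
  unfolding mode_continuous_def
proof (intro allI impI, elim conjE)
  fix A :: "('a \<Rightarrow> 'a) net_index set" and r S L
  assume A: "directed_by A r" and S: "S \<in> A \<rightarrow> carrier (Lob E)" and L: "L \<in> carrier (Lob E)"
    and conv: "mode_conv c1 E A r S L"
  interpret dedekind_complete_vector_lattice E using adm by (simp add: admissible_def)
  have ad: "admits_Hausdorff_uo_Lebesgue E" if "c2 = Mode_tau \<or> c2 = Mode_Stau"
    using that adm by (auto simp: admissible_def)
  let ?S = "\<lambda>\<alpha>. left_mult T (S \<alpha>)" and ?L = "left_mult T L"
  have Tc: "T \<in> carrier (Lob E)" using T by (rule Loc_subset_Lob)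
  have Sc: "S \<alpha> \<in> carrier (Lob E)" if "\<alpha> \<in> A" for \<alpha> using S that by blast
  have TS: "?S \<in> A \<rightarrow> carrier (Lob E)" and TL: "?L \<in> carrier (Lob E)"
    using Lob_comp[OF Sc Tc] Lob_comp[OF L Tc] by (auto simp: left_mult_def)
  have SO: "mode_conv c2 E A r ?S ?L" if "mode_conv Mode_SO E A r ?S ?L" "c2 \<in> {Mode_SO, Mode_SUO, Mode_Stau}"
    using that mode_SO_imp_SUO[OF TS TL] mode_SUO_imp_Stau[OF ad A TS TL] by blast
  show "mode_conv c2 E A r ?S ?L"
  proof (cases "c1 = Mode_o")
    case True
    then have o: "mode_conv Mode_o E A r ?S ?L"
      using conv left_mult_o_o[OF T Sc L] by simp
    then have uo: "mode_conv Mode_uo E A r ?S ?L" by (rule mode_o_imp_uo[OF TS TL])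
    show ?thesis
      using o uo mode_uo_imp_tau[OF ad A TS TL uo] SO[OF mode_o_imp_SO[OF TS TL o]] by (cases c2) blast+
  next
    case False
    then have c: "c1 = Mode_SO" "c2 \<in> {Mode_SO, Mode_SUO, Mode_Stau}" using assms(1) by auto
    then have "mode_conv Mode_SO E A r ?S ?L"
      using conv left_mult_SO_SO[OF T A Sc L] by simp
    then show ?thesis using c(2) by (rule SO)
  qed
qed

lemma Orth_mode_continuous:
  fixes E :: "'a::real_vector gorder"
  assumes "(c1, c2) \<in> {(Mode_uo, Mode_uo), (Mode_uo, Mode_tau), (Mode_tau, Mode_tau),
      (Mode_SUO, Mode_SUO), (Mode_SUO, Mode_Stau), (Mode_Stau, Mode_Stau)}"
    and adm: "admissible c1 c2 E" and T: "T \<in> Orth E"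
  shows "mode_continuous c1 c2 E (left_mult T)"
  unfolding mode_continuous_def
proof (intro allI impI, elim conjE)
  fix A :: "('a \<Rightarrow> 'a) net_index set" and r S L
  assume A: "directed_by A r" and S: "S \<in> A \<rightarrow> carrier (Lob E)" and L: "L \<in> carrier (Lob E)"
    and conv: "mode_conv c1 E A r S L"
  interpret dedekind_complete_vector_lattice E using adm by (simp add: admissible_def)
  have ad: "admits_Hausdorff_uo_Lebesgue E" if "c2 = Mode_tau \<or> c2 = Mode_Stau"
    using that adm by (auto simp: admissible_def)
  let ?S = "\<lambda>\<alpha>. left_mult T (S \<alpha>)" and ?L = "left_mult T L"
  have Tc: "T \<in> carrier (Lob E)" using T by (simp add: Orth_def)
  have Sc: "S \<alpha> \<in> carrier (Lob E)" if "\<alpha> \<in> A" for \<alpha> using S that by blast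
  have TS: "?S \<in> A \<rightarrow> carrier (Lob E)" and TL: "?L \<in> carrier (Lob E)"
    using Lob_comp[OF Sc Tc] Lob_comp[OF L Tc] by (auto simp: left_mult_def)
  have uo: "mode_conv Mode_uo E A r ?S ?L" if "c1 = Mode_uo"
    using conv left_mult_uo_uo[OF T Sc L] that by simp
  have SUO: "mode_conv Mode_SUO E A r ?S ?L" if "c1 = Mode_SUO"
    using conv left_mult_SUO_SUO[OF T, of A S L] Sc L that by simp
  have tau: "mode_conv c2 E A r ?S ?L" if c: "c1 = Mode_tau \<and> c2 = Mode_tau \<or> c1 = Mode_Stau \<and> c2 = Mode_Stau"
  proof -
    have "admits_Hausdorff_uo_Lebesgue E" using c ad by blast
    then interpret E: dedekind_complete_uo_Lebesgue_lattice E "tau_hat E" by (rule tau_hat_uo_Lebesgue)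
    show ?thesis using c conv E.left_mult_tau_tau[OF T A S L] E.left_mult_Stau_Stau[OF T A S L] by auto
  qed
  consider "c1 = Mode_uo" "c2 = Mode_uo" | "c1 = Mode_uo" "c2 = Mode_tau"
    | "c1 = Mode_SUO" "c2 = Mode_SUO" | "c1 = Mode_SUO" "c2 = Mode_Stau"
    | "c1 = Mode_tau \<and> c2 = Mode_tau \<or> c1 = Mode_Stau \<and> c2 = Mode_Stau"
    using assms(1) by blast
  then show "mode_conv c2 E A r ?S ?L"
  proof cases
    case 1 then show ?thesis using uo by simp
  next
    case 2 then show ?thesis using mode_uo_imp_tau[OF ad A TS TL uo] by simp
  next
    case 3 then show ?thesis using SUO by simp
  next
    case 4 then show ?thesis using mode_SUO_imp_Stau[OF ad A TS TL SUO] by simp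
  next
    case 5 then show ?thesis by (rule tau)
  qed
qed

section \<open>Bounded martingales on the binary tree\<close>

definition avg :: "(bool list \<Rightarrow> real) \<Rightarrow> bool list \<Rightarrow> real"
  where "avg h w = (h (False # w) + h (True # w)) / 2"

text \<open>The essentially bounded functions of a sequence of coin tosses, each given by its means over the
  cylinders.\<close>

definition martingales :: "(bool list \<Rightarrow> real) set"
  where "martingales = {h. avg h = h \<and> (\<exists>C. \<forall>w. \<bar>h w\<bar> \<le> C)}"

lemma martingalesD:
  assumes "h \<in> martingales"
  shows "avg h = h" "\<exists>C. \<forall>w. \<bar>h w\<bar> \<le> C"
  using assms by (auto simp: martingales_def)

lemma avg_mono: "(\<And>w. g w \<le> h w) \<Longrightarrow> avg g w \<le> avg h w"
  by (auto simp: avg_def intro!: divide_right_mono add_mono)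

lemma avg_pow_mono: "(\<And>w. g w \<le> h w) \<Longrightarrow> (avg ^^ k) g w \<le> (avg ^^ k) h w"
  by (induction k arbitrary: w) (auto intro: avg_mono)

lemma avg_pow_Suc: "(avg ^^ Suc k) h w = ((avg ^^ k) h (False # w) + (avg ^^ k) h (True # w)) / 2"
  by (simp only: funpow.simps comp_def avg_def[of "(avg ^^ k) h"])

lemma avg_pow_fixed: "avg h = h \<Longrightarrow> (avg ^^ k) h = h"
  by (induction k) auto

lemma avg_pow_add: "(avg ^^ k) (\<lambda>w. g w + h w) w = (avg ^^ k) g w + (avg ^^ k) h w"
  by (induction k arbitrary: w) (auto simp: avg_def field_simps)

lemma avg_pow_scale: "(avg ^^ k) (\<lambda>w. c * h w) w = c * (avg ^^ k) h w"
  by (induction k arbitrary: w) (auto simp: avg_def field_simps)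

lemma avg_pow_const: "(avg ^^ k) (\<lambda>_. c) w = c"
  by (induction k arbitrary: w) (auto simp: avg_def)

lemma avg_pow_bounded:
  assumes "\<And>w. \<bar>h w\<bar> \<le> C"
  shows "\<bar>(avg ^^ k) h w\<bar> \<le> C"
proof -
  have "- C \<le> h v" "h v \<le> C" for v using assms[of v] by auto
  then show ?thesis
    using avg_pow_mono[of h "\<lambda>_. C" k w] avg_pow_mono[of "\<lambda>_. - C" h k w] by (simp add: avg_pow_const abs_le_iff)
qed

lemma avg_pow_cong:
  "(\<And>v. length v = length w + k \<Longrightarrow> g v = h v) \<Longrightarrow> (avg ^^ k) g w = (avg ^^ k) h w"
proof (induction k arbitrary: w)
  case (Suc k)
  have "(avg ^^ k) g (b # w) = (avg ^^ k) h (b # w)" for b by (rule Suc.IH) (simp add: Suc.prems)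
  then show ?case by (simp add: avg_pow_Suc del: funpow.simps)
qed simp

text \<open>The pointwise supremum \<open>s\<close> of \<open>D\<close> is a submartingale, so that its \<open>k\<close>-step averages increase with \<open>k\<close>;
  their limit is the least martingale above \<open>s\<close>.\<close>

lemma martingale_sup:
  assumes D: "D \<subseteq> martingales" "D \<noteq> {}" and u: "u \<in> martingales" "\<And>f w. f \<in> D \<Longrightarrow> f w \<le> u w"
  obtains h where "h \<in> martingales" "\<And>f w. f \<in> D \<Longrightarrow> f w \<le> h w"
    "\<And>v w. v \<in> martingales \<Longrightarrow> (\<And>f w. f \<in> D \<Longrightarrow> f w \<le> v w) \<Longrightarrow> h w \<le> v w"
proof -
  define s where "s w = (SUP f\<in>D. f w)" for w
  have bdd: "bdd_above ((\<lambda>f. f w) ` D)" for w using u(2) by (intro bdd_aboveI[of _ "u w"]) auto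
  have le_s: "f w \<le> s w" if "f \<in> D" for f w unfolding s_def using bdd that by (rule cSUP_upper2) simp
  have s_le: "s w \<le> c" if "\<And>f. f \<in> D \<Longrightarrow> f w \<le> c" for c w
    unfolding s_def using D(2) that by (rule cSUP_least)
  have "s w \<le> avg s w" for w
  proof (rule s_le)
    fix f assume f: "f \<in> D"
    then have "avg f = f" using D martingalesD by blast
    then have "f w = avg f w" by simp
    also have "\<dots> \<le> avg s w" by (rule avg_mono) (rule le_s[OF f])
    finally show "f w \<le> avg s w" .
  qed
  then have "(avg ^^ k) s w \<le> (avg ^^ Suc k) s w" for k w
    unfolding funpow_Suc_right comp_def by (rule avg_pow_mono)
  then have inc: "incseq (\<lambda>k. (avg ^^ k) s w)" for w by (rule incseq_SucI)
  have below: "(avg ^^ k) s w \<le> v w" if "v \<in> martingales" "\<And>f w. f \<in> D \<Longrightarrow> f w \<le> v w" for v k w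
  proof -
    have "(avg ^^ k) s w \<le> (avg ^^ k) v w" by (rule avg_pow_mono) (rule s_le[OF that(2)])
    then show ?thesis using avg_pow_fixed[OF martingalesD(1)[OF that(1)]] by simp
  qed
  have below_u: "(avg ^^ k) s w \<le> u w" for k w using u by (rule below)
  have "\<exists>l. (\<lambda>k. (avg ^^ k) s w) \<longlonglongrightarrow> l \<and> (\<forall>k. (avg ^^ k) s w \<le> l)" for w
    using incseq_convergent[OF inc, of w "u w"] below_u by metis
  then obtain h where h: "\<And>w. (\<lambda>k. (avg ^^ k) s w) \<longlonglongrightarrow> h w" "\<And>w k. (avg ^^ k) s w \<le> h w" by metis
  have sh: "s w \<le> h w" for w using h(2)[of 0 w] by simp
  have h_le: "h w \<le> v w" if "v \<in> martingales" "\<And>f w. f \<in> D \<Longrightarrow> f w \<le> v w" for v w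
    using h(1)[of w] by (rule LIMSEQ_le_const2) (intro exI allI impI below that)
  have hu: "h w \<le> u w" for w using u by (rule h_le)
  have "avg h w = h w" for w
  proof (rule LIMSEQ_unique)
    show "(\<lambda>k. (avg ^^ Suc k) s w) \<longlonglongrightarrow> h w" using h(1)[of w] by (rule LIMSEQ_Suc)
    show "(\<lambda>k. (avg ^^ Suc k) s w) \<longlonglongrightarrow> avg h w"
      unfolding avg_def[of h] funpow.simps comp_def by (subst avg_def) (intro tendsto_intros h(1); simp)
  qed
  moreover have "\<exists>C. \<forall>w. \<bar>h w\<bar> \<le> C"
  proof -
    obtain f where f: "f \<in> D" using D by blast
    obtain C1 C2 where C: "\<And>w. \<bar>f w\<bar> \<le> C1" "\<And>w. \<bar>u w\<bar> \<le> C2" using martingalesD(2) f D u by (metis subsetD)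
    have "\<bar>h w\<bar> \<le> max C1 C2" for w
      using C[of w] le_s[OF f, of w] sh[of w] hu[of w] by linarith
    then show ?thesis by blast
  qed
  ultimately have "h \<in> martingales" by (auto simp: martingales_def)
  moreover have "f w \<le> h w" if "f \<in> D" for f w using le_s[OF that] sh order_trans by blast
  ultimately show thesis using that h_le by blast
qed

text \<open>The martingales are transported from functions on the nodes to functions on the reals, the type
  for which counterexamples are wanted: nodes become real numbers, and functions are zero elsewhere.\<close>

definition enc :: "bool list \<Rightarrow> real"
  where "enc w = real (to_nat w)"

lemma enc_inject [simp]: "enc v = enc w \<longleftrightarrow> v = w"
  by (simp add: enc_def)

definition extend :: "(bool list \<Rightarrow> real) \<Rightarrow> real \<Rightarrow> real"
  where "extend h x = (if x \<in> range enc then h (inv enc x) else 0)"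

lemma extend_enc [simp]: "extend h (enc w) = h w"
  by (simp add: extend_def inj_def)

definition tree :: "(real \<Rightarrow> real) gorder"
  where "tree = \<lparr>carrier = {f. (\<lambda>w. f (enc w)) \<in> martingales \<and> (\<forall>x. x \<notin> range enc \<longrightarrow> f x = 0)},
    eq = (=), le = (\<lambda>f g. \<forall>w. f (enc w) \<le> g (enc w))\<rparr>"

lemma tree_le: "f \<sqsubseteq>\<^bsub>tree\<^esub> g \<longleftrightarrow> (\<forall>w. f (enc w) \<le> g (enc w))"
  by (simp add: tree_def)

lemma tree_martingale: "f \<in> carrier tree \<Longrightarrow> (\<lambda>w. f (enc w)) \<in> martingales"
  by (simp add: tree_def)

lemma tree_eqI:
  assumes "f \<in> carrier tree" "g \<in> carrier tree" "\<And>w. f (enc w) = g (enc w)"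
  shows "f = g"
proof
  fix x show "f x = g x" using assms by (cases "x \<in> range enc") (auto simp: tree_def)
qed

lemma extend_tree: "h \<in> martingales \<Longrightarrow> extend h \<in> carrier tree"
  by (simp add: tree_def) (simp add: extend_def)

lemma martingales_add: "g \<in> martingales \<Longrightarrow> h \<in> martingales \<Longrightarrow> (\<lambda>w. g w + h w) \<in> martingales"
proof -
  assume g: "g \<in> martingales" and h: "h \<in> martingales"
  obtain C C' where C: "\<forall>w. \<bar>g w\<bar> \<le> C" "\<forall>w. \<bar>h w\<bar> \<le> C'" using martingalesD(2)[OF g] martingalesD(2)[OF h] by blast
  have "\<bar>g w + h w\<bar> \<le> C + C'" for w using C(1)[rule_format, of w] C(2)[rule_format, of w] by linarith
  moreover have "avg (\<lambda>w. g w + h w) = (\<lambda>w. g w + h w)"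
    using avg_pow_add[of 1 g h] martingalesD(1)[OF g] martingalesD(1)[OF h] by (simp add: fun_eq_iff)
  ultimately show ?thesis by (auto simp: martingales_def)
qed

lemma martingales_scale: "h \<in> martingales \<Longrightarrow> (\<lambda>w. c * h w) \<in> martingales"
proof -
  assume h: "h \<in> martingales"
  obtain C where C: "\<forall>w. \<bar>h w\<bar> \<le> C" using martingalesD(2)[OF h] by blast
  have "\<bar>c * h w\<bar> \<le> \<bar>c\<bar> * C" for w using C by (simp add: abs_mult mult_left_mono)
  moreover have "avg (\<lambda>w. c * h w) = (\<lambda>w. c * h w)"
    using avg_pow_scale[of 1 c h] martingalesD(1)[OF h] by (simp add: fun_eq_iff)
  ultimately show ?thesis by (auto simp: martingales_def)
qed

lemma martingales_const: "(\<lambda>_. c) \<in> martingales"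
  by (auto simp: martingales_def avg_def fun_eq_iff)

lemma subspace_tree: "subspace (carrier tree)"
proof (rule subspaceI)
  show "0 \<in> carrier tree" using martingales_const[of 0] by (simp add: tree_def)
  show "f + g \<in> carrier tree" if "f \<in> carrier tree" "g \<in> carrier tree" for f g
    using that martingales_add by (auto simp: tree_def)
  show "c *\<^sub>R f \<in> carrier tree" if "f \<in> carrier tree" for c f
    using that martingales_scale by (auto simp: tree_def)
qed

lemma tree_sup:
  assumes D: "D \<subseteq> carrier tree" "D \<noteq> {}" and u: "u \<in> carrier tree" "\<And>f. f \<in> D \<Longrightarrow> f \<sqsubseteq>\<^bsub>tree\<^esub> u"
  shows "\<exists>s. least tree s (Upper tree D)"
proof -
  obtain h where h: "h \<in> martingales" "\<And>f w. f \<in> (\<lambda>f w. f (enc w)) ` D \<Longrightarrow> f w \<le> h w"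
    "\<And>v w. v \<in> martingales \<Longrightarrow> (\<And>f w. f \<in> (\<lambda>f w. f (enc w)) ` D \<Longrightarrow> f w \<le> v w) \<Longrightarrow> h w \<le> v w"
  proof (rule martingale_sup[of "(\<lambda>f w. f (enc w)) ` D" "\<lambda>w. u (enc w)"])
    show "(\<lambda>f w. f (enc w)) ` D \<subseteq> martingales" using D tree_martingale by blast
    show "(\<lambda>w. u (enc w)) \<in> martingales" by (rule tree_martingale[OF u(1)])
  qed (use D u(2) in \<open>auto simp: tree_le\<close>)
  have "least tree (extend h) (Upper tree D)"
    unfolding least_def
  proof (intro conjI ballI)
    show "Upper tree D \<subseteq> carrier tree" by (auto simp: Upper_def)
    show "extend h \<in> Upper tree D" using h(1,2) extend_tree by (auto simp: Upper_def tree_le)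
    fix v assume v: "v \<in> Upper tree D"
    show "extend h \<sqsubseteq>\<^bsub>tree\<^esub> v" unfolding tree_le
    proof
      fix w
      have "h w \<le> (\<lambda>w. v (enc w)) w"
        using v D by (intro h(3) tree_martingale) (auto simp: Upper_def tree_le subset_iff)
      then show "extend h (enc w) \<le> v (enc w)" by simp
    qed
  qed
  then show ?thesis by blast
qed

definition one :: "real \<Rightarrow> real"
  where "one = extend (\<lambda>_. 1)"

lemma one_enc [simp]: "one (enc w) = 1"
  by (simp add: one_def)

lemma one_tree [simp]: "one \<in> carrier tree"
  unfolding one_def by (rule extend_tree[OF martingales_const])

lemma tree_bounded: "f \<in> carrier tree \<Longrightarrow> \<exists>C\<ge>0. \<forall>w. \<bar>f (enc w)\<bar> \<le> C"
  using martingalesD(2)[OF tree_martingale] by (metis abs_ge_zero order_trans)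

lemma tree_dedekind_complete: "dedekind_complete_vector_lattice tree"
proof -
  have po: "partial_order tree"
  proof
    show "f .=\<^bsub>tree\<^esub> g" if "f \<sqsubseteq>\<^bsub>tree\<^esub> g" "g \<sqsubseteq>\<^bsub>tree\<^esub> f" "f \<in> carrier tree" "g \<in> carrier tree" for f g
    proof -
      have "f = g" using that by (intro tree_eqI) (auto simp: tree_le intro: antisym)
      then show ?thesis by (simp add: tree_def)
    qed
    show "f \<sqsubseteq>\<^bsub>tree\<^esub> h" if "f \<sqsubseteq>\<^bsub>tree\<^esub> g" "g \<sqsubseteq>\<^bsub>tree\<^esub> h" for f g h
      using that by (auto simp: tree_le intro: order_trans)
  qed (auto simp: tree_def)
  interpret partial_order tree by (rule po)
  note sub = subspace_add[OF subspace_tree] subspace_scale[OF subspace_tree] subspace_neg[OF subspace_tree]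
  have sup2: "\<exists>s. least tree s (Upper tree {f, g})" if fg: "f \<in> carrier tree" "g \<in> carrier tree" for f g
  proof -
    obtain C C' where C: "\<forall>w. \<bar>f (enc w)\<bar> \<le> C" "\<forall>w. \<bar>g (enc w)\<bar> \<le> C'"
      using tree_bounded fg by metis
    have "f (enc w) \<le> max C C'" "g (enc w) \<le> max C C'" for w
      using C(1)[rule_format, of w] C(2)[rule_format, of w] by linarith+
    then show ?thesis
      using fg sub by (intro tree_sup[of _ "max C C' *\<^sub>R one"]) (auto simp: tree_le)
  qed
  interpret lattice tree
  proof
    show "\<exists>s. least tree s (Upper tree {f, g})" if "f \<in> carrier tree" "g \<in> carrier tree" for f g
      by (rule sup2[OF that])
    fix f g assume fg: "f \<in> carrier tree" "g \<in> carrier tree"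
    then obtain s where s: "least tree s (Upper tree {- f, - g})" using sup2[of "- f" "- g"] sub(3) by blast
    have sc: "s \<in> carrier tree" using s by (simp add: least_def Upper_def)
    have "greatest tree (- s) (Lower tree {f, g})" unfolding greatest_def
    proof (intro conjI ballI)
      show "- s \<in> Lower tree {f, g}"
        using s fg sc sub(3) by (auto simp: least_def Upper_def Lower_def tree_le minus_le_iff)
      fix z assume z: "z \<in> Lower tree {f, g}"
      then have "- z \<in> Upper tree {- f, - g}" using fg sub(3) by (auto simp: Upper_def Lower_def tree_le)
      then have "s \<sqsubseteq>\<^bsub>tree\<^esub> - z" using s by (simp add: least_def)
      then show "z \<sqsubseteq>\<^bsub>tree\<^esub> - s" by (auto simp: tree_le le_minus_iff)
    qed (auto simp: Lower_def)
    then show "\<exists>s. greatest tree s (Lower tree {f, g})" by blast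
  qed
  show ?thesis
  proof
    show "subspace (carrier tree)" by (rule subspace_tree)
    show "f = 0" if f: "f \<in> carrier tree" and "g \<in> carrier tree" "0 \<sqsubseteq>\<^bsub>tree\<^esub> f"
      and le: "\<And>n::nat. real n *\<^sub>R f \<sqsubseteq>\<^bsub>tree\<^esub> g" for f g
    proof (rule tree_eqI[OF f subspace_0[OF subspace_tree]])
      fix w
      have "0 \<le> f (enc w)" using that(3) by (simp add: tree_le)
      moreover have "real n * f (enc w) \<le> g (enc w)" for n using le[of n] by (simp add: tree_le)
      ultimately show "f (enc w) = 0 (enc w)"
        using reals_Archimedean3[of "f (enc w)"] by (metis less_eq_real_def linorder_not_less zero_fun_apply)
    qed
    fix D assume "D \<subseteq> carrier tree" "D \<noteq> {}" "Upper tree D \<noteq> {}"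
    then show "\<exists>s. least tree s (Upper tree D)"
      by (elim ex_in_conv[THEN iffD2, elim_format] exE, intro tree_sup) (auto simp: Upper_def subset_iff)
  qed (auto simp: tree_le intro: mult_left_mono)
qed

interpretation tree: dedekind_complete_vector_lattice tree
  by (rule tree_dedekind_complete)

notation tree.leq (infix "\<unlhd>" 50)

lemma tree_leq: "f \<in> carrier tree \<Longrightarrow> g \<in> carrier tree \<Longrightarrow> f \<unlhd> g \<longleftrightarrow> (\<forall>w. f (enc w) \<le> g (enc w))"
  by (simp add: tree_le flip: tree.leq_iff)

lemma tree_leqD: "f \<unlhd> g \<Longrightarrow> f (enc w) \<le> g (enc w)"
  using tree_le[of 0 "g - f"] by (simp add: tree.leq_def)

lemma tree_nonnegD: "0 \<unlhd> f \<Longrightarrow> 0 \<le> f (enc w)"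
  using tree_leqD[of 0 f w] by simp

text \<open>Averaging recovers the values of a martingale from its values at deep nodes.\<close>

lemma tree_leq_deep:
  assumes f: "f \<in> carrier tree" and g: "g \<in> carrier tree"
    and le: "\<And>w. k \<le> length w \<Longrightarrow> f (enc w) \<le> g (enc w)"
  shows "f \<unlhd> g"
proof -
  have "f (enc w) \<le> g (enc w)" for w
  proof -
    \<comment> \<open>Truncation to the deep nodes makes the comparison available at all nodes.\<close>
    let ?m = "\<lambda>h w. if k \<le> length w then h (enc w) else (0::real)"
    have "h (enc w) = (avg ^^ k) (?m h) w" if "h \<in> carrier tree" for h
    proof -
      have "h (enc w) = (avg ^^ k) (\<lambda>w. h (enc w)) w"
        using avg_pow_fixed[OF martingalesD(1)[OF tree_martingale[OF that]], of k] by (simp add: fun_eq_iff)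
      also have "\<dots> = (avg ^^ k) (?m h) w" by (rule avg_pow_cong) simp
      finally show ?thesis .
    qed
    then show ?thesis using f g le avg_pow_mono[of "?m f" "?m g" k w] by simp
  qed
  then show ?thesis using f g by (simp add: tree_leq)
qed

lemma tree_root_zero:
  assumes f: "0 \<unlhd> f" and root: "f (enc []) \<le> 0"
  shows "f = 0"
proof (rule tree_eqI)
  show fc: "f \<in> carrier tree" using f by (rule tree.leq_carrier)
  have nn: "0 \<le> f (enc w)" for w by (rule tree_nonnegD[OF f])
  have avg: "f (enc w) = (f (enc (False # w)) + f (enc (True # w))) / 2" for w
    using martingalesD(1)[OF tree_martingale[OF fc]] unfolding avg_def by (metis (full_types))
  have "f (enc w) = 0" for w
  proof (induction w)
    case (Cons b w)
    then show ?case using avg[of w] nn[of "False # w"] nn[of "True # w"] by (cases b) auto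
  qed (use root nn[of "[]"] in simp)
  then show "f (enc w) = 0 (enc w)" for w by simp
qed simp

text \<open>The pointwise infimum of a decreasing net of martingales is a martingale, because averages of two values
  commute with infima over directed sets. So the infimum in the lattice is pointwise.\<close>

lemma tree_decreasing_pointwise:
  assumes y: "decreasing_to_zero tree B s y" and e: "0 < e"
  obtains b where "b \<in> B" "y b (enc w) < e"
proof -
  note D = tree.decreasing_to_zeroD[OF y]
  have ne: "B \<noteq> {}" by (rule directed_byD(1)[OF D(1)])
  define h where "h w = (INF b\<in>B. y b (enc w))" for w
  have y0: "0 \<le> y b (enc w)" if "b \<in> B" for b w using tree_nonnegD[OF D(5)[OF that]] .
  have bdd: "bdd_below ((\<lambda>b. y b (enc w)) ` B)" for w using y0 by (intro bdd_belowI[of _ 0]) auto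
  have h_le: "h w \<le> y b (enc w)" if "b \<in> B" for b w unfolding h_def using bdd that by (rule cINF_lower)
  have h0: "0 \<le> h w" for w unfolding h_def by (rule cINF_greatest[OF ne]) (rule y0)
  have near: "\<exists>b\<in>B. y b (enc w) < h w + d" if "0 < d" for w d
  proof -
    have "(INF b\<in>B. y b (enc w)) < h w + d" using that by (simp add: h_def)
    then show ?thesis by (simp add: cINF_less_iff[OF ne bdd])
  qed
  have y_avg: "y b (enc w) = (y b (enc (False # w)) + y b (enc (True # w))) / 2" if "b \<in> B" for b w
    using martingalesD(1)[OF tree_martingale[OF D(2)[OF that]]] unfolding avg_def by (metis (full_types))
  have "avg h w = h w" for w
  proof (rule antisym)
    have "avg h w \<le> y b (enc w)" if "b \<in> B" for b
      unfolding avg_def using h_le[OF that] y_avg[OF that, of w] by (simp add: add_mono)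
    then show "avg h w \<le> h w" unfolding h_def[of w] by (rule cINF_greatest[OF ne])
    have "h w \<le> avg h w + d" if d: "0 < d" for d
    proof -
      obtain b1 b2 where b: "b1 \<in> B" "y b1 (enc (False # w)) < h (False # w) + d"
        "b2 \<in> B" "y b2 (enc (True # w)) < h (True # w) + d" using near[OF d] by meson
      obtain c where c: "c \<in> B" "s b1 c" "s b2 c" using directed_byD(4)[OF D(1) b(1,3)] by blast
      have "y c (enc (False # w)) \<le> y b1 (enc (False # w))" "y c (enc (True # w)) \<le> y b2 (enc (True # w))"
        using D(3)[OF b(1) c(1,2)] D(3)[OF b(3) c(1,3)] tree_leqD by blast+
      then have "y c (enc (False # w)) + y c (enc (True # w)) \<le> h (False # w) + h (True # w) + 2 * d"
        using b(2,4) by linarith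
      moreover have "h w * 2 \<le> y c (enc (False # w)) + y c (enc (True # w))"
        using h_le[OF c(1), of w] y_avg[OF c(1), of w] by simp
      ultimately show ?thesis by (simp add: avg_def field_simps)
    qed
    then show "h w \<le> avg h w" by (rule field_le_epsilon)
  qed
  moreover have "\<exists>C. \<forall>w. \<bar>h w\<bar> \<le> C"
  proof -
    obtain b where b: "b \<in> B" using ne by blast
    obtain C where "\<forall>w. \<bar>y b (enc w)\<bar> \<le> C" using tree_bounded[OF D(2)[OF b]] by blast
    then have "\<bar>h w\<bar> \<le> C" for w using h0[of w] h_le[OF b, of w] by (smt (verit))
    then show ?thesis by blast
  qed
  ultimately have h: "h \<in> martingales" by (auto simp: martingales_def)
  have "extend h \<unlhd> 0"
  proof (rule tree.is_infD(2)[OF D(4)])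
    fix d assume "d \<in> y ` B"
    then show "extend h \<unlhd> d" using h_le D(2) extend_tree[OF h] by (auto simp: tree_leq)
  qed
  then have "h w \<le> 0" using tree_leqD[of "extend h" 0 w] by simp
  then have "\<exists>b\<in>B. y b (enc w) < e" using near[OF e, of w] by force
  then show thesis using that by blast
qed

section \<open>The topology of convergence in probability of truncations\<close>

text \<open>The value at the root is the integral, so these sets describe convergence in probability.\<close>

definition tree_base :: "(real \<Rightarrow> real) set set"
  where "tree_base = {{f \<in> carrier tree. (vabs tree f \<sqinter>\<^bsub>tree\<^esub> u) (enc []) < e} | u e. 0 \<unlhd> u \<and> 0 < e}"

lemma tree_uo_Lebesgue_base: "uo_Lebesgue_base tree tree_base"
proof -
  let ?N = "\<lambda>u e. {f \<in> carrier tree. (vabs tree f \<sqinter>\<^bsub>tree\<^esub> u) (enc []) < e}"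
  have in_base: "?N u e \<in> tree_base" if "0 \<unlhd> u" "0 < e" for u e using that unfolding tree_base_def by blast
  have base: thesis if "W \<in> tree_base" "\<And>u e. W = ?N u e \<Longrightarrow> 0 \<unlhd> u \<Longrightarrow> 0 < e \<Longrightarrow> thesis" for W thesis
    using that unfolding tree_base_def by blast
  show ?thesis
  proof
    show "tree_base \<noteq> {}" using in_base[of 0 1] by auto
  next
    fix W assume W: "W \<in> tree_base"
    from W show "solid tree W"
    proof (rule base)
      fix u e assume N: "W = ?N u e" and u: "0 \<unlhd> u"
      show ?thesis unfolding N
      proof (rule tree.solidI)
        fix f g assume f: "f \<in> carrier tree" and g: "g \<in> ?N u e" and le: "vabs tree f \<unlhd> vabs tree g"
        have "vabs tree f \<sqinter>\<^bsub>tree\<^esub> u \<unlhd> vabs tree g \<sqinter>\<^bsub>tree\<^esub> u"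
          using f u le tree.leq_carrier by (intro tree.meet_mono) auto
        then show "f \<in> ?N u e" using tree_leqD[of _ _ "[]"] f g by fastforce
      qed auto
    qed
    from W show "0 \<in> W"
    proof (rule base)
      fix u e assume "W = ?N u e" "0 \<unlhd> u" "0 < e"
      then show ?thesis by (simp add: tree.meet_absorb1)
    qed
    from W show "\<exists>V\<in>tree_base. \<forall>f\<in>V. \<forall>g\<in>V. f + g \<in> W"
    proof (rule base)
      fix u and e :: real assume N: "W = ?N u e" and u: "0 \<unlhd> u" and e: "0 < e"
      have "f + g \<in> W" if "f \<in> ?N u (e/2)" "g \<in> ?N u (e/2)" for f g
        unfolding N using that tree_leqD[OF tree.meet_triangle[of f g u], of "[]"] u by auto
      then show ?thesis using in_base[OF u, of "e/2"] e by (intro bexI[of _ "?N u (e/2)"]) auto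
    qed
    show "\<exists>c>0. c *\<^sub>R f \<in> W" if f: "f \<in> carrier tree" for f
      using W
    proof (rule base)
      fix u and e :: real assume N: "W = ?N u e" and u: "0 \<unlhd> u" and e: "0 < e"
      let ?v = "vabs tree f (enc [])"
      have v: "0 \<le> ?v" by (rule tree_nonnegD[OF tree.vabs_nonneg[OF f]])
      define c where "c = e / (?v + 1)"
      have c: "0 < c" "c * ?v < e" using v e by (auto simp: c_def field_simps)
      have cf: "c *\<^sub>R f \<in> carrier tree" using f by simp
      have "vabs tree (c *\<^sub>R f) \<sqinter>\<^bsub>tree\<^esub> u \<unlhd> vabs tree (c *\<^sub>R f)"
        using cf u tree.leq_carrier by (intro tree.meet_leq1) auto
      also have "vabs tree (c *\<^sub>R f) \<unlhd> \<bar>c\<bar> *\<^sub>R vabs tree f" by (rule tree.vabs_scaleR_leq[OF f])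
      finally (tree.ord.order_trans) have "(vabs tree (c *\<^sub>R f) \<sqinter>\<^bsub>tree\<^esub> u) (enc []) \<le> c * ?v"
        using tree_leqD[of _ "\<bar>c\<bar> *\<^sub>R vabs tree f" "[]"] c by simp
      then show ?thesis unfolding N using c cf by auto
    qed
    show "\<exists>X\<in>tree_base. X \<subseteq> V \<inter> W" if V: "V \<in> tree_base" for V
      using W
    proof (rule base)
      fix u e assume N: "W = ?N u e" and u: "0 \<unlhd> u" and e: "0 < e"
      from V show ?thesis
      proof (rule base)
        fix u' e' assume N': "V = ?N u' e'" and u': "0 \<unlhd> u'" and e': "0 < e'"
        let ?X = "?N (u + u') (min e e')"
        have "f \<in> V \<inter> W" if f: "f \<in> ?X" for f
        proof -
          have "vabs tree f \<sqinter>\<^bsub>tree\<^esub> u \<unlhd> vabs tree f \<sqinter>\<^bsub>tree\<^esub> (u + u')"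
            "vabs tree f \<sqinter>\<^bsub>tree\<^esub> u' \<unlhd> vabs tree f \<sqinter>\<^bsub>tree\<^esub> (u + u')"
            using f u u' tree.leq_carrier by (intro tree.meet_mono; simp)+
          from this[THEN tree_leqD, of "[]"] show ?thesis using f unfolding N N' by auto
        qed
        moreover have "?X \<in> tree_base" using u u' e e' by (intro in_base) (auto intro: tree.ord.add_nonneg_nonneg)
        ultimately show ?thesis by blast
      qed
    qed
    show "\<exists>\<alpha>\<^sub>0\<in>A. \<forall>\<alpha>\<in>A. r \<alpha>\<^sub>0 \<alpha> \<longrightarrow> f \<alpha> \<in> W"
      if A: "directed_by A r" and f: "f \<in> A \<rightarrow> carrier tree" and uo: "uo_conv tree A r f 0"
      for A :: "(real \<Rightarrow> real) net_index set" and r f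
      using W
    proof (rule base)
      fix u and e :: real assume N: "W = ?N u e" and u: "0 \<unlhd> u" and e: "0 < e"
      let ?g = "\<lambda>\<alpha>. vabs tree (f \<alpha> - 0) \<sqinter>\<^bsub>tree\<^esub> u"
      have fc: "f \<alpha> \<in> carrier tree" if "\<alpha> \<in> A" for \<alpha> using f that by auto
      have g0: "0 \<unlhd> ?g \<alpha>" if "\<alpha> \<in> A" for \<alpha>
        using tree.vabs_nonneg[OF fc[OF that]] u by (simp add: tree.leq_carrier)
      have gc: "?g \<alpha> \<in> carrier tree" if "\<alpha> \<in> A" for \<alpha> using g0[OF that] by (rule tree.leq_carrier)
      have oc: "order_conv tree A r ?g 0" by (rule tree.uo_convD[OF uo u])
      obtain B :: "(real \<Rightarrow> real) set" and s y where dec: "decreasing_to_zero tree B s y"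
        and dom: "\<And>b. b \<in> B \<Longrightarrow> \<exists>\<alpha>\<^sub>0\<in>A. \<forall>\<alpha>\<in>A. r \<alpha>\<^sub>0 \<alpha> \<longrightarrow> vabs tree (0 - ?g \<alpha>) \<unlhd> y b"
        using tree.order_conv_leqE[OF oc gc tree.zero_closed] by blast
      obtain b where b: "b \<in> B" "y b (enc []) < e" by (rule tree_decreasing_pointwise[OF dec e])
      obtain \<alpha>\<^sub>0 where a0: "\<alpha>\<^sub>0 \<in> A" "\<forall>\<alpha>\<in>A. r \<alpha>\<^sub>0 \<alpha> \<longrightarrow> vabs tree (0 - ?g \<alpha>) \<unlhd> y b" using dom[OF b(1)] by blast
      have "f \<alpha> \<in> W" if a: "\<alpha> \<in> A" "r \<alpha>\<^sub>0 \<alpha>" for \<alpha>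
      proof -
        have "vabs tree (0 - ?g \<alpha>) \<unlhd> y b" using a0(2) a by blast
        then have "?g \<alpha> \<unlhd> y b" using g0[OF a(1)] gc[OF a(1)] by (simp add: tree.vabs_of_nonneg)
        from tree_leqD[OF this, of "[]"] show ?thesis unfolding N using b(2) fc[OF a(1)] by simp
      qed
      then show ?thesis using a0(1) by blast
    qed
  next
    fix f assume f: "f \<in> carrier tree" and all: "\<And>W. W \<in> tree_base \<Longrightarrow> f \<in> W"
    have V: "vabs tree f \<in> carrier tree" "0 \<unlhd> vabs tree f" using f tree.vabs_nonneg by auto
    have "vabs tree f (enc []) < e" if "0 < e" for e
      using all[OF in_base[OF V(2) that]] V by (simp add: tree.meet_absorb1)
    then have "vabs tree f (enc []) \<le> 0" by (meson linorder_not_le order_less_irrefl)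
    then have "vabs tree f = 0" using V(2) by (intro tree_root_zero)
    then show "f = 0" using tree.vabs_eq_zero[OF f] by simp
  qed
qed

lemma tree_admits: "admits_Hausdorff_uo_Lebesgue tree"
proof -
  interpret B: uo_Lebesgue_base tree tree_base by (rule tree_uo_Lebesgue_base)
  interpret U: uo_Lebesgue_lattice tree B.base_topology by (rule B.uo_Lebesgue_lattice_base)
  show ?thesis unfolding admits_Hausdorff_uo_Lebesgue_def using U.uo_Lebesgue U.Hausdorff by blast
qed

lemma tree_admissible: "admissible c1 c2 tree"
  using tree_dedekind_complete tree_admits by (simp add: admissible_def)

interpretation tree: dedekind_complete_uo_Lebesgue_lattice tree "tau_hat tree"
  by (rule tree.tau_hat_uo_Lebesgue[OF tree_admits])

lemma tree_limitin_nullI: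
  assumes A: "directed_by A r" and f: "\<And>\<alpha>. \<alpha> \<in> A \<Longrightarrow> f \<alpha> \<in> carrier tree"
    and le: "\<And>\<alpha>. \<alpha> \<in> A \<Longrightarrow> vabs tree (f \<alpha>) \<unlhd> g \<alpha>"
    and lim: "\<And>e. 0 < e \<Longrightarrow> \<exists>\<alpha>\<^sub>0\<in>A. \<forall>\<alpha>\<in>A. r \<alpha>\<^sub>0 \<alpha> \<longrightarrow> g \<alpha> (enc []) < e"
  shows "limitin (tau_hat tree) f 0 (tail_filter A r)"
proof -
  interpret B: uo_Lebesgue_base tree tree_base by (rule tree_uo_Lebesgue_base)
  show ?thesis unfolding tree.tau_hat_eqI[OF B.uo_Lebesgue_lattice_base]
  proof (rule B.limitin_null_baseI[OF A])
    show "f \<in> A \<rightarrow> carrier tree" using f by blast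
    fix W assume "W \<in> tree_base"
    then obtain u e where N: "W = {f \<in> carrier tree. (vabs tree f \<sqinter>\<^bsub>tree\<^esub> u) (enc []) < e}"
      and u: "0 \<unlhd> u" and e: "0 < e" unfolding tree_base_def by blast
    obtain \<alpha>\<^sub>0 where a0: "\<alpha>\<^sub>0 \<in> A" "\<forall>\<alpha>\<in>A. r \<alpha>\<^sub>0 \<alpha> \<longrightarrow> g \<alpha> (enc []) < e" using lim[OF e] by blast
    have "f \<alpha> \<in> W" if a: "\<alpha> \<in> A" "r \<alpha>\<^sub>0 \<alpha>" for \<alpha>
    proof -
      have "vabs tree (f \<alpha>) \<sqinter>\<^bsub>tree\<^esub> u \<unlhd> vabs tree (f \<alpha>)"
        using f[OF a(1)] u tree.leq_carrier by (intro tree.meet_leq1) auto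
      also have "\<dots> \<unlhd> g \<alpha>" by (rule le[OF a(1)])
      finally (tree.ord.order_trans) have "(vabs tree (f \<alpha>) \<sqinter>\<^bsub>tree\<^esub> u) (enc []) \<le> g \<alpha> (enc [])" by (rule tree_leqD)
      moreover have "g \<alpha> (enc []) < e" using a0(2) a by blast
      ultimately show ?thesis unfolding N using f[OF a(1)] by simp
    qed
    then show "\<exists>\<alpha>\<^sub>0\<in>A. \<forall>\<alpha>\<in>A. r \<alpha>\<^sub>0 \<alpha> \<longrightarrow> f \<alpha> \<in> W" using a0(1) by blast
  qed
qed

section \<open>Positive operators on the tree lattice\<close>

interpretation treeL: dedekind_complete_uo_Lebesgue_lattice "Lob tree" "tau_hat (Lob tree)"
  by (rule tree.Lob_uo_Lebesgue)

text \<open>Operators are given by their action \<open>t\<close> on martingales as functions on the nodes.\<close>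

definition tree_op :: "((bool list \<Rightarrow> real) \<Rightarrow> bool list \<Rightarrow> real) \<Rightarrow> (real \<Rightarrow> real) \<Rightarrow> real \<Rightarrow> real"
  where "tree_op t f = (if f \<in> carrier tree then extend (t (\<lambda>w. f (enc w))) else 0)"

lemma tree_op_apply: "f \<in> carrier tree \<Longrightarrow> tree_op t f (enc w) = t (\<lambda>w. f (enc w)) w"
  by (simp add: tree_op_def)

lemma tree_op_nonneg:
  assumes closed: "\<And>h. h \<in> martingales \<Longrightarrow> t h \<in> martingales"
    and add: "\<And>g h w. g \<in> martingales \<Longrightarrow> h \<in> martingales \<Longrightarrow> t (\<lambda>w. g w + h w) w = t g w + t h w"
    and scale: "\<And>c h w. h \<in> martingales \<Longrightarrow> t (\<lambda>w. c * h w) w = c * t h w"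
    and nonneg: "\<And>h w. h \<in> martingales \<Longrightarrow> (\<And>w. 0 \<le> h w) \<Longrightarrow> 0 \<le> t h w"
  shows "treeL.leq 0 (tree_op t)"
proof -
  note M = tree_martingale
  have c: "tree_op t f \<in> carrier tree" if "f \<in> carrier tree" for f
    using that closed[OF M[OF that]] by (simp add: tree_op_def extend_tree)
  have pos: "0 \<unlhd> tree_op t f" if "0 \<unlhd> f" for f
  proof -
    have fc: "f \<in> carrier tree" using that by (rule tree.leq_carrier)
    then show ?thesis
      using nonneg[OF M[OF fc]] tree_nonnegD[OF that] c[OF fc] by (simp add: tree_leq tree_op_apply)
  qed
  have "tree_op t \<in> linear_operators tree"
    unfolding linear_operators_def
  proof (intro CollectI conjI ballI allI impI)
    show "tree_op t \<in> carrier tree \<rightarrow> carrier tree" using c by blast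
    show "tree_op t f = 0" if "f \<notin> carrier tree" for f using that by (simp add: tree_op_def)
    fix f assume f: "f \<in> carrier tree"
    show "tree_op t (f + g) = tree_op t f + tree_op t g" if g: "g \<in> carrier tree" for g
      by (rule tree_eqI) (use f g c add[OF M M] in \<open>simp_all add: tree_op_apply tree.add_closed\<close>)
    show "tree_op t (a *\<^sub>R f) = a *\<^sub>R tree_op t f" for a
      by (rule tree_eqI) (use f c scale[OF M] in \<open>simp_all add: tree_op_apply tree.scaleR_closed\<close>)
  qed
  then have "tree_op t \<in> carrier (Lob tree)" using pos by (rule tree.positive_operator_Lob)
  then show ?thesis using pos by (simp add: tree.Lob_leq_iff)
qed

section \<open>Operators of rank one\<close>

definition rank_one :: "((bool list \<Rightarrow> real) \<Rightarrow> real) \<Rightarrow> (real \<Rightarrow> real) \<Rightarrow> (real \<Rightarrow> real) \<Rightarrow> real \<Rightarrow> real"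
  where "rank_one \<phi> e f = (if f \<in> carrier tree then \<phi> (\<lambda>w. f (enc w)) *\<^sub>R e else 0)"

definition positive_functional :: "((bool list \<Rightarrow> real) \<Rightarrow> real) \<Rightarrow> bool"
  where "positive_functional \<phi> \<longleftrightarrow>
    (\<forall>g\<in>martingales. \<forall>h\<in>martingales. \<phi> (\<lambda>w. g w + h w) = \<phi> g + \<phi> h) \<and>
    (\<forall>c. \<forall>h\<in>martingales. \<phi> (\<lambda>w. c * h w) = c * \<phi> h) \<and>
    (\<forall>h\<in>martingales. (\<forall>w. 0 \<le> h w) \<longrightarrow> 0 \<le> \<phi> h)"

lemma positive_functional_eval: "positive_functional (\<lambda>h. h v)"
  by (simp add: positive_functional_def)

lemma rank_one_nonneg:
  assumes \<phi>: "positive_functional \<phi>" and e: "0 \<unlhd> e"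
  shows "treeL.leq 0 (rank_one \<phi> e)"
proof -
  have ec: "e \<in> carrier tree" using e by (rule tree.leq_carrier)
  have eq: "rank_one \<phi> e = tree_op (\<lambda>h w. \<phi> h * e (enc w))"
  proof (rule ext)
    fix f show "rank_one \<phi> e f = tree_op (\<lambda>h w. \<phi> h * e (enc w)) f"
    proof (cases "f \<in> carrier tree")
      case True
      show ?thesis
      proof (rule tree_eqI)
        show "rank_one \<phi> e f \<in> carrier tree" using True ec by (simp add: rank_one_def)
        show "tree_op (\<lambda>h w. \<phi> h * e (enc w)) f \<in> carrier tree"
          using True martingales_scale[OF tree_martingale[OF ec]] by (simp add: tree_op_def extend_tree)
      qed (use True in \<open>simp add: rank_one_def tree_op_apply\<close>)
    qed (simp add: rank_one_def tree_op_def)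
  qed
  show ?thesis unfolding eq
    by (rule tree_op_nonneg)
      (use \<phi> tree_nonnegD[OF e] martingales_scale[OF tree_martingale[OF ec]] in
        \<open>auto simp: positive_functional_def algebra_simps\<close>)
qed

lemma rank_one_Lob: "positive_functional \<phi> \<Longrightarrow> 0 \<unlhd> e \<Longrightarrow> rank_one \<phi> e \<in> carrier (Lob tree)"
  using treeL.leq_carrier[OF rank_one_nonneg] .

lemma rank_one_apply: "f \<in> carrier tree \<Longrightarrow> rank_one \<phi> e f = \<phi> (\<lambda>w. f (enc w)) *\<^sub>R e"
  by (simp add: rank_one_def)

lemma one_nonneg: "0 \<unlhd> one"
  by (simp add: tree_leq)

lemma one_nonzero: "one \<noteq> 0"
  using one_enc[of "[]"] by (metis zero_fun_apply zero_neq_one)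

lemma rank_one_one_nonzero: "\<phi> (\<lambda>_. 1) = 1 \<Longrightarrow> rank_one \<phi> one \<noteq> 0"
proof
  assume a: "\<phi> (\<lambda>_. 1) = 1" and z: "rank_one \<phi> one = 0"
  from a have "rank_one \<phi> one one = one" by (simp add: rank_one_apply)
  then show False using z one_nonzero by simp
qed

section \<open>Restriction to cylinders\<close>

text \<open>Nodes are lists whose head is the most recent step, so that the ancestor of \<open>w\<close> at level \<open>m\<close> is the
  suffix of \<open>w\<close> of length \<open>m\<close>.\<close>

definition mask :: "nat \<Rightarrow> bool list set \<Rightarrow> (bool list \<Rightarrow> real) \<Rightarrow> bool list \<Rightarrow> real"
  where "mask m V h w = (if drop (length w - m) w \<in> V then h w else 0)"

text \<open>The martingale that agrees with \<open>mask m V h\<close> from level \<open>m\<close> on, that is, \<open>h\<close> multiplied by the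
  indicator of the union of the cylinders of the nodes in \<open>V\<close>.\<close>

definition cut :: "nat \<Rightarrow> bool list set \<Rightarrow> (bool list \<Rightarrow> real) \<Rightarrow> bool list \<Rightarrow> real"
  where "cut m V h = (avg ^^ m) (mask m V h)"

lemma avg_mask:
  assumes "h \<in> martingales" "m \<le> length w"
  shows "avg (mask m V h) w = mask m V h w"
proof -
  have "avg h w = h w" using martingalesD(1)[OF assms(1)] by simp
  then show ?thesis using assms(2) by (simp add: avg_def mask_def Suc_diff_le)
qed

lemma cut_deep:
  assumes "h \<in> martingales" "m \<le> length w"
  shows "cut m V h w = mask m V h w"
proof -
  have "(avg ^^ k) (mask m V h) w = mask m V h w" if "m \<le> length w" for k w
    using that
  proof (induction k arbitrary: w)
    case (Suc k)
    have "(avg ^^ Suc k) (mask m V h) w = avg (mask m V h) w"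
      using Suc.IH[of "False # w"] Suc.IH[of "True # w"] Suc.prems
      by (simp add: avg_pow_Suc avg_def[of "mask m V h"] del: funpow.simps)
    then show ?case using avg_mask[OF assms(1)] Suc.prems by simp
  qed simp
  then show ?thesis using assms(2) by (simp add: cut_def)
qed

lemma cut_martingale:
  assumes h: "h \<in> martingales"
  shows "cut m V h \<in> martingales"
proof -
  have "avg (cut m V h) w = cut m V h w" for w
  proof -
    have "avg (cut m V h) w = (avg ^^ m) (avg (mask m V h)) w"
      unfolding cut_def by (metis comp_apply funpow.simps(2) funpow_Suc_right)
    also have "\<dots> = cut m V h w" unfolding cut_def by (rule avg_pow_cong) (simp add: avg_mask[OF h])
    finally show ?thesis by simp
  qed
  moreover obtain C where C: "\<forall>w. \<bar>h w\<bar> \<le> C" using martingalesD(2)[OF h] by blast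
  moreover have "\<bar>mask m V h w\<bar> \<le> C" for w
    using C[rule_format, of w] by (auto simp: mask_def intro: order_trans[OF abs_ge_zero])
  then have "\<bar>cut m V h w\<bar> \<le> C" for w unfolding cut_def by (rule avg_pow_bounded)
  ultimately show ?thesis by (auto simp: martingales_def)
qed

definition restrict_op :: "nat \<Rightarrow> bool list set \<Rightarrow> (real \<Rightarrow> real) \<Rightarrow> real \<Rightarrow> real"
  where "restrict_op m V = tree_op (cut m V)"

lemma restrict_op_nonneg: "treeL.leq 0 (restrict_op m V)"
  unfolding restrict_op_def
proof (rule tree_op_nonneg[OF cut_martingale])
  have "mask m V (\<lambda>w. g w + h w) = (\<lambda>w. mask m V g w + mask m V h w)" for g h by (auto simp: mask_def)
  then show "cut m V (\<lambda>w. g w + h w) w = cut m V g w + cut m V h w" for g h w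
    by (simp add: cut_def avg_pow_add)
  have "mask m V (\<lambda>w. c * h w) = (\<lambda>w. c * mask m V h w)" for c h by (auto simp: mask_def)
  then show "cut m V (\<lambda>w. c * h w) w = c * cut m V h w" for c h w by (simp add: cut_def avg_pow_scale)
  show "0 \<le> cut m V h w" if "\<And>w. 0 \<le> h w" for h w
    using avg_pow_mono[of "\<lambda>_. 0" "mask m V h" m w] that by (simp add: cut_def avg_pow_const mask_def)
qed

lemmas restrict_op_Lob [simp] = tree.Lob_nonnegD(1)[OF restrict_op_nonneg]

lemma restrict_op_closed [simp]: "f \<in> carrier tree \<Longrightarrow> restrict_op m V f \<in> carrier tree"
  by (rule LobD(1)[OF restrict_op_Lob])

lemma restrict_op_deep:
  "f \<in> carrier tree \<Longrightarrow> m \<le> length w \<Longrightarrow>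
    restrict_op m V f (enc w) = (if drop (length w - m) w \<in> V then f (enc w) else 0)"
  by (simp add: restrict_op_def tree_op_apply cut_deep tree_martingale mask_def)

lemma restrict_op_leq: "0 \<unlhd> f \<Longrightarrow> restrict_op m V f \<unlhd> f"
  by (rule tree_leq_deep[of _ _ m])
    (auto simp: restrict_op_deep tree.leq_carrier intro: tree_nonnegD)

lemma avg_pow_point:
  "(avg ^^ n) (\<lambda>w. if w = v then c else 0) u = (if length v = n + length u \<and> drop n v = u then c / 2 ^ n else 0)"
proof (induction n arbitrary: u)
  case (Suc n)
  have "drop n v = v ! n # drop (Suc n) v" if "length v = Suc n + length u"
    using that by (simp add: Cons_nth_drop_Suc)
  then show ?case unfolding avg_pow_Suc Suc.IH by (cases "v ! n") auto
qed auto

abbreviation cyl :: "bool list \<Rightarrow> (real \<Rightarrow> real) \<Rightarrow> real \<Rightarrow> real"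
  where "cyl v \<equiv> restrict_op (length v) {v}"

lemma cyl_root:
  assumes "f \<in> carrier tree"
  shows "cyl v f (enc []) = f (enc v) / 2 ^ length v"
proof -
  have "cyl v f (enc []) = (avg ^^ length v) (mask (length v) {v} (\<lambda>w. f (enc w))) []"
    using assms by (simp add: restrict_op_def tree_op_apply cut_def)
  also have "\<dots> = (avg ^^ length v) (\<lambda>w. if w = v then f (enc v) else 0) []"
    by (rule avg_pow_cong) (auto simp: mask_def)
  also have "\<dots> = f (enc v) / 2 ^ length v" by (simp add: avg_pow_point)
  finally show ?thesis .
qed

section \<open>Comparing the modes of convergence\<close>

text \<open>Every mode implies one of the two topological ones, so that a net is shown not to converge in several
  modes at once by refuting a topological one.\<close>

lemma tree_mode_weaken:
  assumes A: "directed_by A r" and S: "S \<in> A \<rightarrow> carrier (Lob tree)" and conv: "mode_conv c tree A r S 0"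
  shows "c \<in> {Mode_o, Mode_uo, Mode_tau} \<Longrightarrow> mode_conv Mode_tau tree A r S 0"
    and "c \<notin> {Mode_uo, Mode_tau} \<Longrightarrow> mode_conv Mode_Stau tree A r S 0"
proof -
  note z = treeL.zero_closed
  have uo: "mode_conv Mode_tau tree A r S 0" if "mode_conv Mode_uo tree A r S 0"
    using tree.mode_uo_imp_tau[OF tree_admits A S z that] .
  have SUO: "mode_conv Mode_Stau tree A r S 0" if "mode_conv Mode_SUO tree A r S 0"
    using tree.mode_SUO_imp_Stau[OF tree_admits A S z that] .
  have SO: "mode_conv Mode_Stau tree A r S 0" if "mode_conv Mode_SO tree A r S 0"
    using SUO[OF tree.mode_SO_imp_SUO[OF S z that]] .
  show "c \<in> {Mode_o, Mode_uo, Mode_tau} \<Longrightarrow> mode_conv Mode_tau tree A r S 0"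
    using conv uo tree.mode_o_imp_uo[OF S z] by blast
  show "c \<notin> {Mode_uo, Mode_tau} \<Longrightarrow> mode_conv Mode_Stau tree A r S 0"
    using conv SUO SO tree.mode_o_imp_SO[OF S z] by (cases c) blast+
qed

lemma tree_mode_const:
  assumes A: "directed_by A r" and S: "S \<in> carrier (Lob tree)" and conv: "mode_conv c tree A r (\<lambda>_. S) 0"
  shows "S = 0"
proof (cases "c \<in> {Mode_o, Mode_uo, Mode_tau}")
  case True
  have "mode_conv Mode_tau tree A r (\<lambda>_. S) 0" by (rule tree_mode_weaken(1)[OF A _ conv True]) (use S in simp)
  then show ?thesis using treeL.limitin_const[OF treeL.Hausdorff A S] by simp
next
  case False
  have Stau: "mode_conv Mode_Stau tree A r (\<lambda>_. S) 0"
    by (rule tree_mode_weaken(2)[OF A _ conv]) (use S False in auto)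
  have "S x = 0" if x: "0 \<unlhd> x" for x
  proof -
    have xc: "x \<in> carrier tree" using x by (rule tree.leq_carrier)
    then show ?thesis
      using Stau tree.limitin_const[OF tree.Hausdorff A LobD(1)[OF S xc]] by simp
  qed
  then show ?thesis by (intro tree.Lob_eqI[OF S treeL.zero_closed]) simp
qed

definition ident :: "(real \<Rightarrow> real) \<Rightarrow> real \<Rightarrow> real"
  where "ident f = (if f \<in> carrier tree then f else 0)"

lemma ident_Lob: "ident \<in> carrier (Lob tree)"
  by (rule tree.positive_operator_Lob)
    (auto simp: linear_operators_def ident_def tree.leq_carrier)

lemma ident_Orth: "ident \<in> Orth tree"
proof -
  have "ident f \<in> B" if "band tree B" "f \<in> B" for B f
    using that by (auto simp: band_def solid_def ident_def)
  then show ?thesis using ident_Lob by (auto simp: Orth_def)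
qed

lemma ident_comp: "S \<in> carrier (Lob tree) \<Longrightarrow> left_mult ident S = S"
  using LobD(1,4)[of S tree] by (auto simp: left_mult_def ident_def fun_eq_iff)

lemma not_continuous_identity:
  fixes S :: "'i \<Rightarrow> (real \<Rightarrow> real) \<Rightarrow> real \<Rightarrow> real"
  assumes A: "directed_by UNIV r" and S: "\<And>\<alpha>. S \<alpha> \<in> carrier (Lob tree)"
    and c1: "mode_conv c1 tree UNIV r S 0" and c2: "\<not> mode_conv c2 tree UNIV r S 0"
  shows "\<exists>T\<in>Orth tree. \<not> mode_continuous c1 c2 tree (left_mult T)"
proof (intro bexI[OF _ ident_Orth] notI)
  assume "mode_continuous c1 c2 tree (left_mult ident)"
  from mode_continuousD[OF this A _ treeL.zero_closed c1]
  have "mode_conv c2 tree UNIV r (\<lambda>\<alpha>. left_mult ident (S \<alpha>)) (left_mult ident 0)" using S by blast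
  then show False using c2 S by (simp add: ident_comp)
qed

text \<open>Constant nets converge in all modes to their value only, so one net refutes continuity for all \<open>c2\<close>.\<close>

lemma not_continuous_const:
  fixes S :: "'i \<Rightarrow> (real \<Rightarrow> real) \<Rightarrow> real \<Rightarrow> real"
  assumes A: "directed_by UNIV r" and S: "\<And>\<alpha>. S \<alpha> \<in> carrier (Lob tree)"
    and c1: "mode_conv c1 tree UNIV r S 0" and T: "T \<in> carrier (Lob tree)"
    and TS: "\<And>\<alpha>. left_mult T (S \<alpha>) = R" and R: "R \<in> carrier (Lob tree)" "R \<noteq> 0"
  shows "\<not> mode_continuous c1 c2 tree (left_mult T)"
proof
  assume "mode_continuous c1 c2 tree (left_mult T)"
  from mode_continuousD[OF this A _ treeL.zero_closed c1]
  have "mode_conv c2 tree UNIV r (\<lambda>\<alpha>. left_mult T (S \<alpha>)) (left_mult T 0)" using S by blast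
  moreover have "left_mult T 0 = 0" using tree.Lob_zero[OF T] by (simp add: left_mult_def fun_eq_iff)
  ultimately have "mode_conv c2 tree UNIV r (\<lambda>_. R) 0" using TS by simp
  then show False using tree_mode_const[OF A R(1)] R(2) by blast
qed

section \<open>Disjoint functionals\<close>

text \<open>The cylinders of the offshoots of the leftmost branch are disjoint.\<close>

abbreviation left_spine :: "nat \<Rightarrow> bool list" where "left_spine n \<equiv> replicate n False"

abbreviation offshoot :: "nat \<Rightarrow> bool list" where "offshoot n \<equiv> True # left_spine n"

lemma offshoot_disjoint:
  assumes "m < n"
  shows "drop (n - m) (offshoot n) \<noteq> offshoot m"
proof -
  obtain d where "n - m = Suc d" using assms by (metis Suc_diff_Suc)
  then have "drop (n - m) (offshoot n) = replicate (n - d) False" by simp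
  moreover have "n - d = Suc m" using \<open>n - m = Suc d\<close> by simp
  ultimately show ?thesis by simp
qed

definition disj_functionals :: "nat \<Rightarrow> (real \<Rightarrow> real) \<Rightarrow> real \<Rightarrow> real"
  where "disj_functionals n = rank_one (\<lambda>h. h (offshoot n)) one"

lemma disj_functionals_nonneg: "treeL.leq 0 (disj_functionals n)"
  unfolding disj_functionals_def by (rule rank_one_nonneg[OF positive_functional_eval one_nonneg])

text \<open>In the infimum formula for the meet at \<open>x\<close>, the restriction of \<open>x\<close> to the cylinder of \<open>offshoot m\<close> gives zero.\<close>

lemma disj_functionals_disjoint:
  assumes "m < n"
  shows "disj_functionals n \<sqinter>\<^bsub>Lob tree\<^esub> disj_functionals m = 0"
proof (rule treeL.ord.order.antisym)
  note L = tree.Lob_nonnegD(1)[OF disj_functionals_nonneg]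
  show "treeL.leq 0 (disj_functionals n \<sqinter>\<^bsub>Lob tree\<^esub> disj_functionals m)"
    by (intro treeL.meet_nonneg disj_functionals_nonneg)
  have "(disj_functionals n \<sqinter>\<^bsub>Lob tree\<^esub> disj_functionals m) x \<unlhd> 0" if x: "0 \<unlhd> x" for x
  proof -
    have xc: "x \<in> carrier tree" using x by (rule tree.leq_carrier)
    let ?y = "cyl (offshoot m) x"
    have y: "0 \<unlhd> ?y" "?y \<unlhd> x" using tree.Lob_nonnegD(2)[OF restrict_op_nonneg x] restrict_op_leq[OF x] .
    have yc: "?y \<in> carrier tree" using xc by simp
    have "?y (enc (offshoot n)) = 0"
      using xc assms offshoot_disjoint[OF assms] by (subst restrict_op_deep) auto
    then have 1: "disj_functionals n ?y = 0" using yc by (simp add: disj_functionals_def rank_one_apply)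
    have "?y (enc (offshoot m)) = x (enc (offshoot m))" using xc by (subst restrict_op_deep) auto
    then have 2: "disj_functionals m (x - ?y) = 0"
      using xc yc by (simp add: disj_functionals_def rank_one_apply)
    have "(disj_functionals n \<sqinter>\<^bsub>Lob tree\<^esub> disj_functionals m) x \<unlhd> disj_functionals n ?y + disj_functionals m (x - ?y)"
      by (rule tree.is_infD(1)[OF tree.Lob_meet_apply[OF L L x]]) (use y in blast)
    then show ?thesis using 1 2 by simp
  qed
  then show "treeL.leq (disj_functionals n \<sqinter>\<^bsub>Lob tree\<^esub> disj_functionals m) 0"
    using L by (simp add: tree.Lob_leq_iff)
qed

lemma disj_functionals_uo: "mode_conv Mode_uo tree UNIV (\<le>) disj_functionals 0"
  using treeL.disjoint_seq_uo_null[of disj_functionals] disj_functionals_nonneg disj_functionals_disjoint by simp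

lemma disj_functionals_not_Stau: "\<not> mode_conv Mode_Stau tree UNIV (\<le>) disj_functionals 0"
proof
  assume "mode_conv Mode_Stau tree UNIV (\<le>) disj_functionals 0"
  then have "limitin (tau_hat tree) (\<lambda>n. disj_functionals n one) 0 (tail_filter UNIV (\<le>))" by simp
  moreover have "disj_functionals n one = one" for n by (simp add: disj_functionals_def rank_one_apply)
  ultimately show False
    using tree.limitin_const[OF tree.Hausdorff directed_by_nat one_tree] one_nonzero by simp
qed

section \<open>Disjoint vectors\<close>

text \<open>The indicators of disjoint cylinders, normalized to integral one.\<close>

definition bump :: "nat \<Rightarrow> real \<Rightarrow> real"
  where "bump n = 2 ^ Suc n *\<^sub>R cyl (offshoot n) one"

lemma bump_nonneg: "0 \<unlhd> bump n"
  unfolding bump_def by (intro tree.scaleR_nonneg tree.Lob_nonnegD(2)[OF restrict_op_nonneg one_nonneg]) simp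

lemma bump_tree [simp]: "bump n \<in> carrier tree"
  by (rule tree.leq_carrier[OF bump_nonneg])

lemma bump_root: "bump n (enc []) = 1"
  using cyl_root[OF one_tree, of "offshoot n"] by (simp add: bump_def)

lemma bump_peak: "bump n (enc (offshoot n)) = 2 ^ Suc n"
  by (simp add: bump_def restrict_op_deep)

lemma bump_disjoint:
  assumes "m < n"
  shows "bump n \<sqinter>\<^bsub>tree\<^esub> bump m = 0"
proof (rule tree.ord.order.antisym)
  show "0 \<unlhd> bump n \<sqinter>\<^bsub>tree\<^esub> bump m" by (intro tree.meet_nonneg bump_nonneg)
  have c: "bump n \<sqinter>\<^bsub>tree\<^esub> bump m \<in> carrier tree" by simp
  show "bump n \<sqinter>\<^bsub>tree\<^esub> bump m \<unlhd> 0"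
  proof (rule tree_leq_deep[OF c tree.zero_closed])
    fix w :: "bool list" assume w: "Suc n \<le> length w"
    have "drop (n - m) (drop (length w - Suc n) w) = drop (length w - Suc m) w"
      using w assms by simp
    then have "\<not> (drop (length w - Suc n) w = offshoot n \<and> drop (length w - Suc m) w = offshoot m)"
      using offshoot_disjoint[OF assms] by metis
    then have "bump n (enc w) \<le> 0 \<or> bump m (enc w) \<le> 0"
      using w assms by (auto simp: bump_def restrict_op_deep)
    moreover have "(bump n \<sqinter>\<^bsub>tree\<^esub> bump m) (enc w) \<le> bump n (enc w)" "(bump n \<sqinter>\<^bsub>tree\<^esub> bump m) (enc w) \<le> bump m (enc w)"
      using tree_leqD[OF tree.meet_leq1[of "bump n" "bump m"]] tree_leqD[OF tree.meet_leq2[of "bump n" "bump m"]] by auto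
    ultimately show "(bump n \<sqinter>\<^bsub>tree\<^esub> bump m) (enc w) \<le> 0 (enc w)" by fastforce
  qed
qed

definition disj_vectors :: "nat \<Rightarrow> (real \<Rightarrow> real) \<Rightarrow> real \<Rightarrow> real"
  where "disj_vectors n = rank_one (\<lambda>h. h []) (bump n)"

lemma disj_vectors_nonneg: "treeL.leq 0 (disj_vectors n)"
  unfolding disj_vectors_def by (rule rank_one_nonneg[OF positive_functional_eval bump_nonneg])

lemma disj_vectors_uo: "mode_conv Mode_uo tree UNIV (\<le>) disj_vectors 0"
proof -
  note L = tree.Lob_nonnegD(1)[OF disj_vectors_nonneg]
  have "disj_vectors n \<sqinter>\<^bsub>Lob tree\<^esub> disj_vectors m = 0" if mn: "m < n" for m n
  proof (rule treeL.ord.order.antisym)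
    let ?M = "disj_vectors n \<sqinter>\<^bsub>Lob tree\<^esub> disj_vectors m"
    have Mc: "?M \<in> carrier (Lob tree)" using L by simp
    show "treeL.leq 0 ?M" by (intro treeL.meet_nonneg disj_vectors_nonneg)
    have "?M x \<unlhd> 0" if x: "0 \<unlhd> x" for x
    proof -
      have xc: "x \<in> carrier tree" using x by (rule tree.leq_carrier)
      have "?M x \<unlhd> disj_vectors n x" "?M x \<unlhd> disj_vectors m x"
        using treeL.meet_leq1[OF L L, of n m] treeL.meet_leq2[OF L L, of n m] x Mc L by (auto simp: tree.Lob_leq_iff)
      then have "?M x \<unlhd> (x (enc []) *\<^sub>R bump n) \<sqinter>\<^bsub>tree\<^esub> (x (enc []) *\<^sub>R bump m)"
        using xc by (simp add: disj_vectors_def rank_one_apply)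
      also have "(x (enc []) *\<^sub>R bump n) \<sqinter>\<^bsub>tree\<^esub> (x (enc []) *\<^sub>R bump m) = 0"
      proof -
        have 0: "0 \<le> x (enc [])" using tree_nonnegD[OF x] .
        have "bump n \<sqinter>\<^bsub>tree\<^esub> (x (enc []) *\<^sub>R bump m) = 0"
          using bump_disjoint[OF mn] 0 by (intro tree.disjoint_scaleR bump_nonneg)
        then have "(x (enc []) *\<^sub>R bump m) \<sqinter>\<^bsub>tree\<^esub> (x (enc []) *\<^sub>R bump n) = 0"
          using 0 by (intro tree.disjoint_scaleR tree.scaleR_nonneg bump_nonneg) (simp_all add: tree.meet_commute)
        then show ?thesis by (simp add: tree.meet_commute)
      qed
      finally show ?thesis .
    qed
    then show "treeL.leq ?M 0" using Mc by (simp add: tree.Lob_leq_iff)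
  qed
  then show ?thesis using treeL.disjoint_seq_uo_null[of disj_vectors] disj_vectors_nonneg by simp
qed

lemma disj_vectors_SUO: "mode_conv Mode_SUO tree UNIV (\<le>) disj_vectors 0"
proof -
  have "uo_conv tree UNIV (\<le>) (\<lambda>n. disj_vectors n x) 0" if x: "x \<in> carrier tree" for x
  proof -
    let ?c = "x (enc [])"
    have b0: "0 \<unlhd> \<bar>?c\<bar> *\<^sub>R bump n" for n by (intro tree.scaleR_nonneg bump_nonneg) simp
    have "uo_conv tree UNIV (\<le>) (\<lambda>n. \<bar>?c\<bar> *\<^sub>R bump n) 0"
    proof (rule tree.disjoint_seq_uo_null[OF b0])
      fix m n :: nat assume mn: "m < n"
      have "bump n \<sqinter>\<^bsub>tree\<^esub> (\<bar>?c\<bar> *\<^sub>R bump m) = 0"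
        using bump_disjoint[OF mn] by (intro tree.disjoint_scaleR bump_nonneg) auto
      then have "(\<bar>?c\<bar> *\<^sub>R bump m) \<sqinter>\<^bsub>tree\<^esub> (\<bar>?c\<bar> *\<^sub>R bump n) = 0"
        by (intro tree.disjoint_scaleR b0 bump_nonneg) (simp_all add: tree.meet_commute)
      then show "(\<bar>?c\<bar> *\<^sub>R bump n) \<sqinter>\<^bsub>tree\<^esub> (\<bar>?c\<bar> *\<^sub>R bump m) = 0" by (simp add: tree.meet_commute)
    qed
    moreover have "vabs tree (disj_vectors n x - 0) = vabs tree (\<bar>?c\<bar> *\<^sub>R bump n - 0)" for n
      using x by (cases "0 \<le> ?c") (simp_all add: disj_vectors_def rank_one_apply)
    ultimately show ?thesis unfolding uo_conv_def by simp
  qed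
  then show ?thesis by simp
qed

text \<open>A bound of a tail of the bumps would exceed \<open>2\<^sup>n\<close> at \<open>offshoot n\<close> for all large \<open>n\<close>.\<close>

lemma disj_vectors_not_SO: "\<not> mode_conv Mode_SO tree UNIV (\<le>) disj_vectors 0"
proof
  assume "mode_conv Mode_SO tree UNIV (\<le>) disj_vectors 0"
  moreover have "disj_vectors n one = bump n" for n by (simp add: disj_vectors_def rank_one_apply)
  ultimately have oc: "order_conv tree UNIV (\<le>) bump 0"
    by simp (drule bspec[OF _ one_tree], simp)
  obtain B :: "(real \<Rightarrow> real) set" and s y where dec: "decreasing_to_zero tree B s y"
    and dom: "\<And>b. b \<in> B \<Longrightarrow> \<exists>n0\<in>UNIV. \<forall>n\<in>UNIV. n0 \<le> n \<longrightarrow> vabs tree (0 - bump n) \<unlhd> y b"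
    using tree.order_conv_leqE[OF oc bump_tree tree.zero_closed] by blast
  note D = tree.decreasing_to_zeroD[OF dec]
  obtain b where b: "b \<in> B" using directed_byD(1)[OF D(1)] by blast
  obtain n0 where n0: "\<And>n. n0 \<le> n \<Longrightarrow> bump n \<unlhd> y b"
    using dom[OF b] bump_nonneg by (auto simp: tree.vabs_of_nonneg)
  obtain C where C: "\<forall>w. \<bar>y b (enc w)\<bar> \<le> C" using tree_bounded[OF D(2)[OF b]] by blast
  obtain k where k: "C < 2 ^ k" using real_arch_pow[of 2 C] by auto
  let ?n = "max n0 k"
  have "2 ^ Suc ?n \<le> y b (enc (offshoot ?n))"
    using tree_leqD[OF n0[of ?n], of "offshoot ?n"] bump_peak[of ?n] by simp
  also have "\<dots> \<le> C" using C by (meson abs_le_D1)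
  also have "C < 2 ^ k" by (rule k)
  also have "(2::real) ^ k \<le> 2 ^ Suc ?n" by (rule power_increasing) auto
  finally show False by simp
qed

text \<open>The integral is order continuous because infima of decreasing nets are pointwise.\<close>

lemma rank_one_root_Loc: "rank_one (\<lambda>h. h []) one \<in> Loc tree"
proof -
  let ?T = "rank_one (\<lambda>h. h []) one"
  have T: "?T \<in> carrier (Lob tree)" by (rule rank_one_Lob[OF positive_functional_eval one_nonneg])
  show ?thesis unfolding Loc_def
  proof (intro CollectI conjI allI impI)
    show "?T \<in> linear_operators tree" using T by (simp add: Lob_def)
    fix A :: "(real \<Rightarrow> real) net_index set" and r x
    assume *: "directed_by A r \<and> x \<in> A \<rightarrow> carrier tree \<and> order_conv tree A r x 0"
    then have xc: "x \<alpha> \<in> carrier tree" if "\<alpha> \<in> A" for \<alpha> using that by blast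
    obtain B :: "(real \<Rightarrow> real) set" and s y where dec: "decreasing_to_zero tree B s y"
      and dom: "\<And>b. b \<in> B \<Longrightarrow> \<exists>\<alpha>\<^sub>0\<in>A. \<forall>\<alpha>\<in>A. r \<alpha>\<^sub>0 \<alpha> \<longrightarrow> vabs tree (0 - x \<alpha>) \<unlhd> y b"
      using tree.order_conv_leqE[OF conjunct2[OF conjunct2[OF *]] xc tree.zero_closed] by blast
    note D = tree.decreasing_to_zeroD[OF dec]
    have dec': "decreasing_to_zero tree B s (\<lambda>b. y b (enc []) *\<^sub>R one)"
    proof (rule tree.decreasing_to_zeroI[OF D(1)])
      show "y c (enc []) *\<^sub>R one \<unlhd> y b (enc []) *\<^sub>R one" if "b \<in> B" "c \<in> B" "s b c" for b c
        using tree_leqD[OF D(3)[OF that], of "[]"] by (intro tree.scaleR_mono_left one_nonneg)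
      show "tree.is_inf ((\<lambda>b. y b (enc []) *\<^sub>R one) ` B) 0" unfolding tree.is_inf_def
      proof (intro conjI ballI allI impI)
        show "0 \<unlhd> d" if "d \<in> (\<lambda>b. y b (enc []) *\<^sub>R one) ` B" for d
          using that tree_nonnegD[OF D(5)] one_nonneg by (auto intro: tree.scaleR_nonneg)
        fix z assume z: "\<forall>d\<in>(\<lambda>b. y b (enc []) *\<^sub>R one) ` B. z \<unlhd> d"
        obtain b where "b \<in> B" using directed_byD(1)[OF D(1)] by blast
        then have "z \<unlhd> y b (enc []) *\<^sub>R one" using z by blast
        then have zc: "z \<in> carrier tree" using tree.leq_closed[of z] by simp
        have "z (enc w) \<le> 0" for w
        proof (rule ccontr)
          assume "\<not> z (enc w) \<le> 0"
          then obtain b where b: "b \<in> B" "y b (enc []) < z (enc w)"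
            using tree_decreasing_pointwise[OF dec, of "z (enc w)" "[]"] by auto
          then have "z \<unlhd> y b (enc []) *\<^sub>R one" using z by blast
          then show False using tree_leqD[of z _ w] b by fastforce
        qed
        then show "z \<unlhd> 0" using zc by (simp add: tree_leq)
      qed
    qed
    show "order_conv tree A r (\<lambda>\<alpha>. ?T (x \<alpha>)) 0"
    proof (rule tree.order_conv_leqI[OF dec'])
      fix b assume b: "b \<in> B"
      obtain \<alpha>\<^sub>0 where a0: "\<alpha>\<^sub>0 \<in> A" "\<forall>\<alpha>\<in>A. r \<alpha>\<^sub>0 \<alpha> \<longrightarrow> vabs tree (0 - x \<alpha>) \<unlhd> y b" using dom[OF b] by blast
      have "vabs tree (0 - ?T (x \<alpha>)) \<unlhd> y b (enc []) *\<^sub>R one" if a: "\<alpha> \<in> A" "r \<alpha>\<^sub>0 \<alpha>" for \<alpha>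
      proof -
        have le: "vabs tree (0 - x \<alpha>) \<unlhd> y b" using a0(2) a by blast
        then have "x \<alpha> \<unlhd> y b" "- x \<alpha> \<unlhd> y b" using xc[OF a(1)] by (auto simp: tree.vabs_leq_iff)
        then have *: "x \<alpha> (enc []) \<le> y b (enc [])" "- x \<alpha> (enc []) \<le> y b (enc [])"
          using tree_leqD[of "x \<alpha>" "y b" "[]"] tree_leqD[of "- x \<alpha>" "y b" "[]"] by auto
        have "x \<alpha> (enc []) *\<^sub>R one \<unlhd> y b (enc []) *\<^sub>R one" "(- x \<alpha> (enc [])) *\<^sub>R one \<unlhd> y b (enc []) *\<^sub>R one"
          by (rule tree.scaleR_mono_left[OF *(1) one_nonneg], rule tree.scaleR_mono_left[OF *(2) one_nonneg])
        then have "vabs tree (x \<alpha> (enc []) *\<^sub>R one) \<unlhd> y b (enc []) *\<^sub>R one" by (simp add: tree.vabs_leq_iff)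
        then show ?thesis using xc[OF a(1)] by (simp add: rank_one_apply)
      qed
      then show "\<exists>\<alpha>\<^sub>0\<in>A. \<forall>\<alpha>\<in>A. r \<alpha>\<^sub>0 \<alpha> \<longrightarrow> vabs tree (0 - ?T (x \<alpha>)) \<unlhd> y b (enc []) *\<^sub>R one"
        using a0(1) by blast
    qed
  qed
qed

lemma rank_one_root_comp: "left_mult (rank_one (\<lambda>h. h []) one) (disj_vectors n) = rank_one (\<lambda>h. h []) one"
proof (rule ext)
  fix f show "left_mult (rank_one (\<lambda>h. h []) one) (disj_vectors n) f = rank_one (\<lambda>h. h []) one f"
    by (cases "f \<in> carrier tree") (simp_all add: left_mult_def disj_vectors_def rank_one_def bump_root)
qed

section \<open>The typewriter net\<close>

text \<open>Nodes of the same level precede each other; the net runs through the cylinders of measure \<open>2\<^sup>-\<^sup>n\<close> for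
  all \<open>n\<close>, and the cylinders of each level cover the whole space.\<close>

lemma directed_by_length: "directed_by (UNIV :: bool list set) (\<lambda>v w. length v \<le> length w)"
proof -
  have "\<exists>c :: bool list. length a \<le> length c \<and> length b \<le> length c" for a b :: "bool list"
    by (rule exI[of _ "a @ b"]) simp
  then show ?thesis unfolding directed_by_def by (intro conjI ballI impI) auto
qed

lemma cyl_small:
  assumes f: "f \<in> carrier tree" and e: "0 < e"
  shows "\<exists>v0 :: bool list. \<forall>v. length v0 \<le> length v \<longrightarrow> cyl v f (enc []) < e"
proof -
  obtain C where C: "\<forall>w. \<bar>f (enc w)\<bar> \<le> C" using tree_bounded[OF f] by blast
  obtain k where k: "C / e < 2 ^ k" using real_arch_pow[of 2 "C / e"] by auto
  have "cyl v f (enc []) < e" if v: "length (replicate k False) \<le> length v" for v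
  proof -
    have "f (enc v) \<le> C" using C by (meson abs_le_D1)
    also have "C < e * 2 ^ k" using k e by (simp add: pos_divide_less_eq mult.commute)
    also have "\<dots> \<le> e * 2 ^ length v" using v e by (intro mult_left_mono power_increasing) auto
    finally show ?thesis using f by (simp add: cyl_root pos_divide_less_eq)
  qed
  then show ?thesis by blast
qed

lemma typewriter_Stau: "mode_conv Mode_Stau tree UNIV (\<lambda>v w. length v \<le> length w) cyl 0"
proof -
  have "limitin (tau_hat tree) (\<lambda>v. cyl v f) 0 (tail_filter UNIV (\<lambda>v w. length v \<le> length w))"
    if f: "f \<in> carrier tree" for f
  proof (rule tree_limitin_nullI[OF directed_by_length])
    show "cyl v f \<in> carrier tree" for v using f by simp
    show "vabs tree (cyl v f) \<unlhd> cyl v (vabs tree f)" for v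
      using tree.vabs_apply_leq[OF restrict_op_Lob f, of "length v" "{v}"] restrict_op_nonneg
      by (simp add: treeL.vabs_of_nonneg)
    show "\<exists>v0 :: bool list\<in>UNIV. \<forall>v\<in>UNIV. length v0 \<le> length v \<longrightarrow> cyl v (vabs tree f) (enc []) < e" if "0 < e" for e
      using cyl_small[OF tree.vabs_closed[OF f] that] by simp
  qed
  then show ?thesis by simp
qed

lemma typewriter_tau: "mode_conv Mode_tau tree UNIV (\<lambda>v w. length v \<le> length w) cyl 0"
proof -
  have "limitin (tau_hat (Lob tree)) cyl 0 (tail_filter UNIV (\<lambda>v w. length v \<le> length w))"
    by (rule tree.Lob_limitin_nullI[OF directed_by_length restrict_op_nonneg])
      (use typewriter_Stau tree.leq_carrier in simp)
  then show ?thesis by simp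
qed

text \<open>A bound of a tail of the net dominates the indicators of all cylinders of a large level, hence \<open>one\<close>.\<close>

lemma typewriter_not_order_null:
  "\<not> order_conv tree UNIV (\<lambda>v w. length v \<le> length w) (\<lambda>v. cyl v one) 0"
proof
  assume oc: "order_conv tree UNIV (\<lambda>v w. length v \<le> length w) (\<lambda>v. cyl v one) 0"
  have cc: "cyl v one \<in> carrier tree" if "v \<in> UNIV" for v by simp
  obtain B :: "(real \<Rightarrow> real) set" and s y where dec: "decreasing_to_zero tree B s y"
    and dom: "\<And>b. b \<in> B \<Longrightarrow> \<exists>v0 :: bool list\<in>UNIV. \<forall>v\<in>UNIV. length v0 \<le> length v \<longrightarrow> vabs tree (0 - cyl v one) \<unlhd> y b"
    using tree.order_conv_leqE[OF oc cc tree.zero_closed] by blast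
  note D = tree.decreasing_to_zeroD[OF dec]
  have "one \<unlhd> y b" if b: "b \<in> B" for b
  proof -
    obtain v0 :: "bool list" where v0: "\<forall>v\<in>UNIV. length v0 \<le> length v \<longrightarrow> vabs tree (0 - cyl v one) \<unlhd> y b" using dom[OF b] by blast
    show ?thesis
    proof (rule tree_leq_deep[OF one_tree D(2)[OF b]])
      fix w :: "bool list" assume w: "length v0 \<le> length w"
      have "vabs tree (0 - cyl w one) \<unlhd> y b" using v0 w by blast
      then have "cyl w one \<unlhd> y b"
        using tree.Lob_nonnegD(2)[OF restrict_op_nonneg one_nonneg] by (simp add: tree.vabs_of_nonneg)
      then have "cyl w one (enc w) \<le> y b (enc w)" by (rule tree_leqD)
      then show "one (enc w) \<le> y b (enc w)" by (simp add: restrict_op_deep)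
    qed
  qed
  then have "one \<unlhd> 0" by (intro tree.is_infD(2)[OF D(4)]) auto
  then show False using tree_leqD[of one 0 "[]"] by simp
qed

lemma typewriter_not_SUO: "\<not> mode_conv Mode_SUO tree UNIV (\<lambda>v w. length v \<le> length w) cyl 0"
proof
  assume "mode_conv Mode_SUO tree UNIV (\<lambda>v w. length v \<le> length w) cyl 0"
  then have "uo_conv tree UNIV (\<lambda>v w. length v \<le> length w) (\<lambda>v. cyl v one) 0" by simp
  from tree.uo_convD[OF this one_nonneg]
  have "order_conv tree UNIV (\<lambda>v w. length v \<le> length w) (\<lambda>v. vabs tree (cyl v one - 0) \<sqinter>\<^bsub>tree\<^esub> one) 0" .
  moreover have "vabs tree (cyl v one - 0) \<sqinter>\<^bsub>tree\<^esub> one = cyl v one" for v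
    using tree.Lob_nonnegD(2)[OF restrict_op_nonneg one_nonneg] restrict_op_leq[OF one_nonneg]
    by (simp add: tree.vabs_of_nonneg tree.meet_absorb1)
  ultimately show False using typewriter_not_order_null by simp
qed

text \<open>The net lies below the identity operator, so that truncation there does not change it.\<close>

lemma typewriter_not_uo: "\<not> mode_conv Mode_uo tree UNIV (\<lambda>v w. length v \<le> length w) cyl 0"
proof
  assume "mode_conv Mode_uo tree UNIV (\<lambda>v w. length v \<le> length w) cyl 0"
  then have uo: "uo_conv (Lob tree) UNIV (\<lambda>v w. length v \<le> length w) cyl 0" by simp
  have id0: "treeL.leq 0 ident"
    using ident_Lob by (simp add: tree.Lob_leq_iff) (simp add: ident_def tree.leq_carrier)
  have le: "treeL.leq (cyl v) ident" for v
    using ident_Lob restrict_op_leq by (simp add: tree.Lob_leq_iff) (simp add: ident_def tree.leq_carrier)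
  have "vabs (Lob tree) (cyl v - 0) \<sqinter>\<^bsub>Lob tree\<^esub> ident = cyl v" for v
    using le restrict_op_nonneg by (simp add: treeL.vabs_of_nonneg treeL.meet_absorb1)
  then have "order_conv (Lob tree) UNIV (\<lambda>v w. length v \<le> length w) cyl 0"
    using treeL.uo_convD[OF uo id0] by simp
  from tree.Lob_order_conv_pointwise[OF this restrict_op_Lob treeL.zero_closed one_tree]
  show False using typewriter_not_order_null by simp
qed

section \<open>Rademacher functionals\<close>

definition half_diff :: "(bool list \<Rightarrow> real) \<Rightarrow> bool list \<Rightarrow> real"
  where "half_diff h w = (h (False # w) - h (True # w)) / 2"

lemma avg_pow_square: "((avg ^^ n) g w)\<^sup>2 \<le> (avg ^^ n) (\<lambda>w. (g w)\<^sup>2) w"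
proof (induction n arbitrary: w)
  case (Suc n)
  let ?p = "(avg ^^ n) g (False # w)" and ?q = "(avg ^^ n) g (True # w)"
  have "((?p + ?q) / 2)\<^sup>2 \<le> (?p\<^sup>2 + ?q\<^sup>2) / 2"
    using zero_le_power2[of "?p - ?q"] by (simp add: power2_eq_square field_simps)
  also have "\<dots> \<le> ((avg ^^ n) (\<lambda>w. (g w)\<^sup>2) (False # w) + (avg ^^ n) (\<lambda>w. (g w)\<^sup>2) (True # w)) / 2"
    using Suc.IH[of "False # w"] Suc.IH[of "True # w"] by simp
  finally show ?case unfolding avg_pow_Suc .
qed simp

text \<open>By orthogonality of martingale differences, the mean squares of \<open>h\<close> increase by the mean squares
  of its differences, so that the latter tend to zero. These means are the integrals of \<open>h\<close> against the
  Rademacher functions.\<close>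

lemma mean_diff_tendsto_zero:
  assumes h: "h \<in> martingales"
  shows "(\<lambda>n. (avg ^^ n) (half_diff h) v) \<longlonglongrightarrow> 0"
proof -
  define a where "a n = (avg ^^ n) (\<lambda>w. (h w)\<^sup>2) v" for n
  have "avg (\<lambda>w. (h w)\<^sup>2) w = (h w)\<^sup>2 + (half_diff h w)\<^sup>2" for w
  proof -
    have "h w = (h (False # w) + h (True # w)) / 2" using martingalesD(1)[OF h] unfolding avg_def by metis
    then show ?thesis unfolding avg_def half_diff_def by (simp only:) (simp add: power2_eq_square field_simps)
  qed
  then have "avg (\<lambda>w. (h w)\<^sup>2) = (\<lambda>w. (h w)\<^sup>2 + (half_diff h w)\<^sup>2)" by (rule ext)
  then have a_Suc: "a (Suc n) = a n + (avg ^^ n) (\<lambda>w. (half_diff h w)\<^sup>2) v" for n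
    unfolding a_def funpow_Suc_right comp_def by (simp add: avg_pow_add)
  have sq: "((avg ^^ n) (half_diff h) v)\<^sup>2 \<le> a (Suc n) - a n" for n
    using avg_pow_square[of n "half_diff h" v] a_Suc[of n] by simp
  have "0 \<le> a (Suc n) - a n" for n by (rule order_trans[OF zero_le_power2 sq])
  then have "incseq a" by (intro incseq_SucI) simp
  moreover obtain C where C: "\<forall>w. \<bar>h w\<bar> \<le> C" using martingalesD(2)[OF h] by blast
  have "\<bar>(h w)\<^sup>2\<bar> \<le> C\<^sup>2" for w using power_mono[OF C[rule_format, of w], of 2] by simp
  then have "\<bar>a n\<bar> \<le> C\<^sup>2" for n unfolding a_def by (rule avg_pow_bounded)
  then have "a n \<le> C\<^sup>2" for n by (meson abs_le_D1)
  ultimately obtain L where "a \<longlonglongrightarrow> L" using incseq_convergent[of a "C\<^sup>2"] by blast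
  then have "(\<lambda>n. a (Suc n) - a n) \<longlonglongrightarrow> L - L" by (intro tendsto_diff LIMSEQ_Suc)
  then have lim: "(\<lambda>n. a (Suc n) - a n) \<longlonglongrightarrow> 0" by simp
  have "(\<lambda>n. ((avg ^^ n) (half_diff h) v)\<^sup>2) \<longlonglongrightarrow> 0"
    by (rule tendsto_sandwich[OF _ _ tendsto_const lim]) (simp_all add: sq)
  then have "(\<lambda>n. sqrt (((avg ^^ n) (half_diff h) v)\<^sup>2)) \<longlonglongrightarrow> sqrt 0" by (rule tendsto_real_sqrt)
  then show ?thesis by (simp add: tendsto_rabs_zero_iff)
qed

lemma positive_functional_step: "positive_functional (\<lambda>h. (avg ^^ n) (\<lambda>w. h (b # w) / 2) [])"
proof -
  have "(avg ^^ n) (\<lambda>w. (g (b # w) + h (b # w)) / 2) [] =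
      (avg ^^ n) (\<lambda>w. g (b # w) / 2) [] + (avg ^^ n) (\<lambda>w. h (b # w) / 2) []" for g h
    by (simp add: add_divide_distrib avg_pow_add)
  moreover have "(avg ^^ n) (\<lambda>w. c * h (b # w) / 2) [] = c * (avg ^^ n) (\<lambda>w. h (b # w) / 2) []" for c h
    using avg_pow_scale[of n c "\<lambda>w. h (b # w) / 2"] by simp
  moreover have "0 \<le> (avg ^^ n) (\<lambda>w. h (b # w) / 2) []" if "\<forall>w. 0 \<le> h w" for h
    using avg_pow_mono[of "\<lambda>_. 0" "\<lambda>w. h (b # w) / 2" n "[]"] that by (simp add: avg_pow_const)
  ultimately show ?thesis by (simp add: positive_functional_def)
qed

text \<open>The integral against the Rademacher function that is \<open>1\<close> or \<open>-1\<close> according to step \<open>Suc n\<close>, written as a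
  difference of positive functionals to show that it is order bounded.\<close>

definition rademacher :: "nat \<Rightarrow> (real \<Rightarrow> real) \<Rightarrow> real \<Rightarrow> real"
  where "rademacher n = rank_one (\<lambda>h. (avg ^^ n) (\<lambda>w. h (False # w) / 2) []) one -
    rank_one (\<lambda>h. (avg ^^ n) (\<lambda>w. h (True # w) / 2) []) one"

lemma rademacher_Lob: "rademacher n \<in> carrier (Lob tree)"
  unfolding rademacher_def
  by (intro treeL.diff_closed rank_one_Lob positive_functional_step one_nonneg)

lemma rademacher_apply:
  assumes "f \<in> carrier tree"
  shows "rademacher n f = (avg ^^ n) (half_diff (\<lambda>w. f (enc w))) [] *\<^sub>R one"
proof -
  let ?h = "\<lambda>w. f (enc w)"
  have "(avg ^^ n) (\<lambda>w. ?h (False # w) / 2) [] =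
      (avg ^^ n) (\<lambda>w. half_diff ?h w + ?h (True # w) / 2) []"
    by (rule avg_pow_cong) (simp add: half_diff_def diff_divide_distrib)
  then show ?thesis using assms
    by (simp add: rademacher_def rank_one_apply avg_pow_add flip: scaleR_left_diff_distrib)
qed

lemma rademacher_SO: "mode_conv Mode_SO tree UNIV (\<le>) rademacher 0"
proof -
  have "order_conv tree UNIV (\<le>) (\<lambda>n. rademacher n f) 0" if f: "f \<in> carrier tree" for f
  proof (rule tree.order_conv_leqI[OF tree.inverse_decreasing[OF one_nonneg]])
    fix k :: nat
    let ?a = "\<lambda>n. (avg ^^ n) (half_diff (\<lambda>w. f (enc w))) []"
    have "eventually (\<lambda>n. \<bar>?a n - 0\<bar> < inverse (real (Suc k))) sequentially"
      using tendstoD[OF mean_diff_tendsto_zero[OF tree_martingale[OF f], of "[]"], of "inverse (real (Suc k))"]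
      by (simp add: dist_real_def)
    then obtain N where N: "\<And>n. N \<le> n \<Longrightarrow> \<bar>?a n\<bar> < inverse (real (Suc k))"
      by (auto simp: eventually_sequentially)
    have "vabs tree (0 - rademacher n f) \<unlhd> inverse (real (Suc k)) *\<^sub>R one" if "N \<le> n" for n
    proof -
      have "vabs tree (0 - rademacher n f) = vabs tree (?a n *\<^sub>R one)" using f by (simp add: rademacher_apply)
      also have "\<dots> \<unlhd> \<bar>?a n\<bar> *\<^sub>R vabs tree one" by (rule tree.vabs_scaleR_leq[OF one_tree])
      also have "\<dots> \<unlhd> inverse (real (Suc k)) *\<^sub>R one"
        unfolding tree.vabs_of_nonneg[OF one_nonneg]
        by (rule tree.scaleR_mono_left[OF less_imp_le[OF N[OF that]] one_nonneg])
      finally (tree.ord.order_trans) show ?thesis .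
    qed
    then show "\<exists>n0\<in>UNIV. \<forall>n\<in>UNIV. n0 \<le> n \<longrightarrow> vabs tree (0 - rademacher n f) \<unlhd> inverse (real (Suc k)) *\<^sub>R one"
      by blast
  qed
  then show ?thesis by simp
qed

text \<open>The functional is the integral on \<open>x1\<close>, the part of \<open>x\<close> where the Rademacher function is \<open>1\<close>, and minus the
  integral on the other part \<open>x2\<close>.\<close>

lemma rademacher_modulus: "treeL.leq (rank_one (\<lambda>h. h []) one) (vabs (Lob tree) (rademacher n))"
proof -
  let ?R = "rademacher n" and ?M = "vabs (Lob tree) (rademacher n)"
  note R = rademacher_Lob[of n]
  have M: "?M \<in> carrier (Lob tree)" using R by simp
  have "rank_one (\<lambda>h. h []) one x \<unlhd> ?M x" if x: "0 \<unlhd> x" for x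
  proof -
    have xc: "x \<in> carrier tree" using x by (rule tree.leq_carrier)
    define x1 where "x1 = restrict_op (Suc n) {v. hd v = False} x"
    define x2 where "x2 = x - x1"
    have x1: "0 \<unlhd> x1" "x1 \<unlhd> x"
      using tree.Lob_nonnegD(2)[OF restrict_op_nonneg x] restrict_op_leq[OF x] by (auto simp: x1_def)
    have x2: "0 \<unlhd> x2" using x1(2) by (simp add: x2_def)
    have c: "x1 \<in> carrier tree" "x2 \<in> carrier tree" using x1(1) x2 tree.leq_carrier by auto
    have level: "x1 (enc (False # w)) = x (enc (False # w))" "x1 (enc (True # w)) = 0" if "length w = n" for w
      using xc that by (simp_all add: x1_def restrict_op_deep)
    have mart: "avg (\<lambda>w. f (enc w)) = (\<lambda>w. f (enc w))" if "f \<in> carrier tree" for f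
      using martingalesD(1)[OF tree_martingale[OF that]] .
    have "(avg ^^ n) (half_diff (\<lambda>w. x1 (enc w))) [] = (avg ^^ n) (avg (\<lambda>w. x1 (enc w))) []"
      by (rule avg_pow_cong) (simp add: level half_diff_def avg_def)
    then have 1: "?R x1 = x1 (enc []) *\<^sub>R one"
      using c(1) avg_pow_fixed[OF mart[OF c(1)], of n] mart[OF c(1)] by (simp add: rademacher_apply fun_eq_iff)
    have "(avg ^^ n) (half_diff (\<lambda>w. x2 (enc w))) [] = (avg ^^ n) (\<lambda>w. - 1 * avg (\<lambda>w. x2 (enc w)) w) []"
      by (rule avg_pow_cong) (simp add: level half_diff_def avg_def x2_def)
    also have "\<dots> = - ((avg ^^ n) (avg (\<lambda>w. x2 (enc w))) [])" by (subst avg_pow_scale) simp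
    finally have 2: "- ?R x2 = x2 (enc []) *\<^sub>R one"
      using c(2) avg_pow_fixed[OF mart[OF c(2)], of n] mart[OF c(2)] by (simp add: rademacher_apply fun_eq_iff)
    have "?R x1 \<unlhd> ?M x1"
      using treeL.leq_vabs[OF R] x1(1) R M by (simp add: tree.Lob_leq_iff)
    moreover have "- ?R x2 \<unlhd> ?M x2"
      using treeL.neg_leq_vabs[OF R] x2 treeL.uminus_closed[OF R] M by (simp add: tree.Lob_leq_iff)
    ultimately have "?R x1 + - ?R x2 \<unlhd> ?M x1 + ?M x2" by (rule tree.ord.add_mono)
    also have "?M x1 + ?M x2 = ?M x" using LobD(2)[OF M c] by (simp add: x2_def)
    finally show ?thesis
      unfolding 1 2 using xc by (simp add: rank_one_apply x2_def flip: scaleR_left_distrib)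
  qed
  then show ?thesis
    using M rank_one_Lob[OF positive_functional_eval one_nonneg] by (simp add: tree.Lob_leq_iff)
qed

lemma rademacher_not_tau: "\<not> mode_conv Mode_tau tree UNIV (\<le>) rademacher 0"
proof
  let ?T = "rank_one (\<lambda>h. h []) one"
  have T0: "treeL.leq 0 ?T" by (rule rank_one_nonneg[OF positive_functional_eval one_nonneg])
  note T = treeL.leq_carrier[OF T0]
  assume "mode_conv Mode_tau tree UNIV (\<le>) rademacher 0"
  then have *: "\<forall>W. treeL.solid_nbhd W \<longrightarrow> (\<exists>n0\<in>UNIV. \<forall>n\<in>UNIV. n0 \<le> n \<longrightarrow> rademacher n - 0 \<in> W)"
    using rademacher_Lob by (subst (asm) mode_conv.simps, subst (asm) treeL.limitin_iff_solid_nbhd[OF directed_by_nat]) auto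
  have "?T \<in> W" if W: "treeL.solid_nbhd W" for W
  proof -
    obtain n where "rademacher n \<in> W" using * W by fastforce
    then show ?thesis
      using treeL.solidD[OF treeL.solid_nbhd_solid[OF W] _ T] rademacher_modulus[of n] T0
      by (simp add: treeL.vabs_of_nonneg)
  qed
  then have "?T = 0" by (rule treeL.Hausdorff_solid_nbhd[OF treeL.Hausdorff T])
  then show False using rank_one_one_nonzero[of "\<lambda>h. h []"] by simp
qed

section \<open>A positive functional that is not order continuous\<close>

text \<open>A filter finer than \<open>sequentially\<close> along which all bounded sequences converge, from Tychonoff's
  theorem: the values of the evaluations at \<open>n\<close> accumulate at a point of a product of compact intervals.\<close>

lemma ex_generalized_limit:
  "\<exists>F :: nat filter. F \<noteq> bot \<and> F \<le> sequentially \<and>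
    (\<forall>a :: nat \<Rightarrow> real. (\<exists>C. \<forall>n. \<bar>a n\<bar> \<le> C) \<longrightarrow> (\<exists>l. (a \<longlongrightarrow> l) F))"
proof -
  define bdd where "bdd a \<longleftrightarrow> (\<exists>C. \<forall>n. \<bar>a n\<bar> \<le> C)" for a :: "nat \<Rightarrow> real"
  define bound where "bound a = (if bdd a then (SOME C. \<forall>n. \<bar>a n\<bar> \<le> C) else 0)" for a
  \<comment> \<open>Unbounded sequences are replaced by zero, so that all \<open>p n\<close> lie in a product of compact intervals.\<close>
  define p where "p n a = (if bdd a then a n else 0)" for n a
  have p_le: "\<bar>p n a\<bar> \<le> bound a" for n a
    using someI_ex[of "\<lambda>C. \<forall>n. \<bar>a n\<bar> \<le> C"] by (auto simp: p_def bound_def bdd_def)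
  define K where "K = PiE UNIV (\<lambda>a. {- bound a..bound a})"
  have "compactin (product_topology (\<lambda>_. euclideanreal) UNIV) K"
    unfolding K_def compactin_PiE by auto
  then have K: "compact K" by (simp add: euclidean_product_topology)
  have pK: "p n \<in> K" for n using p_le[of n] by (auto simp: K_def abs_le_iff minus_le_iff)
  have "filtermap p sequentially \<noteq> bot" by (simp add: filtermap_bot_iff)
  moreover have "eventually (\<lambda>x. x \<in> K) (filtermap p sequentially)" using pK by (simp add: eventually_filtermap)
  ultimately obtain \<phi> where \<phi>: "inf (nhds \<phi>) (filtermap p sequentially) \<noteq> bot"
    using K unfolding compact_filter by blast
  define F where "F = inf (filtercomap p (nhds \<phi>)) sequentially"
  have "F \<noteq> bot"
  proof
    assume "F = bot"
    then have "eventually (\<lambda>_. False) F" by simp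
    then obtain P Q where P: "eventually P (filtercomap p (nhds \<phi>))" and Q: "eventually Q sequentially"
      and PQ: "\<And>n. P n \<Longrightarrow> Q n \<Longrightarrow> False" unfolding F_def eventually_inf by blast
    obtain P' where P': "eventually P' (nhds \<phi>)" "\<And>n. P' (p n) \<Longrightarrow> P n"
      using P unfolding eventually_filtercomap by blast
    have "eventually (\<lambda>x. \<exists>n. Q n \<and> p n = x) (filtermap p sequentially)"
      unfolding eventually_filtermap using Q by (rule eventually_mono) blast
    then have "eventually (\<lambda>_. False) (inf (nhds \<phi>) (filtermap p sequentially))"
      unfolding eventually_inf using P' PQ by blast
    then show False using \<phi> by (simp add: eventually_False)
  qed
  moreover have "F \<le> sequentially" by (simp add: F_def)
  moreover have "\<exists>l. (a \<longlongrightarrow> l) F" if "\<exists>C. \<forall>n. \<bar>a n\<bar> \<le> C" for a :: "nat \<Rightarrow> real"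
  proof
    have "(p \<longlongrightarrow> \<phi>) F"
      unfolding F_def by (rule filterlim_mono[OF filterlim_filtercomap order_refl]) simp
    then have "((\<lambda>n. p n a) \<longlongrightarrow> \<phi> a) F"
      by (rule continuous_on_tendsto_compose[OF continuous_on_product_coordinates]) auto
    then show "(a \<longlongrightarrow> \<phi> a) F" using that by (simp add: p_def bdd_def)
  qed
  ultimately show ?thesis by blast
qed

text \<open>The generalized limit of the values along the leftmost branch. It is determined by what happens near
  this null set, and so it is not order continuous.\<close>

lemma ex_functional_at_end:
  "\<exists>\<phi>. positive_functional \<phi> \<and> \<phi> (\<lambda>_. 1) = 1 \<and>
    (\<forall>g\<in>martingales. \<forall>h\<in>martingales. \<forall>k. (\<forall>n\<ge>k. g (left_spine n) = h (left_spine n)) \<longrightarrow> \<phi> g = \<phi> h)"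
proof -
  obtain F :: "nat filter" where F: "F \<noteq> bot" "F \<le> sequentially"
    "\<forall>a :: nat \<Rightarrow> real. (\<exists>C. \<forall>n. \<bar>a n\<bar> \<le> C) \<longrightarrow> (\<exists>l. (a \<longlongrightarrow> l) F)"
    using ex_generalized_limit by (elim exE conjE)
  define \<phi> where "\<phi> h = Lim F (\<lambda>n. h (left_spine n))" for h :: "bool list \<Rightarrow> real"
  have lim: "((\<lambda>n. h (left_spine n)) \<longlongrightarrow> \<phi> h) F" if h: "h \<in> martingales" for h
  proof -
    obtain l where "((\<lambda>n. h (left_spine n)) \<longlongrightarrow> l) F" using F(3)[rule_format, of "\<lambda>n. h (left_spine n)"] martingalesD(2)[OF h] by blast
    then show ?thesis unfolding \<phi>_def using tendsto_Lim[OF F(1)] by metis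
  qed
  have eqI: "\<phi> h = l" if "((\<lambda>n. h (left_spine n)) \<longlongrightarrow> l) F" for h l
    unfolding \<phi>_def by (rule tendsto_Lim[OF F(1) that])
  have "positive_functional \<phi>" unfolding positive_functional_def
  proof (intro conjI ballI allI impI)
    show "\<phi> (\<lambda>w. g w + h w) = \<phi> g + \<phi> h" if "g \<in> martingales" "h \<in> martingales" for g h
      by (intro eqI tendsto_add lim that)
    show "\<phi> (\<lambda>w. c * h w) = c * \<phi> h" if "h \<in> martingales" for c h
      by (intro eqI tendsto_mult tendsto_const lim that)
    show "0 \<le> \<phi> h" if "h \<in> martingales" "\<forall>w. 0 \<le> h w" for h
      by (rule tendsto_lowerbound[OF lim[OF that(1)] _ F(1)]) (use that in simp)
  qed
  moreover have "\<phi> (\<lambda>_. 1) = 1" by (rule eqI) simp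
  moreover have "\<phi> g = \<phi> h" if gh: "g \<in> martingales" "h \<in> martingales"
    and eq: "\<And>n. k \<le> n \<Longrightarrow> g (left_spine n) = h (left_spine n)" for g h k
  proof (rule eqI)
    have "eventually (\<lambda>n. h (left_spine n) = g (left_spine n)) F"
      by (rule filter_leD[OF F(2)]) (use eq in \<open>auto simp: eventually_sequentially intro!: exI[of _ k]\<close>)
    then show "((\<lambda>n. g (left_spine n)) \<longlongrightarrow> \<phi> h) F" using lim[OF gh(2)] by (rule Lim_transform_eventually[rotated])
  qed
  ultimately show ?thesis by blast
qed

text \<open>The cylinders around the leftmost branch shrink to a null set.\<close>

lemma spine_o: "mode_conv Mode_o tree UNIV (\<le>) (\<lambda>n. cyl (left_spine n)) 0"
proof -
  have "decreasing_to_zero (Lob tree) UNIV (\<le>) (\<lambda>n. cyl (left_spine n))"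
  proof (rule tree.Lob_decreasing_to_zeroI[OF directed_by_nat])
    fix x assume x: "0 \<unlhd> x"
    have xc: "x \<in> carrier tree" using x by (rule tree.leq_carrier)
    have nn: "0 \<unlhd> cyl (left_spine n) x" for n using tree.Lob_nonnegD(2)[OF restrict_op_nonneg x] .
    show "decreasing_to_zero tree UNIV (\<le>) (\<lambda>n. cyl (left_spine n) x)"
    proof (rule tree.decreasing_to_zeroI[OF directed_by_nat])
      show "cyl (left_spine n) x \<unlhd> cyl (left_spine m) x" if mn: "m \<le> n" for m n
      proof (rule tree_leq_deep[of _ _ n])
        fix w :: "bool list" assume w: "n \<le> length w"
        have "drop (length w - m) w = drop (n - m) (drop (length w - n) w)" using w mn by simp
        then have "drop (length w - m) w = left_spine m" if "drop (length w - n) w = left_spine n"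
          using that mn by simp
        then show "cyl (left_spine n) x (enc w) \<le> cyl (left_spine m) x (enc w)"
          using w mn xc tree_nonnegD[OF x] by (simp add: restrict_op_deep)
      qed (use xc in auto)
      show "tree.is_inf (range (\<lambda>n. cyl (left_spine n) x)) 0" unfolding tree.is_inf_def
      proof (intro conjI ballI allI impI)
        show "0 \<unlhd> d" if "d \<in> range (\<lambda>n. cyl (left_spine n) x)" for d using that nn by auto
        fix z assume z: "\<forall>d\<in>range (\<lambda>n. cyl (left_spine n) x). z \<unlhd> d"
        have z_le: "z \<unlhd> cyl (left_spine n) x" for n using z by blast
        have zc: "z \<in> carrier tree" using tree.leq_closed[OF z_le[of 0]] xc by simp
        obtain C where C: "\<forall>w. \<bar>x (enc w)\<bar> \<le> C" using tree_bounded[OF xc] by blast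
        have "(tree.pp z) (enc []) \<le> C / 2 ^ n" for n
        proof -
          have "tree.pp z \<unlhd> cyl (left_spine n) x" using z_le nn zc by simp
          then have "(tree.pp z) (enc []) \<le> x (enc (left_spine n)) / 2 ^ n"
            using tree_leqD[of _ "cyl (left_spine n) x" "[]"] cyl_root[OF xc, of "left_spine n"] by simp
          also have "\<dots> \<le> C / 2 ^ n" using C by (intro divide_right_mono) (auto dest: abs_le_D1)
          finally show ?thesis .
        qed
        moreover have "(\<lambda>n. C / 2 ^ n) \<longlonglongrightarrow> 0"
          using tendsto_mult[OF tendsto_const[of C] LIMSEQ_realpow_zero[of "1/2"]] by (simp add: power_one_over field_simps)
        ultimately have "(tree.pp z) (enc []) \<le> 0" by (intro LIMSEQ_le_const) auto
        then have "tree.pp z = 0" by (rule tree_root_zero[OF tree.pp_nonneg[OF zc]])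
        then show "z \<unlhd> 0" using tree.leq_pp[OF zc] by simp
      qed
    qed
  qed simp
  then show ?thesis using treeL.decreasing_to_zero_order_conv by simp
qed

text \<open>Restriction to a cylinder around the leftmost branch changes no values near its end.\<close>

lemma functional_comp_cyl:
  assumes \<phi>: "positive_functional \<phi>" and tail: "\<forall>g\<in>martingales. \<forall>h\<in>martingales. \<forall>k. (\<forall>n\<ge>k. g (left_spine n) = h (left_spine n)) \<longrightarrow> \<phi> g = \<phi> h"
  shows "left_mult (rank_one \<phi> one) (cyl (left_spine n)) = rank_one \<phi> one"
proof (rule ext)
  fix f show "left_mult (rank_one \<phi> one) (cyl (left_spine n)) f = rank_one \<phi> one f"
  proof (cases "f \<in> carrier tree")
    case True
    then have "\<phi> (\<lambda>w. cyl (left_spine n) f (enc w)) = \<phi> (\<lambda>w. f (enc w))"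
      by (intro tail[rule_format, of _ _ n] tree_martingale) (auto simp: restrict_op_deep)
    then show ?thesis using True by (simp add: left_mult_def rank_one_apply del: length_replicate)
  next
    case False
    then show ?thesis using LobD(4)[OF restrict_op_Lob] tree.Lob_zero[OF rank_one_Lob[OF \<phi> one_nonneg]]
      by (simp add: left_mult_def rank_one_def[of _ _ f])
  qed
qed

section \<open>Discontinuity of left multiplication\<close>

text \<open>The operators that multiply by the indicators of the cylinders around the leftmost branch decrease to
  zero, and the functional at the end of that branch does not notice them.\<close>

lemma ex_Lob_not_continuous:
  assumes "(c1, c2) \<in> {Mode_o} \<times> UNIV \<union> {Mode_SO} \<times> {Mode_SO, Mode_SUO, Mode_Stau}"
  shows "\<exists>T\<in>carrier (Lob tree). \<not> mode_continuous c1 c2 tree (left_mult T)"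
proof -
  obtain \<phi> where \<phi>: "positive_functional \<phi>" "\<phi> (\<lambda>_. 1) = 1" and
    tail: "\<forall>g\<in>martingales. \<forall>h\<in>martingales. \<forall>k. (\<forall>n\<ge>k. g (left_spine n) = h (left_spine n)) \<longrightarrow> \<phi> g = \<phi> h"
    using ex_functional_at_end by (elim exE conjE)
  let ?T = "rank_one \<phi> one"
  have T: "?T \<in> carrier (Lob tree)" by (rule rank_one_Lob[OF \<phi>(1) one_nonneg])
  have S: "(\<lambda>n. cyl (left_spine n)) \<in> UNIV \<rightarrow> carrier (Lob tree)" by simp
  have "mode_conv c1 tree UNIV (\<le>) (\<lambda>n. cyl (left_spine n)) 0"
    using assms spine_o tree.mode_o_imp_SO[OF S treeL.zero_closed spine_o] by blast
  then have "\<not> mode_continuous c1 c2 tree (left_mult ?T)"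
    by (rule not_continuous_const[OF directed_by_nat restrict_op_Lob _ T functional_comp_cyl[OF \<phi>(1) tail] T
      rank_one_one_nonzero[of \<phi>, OF \<phi>(2)]])
  then show ?thesis using T by blast
qed

text \<open>Composition of the integral with any member of \<open>disj_vectors\<close> gives the integral, because the bumps have
  integral one.\<close>

lemma ex_Loc_not_continuous:
  assumes "c1 \<in> {Mode_uo, Mode_tau, Mode_SUO, Mode_Stau}"
  shows "\<exists>T\<in>Loc tree. \<not> mode_continuous c1 c2 tree (left_mult T)"
proof (rule bexI[OF _ rank_one_root_Loc])
  note L = tree.Lob_nonnegD(1)[OF disj_vectors_nonneg]
  have S: "disj_vectors \<in> UNIV \<rightarrow> carrier (Lob tree)" using L by simp
  note T = rank_one_Lob[OF positive_functional_eval[of "[]"] one_nonneg]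
  have "mode_conv c1 tree UNIV (\<le>) disj_vectors 0"
    using assms disj_vectors_uo tree_mode_weaken(1)[OF directed_by_nat S disj_vectors_uo]
      disj_vectors_SUO tree_mode_weaken(2)[OF directed_by_nat S disj_vectors_SUO] by blast
  then show "\<not> mode_continuous c1 c2 tree (left_mult (rank_one (\<lambda>h. h []) one))"
    by (rule not_continuous_const[OF directed_by_nat L _ T rank_one_root_comp T])
      (simp add: rank_one_one_nonzero)
qed

text \<open>For the identity operator, continuity means that \<open>c1\<close>-convergence implies \<open>c2\<close>-convergence. Convergence in
  \<open>Lob E\<close> does not imply pointwise convergence by the disjoint functionals, nor conversely by the Rademacher
  functionals; the disjoint vectors and the typewriter separate modes of the same kind.\<close>

lemma ex_Orth_not_continuous:
  assumes "(c1, c2) \<notin> {Mode_o} \<times> UNIV \<union> {Mode_SO} \<times> {Mode_SO, Mode_SUO, Mode_Stau}"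
    "(c1, c2) \<notin> {(Mode_uo, Mode_uo), (Mode_uo, Mode_tau), (Mode_tau, Mode_tau),
      (Mode_SUO, Mode_SUO), (Mode_SUO, Mode_Stau), (Mode_Stau, Mode_Stau)}"
  shows "\<exists>T\<in>Orth tree. \<not> mode_continuous c1 c2 tree (left_mult T)"
proof -
  have "c1 \<in> {Mode_uo, Mode_tau} \<and> c2 \<in> {Mode_o, Mode_SO, Mode_SUO, Mode_Stau} \<or>
      c1 \<in> {Mode_SO, Mode_SUO, Mode_Stau} \<and> c2 \<in> {Mode_o, Mode_uo, Mode_tau} \<or>
      c1 \<in> {Mode_SUO, Mode_Stau} \<and> c2 = Mode_SO \<or>
      c1 = Mode_tau \<and> c2 = Mode_uo \<or> c1 = Mode_Stau \<and> c2 = Mode_SUO"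
    using assms by (cases c1; cases c2; simp)
  then consider
      "c1 \<in> {Mode_uo, Mode_tau}" "c2 \<in> {Mode_o, Mode_SO, Mode_SUO, Mode_Stau}"
    | "c1 \<in> {Mode_SO, Mode_SUO, Mode_Stau}" "c2 \<in> {Mode_o, Mode_uo, Mode_tau}"
    | "c1 \<in> {Mode_SUO, Mode_Stau}" "c2 = Mode_SO"
    | "c1 = Mode_tau" "c2 = Mode_uo"
    | "c1 = Mode_Stau" "c2 = Mode_SUO"
    by (elim disjE conjE)
  then show ?thesis
  proof cases
    case 1
    note L = tree.Lob_nonnegD(1)[OF disj_functionals_nonneg]
    have S: "disj_functionals \<in> UNIV \<rightarrow> carrier (Lob tree)" using L by simp
    show ?thesis
    proof (rule not_continuous_identity[OF directed_by_nat L])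
      show "mode_conv c1 tree UNIV (\<le>) disj_functionals 0"
        using 1(1) disj_functionals_uo tree_mode_weaken(1)[OF directed_by_nat S disj_functionals_uo] by blast
      show "\<not> mode_conv c2 tree UNIV (\<le>) disj_functionals 0"
        using 1(2) disj_functionals_not_Stau tree_mode_weaken(2)[OF directed_by_nat S, of c2] by blast
    qed
  next
    case 2
    have S: "rademacher \<in> UNIV \<rightarrow> carrier (Lob tree)" using rademacher_Lob by simp
    have SUO: "mode_conv Mode_SUO tree UNIV (\<le>) rademacher 0"
      by (rule tree.mode_SO_imp_SUO[OF S treeL.zero_closed rademacher_SO])
    show ?thesis
    proof (rule not_continuous_identity[OF directed_by_nat rademacher_Lob])
      show "mode_conv c1 tree UNIV (\<le>) rademacher 0"
        using 2(1) rademacher_SO SUO tree_mode_weaken(2)[OF directed_by_nat S SUO] by blast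
      show "\<not> mode_conv c2 tree UNIV (\<le>) rademacher 0"
        using 2(2) rademacher_not_tau tree_mode_weaken(1)[OF directed_by_nat S, of c2] by blast
    qed
  next
    case 3
    note L = tree.Lob_nonnegD(1)[OF disj_vectors_nonneg]
    have S: "disj_vectors \<in> UNIV \<rightarrow> carrier (Lob tree)" using L by simp
    show ?thesis
    proof (rule not_continuous_identity[OF directed_by_nat L])
      show "mode_conv c1 tree UNIV (\<le>) disj_vectors 0"
        using 3(1) disj_vectors_SUO tree_mode_weaken(2)[OF directed_by_nat S disj_vectors_SUO] by blast
      show "\<not> mode_conv c2 tree UNIV (\<le>) disj_vectors 0" using 3(2) disj_vectors_not_SO by blast
    qed
  next
    case 4
    show ?thesis unfolding 4
      by (rule not_continuous_identity[OF directed_by_length restrict_op_Lob typewriter_tau typewriter_not_uo])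
  next
    case 5
    show ?thesis unfolding 5
      by (rule not_continuous_identity[OF directed_by_length restrict_op_Lob typewriter_Stau typewriter_not_SUO])
  qed
qed

theorem mainTheorem4:
  "let
      pairsA = {Mode_o} \<times> UNIV \<union> {Mode_SO} \<times> {Mode_SO, Mode_SUO, Mode_Stau};
      pairsB = {(Mode_uo, Mode_uo), (Mode_uo, Mode_tau), (Mode_tau, Mode_tau),
        (Mode_SUO, Mode_SUO), (Mode_SUO, Mode_Stau), (Mode_Stau, Mode_Stau)}
    in
      (\<forall>(c1, c2) \<in> pairsA.
        (\<forall>E :: 'a::real_vector gorder. admissible c1 c2 E \<longrightarrow>
          (\<forall>T \<in> Loc E. mode_continuous c1 c2 E (left_mult T))) \<and>
        (\<exists>E :: (real \<Rightarrow> real) gorder. admissible c1 c2 E \<and>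
          (\<exists>T \<in> carrier (Lob E). \<not> mode_continuous c1 c2 E (left_mult T)))) \<and>
      (\<forall>(c1, c2) \<in> pairsB.
        (\<forall>E :: 'a gorder. admissible c1 c2 E \<longrightarrow>
          (\<forall>T \<in> Orth E. mode_continuous c1 c2 E (left_mult T))) \<and>
        (\<exists>E :: (real \<Rightarrow> real) gorder. admissible c1 c2 E \<and>
          (\<exists>T \<in> Loc E. \<not> mode_continuous c1 c2 E (left_mult T)))) \<and>
      (\<forall>(c1, c2) \<in> UNIV - (pairsA \<union> pairsB).
        \<exists>E :: (real \<Rightarrow> real) gorder. admissible c1 c2 E \<and>
          (\<exists>T \<in> Orth E. \<not> mode_continuous c1 c2 E (left_mult T)))"
  unfolding Let_def
proof (intro conjI; intro ballI; simp only: split_paired_all prod.case)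
  fix c1 c2
  assume A: "(c1, c2) \<in> {Mode_o} \<times> UNIV \<union> {Mode_SO} \<times> {Mode_SO, Mode_SUO, Mode_Stau}"
  show "(\<forall>E :: 'a gorder. admissible c1 c2 E \<longrightarrow> (\<forall>T \<in> Loc E. mode_continuous c1 c2 E (left_mult T))) \<and>
      (\<exists>E :: (real \<Rightarrow> real) gorder. admissible c1 c2 E \<and>
        (\<exists>T \<in> carrier (Lob E). \<not> mode_continuous c1 c2 E (left_mult T)))"
    using Loc_mode_continuous[OF A] tree_admissible ex_Lob_not_continuous[OF A] by blast
next
  fix c1 c2
  assume B: "(c1, c2) \<in> {(Mode_uo, Mode_uo), (Mode_uo, Mode_tau), (Mode_tau, Mode_tau),
      (Mode_SUO, Mode_SUO), (Mode_SUO, Mode_Stau), (Mode_Stau, Mode_Stau)}"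
  then have "c1 \<in> {Mode_uo, Mode_tau, Mode_SUO, Mode_Stau}" by blast
  then show "(\<forall>E :: 'a gorder. admissible c1 c2 E \<longrightarrow> (\<forall>T \<in> Orth E. mode_continuous c1 c2 E (left_mult T))) \<and>
      (\<exists>E :: (real \<Rightarrow> real) gorder. admissible c1 c2 E \<and>
        (\<exists>T \<in> Loc E. \<not> mode_continuous c1 c2 E (left_mult T)))"
    using Orth_mode_continuous[OF B] tree_admissible ex_Loc_not_continuous by blast
next
  fix c1 c2
  assume "(c1, c2) \<in> UNIV - ({Mode_o} \<times> UNIV \<union> {Mode_SO} \<times> {Mode_SO, Mode_SUO, Mode_Stau} \<union>
      {(Mode_uo, Mode_uo), (Mode_uo, Mode_tau), (Mode_tau, Mode_tau),
      (Mode_SUO, Mode_SUO), (Mode_SUO, Mode_Stau), (Mode_Stau, Mode_Stau)})"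
  then show "\<exists>E :: (real \<Rightarrow> real) gorder. admissible c1 c2 E \<and>
      (\<exists>T \<in> Orth E. \<not> mode_continuous c1 c2 E (left_mult T))"
    using tree_admissible ex_Orth_not_continuous[of c1 c2] by blast
qed

end
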